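(* Let $n\in\mathbb{N}$, let $1<p_1,\dots,p_n<\infty$, $1\le q<\infty$, and let $\mu_1,\dots,\mu_n,\nu$ be arbitrary (positive) measures. (1) If $\sum_{i=1}^n \frac{1}{p_i}<\frac{1}{q}$, then all positive $n$-linear operators from $L_{p_1}(\mu_1)\times\cdots\times L_{p_n}(\mu_n)$ to $\ell_q$ and all positive $n$-linear operators from $\ell_{p_1}\times\cdots\times\ell_{p_n}$ to $L_q(\nu)$ are compact. (2) If $1<p_1,\dots,p_n<2$, $1\le q<\infty$ and $\sum_{i=1}^n \frac{1}{p_i}<\frac{1}{q}$, then all positive $n$-linear operators from $\mathrm{FBL}[L_{p_1}(\mu_1)]\times\cdots\times \mathrm{FBL}[L_{p_n}(\mu_n)]$ to $\ell_q$ are compact. (3) If $2\le q<\infty$ and $\sum_{i=1}^n \frac{1}{p_i}<\frac{1}{2}$, then all positive $n$-linear operators from $\ell_{p_1}\times\cdots\times\ell_{p_n}$ to $(\mathrm{FBL}[L_q(\nu)])^*$ are compact. The same holds if $L_q(\nu)$ is replaced with any Banach lattice $F$ such that $2\le s(F)<\infty$.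
   Context: For Banach lattices $E_1,\dots,E_n,F$, an $n$-linear operator $A:E_1\times\cdots\times E_n\to F$ is positive if $A(x_1,\dots,x_n)\ge 0$ whenever $x_i\in E_i$, $x_i\ge 0$ for all $i$ (positive multilinear operators are automatically continuous). It is compact if $A(B_{E_1}\times\cdots\times B_{E_n})$ is relatively compact in $F$, where $B_X$ denotes the closed unit ball of $X$. The spaces $L_p(\mu)$ and $\ell_p$ carry their usual (a.e. pointwise, respectively coordinatewise) orders. Given a Banach space $X$, the free Banach lattice generated by $X$ is a Banach lattice $\mathrm{FBL}[X]$ together with a linear isometric embedding $\phi_X:X\to \mathrm{FBL}[X]$ such that for every Banach lattice $G$ and every bounded linear operator $T:X\to G$ there is a unique lattice homomorphism $\widehat T:\mathrm{FBL}[X]\to G$ with $\widehat T\circ\phi_X=T$, and moreover $\|\widehat T\|=\|T\|$. The dual $(\mathrm{FBL}[X])^*$ is a Banach lattice with the usual dual order. For $1\le p\le\infty$, a Banach lattice $E$ has the $\ell_p$-composition property if every positive disjoint sequence $(x_n)_n$ in $E$ with $(\|x_n\|)_n\in\ell_p$ satisfies $\sup_{n}\|x_1+\cdots+x_n\|<\infty$. The lower index of $E$ is $s(E)=\sup\{p\ge 1: E \text{ has the } \ell_p\text{-composition property}\}$. *)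

theory Defs
  imports "HOL-Analysis.Analysis"
begin

section \<open>Normed spaces and Banach lattices on carrier sets\<close>

text \<open>The spaces \<open>L\<^sub>p(\<mu>)\<close> depend on the terms \<open>p\<close> and \<open>\<mu>\<close>, and an \<open>n\<close>-linear operator acts on a
  family of spaces of variable length, so real Banach spaces and Banach lattices are records with
  an explicit carrier rather than types in the classes of HOL-Analysis. Everything is
  relativised to the carrier; values outside the carrier are irrelevant.\<close>

record 'a nspace =
  vcarrier :: "'a set"
  vzero :: 'a
  vadd :: "'a \<Rightarrow> 'a \<Rightarrow> 'a"
  vscale :: "real \<Rightarrow> 'a \<Rightarrow> 'a"
  vnorm :: "'a \<Rightarrow> real"

record 'a nlattice = "'a nspace" +
  vle :: "'a \<Rightarrow> 'a \<Rightarrow> bool"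

definition vneg :: "('a, 'm) nspace_scheme \<Rightarrow> 'a \<Rightarrow> 'a" where
  "vneg E x = vscale E (-1) x"

definition vball :: "('a, 'm) nspace_scheme \<Rightarrow> 'a set" where
  "vball E = {x \<in> vcarrier E. vnorm E x \<le> 1}"

text \<open>The case distinction is there because \<^locale>\<open>Metric_space\<close> asks for a distance that is
  nonnegative and symmetric on the whole type.\<close>

definition vdist :: "('a, 'm) nspace_scheme \<Rightarrow> 'a \<Rightarrow> 'a \<Rightarrow> real" where
  "vdist E x y =
     (if x \<in> vcarrier E \<and> y \<in> vcarrier E then vnorm E (vadd E x (vneg E y)) else 0)"

locale normed_space_on =
  fixes E :: "('a, 'm) nspace_scheme"
  assumes zero_closed: "vzero E \<in> vcarrier E"
    and add_closed: "\<lbrakk>x \<in> vcarrier E; y \<in> vcarrier E\<rbrakk> \<Longrightarrow> vadd E x y \<in> vcarrier E"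
    and scale_closed: "x \<in> vcarrier E \<Longrightarrow> vscale E a x \<in> vcarrier E"
    and add_assoc: "\<lbrakk>x \<in> vcarrier E; y \<in> vcarrier E; z \<in> vcarrier E\<rbrakk>
        \<Longrightarrow> vadd E (vadd E x y) z = vadd E x (vadd E y z)"
    and add_commute: "\<lbrakk>x \<in> vcarrier E; y \<in> vcarrier E\<rbrakk> \<Longrightarrow> vadd E x y = vadd E y x"
    and add_zero: "x \<in> vcarrier E \<Longrightarrow> vadd E (vzero E) x = x"
    and add_neg: "x \<in> vcarrier E \<Longrightarrow> vadd E x (vneg E x) = vzero E"
    and scale_add_right: "\<lbrakk>x \<in> vcarrier E; y \<in> vcarrier E\<rbrakk>
        \<Longrightarrow> vscale E a (vadd E x y) = vadd E (vscale E a x) (vscale E a y)"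
    and scale_add_left: "x \<in> vcarrier E
        \<Longrightarrow> vscale E (a + b) x = vadd E (vscale E a x) (vscale E b x)"
    and scale_scale: "x \<in> vcarrier E \<Longrightarrow> vscale E a (vscale E b x) = vscale E (a * b) x"
    and scale_one: "x \<in> vcarrier E \<Longrightarrow> vscale E 1 x = x"
    and norm_nonneg: "x \<in> vcarrier E \<Longrightarrow> 0 \<le> vnorm E x"
    and norm_eq_zero: "x \<in> vcarrier E \<Longrightarrow> vnorm E x = 0 \<longleftrightarrow> x = vzero E"
    and norm_scale: "x \<in> vcarrier E \<Longrightarrow> vnorm E (vscale E a x) = \<bar>a\<bar> * vnorm E x"
    and norm_triangle: "\<lbrakk>x \<in> vcarrier E; y \<in> vcarrier E\<rbrakk>
        \<Longrightarrow> vnorm E (vadd E x y) \<le> vnorm E x + vnorm E y"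

locale banach_space_on = normed_space_on E for E :: "('a, 'm) nspace_scheme" +
  assumes complete: "Metric_space.mcomplete (vcarrier E) (vdist E)"

definition is_vsup :: "('a, 'm) nlattice_scheme \<Rightarrow> 'a \<Rightarrow> 'a \<Rightarrow> 'a \<Rightarrow> bool" where
  "is_vsup E x y z \<longleftrightarrow> z \<in> vcarrier E \<and> vle E x z \<and> vle E y z \<and>
     (\<forall>w\<in>vcarrier E. vle E x w \<and> vle E y w \<longrightarrow> vle E z w)"

definition is_vinf :: "('a, 'm) nlattice_scheme \<Rightarrow> 'a \<Rightarrow> 'a \<Rightarrow> 'a \<Rightarrow> bool" where
  "is_vinf E x y z \<longleftrightarrow> z \<in> vcarrier E \<and> vle E z x \<and> vle E z y \<and>
     (\<forall>w\<in>vcarrier E. vle E w x \<and> vle E w y \<longrightarrow> vle E w z)"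

definition vsup :: "('a, 'm) nlattice_scheme \<Rightarrow> 'a \<Rightarrow> 'a \<Rightarrow> 'a" where
  "vsup E x y = (THE z. is_vsup E x y z)"

definition vinf :: "('a, 'm) nlattice_scheme \<Rightarrow> 'a \<Rightarrow> 'a \<Rightarrow> 'a" where
  "vinf E x y = (THE z. is_vinf E x y z)"

definition vabs :: "('a, 'm) nlattice_scheme \<Rightarrow> 'a \<Rightarrow> 'a" where
  "vabs E x = vsup E x (vneg E x)"

definition vdisjoint :: "('a, 'm) nlattice_scheme \<Rightarrow> 'a \<Rightarrow> 'a \<Rightarrow> bool" where
  "vdisjoint E x y \<longleftrightarrow> vinf E (vabs E x) (vabs E y) = vzero E"

locale banach_lattice_on = banach_space_on E for E :: "('a, 'm) nlattice_scheme" +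
  assumes le_refl: "x \<in> vcarrier E \<Longrightarrow> vle E x x"
    and le_antisym: "\<lbrakk>x \<in> vcarrier E; y \<in> vcarrier E; vle E x y; vle E y x\<rbrakk> \<Longrightarrow> x = y"
    and le_trans: "\<lbrakk>x \<in> vcarrier E; y \<in> vcarrier E; z \<in> vcarrier E; vle E x y; vle E y z\<rbrakk>
        \<Longrightarrow> vle E x z"
    and le_add: "\<lbrakk>x \<in> vcarrier E; y \<in> vcarrier E; z \<in> vcarrier E; vle E x y\<rbrakk>
        \<Longrightarrow> vle E (vadd E x z) (vadd E y z)"
    and le_scale: "\<lbrakk>x \<in> vcarrier E; vle E (vzero E) x; 0 \<le> a\<rbrakk>
        \<Longrightarrow> vle E (vzero E) (vscale E a x)"
    and ex_sup: "\<lbrakk>x \<in> vcarrier E; y \<in> vcarrier E\<rbrakk> \<Longrightarrow> \<exists>z. is_vsup E x y z"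
    and ex_inf: "\<lbrakk>x \<in> vcarrier E; y \<in> vcarrier E\<rbrakk> \<Longrightarrow> \<exists>z. is_vinf E x y z"
    and norm_mono: "\<lbrakk>x \<in> vcarrier E; y \<in> vcarrier E; vle E (vabs E x) (vabs E y)\<rbrakk>
        \<Longrightarrow> vnorm E x \<le> vnorm E y"

section \<open>Linear maps, duals, lattice homomorphisms\<close>

definition linear_map_on ::
    "('a, 'm) nspace_scheme \<Rightarrow> ('b, 'k) nspace_scheme \<Rightarrow> ('a \<Rightarrow> 'b) \<Rightarrow> bool" where
  "linear_map_on E F T \<longleftrightarrow> T \<in> vcarrier E \<rightarrow> vcarrier F \<and>
     (\<forall>x\<in>vcarrier E. \<forall>y\<in>vcarrier E. T (vadd E x y) = vadd F (T x) (T y)) \<and>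
     (\<forall>a. \<forall>x\<in>vcarrier E. T (vscale E a x) = vscale F a (T x))"

definition bounded_linear_on ::
    "('a, 'm) nspace_scheme \<Rightarrow> ('b, 'k) nspace_scheme \<Rightarrow> ('a \<Rightarrow> 'b) \<Rightarrow> bool" where
  "bounded_linear_on E F T \<longleftrightarrow> linear_map_on E F T \<and>
     (\<exists>K. \<forall>x\<in>vcarrier E. vnorm F (T x) \<le> K * vnorm E x)"

definition op_norm_on ::
    "('a, 'm) nspace_scheme \<Rightarrow> ('b, 'k) nspace_scheme \<Rightarrow> ('a \<Rightarrow> 'b) \<Rightarrow> real" where
  "op_norm_on E F T = (SUP x\<in>vball E. vnorm F (T x))"

definition lattice_hom_on ::
    "('a, 'm) nlattice_scheme \<Rightarrow> ('b, 'k) nlattice_scheme \<Rightarrow> ('a \<Rightarrow> 'b) \<Rightarrow> bool" where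
  "lattice_hom_on E F T \<longleftrightarrow> linear_map_on E F T \<and>
     (\<forall>x\<in>vcarrier E. \<forall>y\<in>vcarrier E.
        T (vsup E x y) = vsup F (T x) (T y) \<and> T (vinf E x y) = vinf F (T x) (T y))"

definition real_line :: "real nspace" where
  "real_line = \<lparr>vcarrier = UNIV, vzero = 0, vadd = (+), vscale = (*), vnorm = abs\<rparr>"

text \<open>Functionals are taken \<^const>\<open>extensional\<close>, so that functionals which agree on the carrier
  are equal.\<close>

definition dual_lattice :: "('a, 'm) nlattice_scheme \<Rightarrow> ('a \<Rightarrow> real) nlattice" where
  "dual_lattice E =
    \<lparr>vcarrier = {f \<in> extensional (vcarrier E). bounded_linear_on E real_line f},
     vzero = (\<lambda>x\<in>vcarrier E. 0),
     vadd = (\<lambda>f g. \<lambda>x\<in>vcarrier E. f x + g x),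
     vscale = (\<lambda>a f. \<lambda>x\<in>vcarrier E. a * f x),
     vnorm = op_norm_on E real_line,
     vle = (\<lambda>f g. \<forall>x\<in>vcarrier E. vle E (vzero E) x \<longrightarrow> f x \<le> g x)\<rparr>"

section \<open>The spaces \<open>\<ell>\<^sub>p\<close> and \<open>L\<^sub>p(\<mu>)\<close>, for \<open>1 \<le> p < \<infinity>\<close>\<close>

definition lp_space :: "real \<Rightarrow> (nat \<Rightarrow> real) nlattice" where
  "lp_space p =
    \<lparr>vcarrier = {x. summable (\<lambda>k. \<bar>x k\<bar> powr p)},
     vzero = (\<lambda>k. 0),
     vadd = (\<lambda>x y k. x k + y k),
     vscale = (\<lambda>a x k. a * x k),
     vnorm = (\<lambda>x. (\<Sum>k. \<bar>x k\<bar> powr p) powr (1 / p)),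
     vle = (\<lambda>x y. \<forall>k. x k \<le> y k)\<rparr>"

text \<open>Elements of \<open>L\<^sub>p(\<mu>)\<close> are equivalence classes of measurable functions modulo equality almost
  everywhere; the operations are those on (arbitrarily chosen) representatives.\<close>

definition ae_class :: "'a measure \<Rightarrow> ('a \<Rightarrow> real) \<Rightarrow> ('a \<Rightarrow> real) set" where
  "ae_class M f = {g \<in> borel_measurable M. AE t in M. g t = f t}"

definition ae_rep :: "('a \<Rightarrow> real) set \<Rightarrow> 'a \<Rightarrow> real" where
  "ae_rep C = (SOME f. f \<in> C)"

definition Lp_space :: "real \<Rightarrow> 'a measure \<Rightarrow> ('a \<Rightarrow> real) set nlattice" where
  "Lp_space p M =
    \<lparr>vcarrier = {ae_class M f |f. f \<in> borel_measurable M \<and> integrable M (\<lambda>t. \<bar>f t\<bar> powr p)},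
     vzero = ae_class M (\<lambda>t. 0),
     vadd = (\<lambda>C D. ae_class M (\<lambda>t. ae_rep C t + ae_rep D t)),
     vscale = (\<lambda>a C. ae_class M (\<lambda>t. a * ae_rep C t)),
     vnorm = (\<lambda>C. (\<integral>t. \<bar>ae_rep C t\<bar> powr p \<partial>M) powr (1 / p)),
     vle = (\<lambda>C D. AE t in M. ae_rep C t \<le> ae_rep D t)\<rparr>"

section \<open>Free Banach lattices\<close>

text \<open>The lifting condition of the universal property for a single target \<open>G\<close>. Lattice
  homomorphisms between Banach lattices are bounded automatically, so \<open>op_norm_on L G S\<close> is
  a genuine supremum. Maps are identified when they agree on the carrier.\<close>

definition lifts_uniquely ::
    "('x, 'm) nspace_scheme \<Rightarrow> 'f nlattice \<Rightarrow> ('x \<Rightarrow> 'f) \<Rightarrow> 'g nlattice \<Rightarrow> bool" where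
  "lifts_uniquely X L \<phi> G \<longleftrightarrow> (\<forall>T. bounded_linear_on X G T \<longrightarrow>
     (\<exists>S. lattice_hom_on L G S \<and> (\<forall>x\<in>vcarrier X. S (\<phi> x) = T x) \<and>
          op_norm_on L G S = op_norm_on X G T \<and>
          (\<forall>S'. lattice_hom_on L G S' \<and> (\<forall>x\<in>vcarrier X. S' (\<phi> x) = T x) \<longrightarrow>
             (\<forall>u\<in>vcarrier L. S' u = S u))))"

text \<open>\<open>(L, \<phi>)\<close> is a free Banach lattice over \<open>X\<close>. A definition in HOL cannot quantify over Banach
  lattices \<open>G\<close> on all types, so the universal property is required for all \<open>G\<close> carried by a subset
  of the type of \<open>L\<close> itself, and for all \<open>G\<close> carried by a subset of \<open>('x \<Rightarrow> real) \<Rightarrow> real\<close>. No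
  generality is lost: the standard model of \<open>FBL[X]\<close> is a lattice of real functions on \<open>X\<^sup>*\<close>,
  hence lives on the second type, and it has the universal property for all \<open>G\<close>. Lifting the two
  embeddings of \<open>X\<close>, in both directions between the model and \<open>L\<close>, gives mutually inverse
  isometric lattice isomorphisms, the composition on \<open>L\<close> being the identity by uniqueness for
  \<open>G = L\<close>. So \<open>L\<close> has the universal property for all \<open>G\<close> as well.\<close>

definition free_banach_lattice ::
    "('x, 'm) nspace_scheme \<Rightarrow> 'f nlattice \<Rightarrow> ('x \<Rightarrow> 'f) \<Rightarrow> bool" where
  "free_banach_lattice X L \<phi> \<longleftrightarrow>
     banach_lattice_on L \<and>
     linear_map_on X L \<phi> \<and> (\<forall>x\<in>vcarrier X. vnorm L (\<phi> x) = vnorm X x) \<and>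
     (\<forall>G :: 'f nlattice. banach_lattice_on G \<longrightarrow> lifts_uniquely X L \<phi> G) \<and>
     (\<forall>G :: (('x \<Rightarrow> real) \<Rightarrow> real) nlattice. banach_lattice_on G \<longrightarrow> lifts_uniquely X L \<phi> G)"

section \<open>The lower index\<close>

primrec vpsum :: "('a, 'm) nspace_scheme \<Rightarrow> (nat \<Rightarrow> 'a) \<Rightarrow> nat \<Rightarrow> 'a" where
  "vpsum E x 0 = vzero E"
| "vpsum E x (Suc k) = vadd E (vpsum E x k) (x k)"

definition in_lp :: "ereal \<Rightarrow> (nat \<Rightarrow> real) \<Rightarrow> bool" where
  "in_lp p a \<longleftrightarrow>
     (if p = \<infinity> then bounded (range a) else summable (\<lambda>k. \<bar>a k\<bar> powr real_of_ereal p))"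

definition lp_composition_property :: "ereal \<Rightarrow> ('a, 'm) nlattice_scheme \<Rightarrow> bool" where
  "lp_composition_property p E \<longleftrightarrow>
     (\<forall>x :: nat \<Rightarrow> 'a.
        (\<forall>k. x k \<in> vcarrier E \<and> vle E (vzero E) (x k)) \<and>
        (\<forall>j k. j \<noteq> k \<longrightarrow> vdisjoint E (x j) (x k)) \<and>
        in_lp p (\<lambda>k. vnorm E (x k)) \<longrightarrow>
        bdd_above (range (\<lambda>k. vnorm E (vpsum E x k))))"

definition lower_index :: "('a, 'm) nlattice_scheme \<Rightarrow> ereal" where
  "lower_index E = Sup {p. 1 \<le> p \<and> lp_composition_property p E}"

section \<open>Positive and compact multilinear operators\<close>

text \<open>Here \<open>E\<close> is a family of spaces indexed by \<open>I\<close>, with carriers in a common type; a finite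
  family of spaces on different types can be moved to the disjoint sum of those types.\<close>

definition multilinear_on ::
    "'i set \<Rightarrow> ('i \<Rightarrow> ('a, 'm) nspace_scheme) \<Rightarrow> ('b, 'k) nspace_scheme \<Rightarrow>
     (('i \<Rightarrow> 'a) \<Rightarrow> 'b) \<Rightarrow> bool" where
  "multilinear_on I E F A \<longleftrightarrow>
     A \<in> (\<Pi>\<^sub>E i\<in>I. vcarrier (E i)) \<rightarrow> vcarrier F \<and>
     (\<forall>x\<in>(\<Pi>\<^sub>E i\<in>I. vcarrier (E i)). \<forall>i\<in>I. linear_map_on (E i) F (\<lambda>u. A (x(i := u))))"

definition positive_multilinear_on ::
    "'i set \<Rightarrow> ('i \<Rightarrow> ('a, 'm) nlattice_scheme) \<Rightarrow> ('b, 'k) nlattice_scheme \<Rightarrow>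
     (('i \<Rightarrow> 'a) \<Rightarrow> 'b) \<Rightarrow> bool" where
  "positive_multilinear_on I E F A \<longleftrightarrow> multilinear_on I E F A \<and>
     (\<forall>x\<in>(\<Pi>\<^sub>E i\<in>I. vcarrier (E i)).
        (\<forall>i\<in>I. vle (E i) (vzero (E i)) (x i)) \<longrightarrow> vle F (vzero F) (A x))"

definition relatively_compact_in :: "('a, 'm) nspace_scheme \<Rightarrow> 'a set \<Rightarrow> bool" where
  "relatively_compact_in F S \<longleftrightarrow>
     (let top = Metric_space.mtopology (vcarrier F) (vdist F)
      in compactin top (top closure_of S))"

definition compact_multilinear_on ::
    "'i set \<Rightarrow> ('i \<Rightarrow> ('a, 'm) nspace_scheme) \<Rightarrow> ('b, 'k) nspace_scheme \<Rightarrow>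
     (('i \<Rightarrow> 'a) \<Rightarrow> 'b) \<Rightarrow> bool" where
  "compact_multilinear_on I E F A \<longleftrightarrow>
     relatively_compact_in F (A ` (\<Pi>\<^sub>E i\<in>I. vball (E i)))"

abbreviation all_positive_compact ::
    "nat \<Rightarrow> (nat \<Rightarrow> 'a nlattice) \<Rightarrow> 'b nlattice \<Rightarrow> bool" where
  "all_positive_compact n E F \<equiv>
     (\<forall>A. positive_multilinear_on {1..n} E F A \<longrightarrow> compact_multilinear_on {1..n} E F A)"

end

theory Submission
  imports Defs
begin

text \<open>
  If the image of the unit balls under a positive operator \<open>A\<close> is not compact, there are arguments in the
  unit balls and disjoint blocks of coordinates, of the domain or of the target, on which \<open>A\<close> has a
  norm bounded away from zero. Maxima of \<open>m\<close> elements of the unit ball of \<open>L\<^sub>p\<close> have norm at most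
  \<open>m powr (1 / p)\<close>, so by positivity \<open>m\<close> such blocks can be combined in one tuple of arguments with
  product of norms \<open>m powr (\<Sum>i\<in>I. 1 / p i)\<close>. The value of \<open>A\<close> there is too large when positive sums in the
  target grow faster: like \<open>m powr (1 / q)\<close> in \<open>L\<^sub>q\<close> and almost like \<open>m powr (1 / 2)\<close> in \<open>(FBL[F])\<^sup>*\<close>.

  For the growth in the dual of a free Banach lattice, and also for part (2), where the hypotheses
  force \<open>n = 1\<close>, the bound for maxima is replaced by the following. A lattice seminorm on
  \<open>FBL[X]\<close> is as large on \<open>\<phi>\<close> of the unit ball of \<open>X\<close> as on the whole unit ball. If \<open>X\<close> satisfies an upper
  \<open>r\<close>-estimate with \<open>r < 2\<close>, truncated random sums of \<open>m\<close> elements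
  \<open>x j\<close> of its unit ball have norm \<open>O(ln m * m powr (1 / r))\<close>, and
  the average of the moduli of their images dominates all \<open>\<bar>\<phi> (x j)\<bar>\<close> up to a small error. An upper
  \<open>r\<close>-estimate for all \<open>r < s(F)\<close> follows from the composition property by a gliding hump.
\<close>

section \<open>Sublinear functionals and linear functionals below them\<close>

text \<open>Inequalities between finitely many vectors of a lattice are reduced to inequalities
  between reals: the vectors lie in a principal ideal, and its real-valued lattice homomorphisms,
  obtained from a Hahn-Banach argument that keeps track of maxima, determine the order there. The
  estimates for random signs are thus needed for real sequences only.

  Arbitrary elements of the unit ball of \<open>FBL[X]\<close> are not combined directly; a lattice
  seminorm that is large at one of them is also large at some \<open>\<phi> x\<close>, and these can
  be combined.

  The number 2 comes from the truncation level, which has to dominate the square function of the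
  \<open>x j\<close>. Its substitute averages suprema of the moduli of the \<open>x j\<close> with
  random weights \<open>sqrt (m / i)\<close>, \<open>i \<le> m\<close>, and an upper
  \<open>r\<close>-estimate controls it because the average of \<open>(m / i) powr (r / 2)\<close>
  is bounded for \<open>r < 2\<close>. The growth exponent in the dual is then close to
  \<open>1 - 1 / r\<close>, below \<open>1 / 2\<close>. The strict inequalities in the hypotheses
  leave room for this, for the logarithm, and for a lower index that is not attained.\<close>

context normed_space_on
begin

abbreviation V :: "'a set" where "V \<equiv> vcarrier E"
abbreviation add (infixl "\<oplus>" 65) where "x \<oplus> y \<equiv> vadd E x y"
abbreviation scale (infixr "\<odot>" 75) where "a \<odot> x \<equiv> vscale E a x"
abbreviation zero ("\<zero>") where "\<zero> \<equiv> vzero E"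
abbreviation neg ("\<ominus> _" [81] 80) where "\<ominus> x \<equiv> vneg E x"
abbreviation norm_on ("\<parallel>_\<parallel>") where "\<parallel>x\<parallel> \<equiv> vnorm E x"

lemma neg_closed: "x \<in> V \<Longrightarrow> \<ominus> x \<in> V"
  by (simp add: vneg_def scale_closed)

lemmas closed [simp] = zero_closed add_closed scale_closed neg_closed

lemma add_left_commute:
  "x \<in> V \<Longrightarrow> y \<in> V \<Longrightarrow> z \<in> V \<Longrightarrow> x \<oplus> (y \<oplus> z) = y \<oplus> (x \<oplus> z)"
  by (metis add_assoc add_commute)

lemmas add_ac = add_assoc add_commute add_left_commute

lemma add_zero_right: "x \<in> V \<Longrightarrow> x \<oplus> \<zero> = x"
  by (metis add_zero add_commute zero_closed)

lemma scale_zero_left: "x \<in> V \<Longrightarrow> 0 \<odot> x = \<zero>"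
  using norm_scale[of x 0] norm_eq_zero[of "0 \<odot> x"] by simp

lemma scale_zero_right: "a \<odot> \<zero> = \<zero>"
  using scale_zero_left[of \<zero>] scale_scale[of \<zero> a 0] by simp

lemma neg_add_cancel: "x \<in> V \<Longrightarrow> \<ominus> x \<oplus> x = \<zero>"
  by (metis add_commute add_neg neg_closed)

definition subspace_on :: "'a set \<Rightarrow> bool" where
  "subspace_on W \<longleftrightarrow> W \<subseteq> V \<and> \<zero> \<in> W \<and> (\<forall>a\<in>W. \<forall>b\<in>W. a \<oplus> b \<in> W) \<and> (\<forall>a\<in>W. \<forall>c. c \<odot> a \<in> W)"

definition sublinear_on :: "'a set \<Rightarrow> ('a \<Rightarrow> real) \<Rightarrow> bool" where
  "sublinear_on W q \<longleftrightarrow> (\<forall>a\<in>W. \<forall>b\<in>W. q (a \<oplus> b) \<le> q a + q b) \<and>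
     (\<forall>a\<in>W. \<forall>c\<ge>0. q (c \<odot> a) \<le> c * q a)"

lemma sublinear_onD:
  assumes "sublinear_on W q" "a \<in> W"
  shows "b \<in> W \<Longrightarrow> q (a \<oplus> b) \<le> q a + q b" "c \<ge> 0 \<Longrightarrow> q (c \<odot> a) \<le> c * q a"
  using assms by (auto simp: sublinear_on_def)

definition linear_fun_on :: "'a set \<Rightarrow> ('a \<Rightarrow> real) \<Rightarrow> bool" where
  "linear_fun_on W f \<longleftrightarrow> (\<forall>a\<in>W. \<forall>b\<in>W. f (a \<oplus> b) = f a + f b) \<and>
     (\<forall>a\<in>W. \<forall>c. f (c \<odot> a) = c * f a)"

text \<open>\<open>R\<close> stands for the triples whose third entry is the supremum of the first
  two, as only a normed space is given at this point. With \<open>R = {}\<close> the results below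
  are the ordinary Hahn-Banach theorem.\<close>

definition max_bounded_on :: "('a \<times> 'a \<times> 'a) set \<Rightarrow> ('a \<Rightarrow> real) \<Rightarrow> bool" where
  "max_bounded_on R q \<longleftrightarrow> (\<forall>(a, b, c)\<in>R. q c \<le> max (q a) (q b))"

lemma max_bounded_onD: "max_bounded_on R q \<Longrightarrow> (a, b, c) \<in> R \<Longrightarrow> q c \<le> max (q a) (q b)"
  by (auto simp: max_bounded_on_def)

text \<open>Suprema commute with translations. This is what passing from \<open>q\<close> to
  \<open>sharpen q b\<close> uses of them.\<close>

definition translation_invariant :: "'a set \<Rightarrow> ('a \<times> 'a \<times> 'a) set \<Rightarrow> bool" where
  "translation_invariant W R \<longleftrightarrow> R \<subseteq> W \<times> W \<times> W \<and>
     (\<forall>(a, b, c)\<in>R. \<forall>d\<in>W. (a \<oplus> d, b \<oplus> d, c \<oplus> d) \<in> R)"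

text \<open>For \<open>W\<close> a space of continuous functions and \<open>q\<close> the maximum over a closed set, this is the
  maximum over the subset on which \<open>b\<close> is maximal.\<close>

definition sharpen :: "('a \<Rightarrow> real) \<Rightarrow> 'a \<Rightarrow> 'a \<Rightarrow> real" where
  "sharpen q b a = (INF t\<in>{0..}. q (a \<oplus> t \<odot> b) - t * q b)"

context
  fixes W assumes W: "subspace_on W"
begin

lemma W_simps [simp]:
  "a \<in> W \<Longrightarrow> a \<in> V" "\<zero> \<in> W" "a \<in> W \<Longrightarrow> b \<in> W \<Longrightarrow> a \<oplus> b \<in> W" "a \<in> W \<Longrightarrow> c \<odot> a \<in> W"
  "a \<in> W \<Longrightarrow> \<ominus> a \<in> W"
  using W by (auto simp: subspace_on_def vneg_def)

lemma sublinear_zero: "sublinear_on W q \<Longrightarrow> q \<zero> = 0"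
proof -
  assume q: "sublinear_on W q"
  have "q (\<zero> \<oplus> \<zero>) \<le> q \<zero> + q \<zero>" "q (0 \<odot> \<zero>) \<le> 0 * q \<zero>"
    using sublinear_onD[OF q W_simps(2)] W_simps(2) by blast+
  then show ?thesis by (simp add: add_zero scale_zero_right)
qed

lemma sublinear_neg: "sublinear_on W q \<Longrightarrow> a \<in> W \<Longrightarrow> - q (\<ominus> a) \<le> q a"
proof -
  assume q: "sublinear_on W q" and a: "a \<in> W"
  have "q (a \<oplus> \<ominus> a) \<le> q a + q (\<ominus> a)" using q a unfolding sublinear_on_def by simp
  then show ?thesis using a by (simp add: add_neg sublinear_zero[OF q])
qed

text \<open>Makes the infimum in \<open>sharpen\<close> a genuine one: \<open>t \<odot> b\<close> is
  the difference of \<open>a \<oplus> t \<odot> b\<close> and \<open>a\<close>, so subadditivity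
  bounds the family from below.\<close>

lemma sharpen_bdd:
  assumes q: "sublinear_on W q" and "a \<in> W" "b \<in> W" "t \<ge> 0"
  shows "- q (\<ominus> a) \<le> q (a \<oplus> t \<odot> b) - t * q b"
proof -
  have [simp]: "\<ominus> (\<ominus> a) = a" using assms by (simp add: vneg_def scale_scale scale_one)
  have 1: "q (t \<odot> b) \<le> q (a \<oplus> t \<odot> b) + q (\<ominus> a)"
  proof -
    have "t \<odot> b = (a \<oplus> t \<odot> b) \<oplus> \<ominus> a"
      using assms by (simp add: add_commute[of a] add_assoc add_neg add_zero_right)
    moreover have "q ((a \<oplus> t \<odot> b) \<oplus> \<ominus> a) \<le> q (a \<oplus> t \<odot> b) + q (\<ominus> a)"
      using q assms unfolding sublinear_on_def by simp
    ultimately show ?thesis by simp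
  qed
  have "t * q b \<le> q (t \<odot> b)"
  proof (cases "t = 0")
    case True then show ?thesis using assms by (simp add: scale_zero_left sublinear_zero[OF q])
  next
    case False
    have "q ((1/t) \<odot> (t \<odot> b)) \<le> (1/t) * q (t \<odot> b)"
      using sublinear_onD(2)[OF q, of "t \<odot> b" "1/t"] assms by simp
    then show ?thesis using assms False by (simp add: scale_scale scale_one field_simps)
  qed
  with 1 show ?thesis by simp
qed

lemma sharpen_le:
  assumes q: "sublinear_on W q" and "a \<in> W" "b \<in> W" "t \<ge> 0"
  shows "sharpen q b a \<le> q (a \<oplus> t \<odot> b) - t * q b"
  unfolding sharpen_def
  by (rule cINF_lower) (use sharpen_bdd[OF q] assms in \<open>auto intro!: bdd_belowI\<close>)

lemma sharpen_le_self:
  assumes "sublinear_on W q" "a \<in> W" "b \<in> W"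
  shows "sharpen q b a \<le> q a"
  using sharpen_le[OF assms, of 0] assms by (simp add: scale_zero_left add_zero_right)

lemma sharpen_neg:
  assumes "sublinear_on W q" "b \<in> W"
  shows "sharpen q b (\<ominus> b) \<le> - q b"
  using sharpen_le[OF assms(1) _ assms(2), of "\<ominus> b" 1] assms
  by (simp add: scale_one neg_add_cancel sublinear_zero)

lemma le_sharpen:
  assumes "\<And>t. t \<ge> 0 \<Longrightarrow> c \<le> q (a \<oplus> t \<odot> b) - t * q b"
  shows "c \<le> sharpen q b a"
  unfolding sharpen_def by (rule cINF_greatest) (use assms in auto)

text \<open>The infimum in \<open>sharpen\<close> is therefore a limit for growing \<open>t\<close>,
  and the parameters chosen for two vectors can both be replaced by the larger one.\<close>

lemma sharpen_antimono:
  assumes q: "sublinear_on W q" and "a \<in> W" "b \<in> W" "0 \<le> s" "s \<le> t"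
  shows "q (a \<oplus> t \<odot> b) - t * q b \<le> q (a \<oplus> s \<odot> b) - s * q b"
proof -
  have "a \<oplus> t \<odot> b = (a \<oplus> s \<odot> b) \<oplus> (t - s) \<odot> b"
    using assms scale_add_left[of b s "t - s"] by (simp add: add_assoc)
  then have "q (a \<oplus> t \<odot> b) \<le> q (a \<oplus> s \<odot> b) + q ((t - s) \<odot> b)"
    using q assms unfolding sublinear_on_def by simp
  also have "q ((t - s) \<odot> b) \<le> (t - s) * q b"
    using q assms unfolding sublinear_on_def by simp
  finally show ?thesis by (simp add: algebra_simps)
qed

lemma sublinear_sharpen:
  assumes q: "sublinear_on W q" and b: "b \<in> W"
  shows "sublinear_on W (sharpen q b)"
  unfolding sublinear_on_def
proof (intro conjI ballI allI impI)
  fix a a' assume a: "a \<in> W" "a' \<in> W"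
  have *: "sharpen q b (a \<oplus> a') \<le> (q (a \<oplus> s \<odot> b) - s * q b) + (q (a' \<oplus> t \<odot> b) - t * q b)"
    if "s \<ge> 0" "t \<ge> 0" for s t
  proof -
    have "(a \<oplus> a') \<oplus> (s + t) \<odot> b = (a \<oplus> s \<odot> b) \<oplus> (a' \<oplus> t \<odot> b)"
      using a b by (simp add: add_ac scale_add_left)
    then have "q ((a \<oplus> a') \<oplus> (s + t) \<odot> b) \<le> q (a \<oplus> s \<odot> b) + q (a' \<oplus> t \<odot> b)"
      using q a b unfolding sublinear_on_def by simp
    moreover have "sharpen q b (a \<oplus> a') \<le> q ((a \<oplus> a') \<oplus> (s + t) \<odot> b) - (s + t) * q b"
      using sharpen_le[OF q _ b, of "a \<oplus> a'" "s + t"] a that by simp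
    ultimately show ?thesis by (simp add: algebra_simps)
  qed
  have "sharpen q b (a \<oplus> a') - (q (a' \<oplus> t \<odot> b) - t * q b) \<le> sharpen q b a" if "t \<ge> 0" for t
    by (rule le_sharpen) (use *[OF _ that] in \<open>auto simp: algebra_simps\<close>)
  then have "sharpen q b (a \<oplus> a') - sharpen q b a \<le> sharpen q b a'"
    by (intro le_sharpen) (auto simp: algebra_simps)
  then show "sharpen q b (a \<oplus> a') \<le> sharpen q b a + sharpen q b a'" by simp
next
  fix a and c :: real assume a: "a \<in> W" "0 \<le> c"
  show "sharpen q b (c \<odot> a) \<le> c * sharpen q b a"
  proof (cases "c = 0")
    case True
    then show ?thesis using sharpen_le_self[OF q, of \<zero> b] a b
      by (simp add: scale_zero_left sublinear_zero[OF q])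
  next
    case False
    have "sharpen q b (c \<odot> a) / c \<le> sharpen q b a"
    proof (rule le_sharpen)
      fix t :: real assume t: "t \<ge> 0"
      have "c \<odot> a \<oplus> (c * t) \<odot> b = c \<odot> (a \<oplus> t \<odot> b)"
        using a b by (simp add: scale_add_right scale_scale)
      then have "q (c \<odot> a \<oplus> (c * t) \<odot> b) \<le> c * q (a \<oplus> t \<odot> b)"
        using q a b unfolding sublinear_on_def by simp
      moreover have "sharpen q b (c \<odot> a) \<le> q (c \<odot> a \<oplus> (c * t) \<odot> b) - (c * t) * q b"
        using sharpen_le[OF q _ b, of "c \<odot> a" "c * t"] a t by simp
      ultimately have "sharpen q b (c \<odot> a) \<le> c * (q (a \<oplus> t \<odot> b) - t * q b)"
        by (simp add: algebra_simps)
      then show "sharpen q b (c \<odot> a) / c \<le> q (a \<oplus> t \<odot> b) - t * q b"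
        using a False by (simp add: divide_le_eq mult.commute)
    qed
    then show ?thesis using a False by (simp add: divide_le_eq mult.commute)
  qed
qed

lemma max_bounded_sharpen:
  assumes q: "sublinear_on W q" and b: "b \<in> W" and R: "translation_invariant W R"
    and mb: "max_bounded_on R q"
  shows "max_bounded_on R (sharpen q b)"
  unfolding max_bounded_on_def
proof safe
  fix x y z assume r: "(x, y, z) \<in> R"
  then have xyz: "x \<in> W" "y \<in> W" "z \<in> W" using R by (auto simp: translation_invariant_def)
  show "sharpen q b z \<le> max (sharpen q b x) (sharpen q b y)"
  proof (rule ccontr)
    assume "\<not> ?thesis"
    then have l: "sharpen q b x < sharpen q b z" "sharpen q b y < sharpen q b z" by auto
    obtain s where s: "s \<ge> 0" "q (x \<oplus> s \<odot> b) - s * q b < sharpen q b z"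
      using le_sharpen[of "sharpen q b z" q x b] l by force
    obtain t where t: "t \<ge> 0" "q (y \<oplus> t \<odot> b) - t * q b < sharpen q b z"
      using le_sharpen[of "sharpen q b z" q y b] l by force
    define u where "u = max s t"
    have u: "u \<ge> 0" "s \<le> u" "t \<le> u" using s t by (auto simp: u_def)
    have "(x \<oplus> u \<odot> b, y \<oplus> u \<odot> b, z \<oplus> u \<odot> b) \<in> R"
      using R r b by (auto simp: translation_invariant_def)
    then have "q (z \<oplus> u \<odot> b) \<le> max (q (x \<oplus> u \<odot> b)) (q (y \<oplus> u \<odot> b))"
      by (rule max_bounded_onD[OF mb])
    moreover have "sharpen q b z \<le> q (z \<oplus> u \<odot> b) - u * q b"
      using sharpen_le[OF q xyz(3) b u(1)] .
    ultimately show False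
      using sharpen_antimono[OF q xyz(1) b s(1) u(2)] sharpen_antimono[OF q xyz(2) b t(1) u(3)] s t
      by linarith
  qed
qed

text \<open>At \<open>\<ominus> b\<close> the value of \<open>sharpen q b\<close> is at most
  \<open>- q b\<close>, so minimality makes \<open>q\<close> odd; an odd sublinear functional is
  additive.\<close>

lemma minimal_sublinear_is_linear:
  assumes q: "sublinear_on W q" and min: "\<And>b a. b \<in> W \<Longrightarrow> a \<in> W \<Longrightarrow> q a \<le> sharpen q b a"
  shows "linear_fun_on W q"
proof -
  have odd: "q (\<ominus> b) = - q b" if b: "b \<in> W" for b
    using sharpen_neg[OF q b] min[OF b, of "\<ominus> b"] sublinear_neg[OF q b] b by simp
  have A: "q (a \<oplus> b) = q a + q b" if "a \<in> W" "b \<in> W" for a b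
  proof -
    have "\<ominus> (a \<oplus> b) = \<ominus> a \<oplus> \<ominus> b" using that by (simp add: vneg_def scale_add_right)
    then have "q (\<ominus> (a \<oplus> b)) \<le> q (\<ominus> a) + q (\<ominus> b)"
      using q that unfolding sublinear_on_def by simp
    moreover have "q (a \<oplus> b) \<le> q a + q b" using q that unfolding sublinear_on_def by simp
    ultimately show ?thesis using odd that by simp
  qed
  have P: "q (c \<odot> a) = c * q a" if "a \<in> W" "c \<ge> 0" for a c
  proof -
    have "q (c \<odot> \<ominus> a) \<le> c * q (\<ominus> a)" "q (c \<odot> a) \<le> c * q a"
      using q that unfolding sublinear_on_def by simp_all
    moreover have "c \<odot> \<ominus> a = \<ominus> (c \<odot> a)" using that by (simp add: vneg_def scale_scale mult.commute)
    ultimately show ?thesis using odd that by simp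
  qed
  have "q (c \<odot> a) = c * q a" if "a \<in> W" for a c
  proof (cases "c \<ge> 0")
    case False
    have "c \<odot> a = (- c) \<odot> \<ominus> a" using that by (simp add: vneg_def scale_scale)
    then show ?thesis using P[of "\<ominus> a" "- c"] False odd that by simp
  qed (use P that in simp)
  with A show ?thesis by (simp add: linear_fun_on_def)
qed

theorem ex_linear_below_sublinear:
  assumes q: "sublinear_on W q" and R: "translation_invariant W R" and mb: "max_bounded_on R q"
    and b0: "b0 \<in> W"
  shows "\<exists>f. linear_fun_on W f \<and> (\<forall>a\<in>W. f a \<le> q a) \<and> f b0 = q b0 \<and> max_bounded_on R f"
proof -
  \<comment> \<open>Descending from \<open>sharpen q b0\<close> fixes the value at
    \<open>b0\<close>: a linear \<open>f\<close> below it has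
    \<open>f (\<ominus> b0) \<le> - q b0\<close>, that is, \<open>f b0 \<ge> q b0\<close>.\<close>
  define q0 where "q0 = sharpen q b0"
  have q0: "sublinear_on W q0" "max_bounded_on R q0" "\<And>a. a \<in> W \<Longrightarrow> q0 a \<le> q a" "q0 (\<ominus> b0) \<le> - q b0"
    unfolding q0_def using sublinear_sharpen[OF q b0] max_bounded_sharpen[OF q b0 R mb]
      sharpen_le_self[OF q _ b0] sharpen_neg[OF q b0] by auto
  \<comment> \<open>Extensionality makes the pointwise order antisymmetric. \<open>P\<close>
    reverses that order, so the maximal element given by Zorn's lemma is a minimal
    functional.\<close>
  define Q where "Q = {p \<in> extensional W. sublinear_on W p \<and> max_bounded_on R p \<and> (\<forall>a\<in>W. p a \<le> q0 a)}"
  define P where "P = (\<lambda>p p' :: 'a \<Rightarrow> real. \<forall>a\<in>W. p' a \<le> p a)"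
  have res: "restrict p W \<in> Q" if "sublinear_on W p" "max_bounded_on R p" "\<forall>a\<in>W. p a \<le> q0 a" for p
  proof -
    have "sublinear_on W (restrict p W)" using that(1) by (simp add: sublinear_on_def)
    moreover have "max_bounded_on R (restrict p W)"
      using that(2) R unfolding max_bounded_on_def translation_invariant_def by fastforce
    ultimately show ?thesis using that(3) by (simp add: Q_def)
  qed
  have "\<exists>m\<in>Q. \<forall>a\<in>Q. P m a \<longrightarrow> a = m"
  proof (rule predicate_Zorn)
    show "partial_order_on Q (relation_of P Q)"
    proof (rule partial_order_on_relation_ofI)
      show "P a a" if "a \<in> Q" for a by (simp add: P_def)
      show "P a c" if "a \<in> Q" "b \<in> Q" "c \<in> Q" "P a b" "P b c" for a b c
        using that unfolding P_def by force
      show "a = b" if "a \<in> Q" "b \<in> Q" "P a b" "P b a" for a b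
        by (rule extensionalityI[of a W]) (use that in \<open>auto simp: P_def Q_def intro!: antisym\<close>)
    qed
  next
    fix C assume C: "C \<in> Chains (relation_of P Q)"
    show "\<exists>u\<in>Q. \<forall>a\<in>C. P a u"
    proof (cases "C = {}")
      case True then show ?thesis using res[OF q0(1,2)] by auto
    next
      case False
      have CQ: "p \<in> Q" if "p \<in> C" for p using C that by (auto simp: Chains_def relation_of_def)
      have lin: "(\<forall>a\<in>W. p a \<le> p' a) \<or> (\<forall>a\<in>W. p' a \<le> p a)" if "p \<in> C" "p' \<in> C" for p p'
        using C that by (auto simp: Chains_def relation_of_def P_def)
      have bd: "- q0 (\<ominus> a) \<le> p a" if "p \<in> C" "a \<in> W" for p a
      proof -
        have "- p (\<ominus> a) \<le> p a" "p (\<ominus> a) \<le> q0 (\<ominus> a)"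
          using CQ[OF that(1)] that sublinear_neg[of p a] by (auto simp: Q_def)
        then show ?thesis by simp
      qed
      \<comment> \<open>The pointwise infimum of a chain keeps both properties: members chosen for
        two different vectors are comparable, and the smaller one serves both vectors.\<close>
      define u where "u = (\<lambda>a. INF p\<in>C. p a)"
      have u_le: "u a \<le> p a" if "p \<in> C" "a \<in> W" for p a
        unfolding u_def by (rule cINF_lower) (use bd that in \<open>auto intro!: bdd_belowI\<close>)
      have le_u: "c \<le> u a" if "\<And>p. p \<in> C \<Longrightarrow> c \<le> p a" for a c
        unfolding u_def by (rule cINF_greatest) (use False that in auto)
      have s: "sublinear_on W u" unfolding sublinear_on_def
      proof (intro conjI ballI allI impI)
        fix a b assume ab: "a \<in> W" "b \<in> W"
        have *: "u (a \<oplus> b) \<le> p a + p' b" if pp: "p \<in> C" "p' \<in> C" for p p'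
          using lin[OF pp]
        proof
          assume "\<forall>a\<in>W. p a \<le> p' a"
          moreover have "u (a \<oplus> b) \<le> p (a \<oplus> b)" "p (a \<oplus> b) \<le> p a + p b"
            using u_le[OF pp(1)] CQ[OF pp(1)] ab by (auto simp: Q_def sublinear_on_def)
          ultimately show ?thesis using ab by force
        next
          assume "\<forall>a\<in>W. p' a \<le> p a"
          moreover have "u (a \<oplus> b) \<le> p' (a \<oplus> b)" "p' (a \<oplus> b) \<le> p' a + p' b"
            using u_le[OF pp(2)] CQ[OF pp(2)] ab by (auto simp: Q_def sublinear_on_def)
          ultimately show ?thesis using ab by force
        qed
        have "u (a \<oplus> b) - p' b \<le> u a" if "p' \<in> C" for p'
          by (rule le_u) (use *[OF _ that] in \<open>auto simp: algebra_simps\<close>)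
        then have "u (a \<oplus> b) - u a \<le> u b" by (intro le_u) (auto simp: algebra_simps)
        then show "u (a \<oplus> b) \<le> u a + u b" by simp
      next
        fix a and c :: real assume a: "a \<in> W" "0 \<le> c"
        show "u (c \<odot> a) \<le> c * u a"
        proof (cases "c = 0")
          case True
          obtain p where p: "p \<in> C" using False by auto
          show ?thesis using u_le[OF p, of \<zero>] CQ[OF p] True a
            by (simp add: Q_def scale_zero_left sublinear_zero)
        next
          case False
          have "u (c \<odot> a) / c \<le> u a"
          proof (rule le_u)
            fix p assume p: "p \<in> C"
            have "u (c \<odot> a) \<le> p (c \<odot> a)" "p (c \<odot> a) \<le> c * p a"
              using u_le[OF p] CQ[OF p] a by (auto simp: Q_def sublinear_on_def)
            then show "u (c \<odot> a) / c \<le> p a" using a False by (simp add: divide_le_eq mult.commute)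
          qed
          then show ?thesis using a False by (simp add: divide_le_eq mult.commute)
        qed
      qed
      have m: "max_bounded_on R u" unfolding max_bounded_on_def
      proof safe
        fix x y z assume r: "(x, y, z) \<in> R"
        then have xyz: "x \<in> W" "y \<in> W" "z \<in> W" using R by (auto simp: translation_invariant_def)
        show "u z \<le> max (u x) (u y)"
        proof (rule ccontr)
          assume "\<not> ?thesis"
          then have l: "u x < u z" "u y < u z" by auto
          obtain p where p: "p \<in> C" "p x < u z" using le_u[of "u z" x] l by force
          obtain p' where p': "p' \<in> C" "p' y < u z" using le_u[of "u z" y] l by force
          have "p z \<le> max (p x) (p y)" "p' z \<le> max (p' x) (p' y)"
            using CQ[OF p(1)] CQ[OF p'(1)] r by (auto simp: Q_def intro: max_bounded_onD)
          moreover have "p y \<le> p' y \<or> p' x \<le> p x"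
            using lin[OF p(1) p'(1)] xyz by auto
          ultimately show False using u_le[OF p(1) xyz(3)] u_le[OF p'(1) xyz(3)] p p' by linarith
        qed
      qed
      have "\<forall>a\<in>W. u a \<le> q0 a"
      proof
        fix a assume a: "a \<in> W"
        obtain p where p: "p \<in> C" using False by auto
        show "u a \<le> q0 a" using u_le[OF p a] CQ[OF p] a by (force simp: Q_def)
      qed
      from res[OF s m this] show ?thesis
        by (rule bexI[rotated]) (use u_le in \<open>auto simp: P_def\<close>)
    qed
  qed
  then obtain f where f: "f \<in> Q" and fm: "\<And>a. a \<in> Q \<Longrightarrow> P f a \<Longrightarrow> a = f" by blast
  have fs: "sublinear_on W f" "max_bounded_on R f" "\<And>a. a \<in> W \<Longrightarrow> f a \<le> q0 a"
    using f by (auto simp: Q_def)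
  have "linear_fun_on W f"
  proof (rule minimal_sublinear_is_linear[OF fs(1)])
    fix b a assume b: "b \<in> W" and a: "a \<in> W"
    have le: "\<forall>a\<in>W. sharpen f b a \<le> f a" using sharpen_le_self[OF fs(1) _ b] by auto
    have "restrict (sharpen f b) W \<in> Q"
      using res[OF sublinear_sharpen[OF fs(1) b] max_bounded_sharpen[OF fs(1) b R fs(2)]] le fs(3)
      by force
    then have "restrict (sharpen f b) W = f" by (rule fm) (use le in \<open>simp add: P_def\<close>)
    then have "f a = sharpen f b a" using a by (metis restrict_apply')
    then show "f a \<le> sharpen f b a" by simp
  qed
  moreover have "f a \<le> q a" if "a \<in> W" for a using fs(3)[OF that] q0(3)[OF that] by simp
  moreover have "f b0 = q b0"
  proof -
    have "f (\<ominus> b0) = - f b0" using calculation(1) b0 by (simp add: linear_fun_on_def vneg_def)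
    moreover have "f (\<ominus> b0) \<le> - q b0" using fs(3)[of "\<ominus> b0"] q0(4) b0 by simp
    ultimately show ?thesis using \<open>\<And>a. a \<in> W \<Longrightarrow> f a \<le> q a\<close>[OF b0] by simp
  qed
  ultimately show ?thesis using fs(2) by blast
qed

end

declare W_simps [simp del]

lemma subspace_V: "subspace_on V"
  by (simp add: subspace_on_def)

definition lin :: "('a \<Rightarrow> real) \<Rightarrow> bool" where
  "lin f \<longleftrightarrow> linear_fun_on V f"

lemma lin_simps:
  assumes "lin f"
  shows "x \<in> V \<Longrightarrow> y \<in> V \<Longrightarrow> f (x \<oplus> y) = f x + f y" "x \<in> V \<Longrightarrow> f (c \<odot> x) = c * f x"
    "x \<in> V \<Longrightarrow> f (\<ominus> x) = - f x" "f \<zero> = 0"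
proof -
  show "x \<in> V \<Longrightarrow> y \<in> V \<Longrightarrow> f (x \<oplus> y) = f x + f y" and 1: "\<And>x c. x \<in> V \<Longrightarrow> f (c \<odot> x) = c * f x"
    using assms by (auto simp: lin_def linear_fun_on_def)
  show "x \<in> V \<Longrightarrow> f (\<ominus> x) = - f x" using 1 by (simp add: vneg_def)
  show "f \<zero> = 0" using 1[of \<zero> 0] by (simp add: scale_zero_right)
qed

text \<open>Linear functionals separate points, so that a vector identity on the carrier can be checked
  as an identity of real numbers.\<close>

lemma lin_eqI:
  assumes "x \<in> V" "y \<in> V" and eq: "\<And>f. lin f \<Longrightarrow> f x = f y"
  shows "x = y"
proof -
  have s: "sublinear_on V (vnorm E)"
    by (simp add: sublinear_on_def norm_triangle norm_scale)
  obtain f where f: "linear_fun_on V f" "f (x \<oplus> \<ominus> y) = \<parallel>x \<oplus> \<ominus> y\<parallel>"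
    using ex_linear_below_sublinear[OF subspace_V s, of "{}" "x \<oplus> \<ominus> y"] assms
    by (auto simp: translation_invariant_def max_bounded_on_def)
  then have "lin f" by (simp add: lin_def)
  then have "\<parallel>x \<oplus> \<ominus> y\<parallel> = 0" using f(2) eq[of f] assms by (simp add: lin_simps)
  then have "x \<oplus> \<ominus> y = \<zero>" using assms by (simp add: norm_eq_zero)
  then show ?thesis
    using assms add_assoc[of x "\<ominus> y" y] by (simp add: neg_add_cancel add_zero_right add_zero)
qed

end

section \<open>Metric and order structure\<close>

definition finite_enum :: "'i set \<Rightarrow> nat \<Rightarrow> 'i" where
  "finite_enum I = (SOME h. bij_betw h {0..<card I} I)"

lemma bij_finite_enum: "finite I \<Longrightarrow> bij_betw (finite_enum I) {..<card I} I"
  unfolding finite_enum_def using ex_bij_betw_nat_finite[of I]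
  by (metis (mono_tags, lifting) atLeast0LessThan someI_ex)

lemma sum_finite_enum:
  "finite I \<Longrightarrow> (\<Sum>k<card I. f (finite_enum I k)) = sum f I" for f :: "'i \<Rightarrow> real"
  by (rule sum.reindex_bij_betw[OF bij_finite_enum])

lemma finite_enum_in: "finite I \<Longrightarrow> k < card I \<Longrightarrow> finite_enum I k \<in> I"
  using bij_finite_enum bij_betwE by blast

text \<open>Sums over finite index sets such as \<open>signs m\<close>, along a chosen enumeration,
  reduced in this way to \<open>vpsum\<close>.\<close>

definition vsum :: "('a, 'm) nspace_scheme \<Rightarrow> ('i \<Rightarrow> 'a) \<Rightarrow> 'i set \<Rightarrow> 'a" where
  "vsum E g I = vpsum E (\<lambda>k. g (finite_enum I k)) (card I)"

context normed_space_on
begin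

abbreviation sub (infixl "\<ominus>" 65) where "x \<ominus> y \<equiv> x \<oplus> (\<ominus> y)"

lemma norm_zero: "\<parallel>\<zero>\<parallel> = 0"
  by (simp add: norm_eq_zero)

lemma norm_neg: "x \<in> V \<Longrightarrow> \<parallel>\<ominus> x\<parallel> = \<parallel>x\<parallel>"
  by (simp add: vneg_def norm_scale)

lemma norm_sub_commute: "x \<in> V \<Longrightarrow> y \<in> V \<Longrightarrow> \<parallel>x \<ominus> y\<parallel> = \<parallel>y \<ominus> x\<parallel>"
proof -
  assume xy: "x \<in> V" "y \<in> V"
  then have "x \<ominus> y = \<ominus> (y \<ominus> x)" by (intro lin_eqI) (auto simp: lin_simps)
  then show ?thesis using xy by (metis norm_neg add_closed neg_closed)
qed

lemma norm_sub_triangle: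
  "x \<in> V \<Longrightarrow> y \<in> V \<Longrightarrow> z \<in> V \<Longrightarrow> \<parallel>x \<ominus> z\<parallel> \<le> \<parallel>x \<ominus> y\<parallel> + \<parallel>y \<ominus> z\<parallel>"
proof -
  assume xyz: "x \<in> V" "y \<in> V" "z \<in> V"
  then have "x \<ominus> z = (x \<ominus> y) \<oplus> (y \<ominus> z)" by (intro lin_eqI) (auto simp: lin_simps)
  then show ?thesis using xyz by (metis norm_triangle add_closed neg_closed)
qed

lemma Metric_space_vdist: "Metric_space V (vdist E)"
proof
  show "0 \<le> vdist E x y" for x y by (simp add: vdist_def norm_nonneg)
  show "vdist E x y = vdist E y x" for x y by (simp add: vdist_def norm_sub_commute)
  show "(vdist E x y = 0) = (x = y)" if "x \<in> V" "y \<in> V" for x y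
  proof -
    have "x = (x \<ominus> y) \<oplus> y" using that by (intro lin_eqI) (auto simp: lin_simps)
    then have "x \<ominus> y = \<zero> \<Longrightarrow> x = y" using that by (simp add: add_zero)
    then show ?thesis using that by (auto simp: vdist_def norm_eq_zero add_neg)
  qed
  show "vdist E x z \<le> vdist E x y + vdist E y z" if "x \<in> V" "y \<in> V" "z \<in> V" for x y z
    using that norm_sub_triangle by (simp add: vdist_def)
qed

lemma limitin_vdist:
  assumes "range \<sigma> \<subseteq> V" "l \<in> V"
  shows "limitin (Metric_space.mtopology V (vdist E)) \<sigma> l sequentially \<longleftrightarrow>
     (\<lambda>k. \<parallel>\<sigma> k \<ominus> l\<parallel>) \<longlonglongrightarrow> 0"
proof -
  interpret M: Metric_space V "vdist E" by (rule Metric_space_vdist)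
  have "vdist E (\<sigma> k) l = \<parallel>\<sigma> k \<ominus> l\<parallel>" for k using assms by (auto simp: vdist_def)
  then show ?thesis using assms
    by (simp add: M.limitin_metric_dist_null range_subsetD)
qed

text \<open>Points of the closure are replaced by points of \<open>S\<close> at distance below
  \<open>1 / (k + 1)\<close>; this does not affect limits, so subsequences have to be found in
  \<open>S\<close> only.\<close>

lemma relatively_compactI:
  assumes S: "S \<subseteq> V"
    and seq: "\<And>\<sigma> :: nat \<Rightarrow> 'a. range \<sigma> \<subseteq> S \<Longrightarrow>
       \<exists>l\<in>V. \<exists>r. strict_mono r \<and> (\<lambda>k. \<parallel>\<sigma> (r k) \<ominus> l\<parallel>) \<longlonglongrightarrow> 0"
  shows "relatively_compact_in E S"
proof -
  interpret M: Metric_space V "vdist E" by (rule Metric_space_vdist)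
  have "\<exists>l r. l \<in> M.mtopology closure_of S \<and> strict_mono r \<and>
      limitin M.mtopology (\<sigma> \<circ> r) l sequentially"
    if \<sigma>: "range \<sigma> \<subseteq> M.mtopology closure_of S" for \<sigma> :: "nat \<Rightarrow> 'a"
  proof -
    have \<sigma>V: "\<sigma> k \<in> V" for k using \<sigma> closure_of_subset_topspace[of M.mtopology S] by auto
    have "\<exists>y\<in>S. vdist E (\<sigma> k) y < 1 / real (Suc k)" for k
    proof -
      have "\<sigma> k \<in> M.mtopology closure_of S" using \<sigma> by auto
      then have "\<forall>r>0. \<exists>y\<in>S. y \<in> M.mball (\<sigma> k) r" by (simp add: M.metric_closure_of)
      then have "\<exists>y\<in>S. y \<in> M.mball (\<sigma> k) (1 / real (Suc k))"
        by (metis of_nat_0_less_iff zero_less_Suc zero_less_divide_1_iff)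
      then show ?thesis by auto
    qed
    then obtain \<tau> where \<tau>: "\<And>k. \<tau> k \<in> S" "\<And>k. vdist E (\<sigma> k) (\<tau> k) < 1 / real (Suc k)" by metis
    obtain l r where l: "l \<in> V" "strict_mono r" "(\<lambda>k. \<parallel>\<tau> (r k) \<ominus> l\<parallel>) \<longlonglongrightarrow> 0"
      using seq[of \<tau>] \<tau> by blast
    have \<tau>V: "\<tau> k \<in> V" for k using \<tau> S by auto
    have "(\<lambda>k. 1 / real (Suc (r k))) \<longlonglongrightarrow> 0"
      using LIMSEQ_subseq_LIMSEQ[OF LIMSEQ_Suc[OF lim_1_over_n] l(2)] by (simp add: o_def)
    then have "(\<lambda>k. 1 / real (Suc (r k)) + \<parallel>\<tau> (r k) \<ominus> l\<parallel>) \<longlonglongrightarrow> 0 + 0"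
      by (intro tendsto_add l)
    then have lim: "(\<lambda>k. 1 / real (Suc (r k)) + \<parallel>\<tau> (r k) \<ominus> l\<parallel>) \<longlonglongrightarrow> 0" by simp
    have "\<parallel>\<sigma> (r k) \<ominus> l\<parallel> \<le> 1 / real (Suc (r k)) + \<parallel>\<tau> (r k) \<ominus> l\<parallel>" for k
    proof -
      have "\<parallel>\<sigma> (r k) \<ominus> l\<parallel> \<le> \<parallel>\<sigma> (r k) \<ominus> \<tau> (r k)\<parallel> + \<parallel>\<tau> (r k) \<ominus> l\<parallel>"
        using \<sigma>V \<tau>V l by (simp add: norm_sub_triangle)
      moreover have "\<parallel>\<sigma> (r k) \<ominus> \<tau> (r k)\<parallel> < 1 / real (Suc (r k))"
        using \<tau>(2)[of "r k"] \<sigma>V \<tau>V by (simp add: vdist_def)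
      ultimately show ?thesis by linarith
    qed
    moreover have "0 \<le> \<parallel>\<sigma> (r k) \<ominus> l\<parallel>" for k using \<sigma>V l by (simp add: norm_nonneg)
    ultimately have "(\<lambda>k. \<parallel>\<sigma> (r k) \<ominus> l\<parallel>) \<longlonglongrightarrow> 0"
      by (intro tendsto_sandwich[OF _ _ tendsto_const lim] always_eventually) auto
    then have 1: "limitin M.mtopology (\<sigma> \<circ> r) l sequentially"
      using limitin_vdist[of "\<sigma> \<circ> r" l] \<sigma>V l by (auto simp: o_def)
    have "l \<in> M.mtopology closure_of S"
      using limitin_closedin[OF 1 closedin_closure_of[of M.mtopology S]] \<sigma>
      by (auto intro!: always_eventually)
    with 1 l(2) show ?thesis by blast
  qed
  then have "compactin M.mtopology (M.mtopology closure_of S)"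
    by (subst M.compactin_sequentially) (use closure_of_subset_topspace[of M.mtopology S] in auto)
  then show ?thesis by (simp add: relatively_compact_in_def Let_def)
qed

lemma vpsum_closed: "(\<And>i. i < k \<Longrightarrow> x i \<in> V) \<Longrightarrow> vpsum E x k \<in> V"
  by (induction k) auto

lemma vpsum_norm_le: "(\<And>i. i < k \<Longrightarrow> x i \<in> V) \<Longrightarrow> \<parallel>vpsum E x k\<parallel> \<le> (\<Sum>i<k. \<parallel>x i\<parallel>)"
proof (induction k)
  case (Suc k)
  then have "\<parallel>vpsum E x (Suc k)\<parallel> \<le> \<parallel>vpsum E x k\<parallel> + \<parallel>x k\<parallel>"
    by (simp add: norm_triangle vpsum_closed)
  then show ?case using Suc by force
qed (simp add: norm_zero)

lemma vsum_closed: "finite I \<Longrightarrow> (\<And>i. i \<in> I \<Longrightarrow> g i \<in> V) \<Longrightarrow> vsum E g I \<in> V"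
  unfolding vsum_def by (rule vpsum_closed) (simp add: finite_enum_in)

lemma vsum_norm_le:
  "finite I \<Longrightarrow> (\<And>i. i \<in> I \<Longrightarrow> g i \<in> V) \<Longrightarrow> \<parallel>vsum E g I\<parallel> \<le> (\<Sum>i\<in>I. \<parallel>g i\<parallel>)"
proof -
  assume I: "finite I" "\<And>i. i \<in> I \<Longrightarrow> g i \<in> V"
  have "\<parallel>vsum E g I\<parallel> \<le> (\<Sum>k<card I. \<parallel>g (finite_enum I k)\<parallel>)"
    unfolding vsum_def using I by (intro vpsum_norm_le) (simp add: finite_enum_in)
  then show ?thesis using sum_finite_enum[OF I(1), of "\<lambda>i. \<parallel>g i\<parallel>"] by simp
qed

end

lemma linear_map_onD:
  assumes "linear_map_on E F T" "x \<in> vcarrier E"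
  shows "T x \<in> vcarrier F" "y \<in> vcarrier E \<Longrightarrow> T (vadd E x y) = vadd F (T x) (T y)"
    "T (vscale E a x) = vscale F a (T x)" "T (vneg E x) = vneg F (T x)"
  using assms by (auto simp: linear_map_on_def vneg_def)

lemma linear_map_on_zero:
  assumes "normed_space_on E" "normed_space_on F" "linear_map_on E F T"
  shows "T (vzero E) = vzero F"
proof -
  interpret E: normed_space_on E by fact
  interpret F: normed_space_on F by fact
  have "T (vscale E 0 (vzero E)) = vscale F 0 (T (vzero E))"
    by (rule linear_map_onD(3)[OF assms(3) E.zero_closed])
  then show ?thesis using linear_map_onD(1)[OF assms(3) E.zero_closed]
    by (simp add: E.scale_zero_right F.scale_zero_left)
qed

lemma linear_map_on_vpsum:
  assumes "normed_space_on E" "normed_space_on F" "linear_map_on E F T"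
    "\<And>i. i < k \<Longrightarrow> x i \<in> vcarrier E"
  shows "T (vpsum E x k) = vpsum F (\<lambda>i. T (x i)) k"
  using assms(4)
proof (induction k)
  case 0 then show ?case using linear_map_on_zero[OF assms(1-3)] by simp
next
  case (Suc k)
  have "vpsum E x k \<in> vcarrier E"
    using Suc.prems by (intro normed_space_on.vpsum_closed[OF assms(1)]) auto
  then show ?case using Suc linear_map_onD[OF assms(3)] by simp
qed

text \<open>The structure required of the target of an operator. It fits the dual of a free Banach
  lattice, where no suprema are formed; \<open>norm_le_dominated\<close> takes the place of
  monotonicity of the norm in terms of moduli.\<close>

locale ordered_normed_space_on = normed_space_on E for E :: "('a, 'm) nlattice_scheme" +
  assumes le_refl: "x \<in> vcarrier E \<Longrightarrow> vle E x x"
    and le_antisym: "\<lbrakk>x \<in> vcarrier E; y \<in> vcarrier E; vle E x y; vle E y x\<rbrakk> \<Longrightarrow> x = y"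
    and le_trans: "\<lbrakk>x \<in> vcarrier E; y \<in> vcarrier E; z \<in> vcarrier E; vle E x y; vle E y z\<rbrakk>
        \<Longrightarrow> vle E x z"
    and le_add: "\<lbrakk>x \<in> vcarrier E; y \<in> vcarrier E; z \<in> vcarrier E; vle E x y\<rbrakk>
        \<Longrightarrow> vle E (vadd E x z) (vadd E y z)"
    and le_scale: "\<lbrakk>x \<in> vcarrier E; vle E (vzero E) x; 0 \<le> a\<rbrakk>
        \<Longrightarrow> vle E (vzero E) (vscale E a x)"
    and norm_le_dominated: "\<lbrakk>x \<in> vcarrier E; y \<in> vcarrier E; vle E (vneg E y) x; vle E x y\<rbrakk>
        \<Longrightarrow> vnorm E x \<le> vnorm E y"

text \<open>The common part of \<open>ordered_normed_space_on\<close> and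
  \<open>normed_lattice_on\<close>: an ordered vector space and a norm without any link between norm
  and order.\<close>

locale preordered_on = normed_space_on E for E :: "('a, 'm) nlattice_scheme" +
  assumes le_refl: "x \<in> vcarrier E \<Longrightarrow> vle E x x"
    and le_antisym: "\<lbrakk>x \<in> vcarrier E; y \<in> vcarrier E; vle E x y; vle E y x\<rbrakk> \<Longrightarrow> x = y"
    and le_trans: "\<lbrakk>x \<in> vcarrier E; y \<in> vcarrier E; z \<in> vcarrier E; vle E x y; vle E y z\<rbrakk>
        \<Longrightarrow> vle E x z"
    and le_add: "\<lbrakk>x \<in> vcarrier E; y \<in> vcarrier E; z \<in> vcarrier E; vle E x y\<rbrakk>
        \<Longrightarrow> vle E (vadd E x z) (vadd E y z)"
    and le_scale: "\<lbrakk>x \<in> vcarrier E; vle E (vzero E) x; 0 \<le> a\<rbrakk>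
        \<Longrightarrow> vle E (vzero E) (vscale E a x)"
begin

abbreviation le (infix "\<preceq>" 50) where "x \<preceq> y \<equiv> vle E x y"

lemma le_iff_diff: "x \<in> V \<Longrightarrow> y \<in> V \<Longrightarrow> x \<preceq> y \<longleftrightarrow> \<zero> \<preceq> y \<ominus> x"
proof safe
  assume xy: "x \<in> V" "y \<in> V"
  show "\<zero> \<preceq> y \<ominus> x" if "x \<preceq> y" using le_add[of x y "\<ominus> x"] xy that by (simp add: add_neg)
  show "x \<preceq> y" if "\<zero> \<preceq> y \<ominus> x"
  proof -
    have "y \<ominus> x \<oplus> x = y" using xy by (intro lin_eqI) (auto simp: lin_simps)
    then show ?thesis using le_add[of \<zero> "y \<ominus> x" x] xy that by (simp add: add_zero)
  qed
qed

lemma add_mono: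
  assumes "x \<in> V" "y \<in> V" "x' \<in> V" "y' \<in> V" "x \<preceq> y" "x' \<preceq> y'"
  shows "x \<oplus> x' \<preceq> y \<oplus> y'"
proof -
  have "x \<oplus> x' \<preceq> y \<oplus> x'" "x' \<oplus> y \<preceq> y' \<oplus> y" using assms by (auto intro!: le_add)
  then show ?thesis using assms by (metis le_trans add_closed add_commute)
qed

lemma add_nonneg: "x \<in> V \<Longrightarrow> y \<in> V \<Longrightarrow> \<zero> \<preceq> x \<Longrightarrow> \<zero> \<preceq> y \<Longrightarrow> \<zero> \<preceq> x \<oplus> y"
  using add_mono[of \<zero> x \<zero> y] by (simp add: add_zero)

lemma scale_mono: 
  assumes "x \<in> V" "y \<in> V" "x \<preceq> y" "0 \<le> a" shows "a \<odot> x \<preceq> a \<odot> y"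
proof -
  have "a \<odot> y \<ominus> a \<odot> x = a \<odot> (y \<ominus> x)" using assms by (intro lin_eqI) (auto simp: lin_simps algebra_simps)
  then show ?thesis using assms le_iff_diff[of x y] le_iff_diff[of "a \<odot> x"] le_scale[of "y \<ominus> x"] by simp
qed

lemma neg_le_swap: "x \<in> V \<Longrightarrow> y \<in> V \<Longrightarrow> \<ominus> x \<preceq> y \<longleftrightarrow> \<ominus> y \<preceq> x"
proof -
  assume xy: "x \<in> V" "y \<in> V"
  have "y \<ominus> \<ominus> x = x \<ominus> \<ominus> y" using xy by (intro lin_eqI) (auto simp: lin_simps)
  then show ?thesis using xy le_iff_diff[of "\<ominus> x" y] le_iff_diff[of "\<ominus> y" x] by simp
qed

lemma neg_mono: "x \<in> V \<Longrightarrow> y \<in> V \<Longrightarrow> \<ominus> x \<preceq> \<ominus> y \<longleftrightarrow> y \<preceq> x"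
proof -
  assume xy: "x \<in> V" "y \<in> V"
  have "\<ominus> y \<ominus> \<ominus> x = x \<ominus> y" using xy by (intro lin_eqI) (auto simp: lin_simps)
  then show ?thesis using xy le_iff_diff[of "\<ominus> x" "\<ominus> y"] le_iff_diff[of y x] by simp
qed

lemma neg_nonpos: "y \<in> V \<Longrightarrow> \<ominus> y \<preceq> \<zero> \<longleftrightarrow> \<zero> \<preceq> y"
proof -
  assume y: "y \<in> V"
  have "\<zero> \<ominus> \<ominus> y = y" using y by (intro lin_eqI) (auto simp: lin_simps)
  then show ?thesis using y le_iff_diff[of "\<ominus> y" \<zero>] by simp
qed

lemma scale_nonneg_cancel: "x \<in> V \<Longrightarrow> 0 < a \<Longrightarrow> \<zero> \<preceq> a \<odot> x \<Longrightarrow> \<zero> \<preceq> x"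
  using le_scale[of "a \<odot> x" "1 / a"] by (simp add: scale_scale scale_one)

lemma nonneg_if_dominates:
  assumes "x \<in> V" "y \<in> V" "\<ominus> y \<preceq> x" "x \<preceq> y" shows "\<zero> \<preceq> y"
proof -
  have "\<ominus> y \<preceq> y" using assms le_trans[of "\<ominus> y" x y] by simp
  moreover have "y \<ominus> \<ominus> y = 2 \<odot> y" using assms by (intro lin_eqI) (auto simp: lin_simps)
  ultimately show ?thesis using assms le_iff_diff[of "\<ominus> y" y] scale_nonneg_cancel[of y 2] by simp
qed

lemma vpsum_nonneg: "(\<And>i. i < k \<Longrightarrow> x i \<in> V \<and> \<zero> \<preceq> x i) \<Longrightarrow> \<zero> \<preceq> vpsum E x k"
  by (induction k) (simp_all add: le_refl add_nonneg vpsum_closed)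

lemma vpsum_mono:
  "(\<And>i. i < k \<Longrightarrow> x i \<in> V \<and> y i \<in> V \<and> x i \<preceq> y i) \<Longrightarrow> vpsum E x k \<preceq> vpsum E y k"
  by (induction k) (auto intro!: le_refl add_mono vpsum_closed)

end

sublocale ordered_normed_space_on \<subseteq> preordered_on
  by unfold_locales (fact le_refl le_antisym le_trans le_add le_scale)+

context ordered_normed_space_on
begin

lemma norm_le_positive: "x \<in> V \<Longrightarrow> y \<in> V \<Longrightarrow> \<zero> \<preceq> x \<Longrightarrow> x \<preceq> y \<Longrightarrow> \<parallel>x\<parallel> \<le> \<parallel>y\<parallel>"
  using norm_le_dominated[of x y] le_trans[of "\<ominus> y" \<zero> x] neg_nonpos[of y] le_trans[of \<zero> x y] by simp

end

text \<open>Completeness is left out so that the lattice calculus applies to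
  \<open>Lp_space\<close>, for which exactly these axioms are verified.\<close>

locale normed_lattice_on = preordered_on E for E :: "('a, 'm) nlattice_scheme" +
  assumes ex_sup: "\<lbrakk>x \<in> vcarrier E; y \<in> vcarrier E\<rbrakk> \<Longrightarrow> \<exists>z. is_vsup E x y z"
    and ex_inf: "\<lbrakk>x \<in> vcarrier E; y \<in> vcarrier E\<rbrakk> \<Longrightarrow> \<exists>z. is_vinf E x y z"
    and norm_mono: "\<lbrakk>x \<in> vcarrier E; y \<in> vcarrier E; vle E (vabs E x) (vabs E y)\<rbrakk>
        \<Longrightarrow> vnorm E x \<le> vnorm E y"
begin

lemma is_vsup_unique: "is_vsup E x y z \<Longrightarrow> is_vsup E x y z' \<Longrightarrow> z = z'"
  unfolding is_vsup_def by (meson le_antisym)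

lemma is_vinf_unique: "is_vinf E x y z \<Longrightarrow> is_vinf E x y z' \<Longrightarrow> z = z'"
  unfolding is_vinf_def by (meson le_antisym)

lemma vsup_eqI: "is_vsup E x y z \<Longrightarrow> vsup E x y = z"
  unfolding vsup_def by (rule the_equality) (auto intro: is_vsup_unique)

lemma vinf_eqI: "is_vinf E x y z \<Longrightarrow> vinf E x y = z"
  unfolding vinf_def by (rule the_equality) (auto intro: is_vinf_unique)

abbreviation Sup2 (infixl "\<squnion>" 60) where "x \<squnion> y \<equiv> vsup E x y"
abbreviation Inf2 (infixl "\<sqinter>" 60) where "x \<sqinter> y \<equiv> vinf E x y"
abbreviation abs_on ("\<bar>_\<bar>\<^sub>E") where "\<bar>x\<bar>\<^sub>E \<equiv> vabs E x"

lemma is_vsup_vsup: "x \<in> V \<Longrightarrow> y \<in> V \<Longrightarrow> is_vsup E x y (x \<squnion> y)"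
  using ex_sup vsup_eqI by metis

lemma is_vinf_vinf: "x \<in> V \<Longrightarrow> y \<in> V \<Longrightarrow> is_vinf E x y (x \<sqinter> y)"
  using ex_inf vinf_eqI by metis

lemma vsup_closed [simp]: "x \<in> V \<Longrightarrow> y \<in> V \<Longrightarrow> x \<squnion> y \<in> V"
  and vsup_ge1: "x \<in> V \<Longrightarrow> y \<in> V \<Longrightarrow> x \<preceq> x \<squnion> y"
  and vsup_ge2: "x \<in> V \<Longrightarrow> y \<in> V \<Longrightarrow> y \<preceq> x \<squnion> y"
  and vsup_least: "x \<in> V \<Longrightarrow> y \<in> V \<Longrightarrow> z \<in> V \<Longrightarrow> x \<preceq> z \<Longrightarrow> y \<preceq> z \<Longrightarrow> x \<squnion> y \<preceq> z"
  using is_vsup_vsup[of x y] unfolding is_vsup_def by auto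

lemma vinf_closed [simp]: "x \<in> V \<Longrightarrow> y \<in> V \<Longrightarrow> x \<sqinter> y \<in> V"
  and vinf_le1: "x \<in> V \<Longrightarrow> y \<in> V \<Longrightarrow> x \<sqinter> y \<preceq> x"
  and vinf_le2: "x \<in> V \<Longrightarrow> y \<in> V \<Longrightarrow> x \<sqinter> y \<preceq> y"
  and vinf_greatest: "x \<in> V \<Longrightarrow> y \<in> V \<Longrightarrow> z \<in> V \<Longrightarrow> z \<preceq> x \<Longrightarrow> z \<preceq> y \<Longrightarrow> z \<preceq> x \<sqinter> y"
  using is_vinf_vinf[of x y] unfolding is_vinf_def by auto

lemma vabs_closed [simp]: "x \<in> V \<Longrightarrow> \<bar>x\<bar>\<^sub>E \<in> V"
  by (simp add: vabs_def)

lemma le_vabs: "x \<in> V \<Longrightarrow> x \<preceq> \<bar>x\<bar>\<^sub>E" and neg_le_vabs: "x \<in> V \<Longrightarrow> \<ominus> x \<preceq> \<bar>x\<bar>\<^sub>E"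
  by (simp_all add: vabs_def vsup_ge1 vsup_ge2)

lemma vabs_leI: "x \<in> V \<Longrightarrow> y \<in> V \<Longrightarrow> x \<preceq> y \<Longrightarrow> \<ominus> x \<preceq> y \<Longrightarrow> \<bar>x\<bar>\<^sub>E \<preceq> y"
  by (simp add: vabs_def vsup_least)

lemma vabs_nonneg: "x \<in> V \<Longrightarrow> \<zero> \<preceq> \<bar>x\<bar>\<^sub>E"
  by (rule nonneg_if_dominates[of x]) (auto simp: le_vabs neg_le_vabs neg_le_swap)

lemma vabs_of_nonneg: assumes "x \<in> V" "\<zero> \<preceq> x" shows "\<bar>x\<bar>\<^sub>E = x"
proof (rule le_antisym)
  have "\<ominus> x \<preceq> x" using assms neg_nonpos[of x] le_trans[of "\<ominus> x" \<zero> x] by simp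
  then show "\<bar>x\<bar>\<^sub>E \<preceq> x" using assms by (simp add: vabs_leI le_refl)
qed (use assms le_vabs in auto)

lemma norm_vabs: "x \<in> V \<Longrightarrow> \<parallel>\<bar>x\<bar>\<^sub>E\<parallel> = \<parallel>x\<parallel>"
  by (intro antisym norm_mono) (auto simp: vabs_of_nonneg vabs_nonneg le_refl)

lemma norm_le_dominated':
  assumes "x \<in> V" "y \<in> V" "\<ominus> y \<preceq> x" "x \<preceq> y" shows "\<parallel>x\<parallel> \<le> \<parallel>y\<parallel>"
  by (rule norm_mono)
    (use assms nonneg_if_dominates[of x y] in \<open>auto simp: vabs_of_nonneg neg_le_swap intro!: vabs_leI\<close>)

end

sublocale normed_lattice_on \<subseteq> ordered_normed_space_on
  by unfold_locales (fact le_refl le_antisym le_trans le_add le_scale norm_le_dominated')+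

sublocale banach_lattice_on \<subseteq> normed_lattice_on
  by unfold_locales (fact le_refl le_antisym le_trans le_add le_scale ex_sup ex_inf norm_mono)+

section \<open>Real-valued lattice homomorphisms on principal ideals\<close>

text \<open>Because of the start at \<open>vzero E\<close> this is the supremum of zero and the
  \<open>x i\<close>, which is why \<open>Max (insert 0 ...)\<close> appears for its real
  counterpart.\<close>

primrec vpsup :: "('a, 'm) nlattice_scheme \<Rightarrow> (nat \<Rightarrow> 'a) \<Rightarrow> nat \<Rightarrow> 'a" where
  "vpsup E x 0 = vzero E"
| "vpsup E x (Suc k) = vsup E (vpsup E x k) (x k)"

context normed_lattice_on
begin

lemma vsup_translate:
  assumes "x \<in> V" "y \<in> V" "z \<in> V"
  shows "(x \<oplus> z) \<squnion> (y \<oplus> z) = (x \<squnion> y) \<oplus> z"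
proof (rule vsup_eqI)
  have c: "w \<ominus> z \<oplus> z = w" "w \<oplus> z \<ominus> z = w" if "w \<in> V" for w
    using assms that by (auto intro!: lin_eqI simp: lin_simps)
  show "is_vsup E (x \<oplus> z) (y \<oplus> z) ((x \<squnion> y) \<oplus> z)"
    unfolding is_vsup_def
  proof (intro conjI ballI impI)
    fix w assume w: "w \<in> V" "x \<oplus> z \<preceq> w \<and> y \<oplus> z \<preceq> w"
    have "x \<preceq> w \<ominus> z" "y \<preceq> w \<ominus> z"
      using w assms le_add[of "x \<oplus> z" w "\<ominus> z"] le_add[of "y \<oplus> z" w "\<ominus> z"] by (auto simp: c)
    then have "x \<squnion> y \<preceq> w \<ominus> z" using w assms by (simp add: vsup_least)
    then show "(x \<squnion> y) \<oplus> z \<preceq> w"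
      using w assms le_add[of "x \<squnion> y" "w \<ominus> z" z] by (simp add: c)
  qed (use assms in \<open>auto intro!: le_add vsup_ge1 vsup_ge2\<close>)
qed

lemma vinf_eq_neg_vsup:
  assumes "x \<in> V" "y \<in> V"
  shows "x \<sqinter> y = \<ominus> (\<ominus> x \<squnion> \<ominus> y)"
proof (rule vinf_eqI)
  show "is_vinf E x y (\<ominus> (\<ominus> x \<squnion> \<ominus> y))"
    unfolding is_vinf_def
    using assms by (auto simp: neg_le_swap[of "\<ominus> x \<squnion> \<ominus> y"] vsup_ge1 vsup_ge2 neg_mono
      intro!: vsup_least) (metis neg_closed neg_le_swap neg_mono vsup_closed vsup_least)
qed

lemma vpsup_closed: "(\<And>i. i < k \<Longrightarrow> x i \<in> V) \<Longrightarrow> vpsup E x k \<in> V"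
  by (induction k) auto

lemma vpsup_ge: "(\<And>i. i < k \<Longrightarrow> x i \<in> V) \<Longrightarrow> i < k \<Longrightarrow> x i \<preceq> vpsup E x k"
proof (induction k)
  case (Suc k)
  have c: "vpsup E x k \<in> V" "x k \<in> V" "x i \<in> V" using Suc.prems by (auto intro!: vpsup_closed)
  show ?case
  proof (cases "i = k")
    case True then show ?thesis using c by (simp add: vsup_ge2)
  next
    case False
    then have "x i \<preceq> vpsup E x k" using Suc by simp
    moreover have "vpsup E x k \<preceq> vpsup E x k \<squnion> x k" using c by (simp add: vsup_ge1)
    ultimately show ?thesis using c le_trans[of "x i" "vpsup E x k" "vpsup E x k \<squnion> x k"] by simp
  qed
qed simp

lemma vpsup_nonneg: "(\<And>i. i < k \<Longrightarrow> x i \<in> V) \<Longrightarrow> \<zero> \<preceq> vpsup E x k"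
proof (induction k)
  case (Suc k)
  then have c: "vpsup E x k \<in> V" "x k \<in> V" "\<zero> \<preceq> vpsup E x k" by (auto intro!: vpsup_closed)
  then show ?case using le_trans[of \<zero> "vpsup E x k" "vpsup E x k \<squnion> x k"] vsup_ge1[of "vpsup E x k" "x k"] by simp
qed (simp add: le_refl)

lemma vpsup_least:
  "(\<And>i. i < k \<Longrightarrow> x i \<in> V \<and> x i \<preceq> y) \<Longrightarrow> y \<in> V \<Longrightarrow> \<zero> \<preceq> y \<Longrightarrow> vpsup E x k \<preceq> y"
  by (induction k) (auto intro!: vsup_least vpsup_closed)

definition Idl :: "'a \<Rightarrow> 'a set" where
  "Idl u = {x \<in> V. \<exists>c. \<ominus> (c \<odot> u) \<preceq> x \<and> x \<preceq> c \<odot> u}"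

text \<open>In a representation of the ideal by continuous functions on a compact space, these are
  the nonnegative multiples of point evaluations.\<close>

definition lhom :: "'a \<Rightarrow> ('a \<Rightarrow> real) \<Rightarrow> bool" where
  "lhom u h \<longleftrightarrow> linear_fun_on (Idl u) h \<and>
     (\<forall>a\<in>Idl u. \<forall>b\<in>Idl u. (a \<preceq> b \<longrightarrow> h a \<le> h b) \<and> h (a \<squnion> b) = max (h a) (h b))"

text \<open>In the same picture, with \<open>u\<close> as the constant 1, this is the maximum of the
  function \<open>a\<close>, with its sign.\<close>

definition gauge :: "'a \<Rightarrow> 'a \<Rightarrow> real" where
  "gauge u a = Inf {c. a \<preceq> c \<odot> u}"

context
  fixes u assumes u: "u \<in> V" "\<zero> \<preceq> u"
begin

lemma scale_unit_mono: "c \<le> d \<Longrightarrow> c \<odot> u \<preceq> d \<odot> u"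
proof -
  assume "c \<le> d"
  moreover have "d \<odot> u \<ominus> c \<odot> u = (d - c) \<odot> u"
    using u by (intro lin_eqI) (auto simp: lin_simps algebra_simps)
  ultimately show ?thesis using u le_iff_diff[of "c \<odot> u" "d \<odot> u"] le_scale[of u "d - c"] by simp
qed

lemma Idl_V: "x \<in> Idl u \<Longrightarrow> x \<in> V"
  by (simp add: Idl_def)

lemma neg_scale_unit: "\<ominus> (c \<odot> u) = (- c) \<odot> u"
  using u by (simp add: vneg_def scale_scale)

lemma IdlI: "x \<in> V \<Longrightarrow> (- c) \<odot> u \<preceq> x \<Longrightarrow> x \<preceq> d \<odot> u \<Longrightarrow> x \<in> Idl u"
  unfolding Idl_def mem_Collect_eq
  using u scale_unit_mono[of d "max c d"] scale_unit_mono[of "- max c d" "- c"]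
    le_trans[of x "d \<odot> u" "max c d \<odot> u"] le_trans[of "(- max c d) \<odot> u" "(- c) \<odot> u" x]
  by (intro conjI exI[of _ "max c d"]) (auto simp: neg_scale_unit)

lemma IdlE:
  assumes "x \<in> Idl u"
  obtains c where "c \<ge> 0" "(- c) \<odot> u \<preceq> x" "x \<preceq> c \<odot> u"
proof -
  obtain c where c: "x \<in> V" "(- c) \<odot> u \<preceq> x" "x \<preceq> c \<odot> u"
    using assms by (auto simp: Idl_def neg_scale_unit)
  show thesis
    by (rule that[of "max c 0"])
      (use c u scale_unit_mono[of c "max c 0"] scale_unit_mono[of "- max c 0" "- c"]
        le_trans[of x "c \<odot> u" "max c 0 \<odot> u"] le_trans[of "(- max c 0) \<odot> u" "(- c) \<odot> u" x]
       in auto)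
qed

lemma Idl_unit: "u \<in> Idl u"
  by (rule IdlI[of _ 0 1]) (use u in \<open>auto simp: scale_one scale_zero_left le_refl\<close>)

lemma Idl_zero: "\<zero> \<in> Idl u"
  by (rule IdlI[of _ 0 0]) (use u in \<open>auto simp: scale_zero_left le_refl\<close>)

lemma Idl_add: "x \<in> Idl u \<Longrightarrow> y \<in> Idl u \<Longrightarrow> x \<oplus> y \<in> Idl u"
proof -
  assume x: "x \<in> Idl u" and y: "y \<in> Idl u"
  obtain c where c: "(- c) \<odot> u \<preceq> x" "x \<preceq> c \<odot> u" using IdlE[OF x] by metis
  obtain d where d: "(- d) \<odot> u \<preceq> y" "y \<preceq> d \<odot> u" using IdlE[OF y] by metis
  have "(- (c + d)) \<odot> u = (- c) \<odot> u \<oplus> (- d) \<odot> u" "(c + d) \<odot> u = c \<odot> u \<oplus> d \<odot> u"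
    using u scale_add_left[of u "- c" "- d"] by (simp_all add: scale_add_left)
  then show ?thesis using x y u c d
    by (intro IdlI[of _ "c + d" "c + d"]) (auto simp: Idl_V simp del: minus_add_distrib intro!: add_mono)
qed

lemma Idl_neg: "x \<in> Idl u \<Longrightarrow> \<ominus> x \<in> Idl u"
proof -
  assume x: "x \<in> Idl u"
  obtain c where c: "(- c) \<odot> u \<preceq> x" "x \<preceq> c \<odot> u" using IdlE[OF x] by metis
  show ?thesis
    by (rule IdlI[of _ c c]) (use x u c neg_scale_unit[of c] neg_mono[of "c \<odot> u" x]
        neg_le_swap[of x "c \<odot> u"] in \<open>auto simp: Idl_V\<close>)
qed

lemma Idl_scale_nonneg: "x \<in> Idl u \<Longrightarrow> a \<ge> 0 \<Longrightarrow> a \<odot> x \<in> Idl u"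
proof -
  assume x: "x \<in> Idl u" "a \<ge> 0"
  obtain c where c: "(- c) \<odot> u \<preceq> x" "x \<preceq> c \<odot> u" using IdlE[OF x(1)] by metis
  show ?thesis
    by (rule IdlI[of _ "a * c" "a * c"])
      (use x u c scale_mono[of "(- c) \<odot> u" x a] scale_mono[of x "c \<odot> u" a] in
        \<open>auto simp: Idl_V scale_scale\<close>)
qed

lemma Idl_scale: "x \<in> Idl u \<Longrightarrow> a \<odot> x \<in> Idl u"
proof (cases "a \<ge> 0")
  case False
  assume x: "x \<in> Idl u"
  have "a \<odot> x = \<ominus> ((- a) \<odot> x)" using Idl_V[OF x] by (simp add: vneg_def scale_scale)
  then show ?thesis using Idl_neg[OF Idl_scale_nonneg[OF x, of "- a"]] False by simp
qed (simp add: Idl_scale_nonneg)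

lemma Idl_vsup: "x \<in> Idl u \<Longrightarrow> y \<in> Idl u \<Longrightarrow> x \<squnion> y \<in> Idl u"
proof -
  assume x: "x \<in> Idl u" and y: "y \<in> Idl u"
  obtain c where c: "(- c) \<odot> u \<preceq> x" "x \<preceq> c \<odot> u" using IdlE[OF x] by metis
  obtain d where d: "y \<preceq> d \<odot> u" using IdlE[OF y] by metis
  have V: "x \<in> V" "y \<in> V" using x y by (auto simp: Idl_V)
  have "x \<preceq> max c d \<odot> u" "y \<preceq> max c d \<odot> u"
    using c d V u scale_unit_mono[of c "max c d"] scale_unit_mono[of d "max c d"]
      le_trans[of x "c \<odot> u" "max c d \<odot> u"] le_trans[of y "d \<odot> u" "max c d \<odot> u"] by auto
  then show ?thesis
    using V u c le_trans[of "(- c) \<odot> u" x "x \<squnion> y"] vsup_ge1[of x y]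
    by (intro IdlI[of _ c "max c d"]) (auto intro: vsup_least)
qed

lemma Idl_vinf: "x \<in> Idl u \<Longrightarrow> y \<in> Idl u \<Longrightarrow> x \<sqinter> y \<in> Idl u"
  by (simp add: vinf_eq_neg_vsup Idl_V Idl_neg Idl_vsup)

lemma Idl_vabs: "x \<in> Idl u \<Longrightarrow> \<bar>x\<bar>\<^sub>E \<in> Idl u"
  by (simp add: vabs_def Idl_neg Idl_vsup)

lemma Idl_vpsum: "(\<And>i. i < k \<Longrightarrow> x i \<in> Idl u) \<Longrightarrow> vpsum E x k \<in> Idl u"
  by (induction k) (auto simp: Idl_zero Idl_add)

lemma Idl_vpsup: "(\<And>i. i < k \<Longrightarrow> x i \<in> Idl u) \<Longrightarrow> vpsup E x k \<in> Idl u"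
  by (induction k) (auto simp: Idl_zero Idl_vsup)

lemma Idl_vsum: "finite I \<Longrightarrow> (\<And>i. i \<in> I \<Longrightarrow> g i \<in> Idl u) \<Longrightarrow> vsum E g I \<in> Idl u"
  unfolding vsum_def by (rule Idl_vpsum) (simp add: finite_enum_in)

lemmas Idl_intros = Idl_unit Idl_zero Idl_add Idl_neg Idl_scale Idl_vsup Idl_vinf Idl_vabs
  Idl_vpsum Idl_vpsup Idl_vsum

lemma Idl_between: "x \<in> V \<Longrightarrow> y \<in> Idl u \<Longrightarrow> \<zero> \<preceq> x \<Longrightarrow> x \<preceq> y \<Longrightarrow> x \<in> Idl u"
proof -
  assume a: "x \<in> V" "y \<in> Idl u" "\<zero> \<preceq> x" "x \<preceq> y"
  obtain c where c: "y \<preceq> c \<odot> u" using IdlE[OF a(2)] by metis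
  show ?thesis
    by (rule IdlI[of _ 0 c])
      (use a c u le_trans[of x y "c \<odot> u"] in \<open>auto simp: Idl_V scale_zero_left\<close>)
qed

lemma subspace_Idl: "subspace_on (Idl u)"
  by (auto simp: subspace_on_def Idl_intros Idl_V)

context
  fixes h assumes h: "lhom u h"
begin

lemma lhom_add: "x \<in> Idl u \<Longrightarrow> y \<in> Idl u \<Longrightarrow> h (x \<oplus> y) = h x + h y"
  and lhom_scale: "x \<in> Idl u \<Longrightarrow> h (a \<odot> x) = a * h x"
  and lhom_mono: "x \<in> Idl u \<Longrightarrow> y \<in> Idl u \<Longrightarrow> x \<preceq> y \<Longrightarrow> h x \<le> h y"
  and lhom_vsup: "x \<in> Idl u \<Longrightarrow> y \<in> Idl u \<Longrightarrow> h (x \<squnion> y) = max (h x) (h y)"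
  using h by (auto simp: lhom_def linear_fun_on_def)

lemma lhom_neg: "x \<in> Idl u \<Longrightarrow> h (\<ominus> x) = - h x"
  by (simp add: vneg_def lhom_scale)

lemma lhom_zero: "h \<zero> = 0"
  using lhom_scale[of \<zero> 0] Idl_zero by (simp add: scale_zero_left)

lemma lhom_vinf: "x \<in> Idl u \<Longrightarrow> y \<in> Idl u \<Longrightarrow> h (x \<sqinter> y) = min (h x) (h y)"
  by (auto simp: vinf_eq_neg_vsup Idl_V lhom_neg lhom_vsup Idl_intros)

lemma lhom_vabs: "x \<in> Idl u \<Longrightarrow> h (\<bar>x\<bar>\<^sub>E) = \<bar>h x\<bar>"
  by (simp add: vabs_def lhom_vsup lhom_neg Idl_intros abs_real_def max_def)

lemma lhom_vpsum: "(\<And>i. i < k \<Longrightarrow> x i \<in> Idl u) \<Longrightarrow> h (vpsum E x k) = (\<Sum>i<k. h (x i))"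
  by (induction k) (auto simp: lhom_zero lhom_add Idl_vpsum)

lemma lhom_vsum:
  "finite I \<Longrightarrow> (\<And>i. i \<in> I \<Longrightarrow> g i \<in> Idl u) \<Longrightarrow> h (vsum E g I) = (\<Sum>i\<in>I. h (g i))"
proof -
  assume I: "finite I" "\<And>i. i \<in> I \<Longrightarrow> g i \<in> Idl u"
  have "h (vsum E g I) = (\<Sum>k<card I. h (g (finite_enum I k)))"
    unfolding vsum_def using I by (intro lhom_vpsum) (simp add: finite_enum_in)
  then show ?thesis using sum_finite_enum[OF I(1), of "\<lambda>i. h (g i)"] by simp
qed

lemma lhom_vpsup:
  "(\<And>i. i < k \<Longrightarrow> x i \<in> Idl u) \<Longrightarrow> h (vpsup E x k) = Max (insert 0 ((\<lambda>i. h (x i)) ` {..<k}))"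
proof (induction k)
  case (Suc k)
  have "insert 0 ((\<lambda>i. h (x i)) ` {..<Suc k}) = insert (h (x k)) (insert 0 ((\<lambda>i. h (x i)) ` {..<k}))"
    by (auto simp: lessThan_Suc)
  then show ?case using Suc by (simp add: lhom_vsup Idl_vpsup max.commute)
qed (simp add: lhom_zero)

lemma lhom_nonneg: "x \<in> Idl u \<Longrightarrow> \<zero> \<preceq> x \<Longrightarrow> 0 \<le> h x"
  using lhom_mono[of \<zero> x] by (simp add: lhom_zero Idl_zero)

lemmas lhom_simps = lhom_add lhom_scale lhom_neg lhom_zero lhom_vsup lhom_vinf lhom_vabs lhom_vpsum
  lhom_vsum lhom_vpsup

end

text \<open>The homomorphism is found below the gauge functional of \<open>u\<close>, which is compatible with maxima.\<close>

lemma le_by_lhom: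
  assumes a: "a \<in> Idl u" and b: "b \<in> Idl u" and le: "\<And>h. lhom u h \<Longrightarrow> h a \<le> h b"
  shows "a \<preceq> b"
\<comment> \<open>For \<open>u = \<zero>\<close> the gauge would be an infimum over an empty or
  unbounded set of reals; the ideal is then \<open>{\<zero>}\<close> and there is nothing to
  separate.\<close>
proof (cases "u = \<zero>")
  case True
  have "x = \<zero>" if x: "x \<in> Idl u" for x
  proof -
    obtain c where "(- c) \<odot> u \<preceq> x" "x \<preceq> c \<odot> u" using IdlE[OF x] by metis
    then show ?thesis using x True by (simp add: scale_zero_right Idl_V le_antisym)
  qed
  then show ?thesis using a b le_refl zero_closed by metis
next
  case False
  \<comment> \<open>Bounds the set in \<open>gauge\<close> from below; this uses that
    \<open>u\<close> is positive and nonzero.\<close>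
  have bd: "c \<le> d" if "c \<odot> u \<preceq> x" "x \<preceq> d \<odot> u" "x \<in> V" for c d x
  proof (rule ccontr)
    assume "\<not> c \<le> d"
    have "c \<odot> u \<preceq> d \<odot> u" using le_trans[of "c \<odot> u" x "d \<odot> u"] that u by simp
    moreover have "d \<odot> u \<ominus> c \<odot> u = (c - d) \<odot> \<ominus> u"
      using u by (intro lin_eqI) (auto simp: lin_simps algebra_simps)
    ultimately have "\<zero> \<preceq> (c - d) \<odot> \<ominus> u" using u le_iff_diff[of "c \<odot> u" "d \<odot> u"] by simp
    then have "\<zero> \<preceq> \<ominus> u" using scale_nonneg_cancel[of "\<ominus> u" "c - d"] \<open>\<not> c \<le> d\<close> u by simp
    then have "u \<preceq> \<zero>" using u neg_nonpos[of "\<ominus> u"]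
      by (simp add: vneg_def scale_scale scale_one)
    then show False using False u le_antisym by simp
  qed
  define q where "q = gauge u"
  have q_le: "q x \<le> d" if x: "x \<in> Idl u" and "x \<preceq> d \<odot> u" for x d
  proof -
    obtain c where c: "(- c) \<odot> u \<preceq> x" using IdlE[OF x] by metis
    show ?thesis unfolding q_def gauge_def
      by (rule cInf_lower) (use x that bd[OF c] in \<open>auto intro!: bdd_belowI simp: Idl_V\<close>)
  qed
  have le_q: "c \<le> q x" if x: "x \<in> Idl u" and "\<And>d. x \<preceq> d \<odot> u \<Longrightarrow> c \<le> d" for x c
  proof -
    obtain d where "x \<preceq> d \<odot> u" using IdlE[OF x] by metis
    then show ?thesis unfolding q_def gauge_def
      by (intro cInf_greatest) (use that in auto)
  qed
  have q_lt: "x \<preceq> d \<odot> u" if x: "x \<in> Idl u" and "q x < d" for x d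
  proof (rule ccontr)
    assume n: "\<not> x \<preceq> d \<odot> u"
    have "d \<le> q x"
    proof (rule le_q[OF x], rule ccontr)
      fix e assume e: "x \<preceq> e \<odot> u" "\<not> d \<le> e"
      then have "x \<preceq> d \<odot> u"
        using le_trans[of x "e \<odot> u" "d \<odot> u"] scale_unit_mono[of e d] u x by (simp add: Idl_V)
      with n show False by simp
    qed
    with that show False by simp
  qed
  have s: "sublinear_on (Idl u) q" unfolding sublinear_on_def
  proof (intro conjI ballI allI impI)
    fix x y assume xy: "x \<in> Idl u" "y \<in> Idl u"
    have "q (x \<oplus> y) \<le> q x + q y + e" if "e > 0" for e
    proof (rule q_le)
      have "x \<preceq> (q x + e/2) \<odot> u" "y \<preceq> (q y + e/2) \<odot> u" using xy that by (auto intro!: q_lt)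
      then have "x \<oplus> y \<preceq> (q x + e/2) \<odot> u \<oplus> (q y + e/2) \<odot> u"
        using u xy by (intro add_mono) (auto simp: Idl_V)
      also have "(q x + e/2) \<odot> u \<oplus> (q y + e/2) \<odot> u = (q x + q y + e) \<odot> u"
        using u by (intro lin_eqI) (auto simp: lin_simps algebra_simps)
      finally show "x \<oplus> y \<preceq> (q x + q y + e) \<odot> u" .
    qed (use xy in \<open>auto simp: Idl_intros\<close>)
    then show "q (x \<oplus> y) \<le> q x + q y" by (rule field_le_epsilon)
  next
    fix x and c :: real assume x: "x \<in> Idl u" "0 \<le> c"
    have "q (c \<odot> x) \<le> c * q x + e" if "e > 0" for e
    proof (rule q_le)
      have "x \<preceq> (q x + e / (c + 1)) \<odot> u" using x that by (intro q_lt) auto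
      then have "c \<odot> x \<preceq> (c * (q x + e / (c + 1))) \<odot> u"
        using scale_mono[of x "(q x + e / (c + 1)) \<odot> u" c] x u by (simp add: Idl_V scale_scale)
      moreover have "c * (q x + e / (c + 1)) \<le> c * q x + e"
        using x that by (simp add: field_simps)
      ultimately show "c \<odot> x \<preceq> (c * q x + e) \<odot> u"
        using le_trans[of "c \<odot> x" "(c * (q x + e / (c + 1))) \<odot> u" "(c * q x + e) \<odot> u"] x u
          scale_unit_mono[of "c * (q x + e / (c + 1))" "c * q x + e"]
        by (simp add: Idl_V)
    qed (use x in \<open>auto simp: Idl_intros\<close>)
    then show "q (c \<odot> x) \<le> c * q x" by (rule field_le_epsilon)
  qed
  define R where "R = {(x, y, x \<squnion> y) |x y. x \<in> Idl u \<and> y \<in> Idl u}"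
  have R: "translation_invariant (Idl u) R"
    unfolding translation_invariant_def R_def
    by (auto simp: Idl_intros Idl_V vsup_translate[symmetric])
  have mb: "max_bounded_on R q" unfolding max_bounded_on_def
  proof safe
    fix x y z assume "(x, y, z) \<in> R"
    then have xy: "x \<in> Idl u" "y \<in> Idl u" "z = x \<squnion> y" by (auto simp: R_def)
    have "q z \<le> max (q x) (q y) + e" if "e > 0" for e
    proof (rule q_le)
      have "x \<preceq> (max (q x) (q y) + e) \<odot> u" "y \<preceq> (max (q x) (q y) + e) \<odot> u"
        using xy that by (auto intro!: q_lt)
      then show "z \<preceq> (max (q x) (q y) + e) \<odot> u" using xy u by (auto simp: Idl_V intro!: vsup_least)
    qed (use xy in \<open>auto simp: Idl_intros\<close>)
    then show "q z \<le> max (q x) (q y)" by (rule field_le_epsilon)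
  qed
  have ab: "a \<ominus> b \<in> Idl u" using a b by (simp add: Idl_intros)
  obtain f where f: "linear_fun_on (Idl u) f" "\<And>x. x \<in> Idl u \<Longrightarrow> f x \<le> q x"
    "f (a \<ominus> b) = q (a \<ominus> b)" "max_bounded_on R f"
    using ex_linear_below_sublinear[OF subspace_Idl s R mb ab] by blast
  have fmono: "f x \<le> f y" if "x \<in> Idl u" "y \<in> Idl u" "x \<preceq> y" for x y
  proof -
    have "x \<ominus> y \<preceq> 0 \<odot> u"
      using that le_add[of x y "\<ominus> y"] u by (simp add: Idl_V add_neg scale_zero_left)
    then have "f (x \<ominus> y) \<le> 0" using q_le[of "x \<ominus> y" 0] f(2)[of "x \<ominus> y"] that by (simp add: Idl_intros)
    moreover have "f (x \<ominus> y) = f x - f y"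
      using f(1) that Idl_neg[of y] unfolding linear_fun_on_def vneg_def by simp
    ultimately show ?thesis by simp
  qed
  \<comment> \<open>Boundedness by the maximum is one half of the preservation of suprema,
    monotonicity the other.\<close>
  have "lhom u f" unfolding lhom_def
  proof (intro conjI ballI impI f(1) fmono)
    fix x y assume xy: "x \<in> Idl u" "y \<in> Idl u"
    have "f (x \<squnion> y) \<le> max (f x) (f y)"
      by (rule max_bounded_onD[OF f(4)]) (use xy in \<open>auto simp: R_def\<close>)
    moreover have "f x \<le> f (x \<squnion> y)" "f y \<le> f (x \<squnion> y)"
      using xy by (auto intro!: fmono simp: Idl_intros Idl_V vsup_ge1 vsup_ge2)
    ultimately show "f (x \<squnion> y) = max (f x) (f y)" by simp
  qed
  from le[OF this] have "f (a \<ominus> b) \<le> 0"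
    using a b \<open>lhom u f\<close> by (simp add: lhom_simps Idl_intros)
  then have q0: "q (a \<ominus> b) \<le> 0" using f(3) by simp
  \<comment> \<open>The positive part of \<open>a \<ominus> b\<close> lies below every positive
    multiple of \<open>u\<close>, so monotonicity of the norm forces it to be zero. The norm
    provides the Archimedean property here.\<close>
  define w where "w = (a \<ominus> b) \<squnion> \<zero>"
  have wV: "w \<in> V" "\<zero> \<preceq> w" using ab by (auto simp: w_def Idl_V vsup_ge2)
  have "\<parallel>w\<parallel> \<le> e * (\<parallel>u\<parallel> + 1)" if "e > 0" for e
  proof -
    have "a \<ominus> b \<preceq> e \<odot> u" using ab q0 that by (intro q_lt) auto
    then have "w \<preceq> e \<odot> u" using ab u that by (auto simp: w_def Idl_V intro!: vsup_least le_scale)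
    then have "\<parallel>w\<parallel> \<le> \<parallel>e \<odot> u\<parallel>" using wV u by (intro norm_le_positive) auto
    also have "\<dots> \<le> e * (\<parallel>u\<parallel> + 1)" using u that by (simp add: norm_scale)
    finally show ?thesis .
  qed
  then have "\<parallel>w\<parallel> \<le> 0 + e" if "e > 0" for e
    using that norm_nonneg[OF u(1)] by (metis add_0 add_nonneg_pos divide_pos_pos
        nonzero_eq_divide_eq order_less_irrefl zero_less_one)
  then have "\<parallel>w\<parallel> \<le> 0" by (rule field_le_epsilon)
  then have "w = \<zero>" using wV norm_nonneg[of w] norm_eq_zero[of w] by simp
  then have "a \<ominus> b \<preceq> \<zero>" using vsup_ge1[of "a \<ominus> b" \<zero>] ab by (simp add: w_def Idl_V)
  moreover have "\<zero> \<ominus> (a \<ominus> b) = b \<ominus> a" using a b by (intro lin_eqI) (auto simp: lin_simps Idl_V)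
  ultimately show ?thesis using a b ab le_iff_diff[of "a \<ominus> b" \<zero>] le_iff_diff[of a b] by (simp add: Idl_V)
qed

lemma eq_by_lhom:
  assumes "a \<in> Idl u" "b \<in> Idl u" "\<And>h. lhom u h \<Longrightarrow> h a = h b"
  shows "a = b"
proof (rule le_antisym)
  show "a \<preceq> b" "b \<preceq> a" by (rule le_by_lhom; simp add: assms)+
qed (use assms in \<open>simp_all add: Idl_V\<close>)

end

lemma Idl_of_vabs: assumes x: "x \<in> V" shows "x \<in> Idl (\<bar>x\<bar>\<^sub>E)"
  by (rule IdlI[of _ _ 1 1])
    (use x le_vabs[OF x] neg_le_vabs[OF x] vabs_nonneg[OF x] neg_le_swap[of x "\<bar>x\<bar>\<^sub>E"] in
      \<open>auto simp: scale_one vneg_def[symmetric]\<close>)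

lemma Idl_mono:
  assumes uv: "u \<in> V" "v \<in> V" "\<zero> \<preceq> u" "\<zero> \<preceq> v" "u \<preceq> v" and x: "x \<in> Idl u" shows "x \<in> Idl v"
proof -
  obtain c where c: "c \<ge> 0" "(- c) \<odot> u \<preceq> x" "x \<preceq> c \<odot> u" using IdlE[OF uv(1,3) x] by metis
  have xV: "x \<in> V" using x by (simp add: Idl_def)
  have "c \<odot> u \<preceq> c \<odot> v" using scale_mono[of u v c] uv c by simp
  moreover have "\<ominus> (c \<odot> v) \<preceq> \<ominus> (c \<odot> u)" using neg_mono[of "c \<odot> v" "c \<odot> u"] calculation uv by simp
  ultimately show ?thesis using c uv xV
      le_trans[of x "c \<odot> u" "c \<odot> v"] le_trans[of "(- c) \<odot> v" "(- c) \<odot> u" x]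
    by (intro IdlI[of v x c c]) (auto simp: vneg_def scale_scale)
qed

text \<open>Places finitely many vectors in one principal ideal, so that \<open>le_by_lhom\<close>
  and \<open>eq_by_lhom\<close> can be applied to expressions in them.\<close>

lemma ex_unit:
  fixes k :: nat
  assumes "\<And>i. i < k \<Longrightarrow> x i \<in> V"
  obtains u where "u \<in> V" "\<zero> \<preceq> u" "\<And>i. i < k \<Longrightarrow> x i \<in> Idl u"
proof
  define u where "u = vpsup E (\<lambda>i. \<bar>x i\<bar>\<^sub>E) k"
  show u: "u \<in> V" "\<zero> \<preceq> u" using assms by (auto simp: u_def intro!: vpsup_closed vpsup_nonneg)
  show "x i \<in> Idl u" if i: "i < k" for i
    using assms[OF i] vpsup_ge[of k "\<lambda>i. \<bar>x i\<bar>\<^sub>E" i] assms i u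
    by (intro Idl_mono[of "\<bar>x i\<bar>\<^sub>E" u]) (auto simp: vabs_nonneg Idl_of_vabs u_def)
qed

lemma ex_unit2:
  assumes "x \<in> V" "y \<in> V"
  obtains u where "u \<in> V" "\<zero> \<preceq> u" "x \<in> Idl u" "y \<in> Idl u"
proof -
  have "(if i = 0 then x else y) \<in> V" for i :: nat using assms by simp
  then obtain u where u: "u \<in> V" "\<zero> \<preceq> u" "\<And>i. i < 2 \<Longrightarrow> (if i = (0::nat) then x else y) \<in> Idl u"
    using ex_unit[of 2 "\<lambda>i. if i = 0 then x else y"] by blast
  show thesis by (rule that[OF u(1,2)]) (use u(3)[of 0] u(3)[of 1] in simp_all)
qed

lemma vabs_add_le:
  assumes "x \<in> V" "y \<in> V" shows "\<bar>x \<oplus> y\<bar>\<^sub>E \<preceq> \<bar>x\<bar>\<^sub>E \<oplus> \<bar>y\<bar>\<^sub>E"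
proof -
  obtain u where u: "u \<in> V" "\<zero> \<preceq> u" "x \<in> Idl u" "y \<in> Idl u" using ex_unit2[OF assms] by blast
  show ?thesis using u(3-) by (intro le_by_lhom[OF u(1,2)]) (auto simp: Idl_intros[OF u(1,2)] lhom_simps[OF u(1,2)])
qed

lemma vabs_scale:
  assumes "x \<in> V" shows "\<bar>a \<odot> x\<bar>\<^sub>E = \<bar>a\<bar> \<odot> \<bar>x\<bar>\<^sub>E"
proof -
  obtain u where u: "u \<in> V" "\<zero> \<preceq> u" "x \<in> Idl u" using ex_unit2[OF assms assms] by blast
  show ?thesis using u(3-) by (intro eq_by_lhom[OF u(1,2)]) (auto simp: Idl_intros[OF u(1,2)] lhom_simps[OF u(1,2)] abs_mult)
qed

lemma vabs_zero: "\<bar>\<zero>\<bar>\<^sub>E = \<zero>"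
  by (simp add: vabs_of_nonneg le_refl)

end

section \<open>Lattice seminorms on free Banach lattices\<close>

definition lattice_seminorm :: "('a, 'm) nlattice_scheme \<Rightarrow> ('a \<Rightarrow> real) \<Rightarrow> bool" where
  "lattice_seminorm E N \<longleftrightarrow>
     (\<forall>x\<in>vcarrier E. \<forall>y\<in>vcarrier E. N (vadd E x y) \<le> N x + N y) \<and>
     (\<forall>x\<in>vcarrier E. \<forall>a. N (vscale E a x) = \<bar>a\<bar> * N x) \<and>
     (\<forall>x\<in>vcarrier E. \<forall>y\<in>vcarrier E. vle E (vabs E x) (vabs E y) \<longrightarrow> N x \<le> N y) \<and>
     (\<exists>K. \<forall>x\<in>vcarrier E. N x \<le> K * vnorm E x)"

lemma lattice_seminormD:
  assumes "lattice_seminorm E N" "x \<in> vcarrier E"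
  shows "y \<in> vcarrier E \<Longrightarrow> N (vadd E x y) \<le> N x + N y"
    "N (vscale E a x) = \<bar>a\<bar> * N x"
    "y \<in> vcarrier E \<Longrightarrow> vle E (vabs E x) (vabs E y) \<Longrightarrow> N x \<le> N y"
  using assms by (auto simp: lattice_seminorm_def)

lemma (in normed_lattice_on) lattice_seminorm_nonneg:
  assumes N: "lattice_seminorm E N" and x: "x \<in> V"
  shows "0 \<le> N x"
proof -
  have "N \<zero> = 0" using lattice_seminormD(2)[OF N zero_closed, of 0] by (simp add: scale_zero_right)
  moreover have "N (x \<ominus> x) \<le> N x + N (\<ominus> x)" using lattice_seminormD(1)[OF N x, of "\<ominus> x"] x by simp
  moreover have "N (\<ominus> x) = N x" using lattice_seminormD(2)[OF N x, of "-1"] by (simp add: vneg_def)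
  ultimately show ?thesis using x by (simp add: add_neg)
qed

text \<open>The new norm lies between \<open>\<epsilon>\<close> and \<open>\<epsilon> + K\<close>
  times the old one, so Cauchy sequences and limits are the same. The summand with
  \<open>\<epsilon>\<close> is there because \<open>N\<close> may vanish at nonzero vectors.\<close>

lemma banach_lattice_on_renorm:
  fixes L :: "'f nlattice"
  assumes L: "banach_lattice_on L" and N: "lattice_seminorm L N" and \<epsilon>: "\<epsilon> > 0"
  shows "banach_lattice_on (L\<lparr>vnorm := \<lambda>u. \<epsilon> * vnorm L u + N u\<rparr>)" (is "banach_lattice_on ?G")
proof -
  interpret L: banach_lattice_on L by fact
  obtain K where K: "\<And>x. x \<in> vcarrier L \<Longrightarrow> N x \<le> K * vnorm L x"
    using N unfolding lattice_seminorm_def by blast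
  have neg [simp]: "vneg ?G = vneg L" by (simp add: vneg_def fun_eq_iff)
  have sup [simp]: "is_vsup ?G = is_vsup L" "is_vinf ?G = is_vinf L"
    by (simp_all add: is_vsup_def is_vinf_def fun_eq_iff)
  have abs [simp]: "vabs ?G = vabs L" by (simp add: vabs_def vsup_def fun_eq_iff)
  have Nn: "0 \<le> N x" if "x \<in> vcarrier L" for x by (rule L.lattice_seminorm_nonneg[OF N that])
  have lower: "\<epsilon> * vnorm L x \<le> vnorm ?G x" if "x \<in> vcarrier L" for x using Nn[OF that] by simp
  have upper: "vnorm ?G x \<le> (\<epsilon> + K) * vnorm L x" if "x \<in> vcarrier L" for x
    using K[OF that] by (simp add: algebra_simps)
  have ns: "normed_space_on ?G"
  proof
    fix x assume x: "x \<in> vcarrier ?G"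
    show "(vnorm ?G x = 0) = (x = vzero ?G)"
    proof
      assume "vnorm ?G x = 0"
      then have "\<epsilon> * vnorm L x \<le> 0" using lower[of x] x by simp
      then have "vnorm L x = 0" using \<epsilon> L.norm_nonneg[of x] x
        by (simp add: mult_le_0_iff)
      then show "x = vzero ?G" using L.norm_eq_zero x by simp
    next
      assume "x = vzero ?G"
      then show "vnorm ?G x = 0" using L.norm_zero upper[of x] lower[of x] x Nn[of x]
        by simp
    qed
  next
    fix x a assume "x \<in> vcarrier ?G"
    then show "vnorm ?G (vscale ?G a x) = \<bar>a\<bar> * vnorm ?G x"
      using lattice_seminormD(2)[OF N] L.norm_scale by (simp add: algebra_simps)
  next
    fix x y assume "x \<in> vcarrier ?G" "y \<in> vcarrier ?G"
    then show "vnorm ?G (vadd ?G x y) \<le> vnorm ?G x + vnorm ?G y"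
      using lattice_seminormD(1)[OF N, of x y] mult_left_mono[OF L.norm_triangle[of x y], of \<epsilon>] \<epsilon>
      by (simp add: algebra_simps)
  qed (use L.add_closed L.scale_closed L.zero_closed L.add_assoc L.add_commute L.add_zero L.add_neg
      L.scale_add_right L.scale_add_left L.scale_scale L.scale_one \<epsilon> Nn L.norm_nonneg in \<open>simp_all\<close>)
  interpret G: normed_space_on ?G by fact
  interpret MG: Metric_space "vcarrier ?G" "vdist ?G" by (rule G.Metric_space_vdist)
  interpret MetL: Metric_space "vcarrier L" "vdist L" by (rule L.Metric_space_vdist)
  have "MG.mcomplete" unfolding MG.mcomplete_def
  proof safe
    fix \<sigma> assume \<sigma>: "MG.MCauchy \<sigma>"
    then have "range \<sigma> \<subseteq> vcarrier ?G" unfolding MG.MCauchy_def by blast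
    then have \<sigma>V: "range \<sigma> \<subseteq> vcarrier L" by simp
    have "MetL.MCauchy \<sigma>" unfolding MetL.MCauchy_def
    proof (intro conjI allI impI \<sigma>V)
      fix e :: real assume e: "e > 0"
      then obtain n0 where n0: "\<And>n n'. n0 \<le> n \<Longrightarrow> n0 \<le> n' \<Longrightarrow> vdist ?G (\<sigma> n) (\<sigma> n') < \<epsilon> * e"
        using \<sigma> \<epsilon> unfolding MG.MCauchy_def by (meson mult_pos_pos)
      show "\<exists>n0. \<forall>n n'. n0 \<le> n \<longrightarrow> n0 \<le> n' \<longrightarrow> vdist L (\<sigma> n) (\<sigma> n') < e"
      proof (intro exI allI impI)
        fix n n' assume nn: "n0 \<le> n" "n0 \<le> n'"
        have V: "\<sigma> n \<in> vcarrier L" "\<sigma> n' \<in> vcarrier L" using \<sigma>V by auto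
        have "\<epsilon> * vdist L (\<sigma> n) (\<sigma> n') \<le> vdist ?G (\<sigma> n) (\<sigma> n')"
          using V lower[of "vadd L (\<sigma> n) (vneg L (\<sigma> n'))"] by (simp add: vdist_def)
        also have "\<dots> < \<epsilon> * e" by (rule n0[OF nn])
        finally show "vdist L (\<sigma> n) (\<sigma> n') < e" using \<epsilon> by simp
      qed
    qed
    then obtain l where l: "limitin MetL.mtopology \<sigma> l sequentially"
      using L.complete by (auto simp: MetL.mcomplete_def)
    then have lV: "l \<in> vcarrier L" by (auto simp: limitin_def)
    have "(\<lambda>k. vnorm L (vadd L (\<sigma> k) (vneg L l))) \<longlonglongrightarrow> 0"
      using l L.limitin_vdist[OF \<sigma>V lV] by simp
    then have lim: "(\<lambda>k. (\<epsilon> + K) * vnorm L (vadd L (\<sigma> k) (vneg L l))) \<longlonglongrightarrow> 0"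
      by (rule tendsto_mult_right_zero)
    have c: "vadd L (\<sigma> k) (vneg L l) \<in> vcarrier L" for k
      using \<sigma>V lV by (intro L.add_closed L.neg_closed) auto
    have "(\<lambda>k. vnorm ?G (vadd L (\<sigma> k) (vneg L l))) \<longlonglongrightarrow> 0"
      by (rule tendsto_sandwich[OF always_eventually always_eventually tendsto_const lim])
        (use c upper G.norm_nonneg in auto)
    then have "limitin MG.mtopology \<sigma> l sequentially"
      using G.limitin_vdist[of \<sigma> l] \<sigma>V lV by simp
    then show "\<exists>x. limitin MG.mtopology \<sigma> x sequentially" by blast
  qed
  then show ?thesis
  proof unfold_locales
    fix x y assume "x \<in> vcarrier ?G" "y \<in> vcarrier ?G" "vle ?G (vabs ?G x) (vabs ?G y)"
    then show "vnorm ?G x \<le> vnorm ?G y"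
      using lattice_seminormD(3)[OF N, of x y] L.norm_mono[of x y] \<epsilon>
      by (simp add: add_mono mult_left_mono)
  next
    fix x y z assume "x \<in> vcarrier ?G" "y \<in> vcarrier ?G" "z \<in> vcarrier ?G" "vle ?G x y" "vle ?G y z"
    then show "vle ?G x z" using L.le_trans[of x y z] by simp
  qed (use L.le_refl L.le_antisym L.le_add L.le_scale L.ex_sup L.ex_inf in \<open>simp_all\<close>)
qed

text \<open>By the uniqueness of liftings the identity of \<open>L\<close> is the lifting of \<open>\<phi>\<close> also when \<open>L\<close> carries
  the equivalent norm \<open>\<epsilon> * vnorm L + N\<close>, so its norm for the new norm is that of \<open>\<phi>\<close>.\<close>

lemma free_banach_lattice_seminorm_le:
  fixes L :: "'f nlattice" and X :: "('x, 'm) nspace_scheme"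
  assumes free: "free_banach_lattice X L \<phi>" and X: "normed_space_on X"
    and N: "lattice_seminorm L N" and M: "\<And>x. x \<in> vball X \<Longrightarrow> N (\<phi> x) \<le> M"
    and u: "u \<in> vball L"
  shows "N u \<le> M"
proof (rule field_le_epsilon)
  fix \<epsilon> :: real assume \<epsilon>: "\<epsilon> > 0"
  interpret X: normed_space_on X by fact
  interpret L: banach_lattice_on L using free by (simp add: free_banach_lattice_def)
  obtain K where K: "\<And>x. x \<in> vcarrier L \<Longrightarrow> N x \<le> K * vnorm L x"
    using N unfolding lattice_seminorm_def by blast
  define G where "G = L\<lparr>vnorm := \<lambda>u. \<epsilon> * vnorm L u + N u\<rparr>"
  have G: "banach_lattice_on G"
    unfolding G_def by (rule banach_lattice_on_renorm[OF L.banach_lattice_on_axioms N \<epsilon>])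
  have [simp]: "vcarrier G = vcarrier L" "vadd G = vadd L" "vscale G = vscale L" "vle G = vle L"
    "vnorm G x = \<epsilon> * vnorm L x + N x" for x by (simp_all add: G_def)
  have [simp]: "vsup G = vsup L" "vinf G = vinf L"
    by (simp_all add: vsup_def vinf_def is_vsup_def is_vinf_def fun_eq_iff)
  have \<phi>: "linear_map_on X L \<phi>" "\<And>x. x \<in> vcarrier X \<Longrightarrow> vnorm L (\<phi> x) = vnorm X x"
    using free by (auto simp: free_banach_lattice_def)
  have upper: "vnorm G x \<le> \<epsilon> + \<bar>K\<bar>" if "x \<in> vball L" for x
  proof -
    have "K * vnorm L x \<le> \<bar>K\<bar> * vnorm L x"
      using that L.norm_nonneg[of x] by (intro mult_right_mono) (auto simp: vball_def)
    also have "\<dots> \<le> \<bar>K\<bar>" using that by (intro mult_left_le) (auto simp: vball_def)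
    finally have "K * vnorm L x \<le> \<bar>K\<bar>" .
    then have "N x \<le> \<bar>K\<bar>" using that K[of x] by (simp add: vball_def)
    moreover have "\<epsilon> * vnorm L x \<le> \<epsilon>" using that \<epsilon> by (simp add: vball_def)
    ultimately show ?thesis by simp
  qed
  have "bounded_linear_on X G \<phi>" unfolding bounded_linear_on_def
  proof
    show "linear_map_on X G \<phi>" using \<phi>(1) by (simp add: linear_map_on_def)
    show "\<exists>K. \<forall>x\<in>vcarrier X. vnorm G (\<phi> x) \<le> K * vnorm X x"
    proof (intro exI ballI)
      fix x assume x: "x \<in> vcarrier X"
      then have "\<phi> x \<in> vcarrier L" using \<phi>(1) linear_map_onD(1) by metis
      then show "vnorm G (\<phi> x) \<le> (\<epsilon> + K) * vnorm X x"
        using K[of "\<phi> x"] \<phi>(2)[OF x] by (simp add: algebra_simps)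
    qed
  qed
  \<comment> \<open>\<open>G\<close> has the same carrier type as \<open>L\<close>, so the first
    family of targets in \<open>free_banach_lattice\<close> includes it.\<close>
  moreover have "lifts_uniquely X L \<phi> G" using free G by (simp add: free_banach_lattice_def)
  ultimately obtain S where S: "op_norm_on L G S = op_norm_on X G \<phi>"
    and uniq: "\<And>S'. lattice_hom_on L G S' \<Longrightarrow> (\<forall>x\<in>vcarrier X. S' (\<phi> x) = \<phi> x) \<Longrightarrow>
      \<forall>u\<in>vcarrier L. S' u = S u"
    unfolding lifts_uniquely_def by blast
  have "lattice_hom_on L G (\<lambda>u. u)" by (auto simp: lattice_hom_on_def linear_map_on_def)
  then have SI: "S u = u" if "u \<in> vcarrier L" for u using uniq that by fastforce
  have "N u \<le> vnorm G u"
    using u \<epsilon> L.norm_nonneg[of u] by (simp add: vball_def)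
  also have "vnorm G u \<le> (SUP u\<in>vball L. vnorm G (S u))"
  proof -
    have "vnorm G u = vnorm G (S u)" using SI u by (simp add: vball_def)
    also have "\<dots> \<le> (SUP u\<in>vball L. vnorm G (S u))"
    proof (rule cSUP_upper[OF u])
      show "bdd_above ((\<lambda>u. vnorm G (S u)) ` vball L)"
        using upper SI by (intro bdd_aboveI[of _ "\<epsilon> + \<bar>K\<bar>"]) (auto simp: vball_def)
    qed
    finally show ?thesis .
  qed
  also have "\<dots> = (SUP x\<in>vball X. vnorm G (\<phi> x))" using S by (simp add: op_norm_on_def)
  also have "\<dots> \<le> M + \<epsilon>"
  proof (rule cSUP_least)
    have "vzero X \<in> vball X" by (simp add: vball_def X.norm_zero)
    then show "vball X \<noteq> {}" by blast
    fix x assume x: "x \<in> vball X"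
    then have "\<epsilon> * vnorm X x \<le> \<epsilon>" using \<epsilon> by (simp add: vball_def)
    then show "vnorm G (\<phi> x) \<le> M + \<epsilon>" using M[OF x] \<phi>(2)[of x] x by (simp add: vball_def)
  qed
  finally show "N u \<le> M + \<epsilon>" .
qed

section \<open>Averages over signs and over index maps\<close>

text \<open>A coordinate of a uniformly chosen map is uniform. Both sides expand the product of sums
  with the factor \<open>g\<close> at \<open>j\<close> and the factor 1 at all other places.\<close>

lemma sum_PiE_marginal:
  fixes g :: "'b \<Rightarrow> real"
  assumes I: "finite I" "j \<in> I" and S: "finite S"
  shows "(\<Sum>f\<in>PiE I (\<lambda>_. S). g (f j)) = real (card S) ^ (card I - 1) * (\<Sum>i\<in>S. g i)"
proof -
  have "(\<Prod>x\<in>I. \<Sum>y\<in>S. if x = j then g y else 1) = (\<Sum>f\<in>PiE I (\<lambda>_. S). \<Prod>x\<in>I. if x = j then g (f x) else 1)"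
    by (rule prod_sum_PiE) (use I S in auto)
  also have "\<dots> = (\<Sum>f\<in>PiE I (\<lambda>_. S). g (f j))"
    using I by (simp add: prod.delta)
  also have "(\<Prod>x\<in>I. \<Sum>y\<in>S. if x = j then g y else 1) = (\<Sum>y\<in>S. g y) * (\<Prod>x\<in>I-{j}. real (card S))"
    using I by (subst prod.remove[of I j]) (auto intro!: arg_cong2[of _ _ _ _ "(*)"] prod.cong)
  finally show ?thesis using I by (simp add: mult.commute)
qed

text \<open>If \<open>f j\<close> is uniform on \<open>{1..m}\<close>, then \<open>sqrt (m / f j)\<close> has the tail \<open>1 / y\<^sup>2\<close>, so the maximum
  of the independent variables \<open>sqrt (m / f j) * \<bar>t j\<bar>\<close> is of the order of the Euclidean norm of \<open>t\<close>.\<close>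

lemma average_max_ge_L2:
  fixes t :: "nat \<Rightarrow> real" and m :: nat
  assumes m: "m \<ge> 1"
  shows "real m ^ m * sqrt (\<Sum>j<m. (t j)\<^sup>2) / 5 \<le>
    (\<Sum>f\<in>PiE {..<m} (\<lambda>_. {1..m}). Max (insert 0 ((\<lambda>j. sqrt (real m / real (f j)) * \<bar>t j\<bar>) ` {..<m})))"
    (is "_ \<le> (\<Sum>f\<in>?\<Omega>. ?M f)")
proof -
  define \<rho> where "\<rho> = sqrt (\<Sum>j<m. (t j)\<^sup>2)"
  have M0: "0 \<le> ?M f" for f by simp
  show ?thesis
  proof (cases "\<rho> = 0")
    case True
    then show ?thesis using M0 unfolding \<rho>_def[symmetric] by (simp add: sum_nonneg)
  next
    case False
    then have \<rho>: "\<rho> > 0" unfolding \<rho>_def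
      by (metis linorder_neqE_linordered_idom not_le real_sqrt_ge_zero sum_nonneg zero_le_power2)
    have \<rho>2: "\<rho>\<^sup>2 = (\<Sum>j<m. (t j)\<^sup>2)" unfolding \<rho>_def by (simp add: sum_nonneg)
    define a where "a j = (t j)\<^sup>2 / \<rho>\<^sup>2" for j
    have a0: "0 \<le> a j" for j by (simp add: a_def)
    have a1: "(\<Sum>j<m. a j) = 1"
    proof -
      have "(\<Sum>j<m. a j) = (\<Sum>j<m. (t j)\<^sup>2) / \<rho>\<^sup>2" by (simp add: a_def sum_divide_distrib)
      also have "\<dots> = 1" using \<rho> by (simp flip: \<rho>2)
      finally show ?thesis .
    qed
    \<comment> \<open>For \<open>i\<close> in \<open>G j\<close> the term
      \<open>sqrt (m / i) * \<bar>t j\<bar>\<close> is at least \<open>\<rho> / sqrt 2\<close>; the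
      maximum is thus large as soon as one coordinate \<open>f j\<close> falls into
      \<open>G j\<close>.\<close>
    define G where "G j = {i\<in>{1..m}. real i \<le> 2 * m * a j}" for j
    \<comment> \<open>Weights with \<open>2 * m * a j < 1\<close> have an empty \<open>G j\<close>.
      There are at most \<open>m\<close> of them, so discarding them costs at most half of the total
      weight 1.\<close>
    define a' where "a' j = (if 2 * m * a j \<ge> 1 then a j else 0)" for j
    have a'1: "1 / 2 \<le> (\<Sum>j<m. a' j)"
    proof -
      have "a j - 1 / (2 * m) \<le> a' j" for j using m by (auto simp: a'_def field_simps)
      then have "(\<Sum>j<m. a j - 1 / (2 * m)) \<le> (\<Sum>j<m. a' j)" by (rule sum_mono)
      then show ?thesis using a1 m by (simp add: sum_subtractf)
    qed
    have aj1: "a j \<le> 1" if "j < m" for j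
      using member_le_sum[of j "{..<m}" a] that a0 a1 by simp
    \<comment> \<open>Unless the weight is discarded, \<open>G j\<close> has at least
      \<open>m * a j\<close> elements, because the integer part of a number that is at least 1 is at
      least half of it. Then \<open>1 - a \<le> exp (- a)\<close> applies.\<close>
    have cG: "real m - real (card (G j)) \<le> real m * exp (- a' j)" if j: "j < m" for j
    proof (cases "2 * m * a j \<ge> 1")
      case False
      then show ?thesis by (simp add: a'_def)
    next
      case True
      define y where "y = 2 * m * a j"
      have "real m * a j \<le> real (card (G j))"
      proof (cases "y \<ge> m")
        case True
        then have "G j = {1..m}" unfolding G_def y_def[symmetric] by auto
        then show ?thesis using aj1[OF j] m by (simp add: mult_left_le)
      next
        case ym: False
        have fl: "1 \<le> \<lfloor>y\<rfloor>" using True y_def by simp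
        have "{1..nat \<lfloor>y\<rfloor>} \<subseteq> G j"
        proof
          fix i assume "i \<in> {1..nat \<lfloor>y\<rfloor>}"
          then have "1 \<le> i" "int i \<le> \<lfloor>y\<rfloor>" using fl by auto
          moreover have "real i \<le> y" using calculation(2) by (simp add: le_floor_iff)
          ultimately show "i \<in> G j" using ym by (auto simp: G_def y_def)
        qed
        then have "card {1..nat \<lfloor>y\<rfloor>} \<le> card (G j)" by (intro card_mono) (auto simp: G_def)
        then have "real_of_int \<lfloor>y\<rfloor> \<le> real (card (G j))" using fl by simp
        moreover have "y / 2 \<le> real_of_int \<lfloor>y\<rfloor>" using fl by linarith
        ultimately show ?thesis by (simp add: y_def)
      qed
      moreover have "real m * (1 - a j) \<le> real m * exp (- a j)"
        using exp_ge_add_one_self[of "- a j"] by (intro mult_left_mono) auto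
      ultimately show ?thesis using True by (simp add: a'_def algebra_simps)
    qed
    \<comment> \<open>Indicator of the maps that miss every \<open>G j\<close>. Written as a product
      over the coordinates, its sum over all maps factors; this is the independence of the
      coordinates.\<close>
    define bad where "bad f = (\<Prod>j<m. if f j \<in> G j then 0 else 1 :: real)" for f :: "nat \<Rightarrow> nat"
    have finG: "finite (G j)" for j by (simp add: G_def)
    have "(\<Sum>f\<in>?\<Omega>. bad f) = (\<Prod>j<m. \<Sum>i\<in>{1..m}. if i \<in> G j then 0 else 1 :: real)"
      unfolding bad_def by (rule prod_sum_PiE[symmetric]) auto
    also have "\<dots> = (\<Prod>j<m. real m - real (card (G j)))"
    proof (rule prod.cong[OF refl])
      fix j
      have "(\<Sum>i\<in>{1..m}. if i \<in> G j then 0 else 1 :: real) = (\<Sum>i\<in>{1..m}. 1 - (if i \<in> G j then 1 else 0))"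
        by (rule sum.cong) auto
      also have "\<dots> = real m - real (card ({1..m} \<inter> G j))"
        by (simp add: sum_subtractf sum.If_cases)
      also have "{1..m} \<inter> G j = G j" by (auto simp: G_def)
      finally show "(\<Sum>i\<in>{1..m}. if i \<in> G j then 0 else 1 :: real) = real m - real (card (G j))" .
    qed
    also have "\<dots> \<le> (\<Prod>j<m. real m * exp (- a' j))"
    proof (rule prod_mono)
      fix j assume "j \<in> {..<m}"
      moreover have "card (G j) \<le> card {1..m}" by (rule card_mono) (auto simp: G_def)
      ultimately show "0 \<le> real m - real (card (G j)) \<and> real m - real (card (G j)) \<le> real m * exp (- a' j)"
        using cG by simp
    qed
    also have "\<dots> = real m ^ m * exp (- (\<Sum>j<m. a' j))"
      by (simp add: prod.distrib exp_sum sum_negf[symmetric])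
    also have "\<dots> \<le> real m ^ m * (2 / 3)"
    proof -
      have "(3::real) / 2 \<le> exp (1 / 2)" using exp_ge_add_one_self[of "1/2::real"] by simp
      also have "\<dots> \<le> exp (\<Sum>j<m. a' j)" using a'1 by simp
      finally have "exp (- (\<Sum>j<m. a' j)) \<le> 2 / 3"
        by (simp add: exp_minus field_simps)
      then show ?thesis by (intro mult_left_mono) auto
    qed
    finally have sb: "(\<Sum>f\<in>?\<Omega>. bad f) \<le> real m ^ m * (2 / 3)" .
    have "real (card ?\<Omega>) = real m ^ m" by (simp add: card_PiE)
    then have "real m ^ m / 3 \<le> (\<Sum>f\<in>?\<Omega>. 1 - bad f)" using sb by (simp add: sum_subtractf)
    then have "real m ^ m / 3 * (\<rho> / sqrt 2) \<le> (\<Sum>f\<in>?\<Omega>. 1 - bad f) * (\<rho> / sqrt 2)"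
      by (rule mult_right_mono) (use \<rho> in auto)
    also have "\<dots> = (\<Sum>f\<in>?\<Omega>. (1 - bad f) * (\<rho> / sqrt 2))" by (rule sum_distrib_right)
    also have "\<dots> \<le> (\<Sum>f\<in>?\<Omega>. ?M f)"
    proof (rule sum_mono)
      fix f assume f: "f \<in> ?\<Omega>"
      show "(1 - bad f) * (\<rho> / sqrt 2) \<le> ?M f"
      proof (cases "\<exists>j<m. f j \<in> G j")
        case True
        then obtain j where j: "j < m" "f j \<in> G j" by blast
        have "bad f = 0" unfolding bad_def using j by (intro prod_zero) auto
        have fj: "f j \<ge> 1" "real (f j) \<le> 2 * m * a j" using j by (auto simp: G_def)
        have "\<rho> / sqrt 2 \<le> sqrt (real m / real (f j)) * \<bar>t j\<bar>"
        proof (rule power2_le_imp_le)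
          have "real (f j) * \<rho>\<^sup>2 \<le> 2 * m * (t j)\<^sup>2"
            using fj(2) \<rho> by (simp add: a_def field_simps)
          then show "(\<rho> / sqrt 2)\<^sup>2 \<le> (sqrt (real m / real (f j)) * \<bar>t j\<bar>)\<^sup>2"
            using fj(1) by (simp add: power_mult_distrib power_divide field_simps)
        qed simp
        also have "\<dots> \<le> ?M f" by (rule Max_ge) (use j in auto)
        finally show ?thesis using \<open>bad f = 0\<close> by simp
      next
        case False
        then have "bad f = 1" unfolding bad_def by (intro prod.neutral) auto
        then show ?thesis using M0 by simp
      qed
    qed
    finally have 1: "real m ^ m / 3 * (\<rho> / sqrt 2) \<le> (\<Sum>f\<in>?\<Omega>. ?M f)" .
    \<comment> \<open>The factors 3 and \<open>sqrt 2\<close> together stay below the constant 5 of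
      the statement.\<close>
    have "sqrt 2 \<le> 5 / 3" by (rule real_le_lsqrt) (auto simp: power2_eq_square)
    then have "real m ^ m * \<rho> * sqrt 2 \<le> real m ^ m * \<rho> * (5 / 3)"
      by (rule mult_left_mono) (use \<rho> in auto)
    then have "real m ^ m * \<rho> / 5 \<le> real m ^ m / 3 * (\<rho> / sqrt 2)"
      by (simp add: field_simps)
    with 1 show ?thesis by (simp add: \<rho>_def)
  qed
qed

text \<open>After taking logarithms, differentiation leaves \<open>tanh y \<le> y\<close> for
  \<open>y \<ge> 0\<close>, and a second differentiation proves this.\<close>

lemma cosh_le_exp_square: "cosh x \<le> exp (x\<^sup>2 / 2)" for x :: real
proof -
  have tanh_le: "tanh y \<le> y" if "0 \<le> y" for y :: real
  proof -
    have "0 - tanh 0 \<le> y - tanh y"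
    proof (rule DERIV_nonneg_imp_nondecreasing[OF that, of "\<lambda>y. y - tanh y"])
      fix z :: real
      have "((\<lambda>y. y - tanh y) has_real_derivative 1 - (1 - (tanh z)\<^sup>2)) (at z)"
        by (auto intro!: derivative_eq_intros simp: cosh_real_nonzero)
      then show "\<exists>d. ((\<lambda>y. y - tanh y) has_real_derivative d) (at z) \<and> 0 \<le> d" by fastforce
    qed
    then show ?thesis by simp
  qed
  have pos: "cosh y \<le> exp (y\<^sup>2 / 2)" if "0 \<le> y" for y :: real
  proof -
    have "0\<^sup>2 / 2 - ln (cosh 0) \<le> y\<^sup>2 / 2 - ln (cosh y)"
    proof (rule DERIV_nonneg_imp_nondecreasing[OF that, of "\<lambda>y. y\<^sup>2 / 2 - ln (cosh y)"])
      fix z :: real assume "0 \<le> z"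
      have "((\<lambda>y. y\<^sup>2 / 2 - ln (cosh y)) has_real_derivative z - tanh z) (at z)"
        by (auto intro!: derivative_eq_intros simp: cosh_real_pos tanh_def)
      then show "\<exists>d. ((\<lambda>y. y\<^sup>2 / 2 - ln (cosh y)) has_real_derivative d) (at z) \<and> 0 \<le> d"
        using tanh_le[OF \<open>0 \<le> z\<close>] by fastforce
    qed
    then have "ln (cosh y) \<le> y\<^sup>2 / 2" by simp
    then show ?thesis by (metis exp_le_cancel_iff exp_ln cosh_real_pos)
  qed
  show ?thesis using pos[of "\<bar>x\<bar>"] by (simp add: cosh_real_abs)
qed

definition signs :: "nat \<Rightarrow> (nat \<Rightarrow> real) set" where
  "signs m = PiE {..<m} (\<lambda>_. {-1, 1})"

lemma finite_signs [simp]: "finite (signs m)"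
  by (simp add: signs_def finite_PiE)

lemma card_signs [simp]: "card (signs m) = 2 ^ m"
  by (simp add: signs_def card_PiE numeral_2_eq_2)

lemma signs_abs: "s \<in> signs m \<Longrightarrow> j < m \<Longrightarrow> \<bar>s j\<bar> = 1"
  by (auto simp: signs_def PiE_def Pi_def)

text \<open>The Gaussian bound for the exponential moments of a Rademacher sum: the average over the
  signs factors into hyperbolic cosines.\<close>

lemma sum_signs_exp_le:
  "(\<Sum>s\<in>signs m. exp (\<Sum>j<m. s j * c j)) \<le> 2 ^ m * exp ((\<Sum>j<m. (c j)\<^sup>2) / 2)"
proof -
  have "(\<Sum>s\<in>signs m. exp (\<Sum>j<m. s j * c j)) = (\<Sum>s\<in>signs m. \<Prod>j<m. exp (s j * c j))"
    by (simp add: exp_sum)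
  also have "\<dots> = (\<Prod>j<m. \<Sum>y\<in>{-1, 1}. exp (y * c j))"
    unfolding signs_def by (rule prod_sum_PiE[symmetric]) auto
  also have "\<dots> = (\<Prod>j<m. 2 * cosh (c j))" by (intro prod.cong) (auto simp: cosh_field_def)
  also have "\<dots> \<le> (\<Prod>j<m. 2 * exp ((c j)\<^sup>2 / 2))"
    by (intro prod_mono) (auto simp: cosh_le_exp_square cosh_real_nonneg)
  also have "\<dots> = 2 ^ m * exp ((\<Sum>j<m. (c j)\<^sup>2) / 2)"
    by (simp add: prod.distrib exp_sum sum_divide_distrib)
  finally show ?thesis .
qed

text \<open>Orthogonality of the Rademacher functions, by which each entry is recovered as a
  coefficient of the random sum.\<close>

lemma sum_signs_coeff:
  assumes j: "j < m"
  shows "(\<Sum>s\<in>signs m. s j * (\<Sum>i<m. s i * t i)) = 2 ^ m * t j"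
proof -
  have orth: "(\<Sum>s\<in>signs m. s j * s i) = (if i = j then 2 ^ m else 0)" if i: "i < m" for i
  proof (cases "i = j")
    case True
    have "(\<Sum>s\<in>signs m. s j * s i) = (\<Sum>s\<in>signs m. 1)"
    proof (rule sum.cong[OF refl])
      fix s assume "s \<in> signs m"
      then have "s j = 1 \<or> s j = -1" using signs_abs[of s m j] j by linarith
      then show "s j * s i = 1" using True by auto
    qed
    then show ?thesis using True by simp
  next
    case False
    have "(\<Sum>s\<in>signs m. s j * s i) = (\<Sum>s\<in>signs m. \<Prod>k<m. if k = i \<or> k = j then s k else 1)"
    proof (rule sum.cong[OF refl])
      fix s
      have "(\<Prod>k<m. if k = i \<or> k = j then s k else 1) = (\<Prod>k\<in>{i, j}. s k)"
        using i j by (intro prod.mono_neutral_cong_right) auto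
      then show "s j * s i = (\<Prod>k<m. if k = i \<or> k = j then s k else 1)" using False by (simp add: mult.commute)
    qed
    also have "\<dots> = (\<Prod>k<m. \<Sum>y\<in>{-1, 1}. if k = i \<or> k = j then y else 1)"
      unfolding signs_def by (rule prod_sum_PiE[symmetric]) auto
    also have "\<dots> = 0" using i by (intro prod_zero) auto
    finally show ?thesis using False by simp
  qed
  have "(\<Sum>s\<in>signs m. s j * (\<Sum>i<m. s i * t i)) = (\<Sum>i<m. (\<Sum>s\<in>signs m. s j * s i) * t i)"
    by (simp add: sum_distrib_left sum_distrib_right mult.assoc) (rule sum.swap)
  also have "\<dots> = (\<Sum>i<m. if i = j then 2 ^ m * t i else 0)" using orth by (intro sum.cong) auto
  finally show ?thesis using j by simp
qed

text \<open>Let \<open>S\<close> be the random sum with coefficients \<open>t j / \<rho>\<close>. By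
  \<open>x \<le> exp x\<close> the excess is at most
  \<open>\<rho> * exp (\<bar>S\<bar> - 2 * ln m)\<close>, an exponential moment with the small
  factor \<open>1 / m\<^sup>2\<close>.\<close>

lemma sum_signs_excess_le:
  fixes t :: "nat \<Rightarrow> real"
  assumes m: "m \<ge> 1" and b: "2 * ln (real m) * sqrt (\<Sum>j<m. (t j)\<^sup>2) \<le> b"
  shows "(\<Sum>s\<in>signs m. max 0 (\<bar>\<Sum>j<m. s j * t j\<bar> - b)) \<le> 2 ^ m * (4 / (real m)\<^sup>2 * (\<Sum>j<m. \<bar>t j\<bar>))"
proof -
  define \<rho> where "\<rho> = sqrt (\<Sum>j<m. (t j)\<^sup>2)"
  have \<rho>0: "\<rho> \<ge> 0" by (simp add: \<rho>_def sum_nonneg)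
  have \<rho>2: "\<rho>\<^sup>2 = (\<Sum>j<m. (t j)\<^sup>2)" unfolding \<rho>_def by (simp add: sum_nonneg)
  have l0: "ln (real m) \<ge> 0" using m by simp
  have \<rho>1: "\<rho> \<le> (\<Sum>j<m. \<bar>t j\<bar>)"
    unfolding \<rho>_def using L2_set_le_sum_abs[of t "{..<m}"] by (simp add: L2_set_def)
  show ?thesis
  proof (cases "\<rho> = 0")
    case True
    then have "(\<Sum>j<m. (t j)\<^sup>2) = 0" using \<rho>2 by simp
    then have "\<forall>j<m. t j = 0" by (simp add: sum_nonneg_eq_0_iff)
    moreover have "b \<ge> 0" using b True by (simp add: \<rho>_def)
    ultimately show ?thesis by simp
  next
    case False
    with \<rho>0 have \<rho>: "\<rho> > 0" by simp
    define c where "c j = t j / \<rho>" for j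
    have c2: "(\<Sum>j<m. (c j)\<^sup>2) = 1" 
    proof -
      have "(\<Sum>j<m. (c j)\<^sup>2) = (\<Sum>j<m. (t j)\<^sup>2) / \<rho>\<^sup>2"
        by (simp add: c_def power_divide sum_divide_distrib)
      also have "\<dots> = 1" using \<rho> by (simp flip: \<rho>2)
      finally show ?thesis .
    qed
    have pt: "max 0 (\<bar>\<Sum>j<m. s j * t j\<bar> - b) \<le>
        \<rho> / (real m)\<^sup>2 * (exp (\<Sum>j<m. s j * c j) + exp (\<Sum>j<m. s j * - c j))" for s
    proof -
      define S where "S = (\<Sum>j<m. s j * c j)"
      have S: "(\<Sum>j<m. s j * t j) = \<rho> * S" using \<rho>
        by (simp add: S_def c_def sum_distrib_left)
      have S': "(\<Sum>j<m. s j * - c j) = - S" by (simp add: S_def sum_negf)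
      have "\<bar>\<rho> * S\<bar> - b \<le> \<rho> * (\<bar>S\<bar> - 2 * ln (real m))"
        using b \<rho> by (simp add: \<rho>_def[symmetric] abs_mult algebra_simps)
      also have "\<dots> \<le> \<rho> * exp (\<bar>S\<bar> - 2 * ln (real m))"
      proof (rule mult_left_mono)
        show "\<bar>S\<bar> - 2 * ln (real m) \<le> exp (\<bar>S\<bar> - 2 * ln (real m))"
          using exp_ge_add_one_self[of "\<bar>S\<bar> - 2 * ln (real m)"] by linarith
      qed (use \<rho> in simp)
      also have "exp (\<bar>S\<bar> - 2 * ln (real m)) = exp \<bar>S\<bar> / (real m)\<^sup>2"
        using m by (simp add: exp_diff exp_double)
      finally have 1: "\<bar>\<rho> * S\<bar> - b \<le> \<rho> / (real m)\<^sup>2 * exp \<bar>S\<bar>" by simp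
      have "exp \<bar>S\<bar> \<le> exp S + exp (- S)" by (cases "S \<ge> 0") auto
      then have "\<rho> / (real m)\<^sup>2 * exp \<bar>S\<bar> \<le> \<rho> / (real m)\<^sup>2 * (exp S + exp (- S))"
        using \<rho> by (intro mult_left_mono) auto
      moreover have "0 \<le> \<rho> / (real m)\<^sup>2 * (exp S + exp (- S))" using \<rho> by (simp add: add_nonneg_nonneg)
      ultimately show ?thesis using 1 unfolding S S' S_def[symmetric] by simp
    qed
    have "(\<Sum>s\<in>signs m. max 0 (\<bar>\<Sum>j<m. s j * t j\<bar> - b)) \<le>
        (\<Sum>s\<in>signs m. \<rho> / (real m)\<^sup>2 * (exp (\<Sum>j<m. s j * c j) + exp (\<Sum>j<m. s j * - c j)))"
      by (rule sum_mono) (rule pt)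
    also have "\<dots> = \<rho> / (real m)\<^sup>2 *
        ((\<Sum>s\<in>signs m. exp (\<Sum>j<m. s j * c j)) + (\<Sum>s\<in>signs m. exp (\<Sum>j<m. s j * - c j)))"
      by (simp only: sum.distrib sum_distrib_left[symmetric])
    also have "\<dots> \<le> \<rho> / (real m)\<^sup>2 * (2 ^ m * exp (1 / 2) + 2 ^ m * exp (1 / 2))"
      using sum_signs_exp_le[where c = c and m = m] sum_signs_exp_le[where c = "\<lambda>j. - c j" and m = m] c2 \<rho>
      by (intro mult_left_mono add_mono) auto
    also have "\<dots> = 2 ^ m * (2 * exp (1 / 2) / (real m)\<^sup>2 * \<rho>)" by simp
    also have "\<dots> \<le> 2 ^ m * (4 / (real m)\<^sup>2 * (\<Sum>j<m. \<bar>t j\<bar>))"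
    proof -
      \<comment> \<open>Turns the factor \<open>2 * exp (1 / 2)\<close> into the constant 4 of the
        statement.\<close>
      have "exp (1 / 2 :: real) \<le> 2"
      proof (rule power2_le_imp_le)
        have "(exp (1 / 2 :: real))\<^sup>2 = exp 1" by (simp add: power2_eq_square flip: exp_add)
        then show "(exp (1 / 2 :: real))\<^sup>2 \<le> 2\<^sup>2" using e_less_272 by simp
      qed simp
      then show ?thesis using \<rho>1 \<rho>0 by (intro mult_left_mono mult_mono divide_right_mono) auto
    qed
    finally show ?thesis .
  qed
qed

text \<open>By \<open>sum_signs_coeff\<close> the difference is the Rademacher coefficient of the
  part removed by clipping, so the mean excess over \<open>b\<close> bounds it.\<close>

lemma sum_signs_clip:
  fixes t :: "nat \<Rightarrow> real"
  assumes m: "m \<ge> 1" and j: "j < m" and b: "2 * ln (real m) * sqrt (\<Sum>j<m. (t j)\<^sup>2) \<le> b"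
  shows "\<bar>t j - 1 / 2 ^ m * (\<Sum>s\<in>signs m. s j * max (min (\<Sum>i<m. s i * t i) b) (- b))\<bar>
    \<le> 4 / (real m)\<^sup>2 * (\<Sum>j<m. \<bar>t j\<bar>)"
proof -
  have b0: "b \<ge> 0" using b m order_trans[of 0 "2 * ln (real m) * sqrt (\<Sum>j<m. (t j)\<^sup>2)" b]
    by (simp add: sum_nonneg)
  define S where "S s = (\<Sum>i<m. s i * t i)" for s
  have "2 ^ m * t j - (\<Sum>s\<in>signs m. s j * max (min (S s) b) (- b)) =
      (\<Sum>s\<in>signs m. s j * (S s - max (min (S s) b) (- b)))"
    using sum_signs_coeff[OF j, of t] by (simp add: S_def right_diff_distrib sum_subtractf)
  also have "\<bar>\<dots>\<bar> \<le> (\<Sum>s\<in>signs m. \<bar>s j * (S s - max (min (S s) b) (- b))\<bar>)"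
    by (rule sum_abs)
  also have "\<dots> = (\<Sum>s\<in>signs m. max 0 (\<bar>S s\<bar> - b))"
  proof (rule sum.cong[OF refl])
    fix s assume "s \<in> signs m"
    then show "\<bar>s j * (S s - max (min (S s) b) (- b))\<bar> = max 0 (\<bar>S s\<bar> - b)"
      using signs_abs[of s m j] j b0 by (simp add: abs_mult)
  qed
  also have "\<dots> \<le> 2 ^ m * (4 / (real m)\<^sup>2 * (\<Sum>j<m. \<bar>t j\<bar>))"
    unfolding S_def by (rule sum_signs_excess_le[OF m b])
  finally have "\<bar>2 ^ m * t j - (\<Sum>s\<in>signs m. s j * max (min (S s) b) (- b))\<bar> / 2 ^ m
      \<le> 4 / (real m)\<^sup>2 * (\<Sum>j<m. \<bar>t j\<bar>)" by (simp add: divide_le_eq mult.commute)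
  moreover have "\<bar>2 ^ m * t j - (\<Sum>s\<in>signs m. s j * max (min (S s) b) (- b))\<bar> / 2 ^ m =
    \<bar>(2 ^ m * t j - (\<Sum>s\<in>signs m. s j * max (min (S s) b) (- b))) / 2 ^ m\<bar>" by simp
  ultimately show ?thesis by (simp add: S_def diff_divide_distrib)
qed

text \<open>The comparison with the integral of \<open>x powr (- a)\<close>, by induction. The step
  is the weighted inequality between geometric and arithmetic mean for \<open>m / (m + 1)\<close>
  and 1.\<close>

lemma sum_powr_neg_le:
  fixes a :: real
  assumes a: "0 < a" "a < 1"
  shows "(\<Sum>i=1..m. real i powr (- a)) \<le> real m powr (1 - a) / (1 - a)"
proof (induction m)
  case (Suc m)
  have key: "real m powr (1 - a) + (1 - a) * real (Suc m) powr (- a) \<le> real (Suc m) powr (1 - a)"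
  proof (cases "m = 0")
    case False
    have "(real m / real (Suc m)) powr (1 - a) * 1 powr a \<le> (1 - a) * (real m / real (Suc m)) + a * 1"
      by (rule Youngs_inequality_0) (use a False in auto)
    then have "real m powr (1 - a) / real (Suc m) powr (1 - a) \<le> 1 - (1 - a) / real (Suc m)"
      by (simp add: powr_divide field_simps)
    then have "real m powr (1 - a) \<le> (1 - (1 - a) / real (Suc m)) * real (Suc m) powr (1 - a)"
      by (subst (asm) divide_le_eq) simp
    moreover have "real (Suc m) powr (- a) = real (Suc m) powr (1 - a) / real (Suc m)"
      by (simp add: powr_diff powr_minus divide_inverse mult.commute)
    ultimately show ?thesis by (simp add: left_diff_distrib)
  qed (use a in simp)
  have "(\<Sum>i=1..Suc m. real i powr (- a)) \<le> real m powr (1 - a) / (1 - a) + real (Suc m) powr (- a)"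
    using Suc by simp
  also have "\<dots> = (real m powr (1 - a) + (1 - a) * real (Suc m) powr (- a)) / (1 - a)"
    using a by (simp add: field_simps)
  also have "\<dots> \<le> real (Suc m) powr (1 - a) / (1 - a)"
    using key a by (intro divide_right_mono) auto
  finally show ?case .
qed simp

section \<open>Upper estimates\<close>

text \<open>Suprema of arbitrary positive vectors replace sums of disjoint ones, since the vectors
  combined in \<open>ex_sign_family\<close> need not be disjoint; \<open>ex_disjoint_family\<close>
  links the two forms.\<close>

definition upper_estimate :: "real \<Rightarrow> ('a, 'm) nlattice_scheme \<Rightarrow> bool" where
  "upper_estimate r E \<longleftrightarrow> (\<exists>C. \<forall>k x.
     (\<forall>i<k. x i \<in> vcarrier E \<and> vle E (vzero E) (x i)) \<and> (\<Sum>i<k. vnorm E (x i) powr r) \<le> 1 \<longrightarrow>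
     vnorm E (vpsup E x k) \<le> C)"

context normed_lattice_on
begin

lemma vpsup_scale_le:
  assumes x: "\<And>i. i < k \<Longrightarrow> x i \<in> V" and c: "c > 0"
  shows "vpsup E x k \<preceq> c \<odot> vpsup E (\<lambda>i. (1 / c) \<odot> x i) k"
proof (rule vpsup_least)
  have P: "vpsup E (\<lambda>i. (1 / c) \<odot> x i) k \<in> V" using x by (auto intro!: vpsup_closed)
  then show "c \<odot> vpsup E (\<lambda>i. (1 / c) \<odot> x i) k \<in> V" by simp
  show "\<zero> \<preceq> c \<odot> vpsup E (\<lambda>i. (1 / c) \<odot> x i) k"
    using x P c by (intro le_scale vpsup_nonneg) auto
  show "x i \<in> V \<and> x i \<preceq> c \<odot> vpsup E (\<lambda>i. (1 / c) \<odot> x i) k" if i: "i < k" for i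
  proof
    show xi: "x i \<in> V" by (rule x[OF i])
    have "(1 / c) \<odot> x i \<preceq> vpsup E (\<lambda>i. (1 / c) \<odot> x i) k" using x i by (intro vpsup_ge) auto
    then have "c \<odot> ((1 / c) \<odot> x i) \<preceq> c \<odot> vpsup E (\<lambda>i. (1 / c) \<odot> x i) k"
      using xi P c by (intro scale_mono) auto
    then show "x i \<preceq> c \<odot> vpsup E (\<lambda>i. (1 / c) \<odot> x i) k" using xi c by (simp add: scale_scale scale_one)
  qed
qed

text \<open>\<open>S\<close> is any positive number above the \<open>r\<close>-norm of the norms:
  this avoids division by zero and leaves the choice of a convenient bound to
  \<open>ex_sign_family\<close>.\<close>

lemma upper_estimate_homogeneous:
  assumes "upper_estimate r E" and r: "r > 0"
  shows "\<exists>C\<ge>0. \<forall>k x S. (\<forall>i<k. x i \<in> V \<and> \<zero> \<preceq> x i) \<and> S > 0 \<and>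
    (\<Sum>i<k. \<parallel>x i\<parallel> powr r) \<le> S powr r \<longrightarrow> \<parallel>vpsup E x k\<parallel> \<le> C * S"
proof -
  obtain C where C: "\<And>k x. (\<forall>i<k. x i \<in> V \<and> \<zero> \<preceq> x i) \<and> (\<Sum>i<k. \<parallel>x i\<parallel> powr r) \<le> 1 \<Longrightarrow>
     \<parallel>vpsup E x k\<parallel> \<le> C"
    using assms(1) unfolding upper_estimate_def by blast
  show ?thesis
  proof (intro exI[of _ C] conjI allI impI)
    show "C \<ge> 0" using C[of 0 "\<lambda>_. \<zero>"] by (simp add: norm_zero)
    fix k :: nat and x :: "nat \<Rightarrow> 'a" and S :: real
    assume a: "(\<forall>i<k. x i \<in> V \<and> \<zero> \<preceq> x i) \<and> S > 0 \<and> (\<Sum>i<k. \<parallel>x i\<parallel> powr r) \<le> S powr r"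
    then have x: "\<And>i. i < k \<Longrightarrow> x i \<in> V" "\<And>i. i < k \<Longrightarrow> \<zero> \<preceq> x i" and S: "S > 0"
      and le: "(\<Sum>i<k. \<parallel>x i\<parallel> powr r) \<le> S powr r" by auto
    have "(\<Sum>i<k. \<parallel>(1 / S) \<odot> x i\<parallel> powr r) = (\<Sum>i<k. \<parallel>x i\<parallel> powr r / S powr r)"
      using x S by (intro sum.cong) (auto simp: norm_scale powr_divide norm_nonneg)
    also have "\<dots> = (\<Sum>i<k. \<parallel>x i\<parallel> powr r) / S powr r" by (rule sum_divide_distrib[symmetric])
    also have "\<dots> \<le> 1" using le S by (simp add: divide_le_eq)
    finally have 1: "\<parallel>vpsup E (\<lambda>i. (1 / S) \<odot> x i) k\<parallel> \<le> C"
      using x S by (intro C conjI allI impI) (auto intro!: le_scale)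
    have P: "vpsup E (\<lambda>i. (1 / S) \<odot> x i) k \<in> V" using x by (auto intro!: vpsup_closed)
    have "\<parallel>vpsup E x k\<parallel> \<le> \<parallel>S \<odot> vpsup E (\<lambda>i. (1 / S) \<odot> x i) k\<parallel>"
      using x S P by (intro norm_le_positive vpsup_scale_le vpsup_nonneg vpsup_closed) auto
    also have "\<dots> \<le> C * S" using 1 S P by (simp add: norm_scale mult.commute)
    finally show "\<parallel>vpsup E x k\<parallel> \<le> C * S" .
  qed
qed

text \<open>The vectors \<open>z s\<close> are the random sums of the \<open>x j\<close>, truncated at a multiple of a lattice
  substitute for the square function. The truncation hardly changes the Rademacher coefficients.\<close>

lemma ex_sign_family:
  assumes ue: "upper_estimate r E" and r: "1 < r" "r < 2"
  shows "\<exists>C>0. \<forall>m\<ge>2. \<forall>x. (\<forall>j<m. x j \<in> vball E) \<longrightarrow>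
    (\<exists>z. \<forall>s\<in>signs m. z s \<in> V \<and> \<parallel>z s\<parallel> \<le> C * ln (real m) * real m powr (1 / r) \<and>
      (\<forall>j<m. \<parallel>x j \<ominus> (1 / 2 ^ m) \<odot> vsum E (\<lambda>s. s j \<odot> z s) (signs m)\<parallel> \<le> 4 / real m))"
proof -
  have r0: "r > 0" using r by simp
  obtain C0 where C0: "C0 \<ge> 0" "\<And>k x S. (\<forall>i<k. x i \<in> V \<and> \<zero> \<preceq> x i) \<and> S > 0 \<and>
    (\<Sum>i<k. \<parallel>x i\<parallel> powr r) \<le> S powr r \<Longrightarrow> \<parallel>vpsup E x k\<parallel> \<le> C0 * S"
    using upper_estimate_homogeneous[OF ue r0] by blast
  \<comment> \<open>The average of \<open>(m / i) powr (r / 2)\<close> over \<open>i\<close> from 1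
    to \<open>m\<close> is at most \<open>1 / (1 - r / 2)\<close>; this is where
    \<open>r < 2\<close> is needed.\<close>
  define D where "D = (1 / (1 - r / 2)) powr (1 / r)"
  have D: "D > 0" using r by (simp add: D_def)
  show ?thesis
  \<comment> \<open>The summand 1 keeps the constant positive when \<open>C0 = 0\<close>.\<close>
  proof (intro exI[of _ "10 * (2 * C0 * D) + 1"] conjI allI impI)
    show "10 * (2 * C0 * D) + 1 > 0" using C0 D by (intro add_nonneg_pos) auto
    fix m :: nat and x :: "nat \<Rightarrow> 'a" assume m: "2 \<le> m" and xb: "\<forall>j<m. x j \<in> vball E"
    have x: "x j \<in> vball E" if "j < m" for j using xb that by simp
    have m0: "real m > 0" "m \<ge> 1" and lnm: "ln (real m) \<ge> 0" using m by auto
    have xV: "x j \<in> V" and x1: "\<parallel>x j\<parallel> \<le> 1" if "j < m" for j using x[OF that] by (auto simp: vball_def)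
    define \<Omega> where "\<Omega> = PiE {..<m} (\<lambda>_. {1..m})"
    have fin\<Omega>: "finite \<Omega>" by (simp add: \<Omega>_def finite_PiE)
    have card\<Omega>: "real (card \<Omega>) = real m ^ m" by (simp add: \<Omega>_def card_PiE)
    define v where "v f = vpsup E (\<lambda>j. sqrt (real m / real (f j)) \<odot> \<bar>x j\<bar>\<^sub>E) m" for f :: "nat \<Rightarrow> nat"
    have vV: "v f \<in> V" "\<zero> \<preceq> v f" for f
      unfolding v_def using xV by (auto intro!: vpsup_closed vpsup_nonneg)
    \<comment> \<open>By \<open>average_max_ge_L2\<close> the average of the \<open>v f\<close> is
      at least a fifth of the square function of the \<open>x j\<close>. The factor
      \<open>10 * ln m\<close> raises it to the threshold required by
      \<open>sum_signs_clip\<close>.\<close>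
    define w where "w = (10 * ln (real m) / real m ^ m) \<odot> vsum E v \<Omega>"
    have sV: "vsum E v \<Omega> \<in> V" "\<zero> \<preceq> vsum E v \<Omega>"
      using vV fin\<Omega> by (auto intro!: vsum_closed) (auto simp: vsum_def intro!: vpsum_nonneg)
    have wV: "w \<in> V" "\<zero> \<preceq> w" using sV lnm by (auto simp: w_def intro!: le_scale)
    define b where "b = real m / (1 - r / 2)"
    have b: "b > 0" using r m0 by (simp add: b_def)
    have bD: "b powr (1 / r) = D * real m powr (1 / r)"
    proof -
      have "b powr (1 / r) = (1 / (1 - r / 2) * real m) powr (1 / r)" by (simp add: b_def)
      also have "\<dots> = D * real m powr (1 / r)" unfolding D_def by (rule powr_mult)
      finally show ?thesis .
    qed
    define y where "y f = (\<Sum>j<m. (real m / real (f j)) powr (r / 2))" for f :: "nat \<Rightarrow> nat"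
    have y0: "y f \<ge> 0" for f by (simp add: y_def sum_nonneg)
    \<comment> \<open>The number \<open>b powr (1 / r) * (1 + y f / b)\<close> is at least
      \<open>y f powr (1 / r)\<close> and affine in \<open>y f\<close>, so averaging it over
      \<open>f\<close> needs only the mean of \<open>y f\<close>.\<close>
    have v_norm: "\<parallel>v f\<parallel> \<le> C0 * (b powr (1 / r) * (1 + y f / b))" for f
    proof -
      have S0: "0 < b powr (1 / r) * (1 + y f / b)" using b y0[of f]
        by (intro mult_pos_pos add_pos_nonneg) auto
      have "(\<Sum>j<m. \<parallel>sqrt (real m / real (f j)) \<odot> \<bar>x j\<bar>\<^sub>E\<parallel> powr r) \<le> y f"
        unfolding y_def
      proof (rule sum_mono)
        fix j assume "j \<in> {..<m}"
        then have j: "j < m" by simp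
        have "\<parallel>sqrt (real m / real (f j)) \<odot> \<bar>x j\<bar>\<^sub>E\<parallel> \<le> sqrt (real m / real (f j))"
          using xV[OF j] x1[OF j] norm_nonneg[OF xV[OF j]]
          by (simp add: norm_scale norm_vabs mult_left_le)
        then have "\<parallel>sqrt (real m / real (f j)) \<odot> \<bar>x j\<bar>\<^sub>E\<parallel> powr r \<le> sqrt (real m / real (f j)) powr r"
          using xV[OF j] r by (intro powr_mono2 norm_nonneg) auto
        also have "sqrt (real m / real (f j)) powr r = (real m / real (f j)) powr (r / 2)"
          by (simp add: powr_half_sqrt[symmetric] powr_powr)
        finally show "\<parallel>sqrt (real m / real (f j)) \<odot> \<bar>x j\<bar>\<^sub>E\<parallel> powr r \<le> (real m / real (f j)) powr (r / 2)" .
      qed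
      also have "y f \<le> b * (1 + y f / b)" using b by (simp add: field_simps)
      also have "\<dots> \<le> b * (1 + y f / b) powr r"
      proof -
        have "(1 + y f / b) powr 1 \<le> (1 + y f / b) powr r" using r b y0[of f] by (intro powr_mono) auto
        then show ?thesis using b y0[of f] by simp
      qed
      also have "\<dots> = (b powr (1 / r) * (1 + y f / b)) powr r"
        using b r y0[of f] by (simp add: powr_mult powr_powr)
      finally show ?thesis unfolding v_def using xV S0
        by (intro C0(2) conjI allI impI) (auto intro!: le_scale simp: vabs_nonneg)
    qed
    have y_avg: "(\<Sum>f\<in>\<Omega>. y f) \<le> real m ^ m * b"
    proof -
      have "(\<Sum>f\<in>\<Omega>. y f) = (\<Sum>j<m. \<Sum>f\<in>\<Omega>. (real m / real (f j)) powr (r / 2))"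
        unfolding y_def by (rule sum.swap)
      also have "\<dots> = (\<Sum>j<m. real m ^ (m - 1) * (\<Sum>i=1..m. (real m / real i) powr (r / 2)))"
      proof (rule sum.cong[OF refl])
        fix j assume "j \<in> {..<m}"
        then show "(\<Sum>f\<in>\<Omega>. (real m / real (f j)) powr (r / 2)) =
            real m ^ (m - 1) * (\<Sum>i=1..m. (real m / real i) powr (r / 2))"
          unfolding \<Omega>_def
          using sum_PiE_marginal[of "{..<m}" j "{1..m}" "\<lambda>i. (real m / real i) powr (r / 2)"] by simp
      qed
      also have "\<dots> = real m ^ m * (\<Sum>i=1..m. (real m / real i) powr (r / 2))"
        using m power_minus_mult[of m "real m"] by (simp add: sum_distrib_left[symmetric] mult_ac)
      also have "(\<Sum>i=1..m. (real m / real i) powr (r / 2)) = real m powr (r / 2) * (\<Sum>i=1..m. real i powr (- (r / 2)))"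
        by (simp add: sum_distrib_left powr_divide powr_minus_divide)
      also have "\<dots> \<le> real m powr (r / 2) * (real m powr (1 - r / 2) / (1 - r / 2))"
        using r by (intro mult_left_mono sum_powr_neg_le) auto
      also have "\<dots> = b" using m0 by (simp add: b_def powr_add[symmetric])
      finally show ?thesis using m0 by simp
    qed
    have w_norm: "\<parallel>w\<parallel> \<le> (10 * (2 * C0 * D) + 1) * ln (real m) * real m powr (1 / r)"
    proof -
      have "\<parallel>vsum E v \<Omega>\<parallel> \<le> (\<Sum>f\<in>\<Omega>. \<parallel>v f\<parallel>)" using fin\<Omega> vV by (intro vsum_norm_le) auto
      also have "\<dots> \<le> (\<Sum>f\<in>\<Omega>. C0 * (b powr (1 / r) * (1 + y f / b)))" by (rule sum_mono) (rule v_norm)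
      also have "\<dots> = C0 * (b powr (1 / r) * (real m ^ m + (\<Sum>f\<in>\<Omega>. y f) / b))"
        by (simp add: sum_distrib_left[symmetric] sum.distrib card\<Omega> sum_divide_distrib)
      also have "\<dots> \<le> C0 * (b powr (1 / r) * (real m ^ m + real m ^ m))"
        using y_avg b C0 by (intro mult_left_mono add_left_mono) (auto simp: divide_le_eq)
      also have "\<dots> = real m ^ m * (2 * C0 * D * real m powr (1 / r))" by (simp add: bD)
      finally have "\<parallel>vsum E v \<Omega>\<parallel> / real m ^ m \<le> 2 * C0 * D * real m powr (1 / r)"
        using m0 by (simp add: divide_le_eq mult.commute)
      then have "10 * ln (real m) * (\<parallel>vsum E v \<Omega>\<parallel> / real m ^ m) \<le> 10 * ln (real m) * (2 * C0 * D * real m powr (1 / r))"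
        using lnm by (intro mult_left_mono) auto
      moreover have "\<parallel>w\<parallel> = 10 * ln (real m) * (\<parallel>vsum E v \<Omega>\<parallel> / real m ^ m)"
        using sV lnm m0 by (simp add: w_def norm_scale)
      moreover have "0 \<le> ln (real m) * real m powr (1 / r)" using lnm by simp
      ultimately show ?thesis by (simp add: algebra_simps)
    qed
    define z where "z s = (vpsum E (\<lambda>j. s j \<odot> x j) m \<sqinter> w) \<squnion> \<ominus> w" for s :: "nat \<Rightarrow> real"
    have pV: "vpsum E (\<lambda>j. s j \<odot> x j) m \<in> V" for s using xV by (intro vpsum_closed) auto
    have zV: "z s \<in> V" for s using pV wV by (simp add: z_def)
    have z_norm: "\<parallel>z s\<parallel> \<le> \<parallel>w\<parallel>" for s
    proof (rule norm_le_dominated)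
      show "\<ominus> w \<preceq> z s" using pV wV by (simp add: z_def vsup_ge2)
      show "z s \<preceq> w" using pV wV neg_nonpos[of w] le_trans[of "\<ominus> w" \<zero> w]
        by (simp add: z_def vsup_least vinf_le2)
    qed (use zV wV in auto)
    obtain u where u: "u \<in> V" "\<zero> \<preceq> u" "\<And>j. j < m \<Longrightarrow> x j \<in> Idl u" using ex_unit[of m x] xV by blast
    note Idl = Idl_intros[OF u(1,2)]
    have vI: "v f \<in> Idl u" for f unfolding v_def by (intro Idl u(3))
    have wI: "w \<in> Idl u" unfolding w_def by (intro Idl vI fin\<Omega>)
    have pI: "vpsum E (\<lambda>j. s j \<odot> x j) m \<in> Idl u" for s by (intro Idl u(3))
    have zI: "z s \<in> Idl u" for s unfolding z_def by (intro Idl pI wI)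
    define a where "a j = x j \<ominus> (1 / 2 ^ m) \<odot> vsum E (\<lambda>s. s j \<odot> z s) (signs m)" for j
    \<comment> \<open>The error bound of \<open>sum_signs_clip\<close> as a vector. Since the
      \<open>x j\<close> lie in the unit ball, its norm is at most \<open>4 / m\<close>.\<close>
    define d where "d = (4 / (real m)\<^sup>2) \<odot> vpsum E (\<lambda>j. \<bar>x j\<bar>\<^sub>E) m"
    have aI: "a j \<in> Idl u" if "j < m" for j unfolding a_def by (intro Idl u(3) zI that) simp
    have dI: "d \<in> Idl u" unfolding d_def by (intro Idl u(3))
    have "\<bar>a j\<bar>\<^sub>E \<preceq> d" if j: "j < m" for j
    proof (rule le_by_lhom[OF u(1,2)])
      show "\<bar>a j\<bar>\<^sub>E \<in> Idl u" "d \<in> Idl u" using aI[OF j] dI by (auto intro: Idl)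
      fix h assume h: "lhom u h"
      note hs = lhom_simps[OF u(1,2) h]
      define t where "t j = h (x j)" for j
      have hw: "2 * ln (real m) * sqrt (\<Sum>j<m. (t j)\<^sup>2) \<le> h w"
      proof -
        have hv: "h (v f) = Max (insert 0 ((\<lambda>j. sqrt (real m / real (f j)) * \<bar>t j\<bar>) ` {..<m}))" for f
        proof -
          have "h (v f) = Max (insert 0 ((\<lambda>j. h (sqrt (real m / real (f j)) \<odot> \<bar>x j\<bar>\<^sub>E)) ` {..<m}))"
            unfolding v_def by (intro hs Idl u(3))
          also have "(\<lambda>j. h (sqrt (real m / real (f j)) \<odot> \<bar>x j\<bar>\<^sub>E)) ` {..<m} =
              (\<lambda>j. sqrt (real m / real (f j)) * \<bar>t j\<bar>) ` {..<m}"
            by (rule image_cong) (auto simp: hs Idl u(3) t_def)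
          finally show ?thesis .
        qed
        have "h w = 10 * ln (real m) / real m ^ m * (\<Sum>f\<in>\<Omega>. h (v f))"
          unfolding w_def by (simp add: hs Idl vI fin\<Omega>)
        also have "\<dots> \<ge> 10 * ln (real m) / real m ^ m * (real m ^ m * sqrt (\<Sum>j<m. (t j)\<^sup>2) / 5)"
          unfolding hv \<Omega>_def using lnm by (intro mult_left_mono average_max_ge_L2 m0) auto
        finally show ?thesis using m0 by simp
      qed
      have hz: "h (z s) = max (min (\<Sum>i<m. s i * t i) (h w)) (- h w)" for s
        unfolding z_def by (simp add: hs Idl pI wI u(3) t_def)
      have ha: "h (a j) = t j - 1 / 2 ^ m * (\<Sum>s\<in>signs m. s j * max (min (\<Sum>i<m. s i * t i) (h w)) (- h w))"
        unfolding a_def using j by (simp add: hs Idl zI u(3) hz) (simp add: t_def)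
      have "h d = 4 / (real m)\<^sup>2 * (\<Sum>j<m. \<bar>t j\<bar>)"
        unfolding d_def by (simp add: hs Idl u(3) t_def)
      then show "h (\<bar>a j\<bar>\<^sub>E) \<le> h d"
        using sum_signs_clip[OF m0(2) j hw] aI[OF j] by (simp add: hs(7) ha)
    qed
    moreover have "\<parallel>d\<parallel> \<le> 4 / real m"
    proof -
      have "\<parallel>vpsum E (\<lambda>j. \<bar>x j\<bar>\<^sub>E) m\<parallel> \<le> (\<Sum>j<m. \<parallel>\<bar>x j\<bar>\<^sub>E\<parallel>)" using xV by (intro vpsum_norm_le) auto
      also have "\<dots> \<le> (\<Sum>j<m. 1)" using xV x1 by (intro sum_mono) (auto simp: norm_vabs)
      finally have "\<parallel>vpsum E (\<lambda>j. \<bar>x j\<bar>\<^sub>E) m\<parallel> \<le> real m" by simp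
      moreover have "vpsum E (\<lambda>j. \<bar>x j\<bar>\<^sub>E) m \<in> V" using xV by (intro vpsum_closed) auto
      ultimately have "\<parallel>d\<parallel> \<le> 4 / (real m)\<^sup>2 * real m"
        unfolding d_def by (simp add: norm_scale divide_right_mono)
      then show ?thesis using m by (simp add: power2_eq_square)
    qed
    moreover have "\<parallel>a j\<parallel> \<le> \<parallel>d\<parallel>" if "j < m" "\<bar>a j\<bar>\<^sub>E \<preceq> d" for j
    proof -
      have "a j \<in> V" "d \<in> V" using aI[OF that(1)] dI Idl_V[OF u(1,2)] by auto
      then show ?thesis using that(2) norm_le_positive[of "\<bar>a j\<bar>\<^sub>E" d]
        by (simp add: norm_vabs vabs_nonneg)
    qed
    ultimately have "\<forall>j<m. \<parallel>a j\<parallel> \<le> 4 / real m" by force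
    then show "\<exists>z. \<forall>s\<in>signs m. z s \<in> V \<and> \<parallel>z s\<parallel> \<le> (10 * (2 * C0 * D) + 1) * ln (real m) * real m powr (1 / r) \<and>
      (\<forall>j<m. \<parallel>x j \<ominus> (1 / 2 ^ m) \<odot> vsum E (\<lambda>s. s j \<odot> z s) (signs m)\<parallel> \<le> 4 / real m)"
      using zV order_trans[OF z_norm w_norm] unfolding a_def by (intro exI[of _ z]) simp
  qed
qed

end

section \<open>The composition property implies an upper estimate\<close>

text \<open>Perturbing \<open>t j\<close> by the factor \<open>(1 + \<kappa>) ^ (j * l)\<close> makes the two largest values nearly equal
  for at most one \<open>l\<close> per pair of indices. For all other \<open>l\<close> the truncation below keeps the largest
  value.\<close>

lemma sum_perturbed_gaps_ge:
  fixes t :: "nat \<Rightarrow> real" and \<kappa> N :: real and m R :: nat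
  assumes t: "\<And>j. j < m \<Longrightarrow> 0 \<le> t j" and \<kappa>: "\<kappa> > 0" and N: "N = (1 + \<kappa>) / \<kappa>"
  defines "w \<equiv> \<lambda>l j. (1 + \<kappa>) ^ (j * l) * t j"
  defines "M \<equiv> \<lambda>l j. Max (insert 0 ((\<lambda>i. if i = j then 0 else w l i) ` {..<m}))"
  shows "(real R - (real m)\<^sup>2) * Max (insert 0 (t ` {..<m})) \<le>
    (\<Sum>l<R. \<Sum>j<m. min (w l j) (N * max 0 (w l j - M l j)))"
proof -
  define T where "T = Max (insert 0 (t ` {..<m}))"
  define v where "v = (\<lambda>l j. min (w l j) (N * max 0 (w l j - M l j)))"
  have N0: "N > 0" using \<kappa> N by simp
  have w0: "0 \<le> w l j" if "j < m" for l j using t[OF that] \<kappa> by (simp add: w_def)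
  have v0: "0 \<le> v l j" if "j < m" for l j using w0[OF that] N0 by (simp add: v_def)
  have T0: "T \<ge> 0" by (simp add: T_def)
  have tw: "t j \<le> w l j" if "j < m" for l j
    using t[OF that] \<kappa> by (simp add: w_def mult_le_cancel_right1)
  show ?thesis
  proof (cases "T = 0")
    case True
    have "0 \<le> (\<Sum>l<R. \<Sum>j<m. v l j)" by (intro sum_nonneg v0) simp
    then show ?thesis using True unfolding T_def v_def by simp
  next
    case False
    with T0 have Tpos: "T > 0" by simp
    have "T \<in> insert 0 (t ` {..<m})" unfolding T_def by (rule Max_in) auto
    then obtain j1 where j1: "j1 < m" "t j1 = T" using Tpos by auto
    have "\<exists>j<m. \<forall>i<m. w l i \<le> w l j" for l
    proof -
      have "Max (w l ` {..<m}) \<in> w l ` {..<m}" using j1 by (intro Max_in) auto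
      then obtain j where "j < m" "w l j = Max (w l ` {..<m})" by auto
      then show ?thesis by (intro exI[of _ j]) auto
    qed
    then obtain top where top: "\<And>l. top l < m" "\<And>l i. i < m \<Longrightarrow> w l i \<le> w l (top l)" by metis
    have wT: "T \<le> w l (top l)" for l using tw[OF j1(1), of l] top(2)[OF j1(1), of l] j1 by simp
    define bad where "bad = {l\<in>{..<R}. \<exists>i<m. i \<noteq> top l \<and> w l (top l) < (1 + \<kappa>) * w l i}"
    have good: "T \<le> (\<Sum>j<m. v l j)" if "l \<in> {..<R} - bad" for l
    proof -
      have gap: "(1 + \<kappa>) * w l i \<le> w l (top l)" if "i < m" "i \<noteq> top l" for i
        using that \<open>l \<in> {..<R} - bad\<close> by (force simp: bad_def)
      have "M l (top l) \<le> w l (top l) / (1 + \<kappa>)"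
        unfolding M_def
      proof (rule Max.boundedI)
        fix a assume "a \<in> insert 0 ((\<lambda>i. if i = top l then 0 else w l i) ` {..<m})"
        then show "a \<le> w l (top l) / (1 + \<kappa>)"
          using gap \<kappa> w0[OF top(1)] by (auto simp: field_simps)
      qed auto
      \<comment> \<open>\<open>N\<close> is chosen so that the gap
        \<open>w * \<kappa> / (1 + \<kappa>)\<close> is enlarged to \<open>w\<close> itself; the
        minimum in \<open>v\<close> then equals \<open>w\<close>.\<close>
      then have "w l (top l) - M l (top l) \<ge> w l (top l) * \<kappa> / (1 + \<kappa>)"
        using \<kappa> by (simp add: field_simps)
      then have "N * (w l (top l) - M l (top l)) \<ge> N * (w l (top l) * \<kappa> / (1 + \<kappa>))"
        using N0 by (intro mult_left_mono) auto
      also have "N * (w l (top l) * \<kappa> / (1 + \<kappa>)) = w l (top l)" using \<kappa> unfolding N by simp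
      finally have "w l (top l) \<le> N * max 0 (w l (top l) - M l (top l))"
        using N0 by (meson max.cobounded2 mult_left_mono less_imp_le order_trans)
      then have "v l (top l) = w l (top l)" by (simp add: v_def)
      then have "T \<le> v l (top l)" using wT by simp
      also have "\<dots> \<le> (\<Sum>j<m. v l j)" using v0 top(1) by (intro member_le_sum) auto
      finally show ?thesis .
    qed
    have "\<exists>i<m. i \<noteq> top l \<and> w l (top l) < (1 + \<kappa>) * w l i" if "l \<in> bad" for l
      using that by (simp add: bad_def)
    then obtain snd' where s: "\<And>l. l \<in> bad \<Longrightarrow> snd' l < m" "\<And>l. l \<in> bad \<Longrightarrow> snd' l \<noteq> top l"
      "\<And>l. l \<in> bad \<Longrightarrow> w l (top l) < (1 + \<kappa>) * w l (snd' l)" by metis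
    \<comment> \<open>Between \<open>l\<close> and \<open>l'\<close> the ratio of the two values
      changes by a factor of at least \<open>1 + \<kappa>\<close> in one direction, although it lies
      between 1 and \<open>1 + \<kappa>\<close>, excluding the latter, both times.\<close>
    have no: False if l: "l \<in> bad" "l' \<in> bad" "top l = top l'" "snd' l = snd' l'" "l < l'" for l l'
    proof -
      define i j where "i = snd' l" and "j = top l"
      have ij: "i < m" "j < m" "i \<noteq> j" using s l top by (auto simp: i_def j_def)
      have a1: "w l i \<le> w l j" "w l j < (1 + \<kappa>) * w l i" using s(3)[OF l(1)] top(2)[of i l] ij by (auto simp: i_def j_def)
      have a2: "w l' i \<le> w l' j" "w l' j < (1 + \<kappa>) * w l' i"
        using s(3)[OF l(2)] top(2)[of i l'] ij l by (auto simp: i_def j_def)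
      define q where "q k = (1 + \<kappa>) ^ (k * (l' - l))" for k
      have wl': "w l' k = q k * w l k" for k
        unfolding w_def q_def using l(5) by (simp add: power_add[symmetric] diff_mult_distrib2)
      have q0: "q k > 0" for k using \<kappa> by (simp add: q_def)
      have qq: "(1 + \<kappa>) * q k \<le> q k'" if "k < k'" for k k'
      proof -
        have "Suc (k * (l' - l)) \<le> k' * (l' - l)"
          using that l(5) by (metis Suc_leI mult_less_mono1 zero_less_diff)
        then have "(1 + \<kappa>) ^ Suc (k * (l' - l)) \<le> q k'" unfolding q_def by (rule power_increasing) (use \<kappa> in simp)
        then show ?thesis by (simp add: q_def)
      qed
      show False
      proof (cases "i < j")
        case True
        have "q j * w l j < (1 + \<kappa>) * (q i * w l i)" using a2(2) by (simp add: wl')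
        also have "\<dots> \<le> q j * w l i"
          using mult_right_mono[OF qq[OF True] w0[OF ij(1), of l]] by (simp add: mult.assoc)
        finally show False using a1(1) q0[of j] by simp
      next
        case False
        then have ji: "j < i" using ij by simp
        have "q j * ((1 + \<kappa>) * w l i) \<le> q i * w l i"
          using mult_right_mono[OF qq[OF ji] w0[OF ij(1), of l]] by (simp add: mult_ac)
        also have "\<dots> \<le> q j * w l j" using a2(1) by (simp add: wl')
        finally show False using a1(2) q0[of j] by simp
      qed
    qed
    have inj: "inj_on (\<lambda>l. (snd' l, top l)) bad"
    proof (rule inj_onI)
      fix l l' assume l: "l \<in> bad" "l' \<in> bad" "(snd' l, top l) = (snd' l', top l')"
      show "l = l'" using no[of l l'] no[of l' l] l by (cases l l' rule: linorder_cases) auto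
    qed
    have "card bad = card ((\<lambda>l. (snd' l, top l)) ` bad)" using inj by (simp add: card_image)
    also have "\<dots> \<le> card ({..<m} \<times> {..<m})" by (rule card_mono) (use s(1) top(1) in auto)
    finally have cb: "real (card bad) \<le> (real m)\<^sup>2"
      by (simp add: power2_eq_square) (metis of_nat_le_iff of_nat_mult)
    have bR: "bad \<subseteq> {..<R}" by (auto simp: bad_def)
    have "(real R - (real m)\<^sup>2) * T \<le> real (card ({..<R} - bad)) * T"
      using cb T0 bR card_mono[OF _ bR]
      by (intro mult_right_mono) (auto simp: card_Diff_subset finite_subset of_nat_diff)
    also have "\<dots> = (\<Sum>l\<in>{..<R} - bad. T)" by simp
    also have "\<dots> \<le> (\<Sum>l\<in>{..<R} - bad. \<Sum>j<m. v l j)" by (rule sum_mono) (rule good)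
    also have "\<dots> \<le> (\<Sum>l<R. \<Sum>j<m. v l j)"
      using v0 by (intro sum_mono2) (auto intro!: sum_nonneg)
    finally show ?thesis by (simp add: T_def v_def)
  qed
qed

section \<open>Disjoint families below a given family\<close>

context normed_lattice_on
begin

definition disjoint_family :: "nat \<Rightarrow> (nat \<Rightarrow> 'a) \<Rightarrow> bool" where
  "disjoint_family k x \<longleftrightarrow> (\<forall>i<k. x i \<in> V \<and> \<zero> \<preceq> x i) \<and> (\<forall>i<k. \<forall>j<k. i \<noteq> j \<longrightarrow> x i \<sqinter> x j = \<zero>)"

text \<open>For each of finitely many slight rescalings of the \<open>y j\<close>, a member is kept
  only where it exceeds all others, which gives disjointness. At each homomorphism near ties spoil
  at most half of the rescalings, so by averaging the norms one rescaling is good.\<close>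

lemma ex_disjoint_family:
  assumes y: "\<And>j. j < m \<Longrightarrow> y j \<in> V" "\<And>j. j < m \<Longrightarrow> \<zero> \<preceq> y j" and m: "m \<ge> 1"
  obtains x where "disjoint_family m x" "\<And>j. j < m \<Longrightarrow> x j \<preceq> 2 \<odot> y j"
    "\<parallel>vpsup E y m\<parallel> \<le> 2 * \<parallel>vpsum E x m\<parallel>"
proof -
  \<comment> \<open>\<open>sum_perturbed_gaps_ge\<close> loses at most \<open>m * m\<close>
    perturbations; with twice as many the factor \<open>m * m\<close> remains.\<close>
  define R where "R = 2 * m * m"
  have R1: "R \<ge> 1" using m by (simp add: R_def)
  \<comment> \<open>Small enough for every factor \<open>(1 + \<kappa>) ^ (j * l)\<close> to stay
    below \<open>exp (1 / 2)\<close>, hence below 2.\<close>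
  define \<kappa> where "\<kappa> = 1 / (2 * real (m * R))"
  have \<kappa>: "\<kappa> > 0" using m R1 by (simp add: \<kappa>_def)
  define N where "N = (1 + \<kappa>) / \<kappa>"
  have N0: "N > 0" using \<kappa> by (simp add: N_def)
  define w where "w l j = ((1 + \<kappa>) ^ (j * l)) \<odot> y j" for l j
  define M where "M l j = vpsup E (\<lambda>i. if i = j then \<zero> else w l i) m" for l j
  define v where "v l j = w l j \<sqinter> N \<odot> ((w l j \<ominus> M l j) \<squnion> \<zero>)" for l j
  obtain u where u: "u \<in> V" "\<zero> \<preceq> u" "\<And>j. j < m \<Longrightarrow> y j \<in> Idl u" using ex_unit[of m y] y(1) by blast
  note I = Idl_intros[OF u(1,2)]
  have wI: "w l j \<in> Idl u" if "j < m" for l j unfolding w_def by (intro I u(3) that)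
  have MI: "M l j \<in> Idl u" for l j unfolding M_def by (rule I) (auto intro: wI I)
  have vI: "v l j \<in> Idl u" if "j < m" for l j unfolding v_def by (intro I wI MI that)
  have IV: "x \<in> V" if "x \<in> Idl u" for x using Idl_V[OF u(1,2) that] .
  have pow: "(1 + \<kappa>) ^ (j * l) \<le> 2" if "j < m" "l < R" for j l
  proof -
    have "(1 + \<kappa>) ^ (j * l) \<le> exp \<kappa> ^ (j * l)"
      using \<kappa> exp_ge_add_one_self[of \<kappa>] by (intro power_mono) auto
    also have "\<dots> = exp (real (j * l) * \<kappa>)" by (rule exp_of_nat_mult[symmetric])
    also have "\<dots> \<le> exp (1 / 2)"
    proof -
      have "j * l \<le> m * R" using that by (intro mult_le_mono) auto
      then have "real (j * l) * \<kappa> \<le> real (m * R) * \<kappa>" using \<kappa> by (intro mult_right_mono) (simp_all only: of_nat_le_iff)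
      also have "\<dots> = 1 / 2" using m R1 by (simp add: \<kappa>_def)
      finally show ?thesis by simp
    qed
    also have "\<dots> \<le> (2::real)"
    proof (rule power2_le_imp_le)
      have "(exp (1 / 2 :: real))\<^sup>2 = exp 1" by (simp add: power2_eq_square flip: exp_add)
      then show "(exp (1 / 2 :: real))\<^sup>2 \<le> 2\<^sup>2" using e_less_272 by simp
    qed simp
    finally show ?thesis .
  qed
  have facts: "h (w l j) = (1 + \<kappa>) ^ (j * l) * h (y j)"
    "h (M l j) = Max (insert 0 ((\<lambda>i. if i = j then 0 else (1 + \<kappa>) ^ (i * l) * h (y i)) ` {..<m}))"
    "h (v l j) = min (h (w l j)) (N * max 0 (h (w l j) - h (M l j)))"
    "0 \<le> h (y j)"
    if h: "lhom u h" and j: "j < m" for h l j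
  proof -
    note hs = lhom_simps[OF u(1,2) h]
    have 1: "h (w l j) = (1 + \<kappa>) ^ (j * l) * h (y j)" if "j < m" for j
      using that by (simp add: w_def hs u(3))
    then show "h (w l j) = (1 + \<kappa>) ^ (j * l) * h (y j)" using j by simp
    have "h (M l j) = Max (insert 0 ((\<lambda>i. h (if i = j then \<zero> else w l i)) ` {..<m}))"
      unfolding M_def by (rule hs) (auto intro: wI I)
    also have "(\<lambda>i. h (if i = j then \<zero> else w l i)) ` {..<m} =
      (\<lambda>i. if i = j then 0 else (1 + \<kappa>) ^ (i * l) * h (y i)) ` {..<m}"
      by (rule image_cong) (auto simp: 1 hs)
    finally show "h (M l j) = Max (insert 0 ((\<lambda>i. if i = j then 0 else (1 + \<kappa>) ^ (i * l) * h (y i)) ` {..<m}))" .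
    have "w l j \<in> Idl u" "M l j \<in> Idl u" using wI[OF j] MI by auto
    then show "h (v l j) = min (h (w l j)) (N * max 0 (h (w l j) - h (M l j)))"
      unfolding v_def by (simp add: hs I max.commute)
    show "0 \<le> h (y j)" using lhom_nonneg[OF u(1,2) h u(3)[OF j]] y(2)[OF j] by simp
  qed
  have v_nonneg: "\<zero> \<preceq> v l j" if j: "j < m" for l j
  proof (rule le_by_lhom[OF u(1,2)])
    fix h assume h: "lhom u h"
    show "h \<zero> \<le> h (v l j)"
      using facts(1,3,4)[OF h j] N0 \<kappa> by (simp add: lhom_zero[OF u(1,2) h])
  qed (use vI j I in auto)
  have disj: "v l i \<sqinter> v l j = \<zero>" if ij: "i < m" "j < m" "i \<noteq> j" for l i j
  proof (rule eq_by_lhom[OF u(1,2)])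
    fix h assume h: "lhom u h"
    have a: "h (w l j) \<le> h (M l i)" if "i < m" "j < m" "i \<noteq> j" for i j
      unfolding facts(1,2)[OF h that(2)] facts(2)[OF h that(1)]
      by (rule Max_ge) (use that in auto)
    have vn: "0 \<le> h (v l i)" "0 \<le> h (v l j)"
      using lhom_nonneg[OF u(1,2) h] vI ij v_nonneg by auto
    \<comment> \<open>Of two indices the one with the smaller value does not exceed the maximum of
      the others, so its truncation vanishes.\<close>
    have "h (v l i) = 0 \<or> h (v l j) = 0"
    proof (cases "h (w l i) \<le> h (w l j)")
      case True
      then have "h (w l i) - h (M l i) \<le> 0" using a[OF ij] by simp
      then show ?thesis using facts(3)[OF h ij(1), of l] vn(1) by simp
    next
      case False
      then have "h (w l j) - h (M l j) \<le> 0" using a[of j i] ij by simp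
      then show ?thesis using facts(3)[OF h ij(2), of l] vn(2) by simp
    qed
    then show "h (v l i \<sqinter> v l j) = h \<zero>"
      using vn by (auto simp: lhom_simps[OF u(1,2) h] vI ij)
  qed (use vI ij I in auto)
  have v_le: "v l j \<preceq> 2 \<odot> y j" if j: "j < m" and l: "l < R" for l j
  proof (rule le_by_lhom[OF u(1,2)])
    fix h assume h: "lhom u h"
    have "h (v l j) \<le> (1 + \<kappa>) ^ (j * l) * h (y j)" using facts(1,3)[OF h j, of l] by simp
    also have "\<dots> \<le> 2 * h (y j)" using pow[OF j l] facts(4)[OF h j] by (rule mult_right_mono)
    finally show "h (v l j) \<le> h (2 \<odot> y j)" using u(3)[OF j] by (simp add: lhom_simps[OF u(1,2) h])
  qed (use vI j I u(3) in auto)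
  define S where "S = vpsum E (\<lambda>l. vpsum E (v l) m) R"
  have vsI: "vpsum E (v l) m \<in> Idl u" for l by (intro I vI)
  have SI: "S \<in> Idl u" unfolding S_def by (intro I vsI)
  have yI: "vpsup E y m \<in> Idl u" by (intro I u(3))
  have main: "real (m * m) \<odot> vpsup E y m \<preceq> S"
  proof (rule le_by_lhom[OF u(1,2)])
    fix h assume h: "lhom u h"
    note hs = lhom_simps[OF u(1,2) h]
    have hS: "h S = (\<Sum>l<R. \<Sum>j<m. h (v l j))" unfolding S_def by (simp add: hs vsI vI)
    have hy: "h (vpsup E y m) = Max (insert 0 ((\<lambda>j. h (y j)) ` {..<m}))" by (intro hs u(3))
    have "(real R - (real m)\<^sup>2) * Max (insert 0 ((\<lambda>j. h (y j)) ` {..<m})) \<le> (\<Sum>l<R. \<Sum>j<m. h (v l j))"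
    proof (rule order_trans[OF sum_perturbed_gaps_ge[where t = "\<lambda>j. h (y j)" and m = m and R = R, OF facts(4)[OF h] \<kappa> N_def]])
      show "(\<Sum>l<R. \<Sum>j<m. min ((1 + \<kappa>) ^ (j * l) * h (y j)) (N * max 0 ((1 + \<kappa>) ^ (j * l) * h (y j) -
          Max (insert 0 ((\<lambda>i. if i = j then 0 else (1 + \<kappa>) ^ (i * l) * h (y i)) ` {..<m}))))) \<le> (\<Sum>l<R. \<Sum>j<m. h (v l j))"
        by (intro sum_mono) (simp add: facts(1-3)[OF h])
    qed
    moreover have "real R - (real m)\<^sup>2 = real (m * m)" by (simp add: R_def power2_eq_square)
    ultimately show "h (real (m * m) \<odot> vpsup E y m) \<le> h S" using yI by (simp add: hs(2) hy hS)
  qed (use SI yI I in auto)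
  \<comment> \<open>If all \<open>2 * m * m\<close> sums had norm less than half of that of the
    supremum, the triangle inequality would contradict \<open>main\<close>.\<close>
  have "\<exists>l<R. \<parallel>vpsup E y m\<parallel> \<le> 2 * \<parallel>vpsum E (v l) m\<parallel>"
  proof (rule ccontr)
    assume "\<not> ?thesis"
    then have lt: "\<parallel>vpsum E (v l) m\<parallel> < \<parallel>vpsup E y m\<parallel> / 2" if "l < R" for l using that by force
    have yV: "vpsup E y m \<in> V" "\<zero> \<preceq> vpsup E y m" using y by (auto intro!: vpsup_closed vpsup_nonneg)
    have "\<parallel>real (m * m) \<odot> vpsup E y m\<parallel> \<le> \<parallel>S\<parallel>"
      using main yV IV[OF SI] by (intro norm_le_positive le_scale) auto
    also have "\<dots> \<le> (\<Sum>l<R. \<parallel>vpsum E (v l) m\<parallel>)" unfolding S_def by (rule vpsum_norm_le) (rule IV[OF vsI])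
    also have "\<dots> < (\<Sum>l<R. \<parallel>vpsup E y m\<parallel> / 2)"
    proof (rule sum_strict_mono)
      have "0 \<in> {..<R}" using R1 by simp
      then show "{..<R} \<noteq> {}" by blast
    qed (use lt in auto)
    also have "\<dots> = real (m * m) * \<parallel>vpsup E y m\<parallel>" by (simp add: R_def)
    finally show False using yV by (simp add: norm_scale)
  qed
  then obtain l where l: "l < R" "\<parallel>vpsup E y m\<parallel> \<le> 2 * \<parallel>vpsum E (v l) m\<parallel>" by blast
  show thesis
  proof (rule that)
    show "disjoint_family m (v l)"
      using disj v_nonneg IV[OF vI] by (auto simp: disjoint_family_def)
  qed (use v_le l in auto)
qed

end

section \<open>Splitting off disjoint families inside a principal ideal\<close>

context normed_lattice_on
begin

text \<open>The failure of \<open>upper_estimate\<close>, witnessed within one principal ideal but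
  measured in the norm of the whole space. It is the property passed on to ever smaller ideals in
  the gliding hump.\<close>

definition unbounded_suprema :: "real \<Rightarrow> 'a \<Rightarrow> bool" where
  "unbounded_suprema r g \<longleftrightarrow> (\<forall>C. \<exists>k x. (\<forall>i<k. x i \<in> Idl g \<and> \<zero> \<preceq> x i) \<and>
     (\<Sum>i<k. \<parallel>x i\<parallel> powr r) \<le> 1 \<and> C < \<parallel>vpsup E x k\<parallel>)"

lemma Idl_trans:
  assumes g: "g \<in> V" "\<zero> \<preceq> g" and g': "g' \<in> Idl g" "\<zero> \<preceq> g'" and x: "x \<in> Idl g'"
  shows "x \<in> Idl g"
proof -
  have g'V: "g' \<in> V" using g' Idl_V[OF g] by simp
  obtain c where c: "(- c) \<odot> g' \<preceq> x" "x \<preceq> c \<odot> g'" using IdlE[OF g'V g'(2) x] by metis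
  have xV: "x \<in> V" using Idl_V[OF g'V g'(2) x] .
  obtain d where d: "(- d) \<odot> g \<preceq> c \<odot> g'" "c \<odot> g' \<preceq> d \<odot> g"
    using IdlE[OF g Idl_scale[OF g g'(1)]] by metis
  have "\<ominus> (d \<odot> g) \<preceq> \<ominus> (c \<odot> g')" using d g g'V neg_mono[of "d \<odot> g" "c \<odot> g'"] by simp
  then have "(- d) \<odot> g \<preceq> (- c) \<odot> g'" using g g'V by (simp add: vneg_def scale_scale)
  then show ?thesis using c d g g'V xV le_trans[of "(- d) \<odot> g" "(- c) \<odot> g'" x]
      le_trans[of x "c \<odot> g'" "d \<odot> g"] by (intro IdlI[OF g, of _ d d]) auto
qed

lemma disjoint_from_ideal:
  assumes g: "g \<in> V" "\<zero> \<preceq> g" and a: "a \<in> V" "\<zero> \<preceq> a" "a \<sqinter> g = \<zero>" and b: "b \<in> Idl g" "\<zero> \<preceq> b"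
  shows "a \<sqinter> b = \<zero>"
proof -
  obtain u where u: "u \<in> V" "\<zero> \<preceq> u" "a \<in> Idl u" "g \<in> Idl u" using ex_unit2[OF a(1) g(1)] by blast
  have bu: "b \<in> Idl u" by (rule Idl_trans[OF u(1,2,4) g(2) b(1)])
  obtain c where c: "c \<ge> 0" "b \<preceq> c \<odot> g" using IdlE[OF g b(1)] by metis
  show ?thesis
  proof (rule eq_by_lhom[OF u(1,2)])
    fix h assume h: "lhom u h"
    note hs = lhom_simps[OF u(1,2) h] and pos = lhom_nonneg[OF u(1,2) h]
    have 1: "min (h a) (h g) = 0" using arg_cong[OF a(3), of h] u by (simp add: hs)
    have 2: "h b \<le> c * h g"
      using lhom_mono[OF u(1,2) h bu _ c(2)] Idl_scale[OF u(1,2,4)] u by (simp add: hs)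
    have "h a = 0 \<or> h b = 0"
    proof (cases "h a = 0")
      case False
      then have "h g = 0" using 1 by linarith
      then show ?thesis using 2 pos[OF bu b(2)] by simp
    qed simp
    then show "h (a \<sqinter> b) = h \<zero>" using pos[OF bu b(2)] pos[OF u(3) a(2)] u bu by (auto simp: hs)
  qed (use u bu Idl_intros[OF u(1,2)] in auto)
qed

text \<open>A family with large supremum is made disjoint, and then all but one of its members are cut off
  slightly below; the families witnessing unboundedness can be split into parts living on the sets
  where all but one of the members are small.\<close>

lemma unbounded_suprema_split:
  assumes r: "1 \<le> r" and g: "g \<in> V" "\<zero> \<preceq> g" and ub: "unbounded_suprema r g"
  shows "\<exists>k x g'. disjoint_family k x \<and> (\<forall>i<k. x i \<in> Idl g) \<and> (\<Sum>i<k. \<parallel>x i\<parallel> powr r) \<le> 1 \<and>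
    C < \<parallel>vpsum E x k\<parallel> \<and> g' \<in> Idl g \<and> \<zero> \<preceq> g' \<and> (\<forall>i<k. x i \<sqinter> g' = \<zero>) \<and> unbounded_suprema r g'"
proof -
  note I = Idl_intros[OF g]
  have IV: "x \<in> V" if "x \<in> Idl g" for x using Idl_V[OF g that] .
  \<comment> \<open>Passing to a disjoint family and halving it cost a factor 2 each, which leaves
    more than \<open>\<bar>C\<bar> + 2\<close>. The 2 pays for the member that is dropped and for
    the cut at \<open>\<delta> \<odot> g\<close>.\<close>
  obtain k y where y: "\<And>i. i < k \<Longrightarrow> y i \<in> Idl g" "\<And>i. i < k \<Longrightarrow> \<zero> \<preceq> y i"
    and ysum: "(\<Sum>i<k. \<parallel>y i\<parallel> powr r) \<le> 1" and ybig: "4 * \<bar>C\<bar> + 8 < \<parallel>vpsup E y k\<parallel>"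
    using ub unfolding unbounded_suprema_def by blast
  have k1: "k \<ge> 1"
  proof (rule ccontr)
    assume "\<not> k \<ge> 1"
    then have "k = 0" by simp
    then show False using ybig by (simp add: norm_zero)
  qed
  obtain x0 where x0: "disjoint_family k x0" "\<And>j. j < k \<Longrightarrow> x0 j \<preceq> 2 \<odot> y j"
    "\<parallel>vpsup E y k\<parallel> \<le> 2 * \<parallel>vpsum E x0 k\<parallel>"
    using ex_disjoint_family[of k y] y k1 IV by blast
  have x0V: "x0 i \<in> V" "\<zero> \<preceq> x0 i" if "i < k" for i using x0(1) that by (auto simp: disjoint_family_def)
  have x0I: "x0 i \<in> Idl g" if i: "i < k" for i
    by (rule Idl_between[OF g, of _ "2 \<odot> y i"]) (use x0V x0(2) y(1) i I in auto)
  \<comment> \<open>Halving undoes the factor 2 in \<open>x0 j \<preceq> 2 \<odot> y j\<close>, so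
    that the sum of the powers of the norms stays at most 1.\<close>
  define x where "x i = (1 / 2) \<odot> x0 i" for i
  have xI: "x i \<in> Idl g" if "i < k" for i unfolding x_def by (intro I x0I that)
  have xV: "x i \<in> V" "\<zero> \<preceq> x i" if "i < k" for i using x0V[OF that] by (auto simp: x_def intro!: le_scale)
  have x_norm: "\<parallel>x i\<parallel> \<le> \<parallel>y i\<parallel>" if i: "i < k" for i
  proof -
    have "\<parallel>x0 i\<parallel> \<le> \<parallel>2 \<odot> y i\<parallel>" using x0V[OF i] x0(2)[OF i] IV[OF y(1)[OF i]] by (intro norm_le_positive) auto
    then show ?thesis using x0V[OF i] IV[OF y(1)[OF i]] by (simp add: x_def norm_scale)
  qed
  have xp: "\<parallel>x i\<parallel> powr r \<le> \<parallel>y i\<parallel> powr r" if "i < k" for i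
    using x_norm[OF that] xV[OF that] r norm_nonneg by (intro powr_mono2) auto
  have x1: "\<parallel>x i\<parallel> \<le> 1" if i: "i < k" for i
  proof -
    have "\<parallel>y i\<parallel> powr r \<le> (\<Sum>i<k. \<parallel>y i\<parallel> powr r)" by (rule member_le_sum) (use i in auto)
    then have "\<parallel>x i\<parallel> powr r \<le> 1" using xp[OF i] ysum by linarith
    then show ?thesis using r gr_one_powr[of "\<parallel>x i\<parallel>" r] by linarith
  qed
  have x_big: "\<bar>C\<bar> + 2 < \<parallel>vpsum E x k\<parallel>"
  proof -
    have s0: "vpsum E x0 k \<in> Idl g" and s: "vpsum E x k \<in> Idl g" by (intro I x0I xI; assumption)+
    have "vpsum E x k = (1 / 2) \<odot> vpsum E x0 k"
    proof (rule eq_by_lhom[OF g])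
      fix h assume h: "lhom g h"
      note hs = lhom_simps[OF g h]
      have "h (vpsum E x k) = (\<Sum>i<k. h (x i))" by (intro hs xI)
      also have "\<dots> = (\<Sum>i<k. 1 / 2 * h (x0 i))"
        by (intro sum.cong) (auto simp: x_def hs x0I)
      also have "\<dots> = h ((1 / 2) \<odot> vpsum E x0 k)"
        using s0 by (simp add: hs x0I sum_divide_distrib)
      finally show "h (vpsum E x k) = h ((1 / 2) \<odot> vpsum E x0 k)" .
    qed (use s s0 I in auto)
    then show ?thesis using x0(3) ybig IV[OF s0] by (simp add: norm_scale)
  qed
  \<comment> \<open>With this value, lowering all \<open>k\<close> members by
    \<open>\<delta> \<odot> g\<close> costs at most 1 in the norm of their sum.\<close>
  define \<delta> where "\<delta> = 1 / (real k * \<parallel>g\<parallel> + 1)"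
  have kg: "0 \<le> real k * \<parallel>g\<parallel>" using g norm_nonneg by simp
  then have \<delta>: "\<delta> > 0" "\<delta> * (real k * \<parallel>g\<parallel>) \<le> 1" by (auto simp: \<delta>_def divide_le_eq)
  define G where "G i = vpsum E (\<lambda>l. if l = i then \<zero> else x l) k" for i
  \<comment> \<open>The part of \<open>g\<close> living where the members other than
    \<open>x i\<close> are small. It is disjoint from the lowered members \<open>x' l\<close> with
    \<open>l \<noteq> i\<close>, and it agrees with \<open>\<delta> \<odot> g\<close> where all
    these members vanish.\<close>
  define gi where "gi i = (\<delta> \<odot> g \<ominus> G i) \<squnion> \<zero>" for i
  define x' where "x' l = (x l \<ominus> \<delta> \<odot> g) \<squnion> \<zero>" for l
  have GI: "G i \<in> Idl g" for i unfolding G_def by (rule I) (auto intro: xI I)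
  have giI: "gi i \<in> Idl g" for i unfolding gi_def by (intro I GI)
  have x'I: "x' l \<in> Idl g" if "l < k" for l unfolding x'_def by (intro I xI that)
  have gi0: "\<zero> \<preceq> gi i" for i using GI IV g by (simp add: gi_def vsup_ge2)
  have x'0: "\<zero> \<preceq> x' l" if "l < k" for l using xV[OF that] g by (simp add: x'_def vsup_ge2)
  have facts: "0 \<le> h (x l)" "h (x' l) = max (h (x l) - \<delta> * h g) 0"
    "h (G i) = (\<Sum>l<k. if l = i then 0 else h (x l))" "h (gi i) = max (\<delta> * h g - h (G i)) 0"
    "l' < k \<Longrightarrow> l' \<noteq> l \<Longrightarrow> h (x l) = 0 \<or> h (x l') = 0" "0 \<le> h g"
    if h: "lhom g h" and l: "l < k" for h l i l'
  proof -
    note hs = lhom_simps[OF g h] and pos = lhom_nonneg[OF g h]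
    show "0 \<le> h (x l)" using pos xI[OF l] xV[OF l] by simp
    show "0 \<le> h g" using pos[OF I(1) g(2)] .
    show "h (x' l) = max (h (x l) - \<delta> * h g) 0" unfolding x'_def using xI[OF l] by (simp add: hs I)
    have "h (G i) = (\<Sum>l<k. h (if l = i then \<zero> else x l))" unfolding G_def by (rule hs) (auto intro: xI I)
    then show "h (G i) = (\<Sum>l<k. if l = i then 0 else h (x l))" by (simp add: if_distrib[of h] hs cong: if_cong)
    show "h (gi i) = max (\<delta> * h g - h (G i)) 0" unfolding gi_def using GI by (simp add: hs I)
    show "h (x l) = 0 \<or> h (x l') = 0" if l': "l' < k" "l' \<noteq> l"
    proof -
      have "x0 l \<sqinter> x0 l' = \<zero>" using x0(1) l l' by (simp add: disjoint_family_def)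
      from arg_cong[OF this, of h] have "min (h (x0 l)) (h (x0 l')) = 0"
        using x0I l l' by (simp add: hs)
      then show ?thesis using x0I l l' by (auto simp: x_def hs min_def split: if_splits)
    qed
  qed
  have gi_disj: "x' l \<sqinter> gi i = \<zero>" if l: "l < k" "l \<noteq> i" for l i
  proof (rule eq_by_lhom[OF g])
    fix h assume h: "lhom g h"
    note hs = lhom_simps[OF g h]
    have "h (x l) \<le> h (G i)"
    proof -
      have "h (x l) = (if l = i then 0 else h (x l))" using l by simp
      also have "\<dots> \<le> (\<Sum>l<k. if l = i then 0 else h (x l))"
        by (rule member_le_sum) (use l facts(1)[OF h] in auto)
      finally show ?thesis using facts(3)[OF h l(1)] by simp
    qed
    then show "h (x' l \<sqinter> gi i) = h \<zero>"
      using facts(2,4)[OF h l(1)] x'I[OF l(1)] giI by (simp add: hs; linarith?)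
  qed (use x'I[OF l(1)] giI I in auto)
  have x'_disj: "x' l \<sqinter> x' l' = \<zero>" if l: "l < k" "l' < k" "l' \<noteq> l" for l l'
  proof (rule eq_by_lhom[OF g])
    fix h assume h: "lhom g h"
    note hs = lhom_simps[OF g h]
    have "0 \<le> \<delta> * h g" using \<delta> facts(6)[OF h l(1)] by simp
    then show "h (x' l \<sqinter> x' l') = h \<zero>"
      using facts(5)[OF h l] facts(2)[OF h l(1)] facts(2)[OF h l(2)] facts(1)[OF h l(1)]
        facts(1)[OF h l(2)] x'I[OF l(1)] x'I[OF l(2)] by (simp add: hs; linarith?)
  qed (use x'I[OF l(1)] x'I[OF l(2)] I in auto)
  \<comment> \<open>At each homomorphism at most one \<open>x i\<close> is nonzero, so some
    \<open>gi i\<close> is as large as \<open>\<delta> \<odot> g\<close>. Bounds for the suprema in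
    all the ideals of the \<open>gi i\<close> would therefore add up to a bound in the ideal of
    \<open>g\<close>.\<close>
  have "\<exists>i<k. unbounded_suprema r (gi i)"
  proof (rule ccontr)
    assume "\<not> ?thesis"
    then have "\<forall>i. \<exists>C. i < k \<longrightarrow> (\<forall>n Y. (\<forall>l<n. Y l \<in> Idl (gi i) \<and> \<zero> \<preceq> Y l) \<and> (\<Sum>l<n. \<parallel>Y l\<parallel> powr r) \<le> 1
        \<longrightarrow> \<parallel>vpsup E Y n\<parallel> \<le> C)"
      unfolding unbounded_suprema_def by (meson not_le)
    then obtain c where c: "\<And>i n Y. i < k \<Longrightarrow> (\<forall>l<n. Y l \<in> Idl (gi i) \<and> \<zero> \<preceq> Y l) \<and>
        (\<Sum>l<n. \<parallel>Y l\<parallel> powr r) \<le> 1 \<Longrightarrow> \<parallel>vpsup E Y n\<parallel> \<le> c i" by metis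
    obtain n Y where Y: "\<And>l. l < n \<Longrightarrow> Y l \<in> Idl g" "\<And>l. l < n \<Longrightarrow> \<zero> \<preceq> Y l"
      "(\<Sum>l<n. \<parallel>Y l\<parallel> powr r) \<le> 1" "(\<Sum>i<k. c i) < \<parallel>vpsup E Y n\<parallel>"
      using ub unfolding unbounded_suprema_def by blast
    have YV: "Y l \<in> V" if "l < n" for l using IV[OF Y(1)[OF that]] .
    have "\<forall>l. \<exists>d. l < n \<longrightarrow> d \<ge> 0 \<and> Y l \<preceq> d \<odot> g"
      using IdlE[OF g Y(1)] by metis
    then obtain d where d: "\<And>l. l < n \<Longrightarrow> d l \<ge> 0" "\<And>l. l < n \<Longrightarrow> Y l \<preceq> d l \<odot> g" by metis
    \<comment> \<open>Where \<open>G i\<close> vanishes,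
      \<open>(d l / \<delta>) \<odot> gi i\<close> equals \<open>d l \<odot> g\<close> and lies
      above \<open>Y l\<close>, so that nothing is cut off there.\<close>
    define Z where "Z i l = Y l \<sqinter> (d l / \<delta>) \<odot> gi i" for i l
    have giV: "gi i \<in> V" for i using IV[OF giI] .
    have Z0: "\<zero> \<preceq> Z i l" if "l < n" for i l
      unfolding Z_def using YV[OF that] Y(2)[OF that] giV gi0 d(1)[OF that] \<delta> by (intro vinf_greatest le_scale) auto
    have ZV: "Z i l \<in> V" if "l < n" for i l using YV[OF that] giV by (simp add: Z_def)
    have ZI': "Z i l \<in> Idl g" if "l < n" for i l unfolding Z_def by (intro I Y(1) giI that)
    have ZI: "Z i l \<in> Idl (gi i)" if l: "l < n" for i l
      by (rule Idl_between[OF giV gi0, of _ "(d l / \<delta>) \<odot> gi i"])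
        (use l ZV Z0 YV giV Idl_intros(1,5)[OF giV gi0] in \<open>auto simp: Z_def vinf_le2\<close>)
    have Zn: "\<parallel>Z i l\<parallel> \<le> \<parallel>Y l\<parallel>" if l: "l < n" for i l
      using ZV[OF l] Z0[OF l] YV[OF l] giV by (intro norm_le_positive) (auto simp: Z_def vinf_le1)
    have Zc: "\<parallel>vpsup E (Z i) n\<parallel> \<le> c i" if i: "i < k" for i
    proof (rule c[OF i], intro conjI allI impI)
      have "(\<Sum>l<n. \<parallel>Z i l\<parallel> powr r) \<le> (\<Sum>l<n. \<parallel>Y l\<parallel> powr r)"
        using Zn ZV norm_nonneg r by (intro sum_mono powr_mono2) auto
      then show "(\<Sum>l<n. \<parallel>Z i l\<parallel> powr r) \<le> 1" using Y(3) by linarith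
    qed (use ZI Z0 in auto)
    have ZsI: "vpsup E (Z i) n \<in> Idl g" for i by (intro I ZI')
    have YsI: "vpsup E Y n \<in> Idl g" by (intro I Y(1))
    have "vpsup E Y n \<preceq> vpsum E (\<lambda>i. vpsup E (Z i) n) k"
    proof (rule vpsup_least)
      fix l assume l: "l < n"
      have "Y l \<preceq> vpsum E (\<lambda>i. vpsup E (Z i) n) k"
      proof (rule le_by_lhom[OF g])
        fix h assume h: "lhom g h"
        note hs = lhom_simps[OF g h] and pos = lhom_nonneg[OF g h]
        have hZs: "0 \<le> h (vpsup E (Z i) n)" for i
          by (rule pos[OF ZsI]) (use ZV in \<open>auto intro: vpsup_nonneg\<close>)
        obtain i where i: "i < k" "h (G i) = 0"
        proof (cases "\<exists>i<k. h (x i) \<noteq> 0")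
          case True
          then obtain i where i: "i < k" "h (x i) \<noteq> 0" by blast
          have "h (x l) = 0" if "l < k" "l \<noteq> i" for l using facts(5)[OF h i(1) that] i by simp
          then have "h (G i) = 0" using facts(3)[OF h i(1), of i] by (auto intro: sum.neutral)
          with i that show thesis by blast
        next
          case False
          then have "h (G 0) = 0" using facts(3)[OF h, of 0 0] k1 by (auto intro: sum.neutral)
          with k1 that[of 0] show thesis by simp
        qed
        have hg: "0 \<le> h g" using facts(6)[OF h i(1)] .
        have "h (gi i) = \<delta> * h g" using facts(4)[OF h i(1), of i] i \<delta> hg by simp
        moreover have "h (Y l) \<le> d l * h g"
          using lhom_mono[OF g h Y(1)[OF l] _ d(2)[OF l]] by (simp add: I hs)
        ultimately have "h (Z i l) = h (Y l)"
          unfolding Z_def using Y(1)[OF l] giI \<delta> by (simp add: hs I)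
        moreover have "h (Z i l) \<le> h (vpsup E (Z i) n)"
          using vpsup_ge[of n "Z i" l] ZV l by (intro lhom_mono[OF g h] ZI' ZsI) auto
        moreover have "h (vpsup E (Z i) n) \<le> (\<Sum>i<k. h (vpsup E (Z i) n))"
          by (rule member_le_sum) (use i hZs in auto)
        ultimately show "h (Y l) \<le> h (vpsum E (\<lambda>i. vpsup E (Z i) n) k)"
          by (simp add: hs ZsI)
      qed (use Y(1)[OF l] ZsI I in auto)
      then show "Y l \<in> V \<and> Y l \<preceq> vpsum E (\<lambda>i. vpsup E (Z i) n) k" using YV[OF l] by simp
    next
      show "vpsum E (\<lambda>i. vpsup E (Z i) n) k \<in> V" by (rule vpsum_closed) (rule IV[OF ZsI])
      show "\<zero> \<preceq> vpsum E (\<lambda>i. vpsup E (Z i) n) k"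
        using ZV by (intro vpsum_nonneg) (auto intro: vpsup_closed vpsup_nonneg)
    qed
    then have "\<parallel>vpsup E Y n\<parallel> \<le> \<parallel>vpsum E (\<lambda>i. vpsup E (Z i) n) k\<parallel>"
      using YV IV[OF ZsI] by (intro norm_le_positive) (auto intro: vpsup_closed vpsup_nonneg vpsum_closed)
    also have "\<dots> \<le> (\<Sum>i<k. \<parallel>vpsup E (Z i) n\<parallel>)" by (rule vpsum_norm_le) (rule IV[OF ZsI])
    also have "\<dots> \<le> (\<Sum>i<k. c i)" using Zc by (intro sum_mono) auto
    finally show False using Y(4) by simp
  qed
  then obtain i where i: "i < k" "unbounded_suprema r (gi i)" by blast
  \<comment> \<open>\<open>x' i\<close> need not be disjoint from \<open>gi i\<close> and is
    dropped.\<close>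
  define x'' where "x'' l = (if l = i then \<zero> else x' l)" for l
  have x''I: "x'' l \<in> Idl g" if "l < k" for l using x'I[OF that] I by (simp add: x''_def)
  have x''n: "\<parallel>x'' l\<parallel> \<le> \<parallel>x l\<parallel>" if l: "l < k" for l
  proof (cases "l = i")
    case False
    have "x l \<ominus> \<delta> \<odot> g \<preceq> x l"
    proof -
      have "x l \<ominus> (x l \<ominus> \<delta> \<odot> g) = \<delta> \<odot> g" using xV[OF l] g by (intro lin_eqI) (auto simp: lin_simps)
      then show ?thesis using xV[OF l] g \<delta> le_iff_diff[of "x l \<ominus> \<delta> \<odot> g" "x l"] le_scale[of g \<delta>] by simp
    qed
    then have "x' l \<preceq> x l" unfolding x'_def using xV[OF l] g by (intro vsup_least) auto
    then show ?thesis using False x'0[OF l] xV[OF l] IV[OF x'I[OF l]]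
      by (simp add: x''_def norm_le_positive)
  qed (use xV[OF l] norm_nonneg in \<open>simp add: x''_def norm_zero\<close>)
  have "C < \<parallel>vpsum E x'' k\<parallel>"
  proof -
    have s: "vpsum E x k \<in> Idl g" "vpsum E x'' k \<in> Idl g" by (intro I xI x''I; assumption)+
    define R where "R = vpsum E x'' k \<oplus> (x i \<oplus> (real k * \<delta>) \<odot> g)"
    have RI: "R \<in> Idl g" unfolding R_def by (intro I s xI i)
    have "vpsum E x k \<preceq> R"
    proof (rule le_by_lhom[OF g])
      fix h assume h: "lhom g h"
      note hs = lhom_simps[OF g h]
      have "h (x l) \<le> h (x'' l) + (if l = i then h (x i) else 0) + \<delta> * h g" if l: "l < k" for l
        using facts(2,6)[OF h l] \<delta> by (auto simp: x''_def hs)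
      then have "(\<Sum>l<k. h (x l)) \<le> (\<Sum>l<k. h (x'' l) + (if l = i then h (x i) else 0) + \<delta> * h g)"
        by (intro sum_mono) auto
      also have "\<dots> = (\<Sum>l<k. h (x'' l)) + h (x i) + real k * \<delta> * h g"
        using i by (simp add: sum.distrib)
      also have "\<dots> = h R" unfolding R_def using s xI[OF i(1)] by (simp add: hs I x''I)
      finally show "h (vpsum E x k) \<le> h R" by (simp add: hs xI)
    qed (use s RI in auto)
    then have "\<parallel>vpsum E x k\<parallel> \<le> \<parallel>R\<parallel>"
      using IV[OF s(1)] IV[OF RI] xV by (intro norm_le_positive vpsum_nonneg) auto
    also have "\<dots> \<le> \<parallel>vpsum E x'' k\<parallel> + (\<parallel>x i\<parallel> + \<parallel>(real k * \<delta>) \<odot> g\<parallel>)"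
      unfolding R_def using IV[OF s(2)] xV[OF i(1)] g
      by (intro order_trans[OF norm_triangle] add_left_mono norm_triangle) auto
    also have "\<parallel>(real k * \<delta>) \<odot> g\<parallel> \<le> 1" using \<delta> g by (simp add: norm_scale mult_ac)
    finally show ?thesis using x1[OF i(1)] x_big by linarith
  qed
  moreover have "(\<Sum>l<k. \<parallel>x'' l\<parallel> powr r) \<le> 1"
  proof -
    have "(\<Sum>l<k. \<parallel>x'' l\<parallel> powr r) \<le> (\<Sum>l<k. \<parallel>y l\<parallel> powr r)"
    proof (rule sum_mono)
      fix l assume "l \<in> {..<k}"
      then have l: "l < k" by simp
      have "\<parallel>x'' l\<parallel> powr r \<le> \<parallel>x l\<parallel> powr r"
        using x''n[OF l] r IV[OF x''I[OF l]] norm_nonneg by (intro powr_mono2) auto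
      then show "\<parallel>x'' l\<parallel> powr r \<le> \<parallel>y l\<parallel> powr r" using xp[OF l] by linarith
    qed
    then show ?thesis using ysum by linarith
  qed
  moreover have zd: "\<zero> \<sqinter> a = \<zero>" "a \<sqinter> \<zero> = \<zero>" if "a \<in> V" "\<zero> \<preceq> a" for a
    using that vinf_le1[of \<zero> a] vinf_greatest[of \<zero> a \<zero>] vinf_le2[of a \<zero>] vinf_greatest[of a \<zero> \<zero>] le_refl[of \<zero>]
    by (auto intro!: le_antisym)
  moreover have "disjoint_family k x''"
    unfolding disjoint_family_def using IV[OF x'I] x'0 x'_disj zd by (auto simp: x''_def le_refl)
  moreover have "x'' l \<sqinter> gi i = \<zero>" if "l < k" for l
    using gi_disj[of l i] that zd IV[OF giI] gi0 by (auto simp: x''_def)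
  ultimately show ?thesis using x''I giI gi0 i(2) by blast
qed

end

lemma lp_composition_propertyD:
  assumes "lp_composition_property p E"
    and "\<And>k. x k \<in> vcarrier E" "\<And>k. vle E (vzero E) (x k)"
    and "\<And>j k. j \<noteq> k \<Longrightarrow> vdisjoint E (x j) (x k)"
    and "in_lp p (\<lambda>k. vnorm E (x k))"
  shows "bdd_above (range (\<lambda>k. vnorm E (vpsum E x k)))"
  using assms(1)[unfolded lp_composition_property_def, THEN spec[of _ x]] assms(2-) by simp

context normed_lattice_on
begin

lemma vinf_commute: "x \<in> V \<Longrightarrow> y \<in> V \<Longrightarrow> x \<sqinter> y = y \<sqinter> x"
  by (intro le_antisym vinf_greatest) (auto intro: vinf_le1 vinf_le2)

lemma scale_disjoint:
  assumes a: "a \<in> V" "\<zero> \<preceq> a" and b: "b \<in> V" "\<zero> \<preceq> b" and ab: "a \<sqinter> b = \<zero>" and c: "0 \<le> c" "0 \<le> d"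
  shows "(c \<odot> a) \<sqinter> (d \<odot> b) = \<zero>"
proof -
  have dI: "d \<odot> b \<in> Idl b" by (intro Idl_intros b)
  have cI: "c \<odot> a \<in> Idl a" by (intro Idl_intros a)
  have d0: "\<zero> \<preceq> d \<odot> b" "\<zero> \<preceq> c \<odot> a" using a b c by (auto intro: le_scale)
  have "a \<sqinter> (d \<odot> b) = \<zero>" by (rule disjoint_from_ideal[OF b a ab dI d0(1)])
  then have "(d \<odot> b) \<sqinter> a = \<zero>" using a b by (simp add: vinf_commute)
  then have "(d \<odot> b) \<sqinter> (c \<odot> a) = \<zero>" using a b d0 by (intro disjoint_from_ideal[OF a _ _ _ cI]) auto
  then show ?thesis using a b by (simp add: vinf_commute)
qed

lemma vinf_zero: "a \<in> V \<Longrightarrow> \<zero> \<preceq> a \<Longrightarrow> \<zero> \<sqinter> a = \<zero>" "a \<in> V \<Longrightarrow> \<zero> \<preceq> a \<Longrightarrow> a \<sqinter> \<zero> = \<zero>"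
  using vinf_le1[of \<zero> a] vinf_greatest[of \<zero> a \<zero>] vinf_le2[of a \<zero>] vinf_greatest[of a \<zero> \<zero>] le_refl[of \<zero>]
  by (auto intro!: le_antisym)

text \<open>The positive cone is closed: the positive part of \<open>y \<ominus> w\<close> is
  dominated by the modulus of \<open>S k \<ominus> w\<close>, whose norm tends to zero.\<close>

lemma le_limit:
  assumes y: "y \<in> V" and w: "w \<in> V" and S: "\<And>k. S k \<in> V" and lim: "(\<lambda>k. \<parallel>S k \<ominus> w\<parallel>) \<longlonglongrightarrow> 0"
    and le: "\<And>k. k \<ge> k0 \<Longrightarrow> y \<preceq> S k"
  shows "y \<preceq> w"
proof -
  define z where "z = (y \<ominus> w) \<squnion> \<zero>"
  have z: "z \<in> V" "\<zero> \<preceq> z" using y w by (auto simp: z_def vsup_ge2)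
  have "\<parallel>z\<parallel> \<le> \<parallel>S k \<ominus> w\<parallel>" if k: "k \<ge> k0" for k
  proof -
    have "y \<ominus> w \<preceq> S k \<ominus> w" using le[OF k] y w S by (intro le_add) auto
    moreover have "S k \<ominus> w \<preceq> \<bar>S k \<ominus> w\<bar>\<^sub>E" using S w by (simp add: le_vabs)
    ultimately have "y \<ominus> w \<preceq> \<bar>S k \<ominus> w\<bar>\<^sub>E" using le_trans[of "y \<ominus> w" "S k \<ominus> w"] S y w by simp
    then have "z \<preceq> \<bar>S k \<ominus> w\<bar>\<^sub>E" unfolding z_def using S y w by (intro vsup_least) (auto simp: vabs_nonneg)
    then have "\<parallel>z\<parallel> \<le> \<parallel>\<bar>S k \<ominus> w\<bar>\<^sub>E\<parallel>" using z S w by (intro norm_le_positive) auto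
    then show ?thesis using S w by (simp add: norm_vabs)
  qed
  then have "\<parallel>z\<parallel> \<le> 0"
    by (intro LIMSEQ_le_const[OF lim]) auto
  then have "z = \<zero>" using z norm_nonneg[of z] norm_eq_zero[of z] by simp
  then have "y \<ominus> w \<preceq> \<zero>" using vsup_ge1[of "y \<ominus> w" \<zero>] y w by (simp add: z_def)
  moreover have "\<zero> \<ominus> (y \<ominus> w) = w \<ominus> y" using y w by (intro lin_eqI) (auto simp: lin_simps)
  ultimately show ?thesis using y w le_iff_diff[of "y \<ominus> w" \<zero>] le_iff_diff[of y w] by simp
qed

end

context banach_lattice_on
begin

text \<open>The series of the vectors \<open>(1 / 2 ^ j) \<odot> x j\<close> converges absolutely,
  hence in norm by completeness, and its sum dominates each of its positive terms.\<close>

lemma ex_geometric_upper_bound: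
  assumes x: "\<And>j::nat. x j \<in> V" "\<And>j. \<zero> \<preceq> x j" "\<And>j. \<parallel>x j\<parallel> \<le> 1"
  shows "\<exists>w\<in>V. \<zero> \<preceq> w \<and> (\<forall>j. (1 / 2 ^ j) \<odot> x j \<preceq> w)"
proof -
  interpret M: Metric_space V "vdist E" by (rule Metric_space_vdist)
  define S where "S k = vpsum E (\<lambda>j. (1 / 2 ^ j) \<odot> x j) k" for k
  have SV: "S k \<in> V" for k unfolding S_def using x by (intro vpsum_closed) auto
  have S_Suc: "S (Suc k) = S k \<oplus> (1 / 2 ^ k) \<odot> x k" for k by (simp add: S_def)
  have diff: "\<parallel>S (k + i) \<ominus> S k\<parallel> \<le> (1 / 2) ^ k * (2 - 2 * (1 / 2) ^ i)" for k i
  proof (induction i)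
    case 0 then show ?case using SV by (simp add: add_neg norm_zero)
  next
    case (Suc i)
    have "S (k + Suc i) \<ominus> S k = (S (k + i) \<ominus> S k) \<oplus> (1 / 2 ^ (k + i)) \<odot> x (k + i)"
      using SV x by (intro lin_eqI) (auto simp: lin_simps S_Suc)
    then have "\<parallel>S (k + Suc i) \<ominus> S k\<parallel> \<le> \<parallel>S (k + i) \<ominus> S k\<parallel> + \<parallel>(1 / 2 ^ (k + i)) \<odot> x (k + i)\<parallel>"
      using SV x by (simp add: norm_triangle)
    also have "\<parallel>(1 / 2 ^ (k + i)) \<odot> x (k + i)\<parallel> \<le> (1 / 2) ^ (k + i)"
      using x by (simp add: norm_scale power_one_over divide_right_mono)
    finally show ?case using Suc by (simp add: power_add algebra_simps)
  qed
  have diff2: "\<parallel>S (k + i) \<ominus> S k\<parallel> \<le> 2 * (1 / 2) ^ k" for k i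
  proof -
    have "(1 / 2) ^ k * (2 - 2 * (1 / 2) ^ i) \<le> (1 / 2) ^ k * (2::real)" by (intro mult_left_mono) auto
    then show ?thesis using diff[of k i] by linarith
  qed
  have "M.MCauchy S" unfolding M.MCauchy_def
  proof (intro conjI allI impI)
    show "range S \<subseteq> V" using SV by auto
    fix e :: real assume e: "e > 0"
    obtain n0 where n0: "(1 / 2) ^ n0 < e / 4" using real_arch_pow_inv[of "e / 4" "1 / 2"] e by auto
    have "vdist E (S n) (S n') < e" if "n0 \<le> n" "n0 \<le> n'" for n n'
    proof -
      have "\<parallel>S n \<ominus> S n'\<parallel> \<le> \<parallel>S n \<ominus> S n0\<parallel> + \<parallel>S n0 \<ominus> S n'\<parallel>" using SV by (simp add: norm_sub_triangle)
      also have "\<parallel>S n0 \<ominus> S n'\<parallel> = \<parallel>S n' \<ominus> S n0\<parallel>" using SV by (simp add: norm_sub_commute)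
      finally have "\<parallel>S n \<ominus> S n'\<parallel> \<le> 2 * (1 / 2) ^ n0 + 2 * (1 / 2) ^ n0"
        using diff2[of n0 "n - n0"] diff2[of n0 "n' - n0"] that by simp
      then show ?thesis using n0 SV by (simp add: vdist_def)
    qed
    then show "\<exists>n0. \<forall>n n'. n0 \<le> n \<longrightarrow> n0 \<le> n' \<longrightarrow> vdist E (S n) (S n') < e" by blast
  qed
  then obtain w where w: "limitin M.mtopology S w sequentially"
    using complete by (auto simp: M.mcomplete_def)
  then have wV: "w \<in> V" by (auto simp: limitin_def)
  have lim: "(\<lambda>k. \<parallel>S k \<ominus> w\<parallel>) \<longlonglongrightarrow> 0" using w limitin_vdist[of S w] SV wV by auto
  have S0: "\<zero> \<preceq> S k" for k unfolding S_def using x by (intro vpsum_nonneg) (auto intro: le_scale)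
  have S_ge: "(1 / 2 ^ j) \<odot> x j \<preceq> S k" if "k \<ge> Suc j" for j k
    using that
  proof (induction k rule: dec_induct)
    case base
    have "\<zero> \<oplus> (1 / 2 ^ j) \<odot> x j \<preceq> S j \<oplus> (1 / 2 ^ j) \<odot> x j" using S0 SV x by (intro le_add) auto
    then show ?case using x by (simp add: S_Suc add_zero)
  next
    case (step k)
    have "S k \<oplus> \<zero> \<preceq> S k \<oplus> (1 / 2 ^ k) \<odot> x k" using SV x by (intro add_mono le_refl) (auto intro: le_scale)
    then have "S k \<preceq> S (Suc k)" using SV by (simp add: S_Suc add_zero_right)
    then show ?case using step le_trans[of "(1 / 2 ^ j) \<odot> x j" "S k" "S (Suc k)"] SV x by simp
  qed
  show ?thesis
  proof (intro bexI conjI allI)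
    show "\<zero> \<preceq> w" by (rule le_limit[OF _ wV SV lim]) (use S0 in auto)
    show "(1 / 2 ^ j) \<odot> x j \<preceq> w" for j by (rule le_limit[OF _ wV SV lim S_ge]) (use x in auto)
  qed (rule wV)
qed

text \<open>Along a decreasing sequence of ideals, \<open>unbounded_suprema_split\<close> separates
  one disjoint family after another, the \<open>n\<close>-th with a sum of norm above
  \<open>4 ^ n\<close>. Scaled by \<open>1 / 2 ^ n\<close>, the families together satisfy the
  summability condition of the composition property, while their sums have norms above
  \<open>2 ^ n\<close>.\<close>

theorem upper_estimate_if_composition:
  assumes comp: "lp_composition_property (ereal r) E" and r: "1 \<le> r"
  shows "upper_estimate r E"
proof (rule ccontr)
  assume "\<not> upper_estimate r E"
  then have "\<forall>C. \<exists>k x. (\<forall>i<k. x i \<in> V \<and> \<zero> \<preceq> x i) \<and> (\<Sum>i<k. \<parallel>x i\<parallel> powr r) \<le> 1 \<and> C < \<parallel>vpsup E x k\<parallel>"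
    unfolding upper_estimate_def by (meson not_le)
  then have "\<forall>n::nat. \<exists>k x. (\<forall>i<k. x i \<in> V \<and> \<zero> \<preceq> x i) \<and> (\<Sum>i<k. \<parallel>x i\<parallel> powr r) \<le> 1 \<and> real n < \<parallel>vpsup E x k\<parallel>"
    by blast
  then obtain kf xf where f: "\<And>n::nat. \<forall>i<kf n. xf n i \<in> V \<and> \<zero> \<preceq> xf n i"
    "\<And>n. (\<Sum>i<kf n. \<parallel>xf n i\<parallel> powr r) \<le> 1" "\<And>n. real n < \<parallel>vpsup E (xf n) (kf n)\<parallel>" by metis
  define s where "s n = vpsup E (xf n) (kf n)" for n
  have sV: "s n \<in> V" "\<zero> \<preceq> s n" for n unfolding s_def using f(1) by (auto intro: vpsup_closed vpsup_nonneg)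
  define cs where "cs n = 1 / (\<parallel>s n\<parallel> + 1)" for n
  have cs: "cs n > 0" "cs n * \<parallel>s n\<parallel> \<le> 1" for n
    using norm_nonneg[OF sV(1)[of n]] by (auto simp: cs_def divide_le_eq)
  \<comment> \<open>A common unit for all the families: positive multiples of their suprema of norm
    at most 1 are, up to powers of 2, dominated by one vector.\<close>
  obtain w where w: "w \<in> V" "\<zero> \<preceq> w" "\<And>n. (1 / 2 ^ n) \<odot> (cs n \<odot> s n) \<preceq> w"
  proof -
    have "cs n \<odot> s n \<in> V" "\<zero> \<preceq> cs n \<odot> s n" "\<parallel>cs n \<odot> s n\<parallel> \<le> 1" for n
      using sV[of n] cs[of n] by (auto simp: norm_scale intro: le_scale)
    from ex_geometric_upper_bound[of "\<lambda>n. cs n \<odot> s n", OF this] show thesis using that by blast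
  qed
  have sI: "s n \<in> Idl w" for n
  proof -
    define c where "c = 1 / 2 ^ n * cs n"
    have c: "c > 0" using cs by (simp add: c_def)
    have "c \<odot> s n \<preceq> w" using w(3)[of n] sV by (simp add: c_def scale_scale)
    then have "c \<odot> s n \<in> Idl w"
      using sV c w by (intro Idl_between[OF w(1,2) _ Idl_unit[OF w(1,2)]] le_scale) auto
    then have "(1 / c) \<odot> (c \<odot> s n) \<in> Idl w" by (rule Idl_scale[OF w(1,2)])
    then show ?thesis using c sV by (simp add: scale_scale scale_one)
  qed
  have xfI: "xf n i \<in> Idl w" if "i < kf n" for n i
    using f(1) that vpsup_ge[of "kf n" "xf n" i] by (intro Idl_between[OF w(1,2) _ sI[of n]]) (auto simp: s_def)
  have ubw: "unbounded_suprema r w" unfolding unbounded_suprema_def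
  proof
    fix C :: real
    obtain n :: nat where "C \<le> real n" using real_arch_simple by blast
    then show "\<exists>k x. (\<forall>i<k. x i \<in> Idl w \<and> \<zero> \<preceq> x i) \<and> (\<Sum>i<k. \<parallel>x i\<parallel> powr r) \<le> 1 \<and> C < \<parallel>vpsup E x k\<parallel>"
      using f[of n] xfI by (intro exI[of _ "kf n"] exI[of _ "xf n"]) auto
  qed
  have wVp: "g \<in> V" if "g \<in> Idl w" for g using Idl_V[OF w(1,2) that] .
  define Q where "Q n g g' k x \<longleftrightarrow> disjoint_family k x \<and> (\<forall>i<k. x i \<in> Idl g) \<and> (\<Sum>i<k. \<parallel>x i\<parallel> powr r) \<le> 1 \<and>
    4 ^ n < \<parallel>vpsum E x k\<parallel> \<and> g' \<in> Idl g \<and> (\<forall>i<k. x i \<sqinter> g' = \<zero>)" for n :: nat and g g' k x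
  \<comment> \<open>Dependent choice, because each ideal is found only inside the preceding
    one.\<close>
  have "\<exists>G. \<forall>n. (G n \<in> Idl w \<and> \<zero> \<preceq> G n \<and> unbounded_suprema r (G n)) \<and> (\<exists>k x. Q n (G n) (G (Suc n)) k x)"
  proof (rule dependent_nat_choice)
    show "\<exists>g. g \<in> Idl w \<and> \<zero> \<preceq> g \<and> unbounded_suprema r g" using Idl_unit[OF w(1,2)] w ubw by blast
    fix g n assume g: "g \<in> Idl w \<and> \<zero> \<preceq> g \<and> unbounded_suprema r g"
    then have gV: "g \<in> V" "\<zero> \<preceq> g" using wVp by auto
    from unbounded_suprema_split[OF r gV, of "4 ^ n"] g obtain k x g' where
      g': "Q n g g' k x" "\<zero> \<preceq> g'" "unbounded_suprema r g'" "g' \<in> Idl g" unfolding Q_def by blast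
    have "g' \<in> Idl w" by (rule Idl_trans[OF w(1,2) _ _ g'(4)]) (use g in auto)
    with g' show "\<exists>g'. (g' \<in> Idl w \<and> \<zero> \<preceq> g' \<and> unbounded_suprema r g') \<and> (\<exists>k x. Q n g g' k x)"
      by blast
  qed
  then obtain G where G: "\<And>n. G n \<in> Idl w" "\<And>n. \<zero> \<preceq> G n" "\<And>n. \<exists>k x. Q n (G n) (G (Suc n)) k x" by blast
  then obtain k x where Q: "\<And>n. Q n (G n) (G (Suc n)) (k n) (x n)" by metis
  have GV: "G n \<in> V" for n using wVp[OF G(1)] .
  have Gdec: "a \<in> Idl (G n)" if "n \<le> n'" "a \<in> Idl (G n')" for n n' a
    using that
  proof (induction n' arbitrary: a rule: dec_induct)
    case (step n')
    have *: "G (Suc n') \<in> Idl (G n')" using Q[of n'] by (simp add: Q_def)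
    have "a \<in> Idl (G n')" by (rule Idl_trans[OF GV G(2) * G(2) step.prems])
    then show ?case by (rule step.IH)
  qed
  have xG: "x n i \<in> Idl (G n)" and x0: "\<zero> \<preceq> x n i" if "i < k n" for n i
    using Q[of n] that by (auto simp: Q_def disjoint_family_def)
  have xI: "x n i \<in> Idl w" if "i < k n" for n i
    by (rule Idl_trans[OF w(1,2) G(1,2) xG[OF that]])
  have xV: "x n i \<in> V" if "i < k n" for n i using wVp[OF xI[OF that]] .
  have disj_lt: "x n i \<sqinter> x n' i' = \<zero>" if "i < k n" "i' < k n'" "n < n'" for n i n' i'
  proof (rule disjoint_from_ideal[OF GV[of "Suc n"] G(2)])
    show "x n i \<sqinter> G (Suc n) = \<zero>" using Q[of n] that by (simp add: Q_def)
    show "x n' i' \<in> Idl (G (Suc n))" using Gdec[of "Suc n" n'] xG that by simp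
  qed (use that xV x0 in auto)
  have disj: "x n i \<sqinter> x n' i' = \<zero>" if "i < k n" "i' < k n'" "(n, i) \<noteq> (n', i')" for n i n' i'
  proof (cases n n' rule: linorder_cases)
    case equal
    then show ?thesis using Q[of n] that by (auto simp: Q_def disjoint_family_def)
  next
    case greater
    then show ?thesis using disj_lt[of i' n' i n] that xV by (simp add: vinf_commute)
  qed (use disj_lt that in auto)
  \<comment> \<open>All families in one sequence, by the pairing of natural numbers. Codes without a
    member get \<open>\<zero>\<close>, which is disjoint from every positive vector and changes
    neither norms nor sums.\<close>
  define X where "X j = (let (n, i) = prod_decode j in if i < k n then (1 / 2 ^ n) \<odot> x n i else \<zero>)" for j
  have Xv: "X j = (1 / 2 ^ fst (prod_decode j)) \<odot> x (fst (prod_decode j)) (snd (prod_decode j))"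
    if "snd (prod_decode j) < k (fst (prod_decode j))" for j
    using that by (cases "prod_decode j") (simp add: X_def)
  have Xz: "X j = \<zero>" if "\<not> snd (prod_decode j) < k (fst (prod_decode j))" for j
    using that by (cases "prod_decode j") (simp add: X_def)
  have XI: "X j \<in> Idl w" for j
    using Xv[of j] Xz[of j] xI Idl_intros[OF w(1,2)] by (cases "snd (prod_decode j) < k (fst (prod_decode j))") auto
  have XV: "X j \<in> V" for j using wVp[OF XI] .
  have X0: "\<zero> \<preceq> X j" for j
    using Xv[of j] Xz[of j] xV x0 by (cases "snd (prod_decode j) < k (fst (prod_decode j))") (auto intro: le_scale le_refl)
  have Xdisj: "vdisjoint E (X j) (X j')" if "j \<noteq> j'" for j j'
  proof -
    have "X j \<sqinter> X j' = \<zero>"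
    proof (cases "snd (prod_decode j) < k (fst (prod_decode j)) \<and> snd (prod_decode j') < k (fst (prod_decode j'))")
      case True
      have "prod_decode j \<noteq> prod_decode j'" using that by (metis prod_decode_inverse)
      then have "x (fst (prod_decode j)) (snd (prod_decode j)) \<sqinter> x (fst (prod_decode j')) (snd (prod_decode j')) = \<zero>"
        using True by (intro disj) auto
      then show ?thesis using True xV x0 by (simp add: Xv scale_disjoint)
    next
      case False
      then have "X j = \<zero> \<or> X j' = \<zero>" using Xz[of j] Xz[of j'] by blast
      then show ?thesis
        using vinf_zero(1)[OF XV[of j'] X0[of j']] vinf_zero(2)[OF XV[of j] X0[of j]] by auto
    qed
    then show ?thesis using XV X0 by (simp add: vdisjoint_def vabs_of_nonneg)
  qed
  have Xsum: "(\<Sum>j<K. \<parallel>X j\<parallel> powr r) \<le> 2" for K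
  proof -
    define A where "A = {j\<in>{..<K}. snd (prod_decode j) < k (fst (prod_decode j))}"
    have "(\<Sum>j<K. \<parallel>X j\<parallel> powr r) = (\<Sum>j\<in>A. \<parallel>X j\<parallel> powr r)"
      unfolding A_def using Xz r by (intro sum.mono_neutral_right) (auto simp: norm_zero)
    also have "\<dots> = (\<Sum>j\<in>A. case prod_decode j of (n, i) \<Rightarrow> \<parallel>(1 / 2 ^ n) \<odot> x n i\<parallel> powr r)"
      by (rule sum.cong) (auto simp: A_def Xv split: prod.splits)
    also have "\<dots> = (\<Sum>(n, i)\<in>prod_decode ` A. \<parallel>(1 / 2 ^ n) \<odot> x n i\<parallel> powr r)"
      by (subst sum.reindex) (auto simp: inj_prod_decode o_def inj_on_subset)
    also have "\<dots> \<le> (\<Sum>(n, i)\<in>Sigma {..<K} (\<lambda>n. {..<k n}). \<parallel>(1 / 2 ^ n) \<odot> x n i\<parallel> powr r)"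
    proof (rule sum_mono2)
      \<comment> \<open>The first component of a pair is at most its code, so codes below
        \<open>K\<close> involve only the families with index below \<open>K\<close>.\<close>
      show "prod_decode ` A \<subseteq> Sigma {..<K} (\<lambda>n. {..<k n})"
      proof safe
        fix n i j assume j: "(n, i) = prod_decode j" "j \<in> A"
        have "j = prod_encode (n, i)" using j(1) by simp
        then have "n \<le> j" by (simp add: le_prod_encode_1)
        then show "n < K" "i < k n" using j by (auto simp: A_def simp flip: j(1))
      qed
    qed auto
    also have "\<dots> = (\<Sum>n<K. \<Sum>i<k n. \<parallel>(1 / 2 ^ n) \<odot> x n i\<parallel> powr r)"
      by (subst sum.Sigma) auto
    also have "\<dots> \<le> (\<Sum>n<K. (1 / 2) ^ n)"
    proof (rule sum_mono)
      fix n
      have "(\<Sum>i<k n. \<parallel>(1 / 2 ^ n) \<odot> x n i\<parallel> powr r) = (\<Sum>i<k n. (1 / 2 ^ n) powr r * \<parallel>x n i\<parallel> powr r)"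
        using xV by (intro sum.cong) (auto simp: norm_scale powr_divide)
      also have "\<dots> = (1 / 2 ^ n) powr r * (\<Sum>i<k n. \<parallel>x n i\<parallel> powr r)" by (rule sum_distrib_left[symmetric])
      also have "\<dots> \<le> (1 / 2 ^ n) powr r * 1" using Q[of n] by (intro mult_left_mono) (auto simp: Q_def)
      also have "(1 / 2 ^ n :: real) powr r \<le> (1 / 2 ^ n) powr 1"
        using r by (intro powr_mono') auto
      finally show "(\<Sum>i<k n. \<parallel>(1 / 2 ^ n) \<odot> x n i\<parallel> powr r) \<le> (1 / 2) ^ n" by (simp add: power_one_over)
    qed
    also have "\<dots> \<le> 2" by (simp add: sum_gp_strict)
    finally show ?thesis .
  qed
  have "summable (\<lambda>j. \<parallel>X j\<parallel> powr r)"
    by (rule summableI_nonneg_bounded[where x = 2]) (use Xsum in auto)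
  then have "in_lp (ereal r) (\<lambda>j. \<parallel>X j\<parallel>)" using XV by (simp add: in_lp_def norm_nonneg)
  then have "bdd_above (range (\<lambda>K. \<parallel>vpsum E X K\<parallel>))"
    by (intro lp_composition_propertyD[OF comp XV X0 Xdisj])
  then obtain B where B: "\<And>K. \<parallel>vpsum E X K\<parallel> \<le> B" by (auto simp: bdd_above_def)
  have "2 ^ n \<le> B" for n
  proof -
    define A where "A = (\<lambda>i. prod_encode (n, i)) ` {..<k n}"
    define K where "K = Suc (Max (insert 0 A))"
    have finA: "finite A" by (simp add: A_def)
    have AK: "A \<subseteq> {..<K}" using finA by (auto simp: K_def less_Suc_eq_le)
    have sI': "vpsum E (x n) (k n) \<in> Idl w" "vpsum E X K \<in> Idl w"
      by (intro Idl_intros[OF w(1,2)] xI XI; assumption)+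
    have "(1 / 2 ^ n) \<odot> vpsum E (x n) (k n) \<preceq> vpsum E X K"
    proof (rule le_by_lhom[OF w(1,2)])
      fix h assume h: "lhom w h"
      note hs = lhom_simps[OF w(1,2) h]
      have "h ((1 / 2 ^ n) \<odot> vpsum E (x n) (k n)) = (\<Sum>i<k n. h (X (prod_encode (n, i))))"
        using sI' by (simp add: hs xI sum_divide_distrib Xv)
      also have "\<dots> = (\<Sum>j\<in>A. h (X j))"
        unfolding A_def by (subst sum.reindex) (auto simp: inj_on_def)
      also have "\<dots> \<le> (\<Sum>j<K. h (X j))"
        using AK lhom_nonneg[OF w(1,2) h XI X0] by (intro sum_mono2) auto
      finally show "h ((1 / 2 ^ n) \<odot> vpsum E (x n) (k n)) \<le> h (vpsum E X K)" by (simp add: hs XI)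
    qed (use sI' Idl_intros[OF w(1,2)] in auto)
    then have "\<parallel>(1 / 2 ^ n) \<odot> vpsum E (x n) (k n)\<parallel> \<le> \<parallel>vpsum E X K\<parallel>"
      using wVp[OF sI'(1)] wVp[OF sI'(2)] xV x0 by (intro norm_le_positive le_scale vpsum_nonneg) auto
    then have "\<parallel>vpsum E (x n) (k n)\<parallel> / 2 ^ n \<le> B" using wVp[OF sI'(1)] B[of K] by (simp add: norm_scale)
    moreover have "(4::real) ^ n < \<parallel>vpsum E (x n) (k n)\<parallel>" using Q[of n] by (simp add: Q_def)
    moreover have "(4::real) ^ n = 2 ^ n * 2 ^ n" by (simp flip: power_mult_distrib)
    ultimately have "(2 ^ n * 2 ^ n) / 2 ^ n \<le> B"
      by (smt (verit) divide_right_mono zero_le_power)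
    then show ?thesis by simp
  qed
  moreover obtain n where "B < 2 ^ n" using real_arch_pow[of 2 B] by auto
  ultimately show False by (metis not_le)
qed

end

text \<open>The supremum in \<open>lower_index\<close> may not be attained; this leads from some
  exponent above \<open>r\<close> down to \<open>r\<close>. It holds because the
  \<open>\<ell>\<^sub>p\<close> spaces grow with the exponent.\<close>

lemma lp_composition_property_mono:
  fixes E :: "('a, 'm) nlattice_scheme"
  assumes "lp_composition_property p E" "1 \<le> r" "ereal r < p"
  shows "lp_composition_property (ereal r) E"
proof -
  have "in_lp p a" if a: "in_lp (ereal r) a" for a
  proof -
    have s: "summable (\<lambda>k. \<bar>a k\<bar> powr r)" using a by (simp add: in_lp_def)
    have "(\<lambda>k. \<bar>a k\<bar> powr r) \<longlonglongrightarrow> 0" by (rule summable_LIMSEQ_zero[OF s])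
    then have "eventually (\<lambda>k. \<bar>a k\<bar> powr r < 1) sequentially" by (rule order_tendstoD) simp
    then obtain k0 where k0: "\<And>k. k \<ge> k0 \<Longrightarrow> \<bar>a k\<bar> powr r < 1" by (auto simp: eventually_sequentially)
    have le1: "\<bar>a k\<bar> \<le> 1" if "k \<ge> k0" for k
      using k0[OF that] gr_one_powr[of "\<bar>a k\<bar>" r] assms(2) by (smt (verit))
    show ?thesis
    proof (cases p)
      case (real p')
      have "summable (\<lambda>k. \<bar>a k\<bar> powr p')"
      proof (rule summable_comparison_test[OF _ s], intro exI allI impI)
        fix k assume "k0 \<le> k"
        then show "norm (\<bar>a k\<bar> powr p') \<le> \<bar>a k\<bar> powr r"
          using le1[of k] assms(3) real by (simp add: powr_mono')
      qed
      then show ?thesis using real by (simp add: in_lp_def)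
    next
      case PInf
      have "range a \<subseteq> a ` {..<k0} \<union> cball 0 1"
      proof
        fix y assume "y \<in> range a"
        then obtain k where "y = a k" by blast
        then show "y \<in> a ` {..<k0} \<union> cball 0 1" using le1[of k] by (cases "k < k0") auto
      qed
      moreover have "bounded (a ` {..<k0} \<union> cball 0 1)" by (simp add: finite_imp_bounded)
      ultimately have "bounded (range a)" by (rule bounded_subset[rotated])
      then show ?thesis using PInf by (simp add: in_lp_def)
    qed (use assms in auto)
  qed
  note * = this
  show ?thesis unfolding lp_composition_property_def
  proof (intro allI impI)
    fix x :: "nat \<Rightarrow> 'a"
    assume "(\<forall>k. x k \<in> vcarrier E \<and> vle E (vzero E) (x k)) \<and>
      (\<forall>j k. j \<noteq> k \<longrightarrow> vdisjoint E (x j) (x k)) \<and> in_lp (ereal r) (\<lambda>k. vnorm E (x k))"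
    then show "bdd_above (range (\<lambda>k. vnorm E (vpsum E x k)))"
      by (intro lp_composition_propertyD[OF assms(1)] *) auto
  qed
qed

section \<open>Test elements in free Banach lattices\<close>

lemma (in normed_lattice_on) vabs_vpsum_le:
  "(\<And>i. i < k \<Longrightarrow> x i \<in> V) \<Longrightarrow> \<bar>vpsum E x k\<bar>\<^sub>E \<preceq> vpsum E (\<lambda>i. \<bar>x i\<bar>\<^sub>E) k"
proof (induction k)
  case (Suc k)
  then have c: "vpsum E x k \<in> V" "x k \<in> V" "vpsum E (\<lambda>i. \<bar>x i\<bar>\<^sub>E) k \<in> V" by (auto intro!: vpsum_closed)
  have "\<bar>vpsum E x k\<bar>\<^sub>E \<oplus> \<bar>x k\<bar>\<^sub>E \<preceq> vpsum E (\<lambda>i. \<bar>x i\<bar>\<^sub>E) k \<oplus> \<bar>x k\<bar>\<^sub>E"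
    using Suc c by (intro le_add) auto
  then show ?case using c vabs_add_le[of "vpsum E x k" "x k"]
      le_trans[of "\<bar>vpsum E x k \<oplus> x k\<bar>\<^sub>E" "\<bar>vpsum E x k\<bar>\<^sub>E \<oplus> \<bar>x k\<bar>\<^sub>E" "vpsum E (\<lambda>i. \<bar>x i\<bar>\<^sub>E) k \<oplus> \<bar>x k\<bar>\<^sub>E"]
    by simp
qed (simp add: vabs_zero le_refl)

text \<open>One vector tests \<open>m\<close> lattice seminorms at once.
  \<open>free_banach_lattice_seminorm_le\<close> yields \<open>x j\<close> in the ball of
  \<open>X\<close> with at least half of the supremum of \<open>N j\<close>. Up to a small error,
  \<open>x j\<close> is a Rademacher coefficient of the vectors from \<open>ex_sign_family\<close>,
  so the average \<open>u\<close> of the moduli of their images dominates the modulus of the image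
  of this coefficient.\<close>

lemma free_banach_lattice_test_element:
  fixes L :: "'f nlattice" and X :: "('x, 'm) nlattice_scheme"
  assumes free: "free_banach_lattice X L \<phi>" and X: "normed_lattice_on X"
    and ue: "upper_estimate r X" and r: "1 < r" "r < 2"
  shows "\<exists>C>0. \<forall>m\<ge>16. \<forall>N \<epsilon>. \<epsilon> > 0 \<and> (\<forall>j<m. lattice_seminorm L (N j) \<and> (\<exists>u\<in>vball L. \<epsilon> \<le> N j u)) \<longrightarrow>
    (\<exists>u\<in>vcarrier L. vle L (vzero L) u \<and> vnorm L u \<le> C * ln (real m) * real m powr (1 / r) \<and>
      (\<forall>j<m. \<epsilon> / 4 \<le> N j u))"
proof -
  interpret X: normed_lattice_on X by fact
  interpret L: banach_lattice_on L using free by (simp add: free_banach_lattice_def)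
  have \<phi>: "linear_map_on X L \<phi>" "\<And>x. x \<in> vcarrier X \<Longrightarrow> vnorm L (\<phi> x) = vnorm X x"
    using free by (auto simp: free_banach_lattice_def)
  have \<phi>V: "\<phi> x \<in> vcarrier L" if "x \<in> vcarrier X" for x using linear_map_onD(1)[OF \<phi>(1) that] .
  obtain C where C: "C > 0" "\<And>m x. 2 \<le> m \<Longrightarrow> \<forall>j<m. x j \<in> vball X \<Longrightarrow>
    \<exists>z. \<forall>s\<in>signs m. z s \<in> vcarrier X \<and> vnorm X (z s) \<le> C * ln (real m) * real m powr (1 / r) \<and>
      (\<forall>j<m. vnorm X (vadd X (x j) (vneg X (vscale X (1 / 2 ^ m) (vsum X (\<lambda>s. vscale X (s j) (z s)) (signs m))))) \<le> 4 / real m)"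
    using X.ex_sign_family[OF ue r] by blast
  show ?thesis
  proof (intro exI[of _ C] conjI allI impI C(1))
    fix m :: nat and N :: "nat \<Rightarrow> 'f \<Rightarrow> real" and \<epsilon> :: real
    assume m: "16 \<le> m" and a: "\<epsilon> > 0 \<and> (\<forall>j<m. lattice_seminorm L (N j) \<and> (\<exists>u\<in>vball L. \<epsilon> \<le> N j u))"
    then have \<epsilon>: "\<epsilon> > 0" and N: "\<And>j. j < m \<Longrightarrow> lattice_seminorm L (N j)"
      and Nu: "\<And>j. j < m \<Longrightarrow> \<exists>u\<in>vball L. \<epsilon> \<le> N j u" by auto
    \<comment> \<open>The supremum over the ball and not \<open>\<epsilon>\<close>: the error made
      in replacing \<open>x j\<close> is estimated by this supremum and has to be compared with the
      value at \<open>x j\<close>.\<close>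
    define \<kappa> where "\<kappa> j = (SUP u\<in>vball L. N j u)" for j
    have bdd: "bdd_above (N j ` vball L)" if j: "j < m" for j
    proof -
      obtain K where K: "\<forall>x\<in>vcarrier L. N j x \<le> K * vnorm L x"
        using N[OF j] unfolding lattice_seminorm_def by blast
      have "N j u \<le> \<bar>K\<bar>" if u: "u \<in> vball L" for u
      proof -
        have "K * vnorm L u \<le> \<bar>K\<bar> * vnorm L u"
          using u L.norm_nonneg[of u] by (intro mult_right_mono) (auto simp: vball_def)
        also have "\<dots> \<le> \<bar>K\<bar>" using u by (intro mult_left_le) (auto simp: vball_def)
        finally show ?thesis using K u by (force simp: vball_def)
      qed
      then show ?thesis by (intro bdd_aboveI[of _ "\<bar>K\<bar>"]) auto
    qed
    have \<kappa>_ge: "N j u \<le> \<kappa> j" if "j < m" "u \<in> vball L" for j u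
      unfolding \<kappa>_def by (rule cSUP_upper[OF that(2) bdd[OF that(1)]])
    have \<kappa>\<epsilon>: "\<epsilon> \<le> \<kappa> j" if "j < m" for j using Nu[OF that] \<kappa>_ge[OF that] by force
    have "\<exists>x\<in>vball X. \<kappa> j / 2 < N j (\<phi> x)" if j: "j < m" for j
    proof (rule ccontr)
      assume "\<not> ?thesis"
      then have "N j (\<phi> x) \<le> \<kappa> j / 2" if "x \<in> vball X" for x using that by force
      then have "N j u \<le> \<kappa> j / 2" if "u \<in> vball L" for u
        using free_banach_lattice_seminorm_le[OF free X.normed_space_on_axioms N[OF j] _ that] by blast
      moreover have "vball L \<noteq> {}" using Nu[OF j] by blast
      ultimately have "\<kappa> j \<le> \<kappa> j / 2" unfolding \<kappa>_def by (intro cSUP_least) auto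
      then show False using \<kappa>\<epsilon>[OF j] \<epsilon> by simp
    qed
    then obtain x where x: "\<And>j. j < m \<Longrightarrow> x j \<in> vball X" "\<And>j. j < m \<Longrightarrow> \<kappa> j / 2 < N j (\<phi> (x j))" by metis
    have xV: "x j \<in> vcarrier X" if "j < m" for j using x(1)[OF that] by (simp add: vball_def)
    define D where "D = C * ln (real m) * real m powr (1 / r)"
    define x' where "x' z j = vscale X (1 / 2 ^ m) (vsum X (\<lambda>s. vscale X (s j) (z s)) (signs m))"
      for z :: "(nat \<Rightarrow> real) \<Rightarrow> 'x" and j
    obtain z where z: "\<And>s. s \<in> signs m \<Longrightarrow> z s \<in> vcarrier X" "\<And>s. s \<in> signs m \<Longrightarrow> vnorm X (z s) \<le> D"
      "\<And>s j. s \<in> signs m \<Longrightarrow> j < m \<Longrightarrow> vnorm X (vadd X (x j) (vneg X (x' z j))) \<le> 4 / real m"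
      using C(2)[of m x] x(1) m unfolding D_def x'_def by force
    have "signs m \<noteq> {}" by (metis card_signs card.empty power_not_zero zero_neq_numeral)
    then have z3: "vnorm X (vadd X (x j) (vneg X (x' z j))) \<le> 4 / real m" if "j < m" for j using z(3) that by blast
    define I where "I = finite_enum (signs m)"
    have I: "I k \<in> signs m" if "k < 2 ^ m" for k using finite_enum_in[of "signs m" k] that by (simp add: I_def)
    have vs: "vsum E g (signs m) = vpsum E (\<lambda>k. g (I k)) (2 ^ m)" for E :: "('b, 'd) nspace_scheme" and g
      by (simp add: vsum_def I_def)
    define v where "v k = vabs L (\<phi> (z (I k)))" for k
    have vV: "v k \<in> vcarrier L" "vle L (vzero L) (v k)" "vnorm L (v k) \<le> D" if "k < 2 ^ m" for k
      using I[OF that] z \<phi>V \<phi>(2) by (auto simp: v_def L.norm_vabs L.vabs_nonneg)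
    define u where "u = vscale L (1 / 2 ^ m) (vpsum L v (2 ^ m))"
    have pV: "vpsum L v (2 ^ m) \<in> vcarrier L" using vV by (intro L.vpsum_closed) auto
    have uV: "u \<in> vcarrier L" using pV by (simp add: u_def)
    have u0: "vle L (vzero L) u" unfolding u_def using vV pV by (intro L.le_scale L.vpsum_nonneg) auto
    have "vnorm L u \<le> D"
    proof -
      have "vnorm L (vpsum L v (2 ^ m)) \<le> (\<Sum>k<2 ^ m. vnorm L (v k))" using vV by (intro L.vpsum_norm_le) auto
      also have "\<dots> \<le> (\<Sum>k<(2::nat) ^ m. D)" using vV by (intro sum_mono) auto
      finally have "vnorm L (vpsum L v (2 ^ m)) \<le> 2 ^ m * D" by simp
      then show ?thesis unfolding u_def using pV by (simp add: L.norm_scale divide_le_eq mult.commute)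
    qed
    moreover have "\<epsilon> / 4 \<le> N j u" if j: "j < m" for j
    proof -
      have sV: "vscale X (I k j) (z (I k)) \<in> vcarrier X" if "k < 2 ^ m" for k using z(1)[OF I[OF that]] by simp
      have psV: "vpsum X (\<lambda>k. vscale X (I k j) (z (I k))) (2 ^ m) \<in> vcarrier X"
        using sV by (rule X.vpsum_closed)
      have x'V: "x' z j \<in> vcarrier X" unfolding x'_def vs using psV by simp
      define y where "y = \<phi> (x' z j)"
      have y: "y = vscale L (1 / 2 ^ m) (vpsum L (\<lambda>k. \<phi> (vscale X (I k j) (z (I k)))) (2 ^ m))"
        unfolding y_def x'_def vs linear_map_onD(3)[OF \<phi>(1) psV]
        using linear_map_on_vpsum[OF X.normed_space_on_axioms L.normed_space_on_axioms \<phi>(1) sV] by simp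
      define yk where "yk k = \<phi> (vscale X (I k j) (z (I k)))" for k
      have ykV: "yk k \<in> vcarrier L" if "k < 2 ^ m" for k using sV[OF that] \<phi>V by (simp add: yk_def)
      have yk_abs: "vabs L (yk k) = v k" if k: "k < 2 ^ m" for k
      proof -
        have "yk k = vscale L (I k j) (\<phi> (z (I k)))"
          unfolding yk_def using linear_map_onD(3)[OF \<phi>(1)] z(1)[OF I[OF k]] by simp
        then show ?thesis
          using z(1)[OF I[OF k]] \<phi>V signs_abs[OF I[OF k] j]
          by (simp add: L.vabs_scale v_def L.scale_one)
      qed
      have pyV: "vpsum L yk (2 ^ m) \<in> vcarrier L" using ykV by (rule L.vpsum_closed)
      have "vle L (vabs L (vpsum L yk (2 ^ m))) (vpsum L (\<lambda>k. vabs L (yk k)) (2 ^ m))"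
        using ykV by (rule L.vabs_vpsum_le)
      moreover have "vle L (vpsum L (\<lambda>k. vabs L (yk k)) (2 ^ m)) (vpsum L v (2 ^ m))"
        using ykV vV yk_abs by (intro L.vpsum_mono) (auto intro: L.le_refl)
      moreover have "vpsum L (\<lambda>k. vabs L (yk k)) (2 ^ m) \<in> vcarrier L" using ykV by (intro L.vpsum_closed) auto
      ultimately have "vle L (vabs L (vpsum L yk (2 ^ m))) (vpsum L v (2 ^ m))"
        using pyV pV L.le_trans[of "vabs L (vpsum L yk (2 ^ m))" "vpsum L (\<lambda>k. vabs L (yk k)) (2 ^ m)" "vpsum L v (2 ^ m)"]
        by simp
      moreover have "y = vscale L (1 / 2 ^ m) (vpsum L yk (2 ^ m))" unfolding y yk_def ..
      ultimately have "vle L (vabs L y) u" unfolding u_def using pyV pV by (simp add: L.vabs_scale L.scale_mono)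
      moreover have yV: "y \<in> vcarrier L" unfolding y_def by (rule \<phi>V[OF x'V])
      ultimately have Ny: "N j y \<le> N j u"
        using lattice_seminormD(3)[OF N[OF j] yV uV] uV u0 by (simp add: L.vabs_of_nonneg)
      define e where "e = vadd X (x j) (vneg X (x' z j))"
      have eV: "e \<in> vcarrier X" using xV[OF j] x'V by (simp add: e_def)
      have Ne: "N j (\<phi> e) \<le> \<kappa> j * vnorm X e"
      proof (cases "vnorm X e = 0")
        case True
        then have "vscale L 0 (\<phi> e) = \<phi> e"
          using eV \<phi>V \<phi>(2)[OF eV] L.norm_eq_zero[of "\<phi> e"] by (simp add: L.scale_zero_left)
        then have "N j (\<phi> e) = \<bar>0\<bar> * N j (\<phi> e)" using lattice_seminormD(2)[OF N[OF j] \<phi>V[OF eV], of 0] by simp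
        then show ?thesis using True by simp
      next
        case False
        then have ne: "vnorm X e > 0" using X.norm_nonneg[OF eV] by simp
        have "vscale L (1 / vnorm X e) (\<phi> e) \<in> vball L"
          using \<phi>V[OF eV] \<phi>(2)[OF eV] ne by (simp add: vball_def L.norm_scale)
        then have "N j (vscale L (1 / vnorm X e) (\<phi> e)) \<le> \<kappa> j" by (rule \<kappa>_ge[OF j])
        then have "N j (\<phi> e) / vnorm X e \<le> \<kappa> j"
          using lattice_seminormD(2)[OF N[OF j] \<phi>V[OF eV], of "1 / vnorm X e"] ne by simp
        then show ?thesis using ne by (simp add: divide_le_eq)
      qed
      have "\<phi> (x j) = vadd L y (\<phi> e)"
      proof -
        have "x j = vadd X (x' z j) e" unfolding e_def
          using xV[OF j] x'V by (intro X.lin_eqI) (auto simp: X.lin_simps)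
        then show ?thesis unfolding y_def using linear_map_onD(2)[OF \<phi>(1) x'V eV] by simp
      qed
      then have "N j (\<phi> (x j)) \<le> N j y + N j (\<phi> e)"
        using lattice_seminormD(1)[OF N[OF j] yV \<phi>V[OF eV]] by simp
      moreover have "\<kappa> j * vnorm X e \<le> \<kappa> j * (1 / 4)"
      proof (rule mult_left_mono)
        \<comment> \<open>The origin of the bound 16: of the value \<open>\<kappa> j / 2\<close> at
          \<open>x j\<close> the error takes at most \<open>\<kappa> j / 4\<close>.\<close>
        have "4 / real m \<le> 1 / 4" using m by (simp add: field_simps)
        then show "vnorm X e \<le> 1 / 4" using z3[OF j] by (simp add: e_def)
      qed (use \<kappa>\<epsilon>[OF j] \<epsilon> in simp)
      ultimately have "\<kappa> j / 4 \<le> N j u" using x(2)[OF j] Ny Ne by simp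
      then show ?thesis using \<kappa>\<epsilon>[OF j] by simp
    qed
    ultimately show "\<exists>u\<in>vcarrier L. vle L (vzero L) u \<and> vnorm L u \<le> C * ln (real m) * real m powr (1 / r) \<and>
      (\<forall>j<m. \<epsilon> / 4 \<le> N j u)" using uV u0 unfolding D_def by blast
  qed
qed

section \<open>The dual of a normed lattice\<close>

context normed_lattice_on
begin

lemma dual_simps [simp]:
  "vzero (dual_lattice E) = (\<lambda>x\<in>V. 0)" "vadd (dual_lattice E) = (\<lambda>f g. \<lambda>x\<in>V. f x + g x)"
  "vscale (dual_lattice E) = (\<lambda>a f. \<lambda>x\<in>V. a * f x)" "vnorm (dual_lattice E) = op_norm_on E real_line"
  "vle (dual_lattice E) = (\<lambda>f g. \<forall>x\<in>V. \<zero> \<preceq> x \<longrightarrow> f x \<le> g x)"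
  "vneg (dual_lattice E) = (\<lambda>f. \<lambda>x\<in>V. - f x)"
  by (simp_all add: dual_lattice_def vneg_def fun_eq_iff restrict_def)

lemma dual_carrier: "f \<in> vcarrier (dual_lattice E) \<longleftrightarrow> f \<in> extensional V \<and>
    (\<forall>x\<in>V. \<forall>y\<in>V. f (x \<oplus> y) = f x + f y) \<and> (\<forall>a. \<forall>x\<in>V. f (a \<odot> x) = a * f x) \<and>
    (\<exists>K. \<forall>x\<in>V. \<bar>f x\<bar> \<le> K * \<parallel>x\<parallel>)"
  by (auto simp: dual_lattice_def bounded_linear_on_def linear_map_on_def real_line_def)

lemma dualD:
  assumes "f \<in> vcarrier (dual_lattice E)" "x \<in> V"
  shows "y \<in> V \<Longrightarrow> f (x \<oplus> y) = f x + f y" "f (a \<odot> x) = a * f x" "f (\<ominus> x) = - f x"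
  using assms by (auto simp: dual_carrier vneg_def)

lemma zero_in_vball: "\<zero> \<in> vball E"
  by (simp add: vball_def norm_zero)

lemma dual_norm_bound:
  assumes f: "f \<in> vcarrier (dual_lattice E)" and x: "x \<in> V"
  shows "\<bar>f x\<bar> \<le> op_norm_on E real_line f * \<parallel>x\<parallel>"
proof -
  obtain K where K: "\<forall>x\<in>V. \<bar>f x\<bar> \<le> K * \<parallel>x\<parallel>" using f by (auto simp: dual_carrier)
  have b: "\<bar>f u\<bar> \<le> \<bar>K\<bar>" if u: "u \<in> vball E" for u
  proof -
    have "K * \<parallel>u\<parallel> \<le> \<bar>K\<bar> * \<parallel>u\<parallel>"
      using u norm_nonneg[of u] by (intro mult_right_mono) (auto simp: vball_def)
    also have "\<dots> \<le> \<bar>K\<bar>" using u by (intro mult_left_le) (auto simp: vball_def)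
    finally show ?thesis using K u by (force simp: vball_def)
  qed
  have ub: "\<bar>f u\<bar> \<le> op_norm_on E real_line f" if "u \<in> vball E" for u
    unfolding op_norm_on_def
    by (rule order_trans[OF _ cSUP_upper[OF that]]) (use b in \<open>auto simp: real_line_def intro!: bdd_aboveI[of _ "\<bar>K\<bar>"]\<close>)
  show ?thesis
  proof (cases "\<parallel>x\<parallel> = 0")
    case True
    then show ?thesis using K x by force
  next
    case False
    then have nx: "\<parallel>x\<parallel> > 0" using norm_nonneg[OF x] by simp
    have "(1 / \<parallel>x\<parallel>) \<odot> x \<in> vball E" using x nx by (simp add: vball_def norm_scale)
    from ub[OF this] have "\<bar>f x\<bar> / \<parallel>x\<parallel> \<le> op_norm_on E real_line f"
      using nx dualD(2)[OF f x] by (simp add: abs_mult)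
    then show ?thesis using nx by (simp add: divide_le_eq)
  qed
qed

lemma dual_norm_le:
  assumes "\<And>x. x \<in> vball E \<Longrightarrow> \<bar>f x\<bar> \<le> K"
  shows "op_norm_on E real_line f \<le> K"
  unfolding op_norm_on_def by (rule cSUP_least) (use assms zero_in_vball in \<open>auto simp: real_line_def\<close>)

lemma dual_norm_nonneg: "f \<in> vcarrier (dual_lattice E) \<Longrightarrow> 0 \<le> op_norm_on E real_line f"
  unfolding op_norm_on_def
proof (rule order_trans[OF _ cSUP_upper[OF zero_in_vball]])
  assume f: "f \<in> vcarrier (dual_lattice E)"
  show "bdd_above ((\<lambda>x. vnorm real_line (f x)) ` vball E)"
  proof (rule bdd_aboveI[of _ "\<bar>op_norm_on E real_line f\<bar>"])
    fix y assume "y \<in> (\<lambda>x. vnorm real_line (f x)) ` vball E"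
    then obtain x where x: "x \<in> V" "\<parallel>x\<parallel> \<le> 1" "y = \<bar>f x\<bar>" by (auto simp: vball_def real_line_def)
    have "\<bar>f x\<bar> \<le> op_norm_on E real_line f * \<parallel>x\<parallel>" by (rule dual_norm_bound[OF f x(1)])
    also have "\<dots> \<le> \<bar>op_norm_on E real_line f\<bar> * \<parallel>x\<parallel>" using norm_nonneg[OF x(1)] by (intro mult_right_mono) auto
    also have "\<dots> \<le> \<bar>op_norm_on E real_line f\<bar>" using x by (intro mult_left_le) auto
    finally show "y \<le> \<bar>op_norm_on E real_line f\<bar>" using x by simp
  qed
qed (simp add: real_line_def)

lemma vabs_decomp: "x \<in> V \<Longrightarrow> \<zero> \<preceq> \<bar>x\<bar>\<^sub>E \<ominus> x" "x \<in> V \<Longrightarrow> \<zero> \<preceq> \<bar>x\<bar>\<^sub>E \<oplus> x"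
proof -
  assume x: "x \<in> V"
  show "\<zero> \<preceq> \<bar>x\<bar>\<^sub>E \<ominus> x" using x le_iff_diff[of x "\<bar>x\<bar>\<^sub>E"] by (simp add: le_vabs)
  have "\<bar>x\<bar>\<^sub>E \<ominus> \<ominus> x = \<bar>x\<bar>\<^sub>E \<oplus> x" using x by (intro lin_eqI) (auto simp: lin_simps)
  then show "\<zero> \<preceq> \<bar>x\<bar>\<^sub>E \<oplus> x" using x le_iff_diff[of "\<ominus> x" "\<bar>x\<bar>\<^sub>E"] by (simp add: neg_le_vabs)
qed

text \<open>Twice \<open>x\<close> is the difference, and twice its modulus the sum, of the positive
  vectors \<open>\<bar>x\<bar>\<^sub>E \<oplus> x\<close> and
  \<open>\<bar>x\<bar>\<^sub>E \<ominus> x\<close>.\<close>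

lemma dual_abs_le:
  assumes f: "f \<in> vcarrier (dual_lattice E)" and g: "g \<in> vcarrier (dual_lattice E)"
    and fg: "\<And>x. x \<in> V \<Longrightarrow> \<zero> \<preceq> x \<Longrightarrow> - g x \<le> f x \<and> f x \<le> g x" and x: "x \<in> V"
  shows "\<bar>f x\<bar> \<le> g (\<bar>x\<bar>\<^sub>E)"
proof -
  have p: "\<bar>f (\<bar>x\<bar>\<^sub>E \<oplus> x)\<bar> \<le> g (\<bar>x\<bar>\<^sub>E \<oplus> x)" "\<bar>f (\<bar>x\<bar>\<^sub>E \<ominus> x)\<bar> \<le> g (\<bar>x\<bar>\<^sub>E \<ominus> x)"
    using fg[of "\<bar>x\<bar>\<^sub>E \<oplus> x"] fg[of "\<bar>x\<bar>\<^sub>E \<ominus> x"] vabs_decomp x by auto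
  then show ?thesis using dualD[OF f] dualD[OF g] x by simp
qed

lemma normed_space_on_dual: "normed_space_on (dual_lattice E)"
proof
  let ?D = "dual_lattice E"
  show "vzero ?D \<in> vcarrier ?D" by (auto simp: dual_carrier intro!: exI[of _ 0])
  fix f assume f: "f \<in> vcarrier ?D"
  have extE: "f x = undefined" if "x \<notin> V" for x using f that by (auto simp: dual_carrier extensional_def)
  show sc: "vscale ?D a f \<in> vcarrier ?D" for a
  proof -
    obtain K where K: "\<forall>x\<in>V. \<bar>f x\<bar> \<le> K * \<parallel>x\<parallel>" using f by (auto simp: dual_carrier)
    have "\<bar>a * f x\<bar> \<le> (\<bar>a\<bar> * K) * \<parallel>x\<parallel>" if "x \<in> V" for x
      using mult_left_mono[OF K[rule_format, OF that], of "\<bar>a\<bar>"] by (simp add: abs_mult mult.assoc)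
    then have "\<exists>K. \<forall>x\<in>V. \<bar>a * f x\<bar> \<le> K * \<parallel>x\<parallel>" by blast
    then show ?thesis using dualD[OF f] by (auto simp: dual_carrier algebra_simps)
  qed
  show "vadd ?D (vzero ?D) f = f" using extE by (auto simp: restrict_def fun_eq_iff)
  show "vadd ?D f (vneg ?D f) = vzero ?D" by (auto simp: restrict_def fun_eq_iff)
  show "vscale ?D (a + b) f = vadd ?D (vscale ?D a f) (vscale ?D b f)" for a b
    by (auto simp: restrict_def fun_eq_iff algebra_simps)
  show "vscale ?D a (vscale ?D b f) = vscale ?D (a * b) f" for a b by (auto simp: restrict_def fun_eq_iff)
  show "vscale ?D 1 f = f" using extE by (auto simp: restrict_def fun_eq_iff)
  show "0 \<le> vnorm ?D f" using dual_norm_nonneg[OF f] by simp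
  show "(vnorm ?D f = 0) = (f = vzero ?D)"
  proof
    assume "vnorm ?D f = 0"
    then have "f x = 0" if "x \<in> V" for x using dual_norm_bound[OF f that] by simp
    then show "f = vzero ?D" using extE by (auto simp: restrict_def fun_eq_iff)
  next
    assume 0: "f = vzero ?D"
    have "op_norm_on E real_line f \<le> 0" by (rule dual_norm_le) (auto simp: 0 vball_def)
    then show "vnorm ?D f = 0" using dual_norm_nonneg[OF f] by simp
  qed
  have half: "op_norm_on E real_line (vscale ?D a h) \<le> \<bar>a\<bar> * op_norm_on E real_line h"
    if h: "h \<in> vcarrier ?D" for a h
  proof (rule dual_norm_le)
    fix x assume x: "x \<in> vball E"
    have "\<bar>h x\<bar> \<le> op_norm_on E real_line h * \<parallel>x\<parallel>" using x by (intro dual_norm_bound[OF h]) (simp add: vball_def)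
    also have "\<dots> \<le> op_norm_on E real_line h" using x dual_norm_nonneg[OF h] by (intro mult_left_le) (auto simp: vball_def)
    finally show "\<bar>vscale ?D a h x\<bar> \<le> \<bar>a\<bar> * op_norm_on E real_line h"
      using x by (simp add: vball_def abs_mult mult_left_mono)
  qed
  show "vnorm ?D (vscale ?D a f) = \<bar>a\<bar> * vnorm ?D f" for a
  proof (cases "a = 0")
    case True
    then show ?thesis using half[OF f, of 0] dual_norm_nonneg[OF sc[of 0]] by simp
  next
    case False
    have "vscale ?D (1 / a) (vscale ?D a f) = f" using extE False by (auto simp: restrict_def fun_eq_iff)
    then have "op_norm_on E real_line f \<le> \<bar>1 / a\<bar> * op_norm_on E real_line (vscale ?D a f)"
      using half[OF sc[of a], of "1 / a"] by simp
    then have "\<bar>a\<bar> * op_norm_on E real_line f \<le> op_norm_on E real_line (vscale ?D a f)"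
      using False by (simp add: field_simps)
    then show ?thesis using half[OF f, of a] by simp
  qed
  fix g assume g: "g \<in> vcarrier ?D"
  show "vadd ?D f g \<in> vcarrier ?D"
  proof -
    obtain K where K: "\<forall>x\<in>V. \<bar>f x\<bar> \<le> K * \<parallel>x\<parallel>" using f by (auto simp: dual_carrier)
    obtain K' where K': "\<forall>x\<in>V. \<bar>g x\<bar> \<le> K' * \<parallel>x\<parallel>" using g by (auto simp: dual_carrier)
    have "\<bar>f x + g x\<bar> \<le> (K + K') * \<parallel>x\<parallel>" if "x \<in> V" for x
      using K[rule_format, OF that] K'[rule_format, OF that] by (simp add: algebra_simps)
    then have "\<exists>K. \<forall>x\<in>V. \<bar>f x + g x\<bar> \<le> K * \<parallel>x\<parallel>" by blast
    then show ?thesis using dualD[OF f] dualD[OF g] by (auto simp: dual_carrier algebra_simps)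
  qed
  show "vadd ?D f g = vadd ?D g f" by (auto simp: restrict_def fun_eq_iff)
  show "vscale ?D a (vadd ?D f g) = vadd ?D (vscale ?D a f) (vscale ?D a g)" for a
    by (auto simp: restrict_def fun_eq_iff algebra_simps)
  show "vnorm ?D (vadd ?D f g) \<le> vnorm ?D f + vnorm ?D g"
    unfolding dual_simps
  proof (rule dual_norm_le)
    fix x assume x: "x \<in> vball E"
    then have xV: "x \<in> V" by (simp add: vball_def)
    have "op_norm_on E real_line f * \<parallel>x\<parallel> \<le> op_norm_on E real_line f"
      "op_norm_on E real_line g * \<parallel>x\<parallel> \<le> op_norm_on E real_line g"
      using x dual_norm_nonneg[OF f] dual_norm_nonneg[OF g] by (auto simp: vball_def intro: mult_left_le)
    then show "\<bar>(\<lambda>x\<in>V. f x + g x) x\<bar> \<le> op_norm_on E real_line f + op_norm_on E real_line g"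
      using xV dual_norm_bound[OF f xV] dual_norm_bound[OF g xV] by simp
  qed
  show "vadd ?D (vadd ?D f g) h = vadd ?D f (vadd ?D g h)" for h by (auto simp: restrict_def fun_eq_iff)
qed

lemma ordered_normed_space_on_dual: "ordered_normed_space_on (dual_lattice E)"
proof -
  let ?D = "dual_lattice E"
  interpret D: normed_space_on ?D by (rule normed_space_on_dual)
  show ?thesis
  proof
    fix f g assume f: "f \<in> vcarrier ?D" and g: "g \<in> vcarrier ?D"
    show "f = g" if "vle ?D f g" "vle ?D g f"
    proof (rule extensionalityI[of _ V])
      show "f \<in> extensional V" "g \<in> extensional V" using f g by (auto simp: dual_carrier)
      fix x assume x: "x \<in> V"
      have eq: "f y = g y" if "y \<in> V" "\<zero> \<preceq> y" for y using that \<open>vle ?D f g\<close> \<open>vle ?D g f\<close> by (auto intro: antisym)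
      have "f (\<bar>x\<bar>\<^sub>E) = g (\<bar>x\<bar>\<^sub>E)" "f (\<bar>x\<bar>\<^sub>E \<oplus> x) = g (\<bar>x\<bar>\<^sub>E \<oplus> x)"
        using x vabs_decomp vabs_nonneg by (auto intro!: eq)
      then show "f x = g x" using x dualD[OF f] dualD[OF g] by simp
    qed
    show "vnorm ?D f \<le> vnorm ?D g" if le: "vle ?D (vneg ?D g) f" "vle ?D f g"
      unfolding dual_simps
    proof (rule dual_norm_le)
      fix x assume x: "x \<in> vball E"
      then have xV: "x \<in> V" by (simp add: vball_def)
      have "\<bar>f x\<bar> \<le> g (\<bar>x\<bar>\<^sub>E)" by (rule dual_abs_le[OF f g _ xV]) (use le in auto)
      also have "\<dots> \<le> op_norm_on E real_line g * \<parallel>\<bar>x\<bar>\<^sub>E\<parallel>" using dual_norm_bound[OF g, of "\<bar>x\<bar>\<^sub>E"] xV by simp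
      also have "\<dots> \<le> op_norm_on E real_line g"
        using x dual_norm_nonneg[OF g] by (intro mult_left_le) (auto simp: vball_def norm_vabs)
      finally show "\<bar>f x\<bar> \<le> op_norm_on E real_line g" .
    qed
  qed (auto, meson order_trans)
qed

end

text \<open>Besides order and norm, this is what the compactness proof for operators on
  \<open>\<ell>\<^sub>p\<close> spaces uses of the target, with \<open>\<sigma>\<close> the sum of
  the \<open>1 / p i\<close>. A single \<open>m\<close> for each \<open>\<epsilon>\<close> and
  \<open>K\<close> is enough for a contradiction.\<close>

definition lower_growth :: "real \<Rightarrow> ('a, 'm) nlattice_scheme \<Rightarrow> bool" where
  "lower_growth \<sigma> G \<longleftrightarrow> (\<forall>\<epsilon>>0. \<forall>K. \<exists>m\<ge>1. \<forall>g.
     (\<forall>j<m. g j \<in> vcarrier G \<and> vle G (vzero G) (g j) \<and> \<epsilon> \<le> vnorm G (g j)) \<longrightarrow>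
     K * real m powr \<sigma> < vnorm G (vpsum G g m))"

lemma ex_nat_powr_gt:
  assumes "\<delta> > (0::real)" "c > 0"
  shows "\<exists>m\<ge>M. K < c * real m powr \<delta>"
proof -
  have "eventually (\<lambda>m. (\<bar>K\<bar> + 1) / c < real m powr \<delta>) sequentially"
    using filterlim_compose[OF real_powr_at_top[OF assms(1)] filterlim_real_sequentially]
    by (simp add: filterlim_at_top_dense)
  then obtain n where n: "\<And>m. m \<ge> n \<Longrightarrow> (\<bar>K\<bar> + 1) / c < real m powr \<delta>"
    by (auto simp: eventually_sequentially)
  have "\<bar>K\<bar> + 1 < c * real (max M n) powr \<delta>" using n[of "max M n"] assms by (simp add: divide_less_eq mult.commute)
  then show ?thesis by (intro exI[of _ "max M n"]) auto
qed

text \<open>The seminorms to be tested are the values of the \<open>g j\<close> at moduli. At the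
  vector \<open>u\<close> obtained for them the sum of the \<open>g j\<close> is at least of order
  \<open>m\<close>, while the norm of \<open>u\<close> is at most of order
  \<open>ln m * m powr (1 / r)\<close>.\<close>

theorem lower_growth_dual_free:
  fixes L :: "'f nlattice" and X :: "('x, 'm) nlattice_scheme"
  assumes free: "free_banach_lattice X L \<phi>" and X: "normed_lattice_on X"
    and ue: "upper_estimate r X" and r: "1 < r" "r < 2" and \<sigma>: "\<sigma> < 1 - 1 / r"
  shows "lower_growth \<sigma> (dual_lattice L)"
  unfolding lower_growth_def
proof (intro allI impI)
  fix \<epsilon> K :: real assume \<epsilon>: "\<epsilon> > 0"
  interpret L: banach_lattice_on L using free by (simp add: free_banach_lattice_def)
  let ?D = "dual_lattice L"
  interpret D: ordered_normed_space_on ?D by (rule L.ordered_normed_space_on_dual)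
  obtain C where C: "C > 0" "\<And>m N \<epsilon>. m \<ge> 16 \<Longrightarrow> \<epsilon> > 0 \<and> (\<forall>j<m. lattice_seminorm L (N j) \<and> (\<exists>u\<in>vball L. \<epsilon> \<le> N j u)) \<Longrightarrow>
    (\<exists>u\<in>vcarrier L. vle L (vzero L) u \<and> vnorm L u \<le> C * ln (real m) * real m powr (1 / r) \<and>
      (\<forall>j<m. \<epsilon> / 4 \<le> N j u))"
    using free_banach_lattice_test_element[OF free X ue r] by blast
  \<comment> \<open>Half of the gap between the exponents absorbs the logarithm, the other half the
    constants.\<close>
  define \<delta> where "\<delta> = (1 - 1 / r - \<sigma>) / 2"
  have \<delta>: "\<delta> > 0" using \<sigma> by (simp add: \<delta>_def)
  obtain m where m: "m \<ge> 16" "\<bar>K\<bar> < (\<epsilon> * \<delta> / (8 * C)) * real m powr \<delta>"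
    using ex_nat_powr_gt[OF \<delta>, of "\<epsilon> * \<delta> / (8 * C)" 16 "\<bar>K\<bar>"] \<epsilon> \<delta> C by auto
  show "\<exists>m\<ge>1. \<forall>g. (\<forall>j<m. g j \<in> vcarrier ?D \<and> vle ?D (vzero ?D) (g j) \<and> \<epsilon> \<le> vnorm ?D (g j)) \<longrightarrow>
     K * real m powr \<sigma> < vnorm ?D (vpsum ?D g m)"
  proof (intro exI[of _ m] conjI allI impI)
    show "1 \<le> m" using m by simp
    fix g assume "\<forall>j<m. g j \<in> vcarrier ?D \<and> vle ?D (vzero ?D) (g j) \<and> \<epsilon> \<le> vnorm ?D (g j)"
    then have g: "g j \<in> vcarrier ?D" "\<And>x. x \<in> vcarrier L \<Longrightarrow> vle L (vzero L) x \<Longrightarrow> 0 \<le> g j x"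
      "\<epsilon> \<le> op_norm_on L real_line (g j)" if "j < m" for j using that by auto
    have gmono: "g j x \<le> g j y" if j: "j < m" and xy: "x \<in> vcarrier L" "y \<in> vcarrier L" "vle L x y" for j x y
    proof -
      have "0 \<le> g j (vadd L y (vneg L x))" using g(2)[OF j] xy L.le_iff_diff[of x y] by simp
      then show ?thesis using L.dualD[OF g(1)[OF j]] xy by simp
    qed
    have sn: "lattice_seminorm L (\<lambda>u. g j (vabs L u))" if j: "j < m" for j
      unfolding lattice_seminorm_def
    proof (intro conjI ballI allI impI)
      fix x y assume xy: "x \<in> vcarrier L" "y \<in> vcarrier L"
      have "g j (vabs L (vadd L x y)) \<le> g j (vadd L (vabs L x) (vabs L y))"
        using xy by (intro gmono[OF j] L.vabs_add_le) auto
      then show "g j (vabs L (vadd L x y)) \<le> g j (vabs L x) + g j (vabs L y)"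
        using L.dualD(1)[OF g(1)[OF j]] xy by simp
      show "g j (vabs L x) \<le> g j (vabs L y)" if "vle L (vabs L x) (vabs L y)"
        using that xy by (intro gmono[OF j]) auto
      show "g j (vabs L (vscale L a x)) = \<bar>a\<bar> * g j (vabs L x)" for a
        using L.dualD(2)[OF g(1)[OF j]] xy by (simp add: L.vabs_scale)
    next
      show "\<exists>K. \<forall>x\<in>vcarrier L. g j (vabs L x) \<le> K * vnorm L x"
      proof (intro exI ballI)
        fix x assume x: "x \<in> vcarrier L"
        then show "g j (vabs L x) \<le> op_norm_on L real_line (g j) * vnorm L x"
          using L.dual_norm_bound[OF g(1)[OF j], of "vabs L x"] by (simp add: L.norm_vabs)
      qed
    qed
    \<comment> \<open>Half of the norm, as the supremum defining it need not be attained.\<close>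
    have big: "\<exists>u\<in>vball L. \<epsilon> / 2 \<le> g j (vabs L u)" if j: "j < m" for j
    proof (rule ccontr)
      assume "\<not> ?thesis"
      then have lt: "g j (vabs L u) < \<epsilon> / 2" if "u \<in> vball L" for u using that by force
      have "op_norm_on L real_line (g j) \<le> \<epsilon> / 2"
      proof (rule L.dual_norm_le)
        fix x assume x: "x \<in> vball L"
        have "\<bar>g j x\<bar> \<le> g j (vabs L x)"
          by (rule L.dual_abs_le[OF g(1)[OF j] g(1)[OF j]])
            (use x g(2)[OF j] in \<open>auto simp: vball_def intro: order_trans[of _ 0]\<close>)
        then show "\<bar>g j x\<bar> \<le> \<epsilon> / 2" using lt[OF x] by simp
      qed
      then show False using g(3)[OF j] \<epsilon> by simp
    qed
    obtain u where u: "u \<in> vcarrier L" "vle L (vzero L) u" "vnorm L u \<le> C * ln (real m) * real m powr (1 / r)"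
      "\<And>j. j < m \<Longrightarrow> \<epsilon> / 2 / 4 \<le> g j (vabs L u)"
      using C(2)[OF m(1), of "\<epsilon> / 2" "\<lambda>j u. g j (vabs L u)"] \<epsilon> sn big by auto
    define S where "S = vpsum ?D g m"
    have SV: "S \<in> vcarrier ?D" unfolding S_def using g(1) by (rule D.vpsum_closed)
    have val: "vpsum ?D g k x = (\<Sum>j<k. g j x)" if "x \<in> vcarrier L" for k x
      using that by (induction k) auto
    have m0: "real m > 0" "ln (real m) > 0" using m(1) by auto
    have "real m * (\<epsilon> / 8) = (\<Sum>j<m. \<epsilon> / 8)" by simp
    also have "\<dots> \<le> (\<Sum>j<m. g j u)" using u by (intro sum_mono) (auto simp: L.vabs_of_nonneg)
    also have "\<dots> = S u" using val[OF u(1)] by (simp add: S_def)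
    also have "\<dots> \<le> op_norm_on L real_line S * vnorm L u" using L.dual_norm_bound[OF SV u(1)] by simp
    also have "\<dots> \<le> op_norm_on L real_line S * (C * ln (real m) * real m powr (1 / r))"
      using u(3) L.dual_norm_nonneg[OF SV] by (rule mult_left_mono)
    also have "\<dots> \<le> op_norm_on L real_line S * (C * (real m powr \<delta> / \<delta>) * real m powr (1 / r))"
      using m(1) C(1) \<delta> L.dual_norm_nonneg[OF SV]
      by (intro mult_left_mono mult_right_mono ln_powr_bound) auto
    finally have 1: "real m * (\<epsilon> / 8) \<le> op_norm_on L real_line S * (C * (real m powr \<delta> / \<delta>) * real m powr (1 / r))" .
    have "\<bar>K\<bar> * real m powr \<sigma> * (C * (real m powr \<delta> / \<delta>) * real m powr (1 / r))
       < (\<epsilon> * \<delta> / (8 * C)) * real m powr \<delta> * real m powr \<sigma> * (C * (real m powr \<delta> / \<delta>) * real m powr (1 / r))"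
      using m(2) m0 C(1) \<delta> by (intro mult_strict_right_mono) auto
    also have "\<dots> = (\<epsilon> / 8) * (real m powr \<delta> * real m powr \<sigma> * real m powr \<delta> * real m powr (1 / r))"
      using C(1) \<delta> by (simp add: field_simps)
    also have "real m powr \<delta> * real m powr \<sigma> * real m powr \<delta> * real m powr (1 / r) = real m powr 1"
    proof -
      have "\<delta> + \<sigma> + \<delta> + 1 / r = 1" by (simp add: \<delta>_def field_simps)
      then show ?thesis by (simp only: powr_add[symmetric])
    qed
    finally have "\<bar>K\<bar> * real m powr \<sigma> * (C * (real m powr \<delta> / \<delta>) * real m powr (1 / r)) <
        op_norm_on L real_line S * (C * (real m powr \<delta> / \<delta>) * real m powr (1 / r))" using 1 m0 by (simp add: mult.commute)
    then have "\<bar>K\<bar> * real m powr \<sigma> < op_norm_on L real_line S"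
      using m0 C(1) \<delta> by (subst (asm) mult_less_cancel_right_pos) auto
    moreover have "K * real m powr \<sigma> \<le> \<bar>K\<bar> * real m powr \<sigma>" by (intro mult_right_mono) auto
    ultimately show "K * real m powr \<sigma> < vnorm ?D (vpsum ?D g m)" by (simp add: S_def)
  qed
qed

section \<open>The spaces \<open>L\<^sub>p\<close> and \<open>\<ell>\<^sub>p\<close>\<close>

text \<open>Convexity of the power function settles positive arguments; if one of them is zero, the
  claim comes down to \<open>l powr p \<le> l\<close> on the unit interval.\<close>

lemma powr_convex_ineq:
  fixes u v l p :: real
  assumes "p \<ge> 1" "0 \<le> u" "0 \<le> v" "0 \<le> l" "l \<le> 1"
  shows "(l * u + (1 - l) * v) powr p \<le> l * u powr p + (1 - l) * v powr p"
proof -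
  have z: "(l * u) powr p \<le> l * u powr p" if "0 \<le> l" "l \<le> 1" "u \<ge> 0" for l u
  proof -
    have "l powr p \<le> l" using that assms(1) powr_mono'[of 1 p l] by simp
    then show ?thesis using that by (simp add: powr_mult mult_right_mono)
  qed
  consider "u = 0" | "v = 0" | "u > 0" "v > 0" using assms by linarith
  then show ?thesis
  proof cases
    case 1 then show ?thesis using z[of "1 - l" v] assms by simp
  next
    case 2 then show ?thesis using z[of l u] assms by simp
  next
    case 3
    have "((1 - l) *\<^sub>R v + l *\<^sub>R u) powr p \<le> (1 - l) * v powr p + l * u powr p"
      by (rule convex_onD[OF powr_convex[OF assms(1)]]) (use 3 assms in auto)
    then show ?thesis by (simp add: algebra_simps)
  qed
qed

lemma abs_add_powr_le:
  fixes a b p :: real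
  assumes "p \<ge> 1"
  shows "\<bar>a + b\<bar> powr p \<le> 2 powr p * (\<bar>a\<bar> powr p + \<bar>b\<bar> powr p)"
proof -
  have "\<bar>a + b\<bar> powr p \<le> (2 * max \<bar>a\<bar> \<bar>b\<bar>) powr p" using assms by (intro powr_mono2) auto
  also have "\<dots> = 2 powr p * max \<bar>a\<bar> \<bar>b\<bar> powr p" by (simp add: powr_mult)
  also have "max \<bar>a\<bar> \<bar>b\<bar> powr p \<le> \<bar>a\<bar> powr p + \<bar>b\<bar> powr p" by (auto simp: max_def)
  finally show ?thesis by simp
qed

text \<open>Functions before the passage to classes. With the counting measure they also describe
  \<open>lp_space\<close>, so both kinds of spaces share one set of inequalities.\<close>

definition Lp_fun :: "real \<Rightarrow> 'a measure \<Rightarrow> ('a \<Rightarrow> real) set" where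
  "Lp_fun p M = {f \<in> borel_measurable M. integrable M (\<lambda>t. \<bar>f t\<bar> powr p)}"

definition Lp_norm :: "real \<Rightarrow> 'a measure \<Rightarrow> ('a \<Rightarrow> real) \<Rightarrow> real" where
  "Lp_norm p M f = (\<integral>t. \<bar>f t\<bar> powr p \<partial>M) powr (1 / p)"

lemma Lp_funD: "f \<in> Lp_fun p M \<Longrightarrow> f \<in> borel_measurable M" "f \<in> Lp_fun p M \<Longrightarrow> integrable M (\<lambda>t. \<bar>f t\<bar> powr p)"
  by (simp_all add: Lp_fun_def)

lemma Lp_norm_powr: "p > 0 \<Longrightarrow> Lp_norm p M f powr p = (\<integral>t. \<bar>f t\<bar> powr p \<partial>M)"
  by (simp add: Lp_norm_def powr_powr)

lemma Lp_norm_nonneg: "0 \<le> Lp_norm p M f"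
  by (simp add: Lp_norm_def)

lemma Lp_norm_le_iff:
  assumes "p > 0" "0 \<le> c" shows "Lp_norm p M f \<le> c \<longleftrightarrow> (\<integral>t. \<bar>f t\<bar> powr p \<partial>M) \<le> c powr p"
proof
  assume "Lp_norm p M f \<le> c"
  then have "Lp_norm p M f powr p \<le> c powr p" using assms Lp_norm_nonneg by (intro powr_mono2) auto
  then show "(\<integral>t. \<bar>f t\<bar> powr p \<partial>M) \<le> c powr p" using assms by (simp add: Lp_norm_powr)
next
  assume "(\<integral>t. \<bar>f t\<bar> powr p \<partial>M) \<le> c powr p"
  then have "Lp_norm p M f \<le> (c powr p) powr (1 / p)"
    unfolding Lp_norm_def using assms by (intro powr_mono2) auto
  then show "Lp_norm p M f \<le> c" using assms by (simp add: powr_powr)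
qed

lemma Lp_norm_mono:
  assumes "p > 0" "f \<in> Lp_fun p M" "g \<in> Lp_fun p M" "AE t in M. \<bar>f t\<bar> \<le> \<bar>g t\<bar>"
  shows "Lp_norm p M f \<le> Lp_norm p M g"
  unfolding Lp_norm_def
proof (rule powr_mono2)
  show "(\<integral>t. \<bar>f t\<bar> powr p \<partial>M) \<le> (\<integral>t. \<bar>g t\<bar> powr p \<partial>M)"
    by (rule integral_mono_AE) (use assms Lp_funD in \<open>auto elim!: eventually_mono intro!: powr_mono2\<close>)
qed (use assms in auto)

lemma Lp_norm_cong_AE:
  assumes "f \<in> borel_measurable M" "g \<in> borel_measurable M" "AE t in M. f t = g t"
  shows "Lp_norm p M f = Lp_norm p M g"
proof -
  have "(\<integral>t. \<bar>f t\<bar> powr p \<partial>M) = (\<integral>t. \<bar>g t\<bar> powr p \<partial>M)"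
    by (rule integral_cong_AE) (use assms in \<open>auto elim!: eventually_mono\<close>)
  then show ?thesis by (simp add: Lp_norm_def)
qed

lemma Lp_fun_cong_AE:
  assumes "f \<in> Lp_fun p M" "g \<in> borel_measurable M" "AE t in M. f t = g t"
  shows "g \<in> Lp_fun p M"
proof -
  have "integrable M (\<lambda>t. \<bar>g t\<bar> powr p)"
    by (rule integrable_cong_AE_imp[OF Lp_funD(2)[OF assms(1)]])
      (use assms Lp_funD in \<open>auto elim!: eventually_mono\<close>)
  then show ?thesis using assms by (simp add: Lp_fun_def)
qed

lemma Lp_fun_zero: "(\<lambda>t. 0) \<in> Lp_fun p M"
  by (simp add: Lp_fun_def)

lemma Lp_fun_add:
  assumes p: "p \<ge> 1" and f: "f \<in> Lp_fun p M" and g: "g \<in> Lp_fun p M"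
  shows "(\<lambda>t. f t + g t) \<in> Lp_fun p M"
proof -
  note [measurable] = Lp_funD(1)[OF f] Lp_funD(1)[OF g]
  have "integrable M (\<lambda>t. \<bar>f t + g t\<bar> powr p)"
  proof (rule Bochner_Integration.integrable_bound)
    show "integrable M (\<lambda>t. 2 powr p * (\<bar>f t\<bar> powr p + \<bar>g t\<bar> powr p))"
      using Lp_funD(2)[OF f] Lp_funD(2)[OF g] by simp
    show "AE t in M. norm (\<bar>f t + g t\<bar> powr p) \<le> norm (2 powr p * (\<bar>f t\<bar> powr p + \<bar>g t\<bar> powr p))"
      using abs_add_powr_le[OF p] by (intro AE_I2) auto
  qed measurable
  then show ?thesis by (simp add: Lp_fun_def)
qed

lemma Lp_fun_scale: "f \<in> Lp_fun p M \<Longrightarrow> (\<lambda>t. a * f t) \<in> Lp_fun p M"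
  by (auto simp: Lp_fun_def abs_mult powr_mult)

lemma Lp_norm_scale: "p > 0 \<Longrightarrow> Lp_norm p M (\<lambda>t. a * f t) = \<bar>a\<bar> * Lp_norm p M f"
  by (simp add: Lp_norm_def abs_mult powr_mult powr_powr)

lemma Lp_fun_bounded:
  assumes p: "p > 0" and f: "f \<in> Lp_fun p M" and g: "g \<in> borel_measurable M"
    and le: "AE t in M. \<bar>g t\<bar> \<le> \<bar>f t\<bar>"
  shows "g \<in> Lp_fun p M"
proof -
  note [measurable] = g Lp_funD(1)[OF f]
  have "integrable M (\<lambda>t. \<bar>g t\<bar> powr p)"
  proof (rule Bochner_Integration.integrable_bound[OF Lp_funD(2)[OF f]])
    show "AE t in M. norm (\<bar>g t\<bar> powr p) \<le> norm (\<bar>f t\<bar> powr p)"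
      using le by eventually_elim (use p in \<open>auto intro!: powr_mono2\<close>)
  qed measurable
  then show ?thesis using g by (simp add: Lp_fun_def)
qed

lemma Lp_fun_abs: "f \<in> Lp_fun p M \<Longrightarrow> (\<lambda>t. \<bar>f t\<bar>) \<in> Lp_fun p M"
  by (auto simp: Lp_fun_def)

lemma Lp_norm_eq_0:
  assumes "p > 0" "f \<in> Lp_fun p M" "Lp_norm p M f = 0"
  shows "AE t in M. f t = 0"
proof -
  have "(\<integral>t. \<bar>f t\<bar> powr p \<partial>M) = 0" using Lp_norm_powr[OF assms(1), of M f] assms(3) by simp
  then have "AE t in M. \<bar>f t\<bar> powr p = 0"
    using integral_nonneg_eq_0_iff_AE[OF Lp_funD(2)[OF assms(2)]] by simp
  then show ?thesis by (auto elim!: eventually_mono)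
qed

text \<open>With \<open>a\<close> and \<open>b\<close> the two norms, convexity of the power is
  applied to \<open>\<bar>f t\<bar> / a\<close> and \<open>\<bar>g t\<bar> / b\<close> with weight
  \<open>a / (a + b)\<close>.\<close>

lemma Minkowski_Lp:
  assumes p: "p \<ge> 1" and f: "f \<in> Lp_fun p M" and g: "g \<in> Lp_fun p M"
  shows "Lp_norm p M (\<lambda>t. f t + g t) \<le> Lp_norm p M f + Lp_norm p M g"
proof -
  define a b where "a = Lp_norm p M f" and "b = Lp_norm p M g"
  have ab: "a \<ge> 0" "b \<ge> 0" by (auto simp: a_def b_def Lp_norm_nonneg)
  have p0: "p > 0" using p by simp
  note m = Lp_funD(1)[OF f] Lp_funD(1)[OF g]
  consider "a = 0" | "b = 0" | "a > 0" "b > 0" using ab by linarith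
  then show ?thesis
  proof cases
    case 1
    then have "AE t in M. f t + g t = g t"
      using Lp_norm_eq_0[OF p0 f] by (auto simp: a_def elim!: eventually_mono)
    then have "Lp_norm p M (\<lambda>t. f t + g t) = b" unfolding b_def using m by (intro Lp_norm_cong_AE) auto
    then show ?thesis using ab by (simp add: a_def b_def)
  next
    case 2
    then have "AE t in M. f t + g t = f t"
      using Lp_norm_eq_0[OF p0 g] by (auto simp: b_def elim!: eventually_mono)
    then have "Lp_norm p M (\<lambda>t. f t + g t) = a" unfolding a_def using m by (intro Lp_norm_cong_AE) auto
    then show ?thesis using ab by (simp add: a_def b_def)
  next
    case 3
    define l where "l = a / (a + b)"
    have l: "0 \<le> l" "l \<le> 1" "1 - l = b / (a + b)" using 3 by (auto simp: l_def field_simps)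
    define H where "H t = (a + b) powr p * (l * (\<bar>f t\<bar> powr p / a powr p) + (1 - l) * (\<bar>g t\<bar> powr p / b powr p))" for t
    have pt: "\<bar>f t + g t\<bar> powr p \<le> H t" for t
    proof -
      have "\<bar>f t + g t\<bar> \<le> (a + b) * (l * (\<bar>f t\<bar> / a) + (1 - l) * (\<bar>g t\<bar> / b))"
      proof -
        have "(a + b) * (l * (\<bar>f t\<bar> / a) + (1 - l) * (\<bar>g t\<bar> / b)) = \<bar>f t\<bar> + \<bar>g t\<bar>"
          unfolding l(3) unfolding l_def using 3 by (simp add: distrib_left)
        then show ?thesis by simp
      qed
      then have "\<bar>f t + g t\<bar> powr p \<le> ((a + b) * (l * (\<bar>f t\<bar> / a) + (1 - l) * (\<bar>g t\<bar> / b))) powr p"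
        using p by (intro powr_mono2) auto
      also have "\<dots> = (a + b) powr p * (l * (\<bar>f t\<bar> / a) + (1 - l) * (\<bar>g t\<bar> / b)) powr p"
        by (simp add: powr_mult)
      also have "\<dots> \<le> (a + b) powr p * (l * (\<bar>f t\<bar> / a) powr p + (1 - l) * (\<bar>g t\<bar> / b) powr p)"
        using 3 l p by (intro mult_left_mono powr_convex_ineq) auto
      finally show ?thesis using 3 by (simp add: H_def powr_divide)
    qed
    have fi: "integrable M (\<lambda>t. \<bar>f t\<bar> powr p)" and gi: "integrable M (\<lambda>t. \<bar>g t\<bar> powr p)"
      using f g by (auto dest: Lp_funD)
    have Hi: "integrable M H" unfolding H_def using fi gi by simp
    have "(\<integral>t. \<bar>f t + g t\<bar> powr p \<partial>M) \<le> (\<integral>t. H t \<partial>M)"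
      using pt Lp_funD(2)[OF Lp_fun_add[OF p f g]] Hi by (intro integral_mono) auto
    also have "\<dots> = (a + b) powr p * (l * ((\<integral>t. \<bar>f t\<bar> powr p \<partial>M) / a powr p) + (1 - l) * ((\<integral>t. \<bar>g t\<bar> powr p \<partial>M) / b powr p))"
      unfolding H_def using fi gi by simp
    also have "\<dots> = (a + b) powr p"
      using 3 p0 by (simp add: a_def b_def flip: Lp_norm_powr)
    finally show ?thesis using Lp_norm_le_iff[OF p0, of "a + b" M "\<lambda>t. f t + g t"] ab by (simp add: a_def b_def)
  qed
qed

text \<open>The witness is the pointwise \<open>p\<close>-norm of the family: it lies above every
  modulus, and its \<open>p\<close>-th power integrates term by term.\<close>

lemma Lp_upper_bound_finite:
  fixes m :: nat
  assumes p: "p > 0" and f: "\<And>j. j < m \<Longrightarrow> f j \<in> Lp_fun p M"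
  shows "\<exists>w\<in>Lp_fun p M. (\<forall>t. 0 \<le> w t) \<and> (\<forall>j<m. \<forall>t. \<bar>f j t\<bar> \<le> w t) \<and>
    Lp_norm p M w powr p = (\<Sum>j<m. Lp_norm p M (f j) powr p)"
proof -
  define w where "w = (\<lambda>t. (\<Sum>j<m. \<bar>f j t\<bar> powr p) powr (1 / p))"
  have meas [measurable]: "f j \<in> borel_measurable M" if "j < m" for j using f[OF that] by (rule Lp_funD)
  have wp: "\<bar>w t\<bar> powr p = (\<Sum>j<m. \<bar>f j t\<bar> powr p)" for t
    using p by (simp add: w_def powr_powr sum_nonneg)
  show ?thesis
  proof (intro bexI conjI allI impI)
    show "w \<in> Lp_fun p M" unfolding Lp_fun_def mem_Collect_eq wp
    proof
      have "w = (\<lambda>t. \<bar>\<Sum>j<m. \<bar>f j t\<bar> powr p\<bar> powr (1 / p))" by (simp add: w_def fun_eq_iff sum_nonneg)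
      also have "\<dots> \<in> borel_measurable M"
        by (intro measurable_abs_powr borel_measurable_sum) (auto intro: meas)
      finally show "w \<in> borel_measurable M" .
      show "integrable M (\<lambda>t. \<Sum>j<m. \<bar>f j t\<bar> powr p)" using f by (intro Bochner_Integration.integrable_sum) (auto dest: Lp_funD)
    qed
    show "0 \<le> w t" for t by (simp add: w_def)
    show "\<bar>f j t\<bar> \<le> w t" if j: "j < m" for j t
    proof -
      have "\<bar>f j t\<bar> = (\<bar>f j t\<bar> powr p) powr (1 / p)" using p by (simp add: powr_powr)
      also have "\<dots> \<le> w t" unfolding w_def
        using p j by (intro powr_mono2 member_le_sum) auto
      finally show ?thesis .
    qed
    show "Lp_norm p M w powr p = (\<Sum>j<m. Lp_norm p M (f j) powr p)"
      unfolding Lp_norm_powr[OF p] wp using f by (intro Bochner_Integration.integral_sum) (auto dest: Lp_funD)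
  qed
qed

text \<open>The counterpart of \<open>ex_geometric_upper_bound\<close>, by monotone convergence:
  almost everywhere \<open>w powr p\<close> is the sum of the series of
  \<open>\<bar>f j t\<bar> powr p / 2 ^ j\<close>, and \<open>2 ^ j \<le> (2 ^ j) powr p\<close>
  because \<open>p \<ge> 1\<close>.\<close>

lemma Lp_upper_bound_geometric:
  fixes f :: "nat \<Rightarrow> 'a \<Rightarrow> real"
  assumes p: "p \<ge> 1" and f: "\<And>j. f j \<in> Lp_fun p M" and f1: "\<And>j. Lp_norm p M (f j) \<le> 1"
  shows "\<exists>w\<in>Lp_fun p M. (\<forall>t. 0 \<le> w t) \<and> (AE t in M. \<forall>j. \<bar>f j t\<bar> / 2 ^ j \<le> w t)"
proof -
  have p0: "p > 0" using p by simp
  have meas [measurable]: "f j \<in> borel_measurable M" for j using f by (rule Lp_funD)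
  define F where "F j t = \<bar>f j t\<bar> powr p / 2 ^ j" for j t
  have Fi: "integrable M (F j)" for j unfolding F_def using Lp_funD(2)[OF f[of j]] by simp
  have F0: "0 \<le> F j t" for j t by (simp add: F_def)
  have [measurable]: "F j \<in> borel_measurable M" for j using Fi by blast
  have F1: "(\<integral>t. F j t \<partial>M) \<le> (1 / 2) ^ j" for j
    using Lp_norm_le_iff[OF p0, of 1 M "f j"] f1[of j] by (simp add: F_def power_one_over divide_right_mono)
  have sI: "summable (\<lambda>j. \<integral>t. norm (F j t) \<partial>M)"
    by (rule summable_comparison_test[OF _ summable_geometric[of "1 / 2 :: real"]]) (use F0 F1 in auto)
  have AEs: "AE t in M. summable (\<lambda>j. norm (F j t))"
  proof -
    have "(\<integral>\<^sup>+t. (\<Sum>j. ennreal (F j t)) \<partial>M) = (\<Sum>j. \<integral>\<^sup>+t. ennreal (F j t) \<partial>M)"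
      by (rule nn_integral_suminf) measurable
    also have "\<dots> = (\<Sum>j. ennreal (\<integral>t. F j t \<partial>M))"
      using Fi F0 by (simp add: nn_integral_eq_integral)
    also have "\<dots> \<noteq> top"
      using sI F0 by (simp add: ennreal_suminf_neq_top)
    finally have "AE t in M. (\<Sum>j. ennreal (F j t)) \<noteq> top"
      using nn_integral_noteq_infinite[of "\<lambda>t. \<Sum>j. ennreal (F j t)" M] by simp
    then show ?thesis
      by eventually_elim (use F0 in \<open>auto intro: summable_suminf_not_top\<close>)
  qed
  define S where "S t = (\<Sum>j. F j t)" for t
  have Si: "integrable M S" unfolding S_def by (rule integrable_suminf[OF Fi AEs sI])
  define w where "w t = \<bar>S t\<bar> powr (1 / p)" for t
  have [measurable]: "S \<in> borel_measurable M" using Si by blast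
  have wp: "\<bar>w t\<bar> powr p = \<bar>S t\<bar>" for t using p0 by (simp add: w_def powr_powr)
  show ?thesis
  proof (intro bexI conjI allI)
    show "w \<in> Lp_fun p M" unfolding Lp_fun_def mem_Collect_eq wp
      using Si by (auto simp: w_def[abs_def] intro!: integrable_abs)
    show "0 \<le> w t" for t by (simp add: w_def)
    show "AE t in M. \<forall>j. \<bar>f j t\<bar> / 2 ^ j \<le> w t"
      using AEs
    proof eventually_elim
      fix t assume s: "summable (\<lambda>j. norm (F j t))"
      show "\<forall>j. \<bar>f j t\<bar> / 2 ^ j \<le> w t"
      proof
        fix j
        have s': "summable (\<lambda>j. F j t)" using s F0 by simp
        have "F j t \<le> S t" unfolding S_def using sum_le_suminf[OF s', of "{j}"] F0 by simp
        have "(\<bar>f j t\<bar> / 2 ^ j) powr p \<le> F j t"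
        proof -
          have "(2::real) ^ j \<le> (2 ^ j) powr p" using p powr_mono[of 1 p "2 ^ j :: real"] by simp
          then show ?thesis by (simp add: F_def powr_divide divide_left_mono)
        qed
        with \<open>F j t \<le> S t\<close> have "(\<bar>f j t\<bar> / 2 ^ j) powr p \<le> \<bar>S t\<bar>" by simp
        then have "((\<bar>f j t\<bar> / 2 ^ j) powr p) powr (1 / p) \<le> w t" unfolding w_def using p0 by (intro powr_mono2) auto
        then show "\<bar>f j t\<bar> / 2 ^ j \<le> w t" using p0 by (simp add: powr_powr)
      qed
    qed
  qed
qed

text \<open>The properties of a domain behind the automatic boundedness of positive operators: a
  substitute for moduli and a substitute for completeness. Both kinds of
  \<open>\<ell>\<^sub>p\<close> and \<open>L\<^sub>p\<close> spaces and all Banach lattices have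
  them.\<close>

definition solid_domain :: "('a, 'm) nlattice_scheme \<Rightarrow> bool" where
  "solid_domain E \<longleftrightarrow> ordered_normed_space_on E \<and>
     (\<forall>x\<in>vcarrier E. \<exists>y\<in>vcarrier E. vle E (vneg E y) x \<and> vle E x y \<and> vnorm E y \<le> vnorm E x) \<and>
     (\<forall>x :: nat \<Rightarrow> 'a. (\<forall>j. x j \<in> vball E \<and> vle E (vzero E) (x j)) \<longrightarrow>
        (\<exists>w\<in>vcarrier E. vle E (vzero E) w \<and> (\<forall>j. vle E (vscale E (1 / 2 ^ j) (x j)) w)))"

text \<open>The bound for maxima of \<open>m\<close> vectors of the unit ball. In contrast to
  \<open>upper_estimate\<close> its constant is 1, and some upper bound is asked for instead of the
  supremum.\<close>

definition upper_bounds :: "real \<Rightarrow> ('a, 'm) nlattice_scheme \<Rightarrow> bool" where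
  "upper_bounds p E \<longleftrightarrow> (\<forall>m::nat. \<forall>x. (\<forall>j<m. x j \<in> vball E \<and> vle E (vzero E) (x j)) \<longrightarrow>
     (\<exists>w\<in>vcarrier E. vle E (vzero E) w \<and> vnorm E w \<le> real m powr (1 / p) \<and> (\<forall>j<m. vle E (x j) w)))"

lemma solid_domain_banach_lattice: "banach_lattice_on E \<Longrightarrow> solid_domain E"
proof -
  assume "banach_lattice_on E"
  then interpret banach_lattice_on E .
  have "\<exists>y\<in>V. \<ominus> y \<preceq> x \<and> x \<preceq> y \<and> \<parallel>y\<parallel> \<le> \<parallel>x\<parallel>" if "x \<in> V" for x
    using that le_vabs neg_le_vabs neg_le_swap norm_vabs by (intro bexI[of _ "\<bar>x\<bar>\<^sub>E"]) auto
  then show ?thesis unfolding solid_domain_def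
    using ordered_normed_space_on_axioms ex_geometric_upper_bound by (simp add: vball_def)
qed

section \<open>The sequence spaces\<close>

lemma lp_simps [simp]:
  "vzero (lp_space p) = (\<lambda>k. 0)" "vadd (lp_space p) = (\<lambda>x y k. x k + y k)"
  "vscale (lp_space p) = (\<lambda>a x k. a * x k)" "vle (lp_space p) = (\<lambda>x y. \<forall>k. x k \<le> y k)"
  "vneg (lp_space p) x = (\<lambda>k. - x k)"
  by (simp_all add: lp_space_def vneg_def)

text \<open>Through the counting measure the estimates for integrals carry over to
  sequences.\<close>

lemma lp_carrier: "vcarrier (lp_space p) = Lp_fun p (count_space UNIV)"
  by (simp add: lp_space_def Lp_fun_def integrable_count_space_nat_iff)

lemma lp_carrier_iff: "x \<in> vcarrier (lp_space p) \<longleftrightarrow> summable (\<lambda>k. \<bar>x k\<bar> powr p)"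
  by (simp add: lp_space_def)

lemma lp_norm: "x \<in> vcarrier (lp_space p) \<Longrightarrow> vnorm (lp_space p) x = Lp_norm p (count_space UNIV) x"
  by (simp add: lp_space_def Lp_norm_def integral_count_space_nat integrable_count_space_nat_iff)

lemma ordered_normed_space_on_lp:
  assumes p: "p \<ge> 1" shows "ordered_normed_space_on (lp_space p)"
proof -
  let ?E = "lp_space p"
  have p0: "p > 0" using p by simp
  have add: "vadd ?E x y \<in> vcarrier ?E" if "x \<in> vcarrier ?E" "y \<in> vcarrier ?E" for x y
    using that Lp_fun_add[OF p] by (simp add: lp_carrier)
  have scale: "vscale ?E a x \<in> vcarrier ?E" if "x \<in> vcarrier ?E" for a x
    using that Lp_fun_scale by (simp add: lp_carrier)
  show ?thesis
  proof
    show z: "vzero ?E \<in> vcarrier ?E" by (simp add: lp_carrier Lp_fun_zero)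
    fix x assume x: "x \<in> vcarrier ?E"
    show "0 \<le> vnorm ?E x" using x by (simp add: lp_norm Lp_norm_nonneg)
    show "(vnorm ?E x = 0) = (x = vzero ?E)"
    proof
      assume "vnorm ?E x = 0"
      then have "AE k in count_space UNIV. x k = 0"
        using x Lp_norm_eq_0[OF p0, of x "count_space UNIV"] by (simp add: lp_norm lp_carrier)
      then show "x = vzero ?E" by (simp add: AE_count_space fun_eq_iff)
    next
      assume "x = vzero ?E"
      then show "vnorm ?E x = 0" using p0 z by (simp add: lp_norm Lp_norm_def)
    qed
    show "vnorm ?E (vscale ?E a x) = \<bar>a\<bar> * vnorm ?E x" for a
      using x scale[OF x, of a] Lp_norm_scale[OF p0] by (simp add: lp_norm)
    fix y assume y: "y \<in> vcarrier ?E"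
    show "vnorm ?E (vadd ?E x y) \<le> vnorm ?E x + vnorm ?E y"
      using x y add[OF x y] Minkowski_Lp[OF p] by (simp add: lp_norm) (simp add: lp_carrier)
    show "vnorm ?E x \<le> vnorm ?E y" if "vle ?E (vneg ?E y) x" "vle ?E x y"
    proof -
      have "\<bar>x k\<bar> \<le> \<bar>y k\<bar>" for k using that by (smt (verit) lp_simps)
      then show ?thesis unfolding lp_norm[OF x] lp_norm[OF y]
        using x y p0 by (intro Lp_norm_mono) (auto simp: lp_carrier)
    qed
  qed (use add scale in \<open>auto simp: algebra_simps fun_eq_iff intro: order_trans antisym\<close>)
qed

lemma solid_domain_lp:
  assumes p: "p \<ge> 1" shows "solid_domain (lp_space p)"
  unfolding solid_domain_def
proof (intro conjI ballI allI impI ordered_normed_space_on_lp p)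
  let ?E = "lp_space p"
  fix x assume x: "x \<in> vcarrier ?E"
  then have "(\<lambda>k. \<bar>x k\<bar>) \<in> vcarrier ?E" by (simp add: lp_carrier Lp_fun_abs)
  then show "\<exists>y\<in>vcarrier ?E. vle ?E (vneg ?E y) x \<and> vle ?E x y \<and> vnorm ?E y \<le> vnorm ?E x"
    using x by (intro bexI[of _ "\<lambda>k. \<bar>x k\<bar>"]) (auto simp: lp_norm Lp_norm_def)
next
  let ?E = "lp_space p"
  fix x :: "nat \<Rightarrow> nat \<Rightarrow> real" assume x: "\<forall>j. x j \<in> vball ?E \<and> vle ?E (vzero ?E) (x j)"
  then have xb: "x j \<in> vcarrier ?E" "vnorm ?E (x j) \<le> 1" for j by (simp_all add: vball_def)
  then have "x j \<in> Lp_fun p (count_space UNIV)" "Lp_norm p (count_space UNIV) (x j) \<le> 1" for j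
    using xb(1)[of j] xb(2)[of j] by (simp_all add: lp_norm) (simp_all add: lp_carrier)
  then obtain w where w: "w \<in> Lp_fun p (count_space UNIV)" "\<And>t. 0 \<le> w t"
    "AE t in count_space UNIV. \<forall>j. \<bar>x j t\<bar> / 2 ^ j \<le> w t"
    using Lp_upper_bound_geometric[OF p, of x "count_space UNIV"] by blast
  have "x j t / 2 ^ j \<le> w t" for j t
    using w(3) by (auto simp: AE_count_space intro: order_trans[OF divide_right_mono[OF abs_ge_self]])
  then show "\<exists>w\<in>vcarrier ?E. vle ?E (vzero ?E) w \<and> (\<forall>j. vle ?E (vscale ?E (1 / 2 ^ j) (x j)) w)"
    using w by (intro bexI[of _ w]) (auto simp: lp_carrier)
qed

section \<open>The function spaces modulo equality almost everywhere\<close>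

lemma AE_ae_rep:
  assumes "f \<in> borel_measurable M"
  shows "ae_rep (ae_class M f) \<in> borel_measurable M" "AE t in M. ae_rep (ae_class M f) t = f t"
proof -
  have "f \<in> ae_class M f" using assms by (simp add: ae_class_def)
  then have "ae_rep (ae_class M f) \<in> ae_class M f" unfolding ae_rep_def by (metis someI)
  then show "ae_rep (ae_class M f) \<in> borel_measurable M" "AE t in M. ae_rep (ae_class M f) t = f t"
    by (auto simp: ae_class_def)
qed

lemma ae_class_eqI:
  assumes "AE t in M. f t = g t" shows "ae_class M f = ae_class M g"
  unfolding ae_class_def using assms by (auto elim: eventually_elim2)

lemma Lp_carrier: "vcarrier (Lp_space p M) = ae_class M ` Lp_fun p M"
  by (auto simp: Lp_space_def Lp_fun_def)

lemma Lp_simps [simp]: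
  "vzero (Lp_space p M) = ae_class M (\<lambda>t. 0)"
  "vadd (Lp_space p M) = (\<lambda>C D. ae_class M (\<lambda>t. ae_rep C t + ae_rep D t))"
  "vscale (Lp_space p M) = (\<lambda>a C. ae_class M (\<lambda>t. a * ae_rep C t))"
  "vle (Lp_space p M) = (\<lambda>C D. AE t in M. ae_rep C t \<le> ae_rep D t)"
  "vnorm (Lp_space p M) C = Lp_norm p M (ae_rep C)"
  "vneg (Lp_space p M) C = ae_class M (\<lambda>t. - ae_rep C t)"
  by (simp_all add: Lp_space_def vneg_def Lp_norm_def)

lemma Lp_rep:
  assumes "C \<in> vcarrier (Lp_space p M)"
  shows "ae_rep C \<in> Lp_fun p M" "ae_class M (ae_rep C) = C"
proof -
  obtain f where f: "f \<in> Lp_fun p M" "C = ae_class M f" using assms by (auto simp: Lp_carrier)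
  have r: "ae_rep C \<in> borel_measurable M" "AE t in M. ae_rep C t = f t"
    using AE_ae_rep[OF Lp_funD(1)[OF f(1)]] f(2) by auto
  have "AE t in M. f t = ae_rep C t" using r(2) by (auto elim: eventually_mono)
  then show "ae_rep C \<in> Lp_fun p M" by (rule Lp_fun_cong_AE[OF f(1) r(1)])
  show "ae_class M (ae_rep C) = C" unfolding f(2) using r(2) by (intro ae_class_eqI) (simp add: f(2))
qed

lemma Lp_closed: "f \<in> Lp_fun p M \<Longrightarrow> ae_class M f \<in> vcarrier (Lp_space p M)"
  by (simp add: Lp_carrier)

lemma Lp_norm_rep: "f \<in> borel_measurable M \<Longrightarrow> Lp_norm p M (ae_rep (ae_class M f)) = Lp_norm p M f"
  using AE_ae_rep[of f M] by (intro Lp_norm_cong_AE) auto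

text \<open>Reduces equations between classes to equations almost everywhere between
  representatives, the form in which the vector space axioms are checked.\<close>

lemma Lp_eqI:
  assumes "C \<in> vcarrier (Lp_space p M)" "D \<in> vcarrier (Lp_space p M)"
    and "AE t in M. ae_rep C t = ae_rep D t"
  shows "C = D"
  using ae_class_eqI[OF assms(3)] Lp_rep(2)[OF assms(1)] Lp_rep(2)[OF assms(2)] by simp

lemma normed_lattice_on_Lp:
  fixes M :: "'a measure"
  assumes p: "p \<ge> 1" shows "normed_lattice_on (Lp_space p M)"
proof -
  let ?E = "Lp_space p M"
  have p0: "p > 0" using p by simp
  note m = Lp_funD(1)[OF Lp_rep(1)]
  have cadd: "(\<lambda>t. ae_rep x t + ae_rep y t) \<in> Lp_fun p M" if "x \<in> vcarrier ?E" "y \<in> vcarrier ?E" for x y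
    using that by (intro Lp_fun_add[OF p] Lp_rep)
  have cscale: "(\<lambda>t. a * ae_rep x t) \<in> Lp_fun p M" if "x \<in> vcarrier ?E" for a x
    using that by (intro Lp_fun_scale Lp_rep)
  have cabs: "(\<lambda>t. \<bar>ae_rep x t\<bar>) \<in> Lp_fun p M" if "x \<in> vcarrier ?E" for x
    using that by (intro Lp_fun_abs Lp_rep)
  have cmax: "(\<lambda>t. max (ae_rep x t) (ae_rep y t)) \<in> Lp_fun p M" "(\<lambda>t. min (ae_rep x t) (ae_rep y t)) \<in> Lp_fun p M"
    if x: "x \<in> vcarrier ?E" and y: "y \<in> vcarrier ?E" for x y
    using m[OF x] m[OF y] by (auto intro!: Lp_fun_bounded[OF p0 Lp_fun_add[OF p cabs[OF x] cabs[OF y]]])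
  have radd: "AE t in M. ae_rep (vadd ?E x y) t = ae_rep x t + ae_rep y t"
    if "x \<in> vcarrier ?E" "y \<in> vcarrier ?E" for x y
    using AE_ae_rep(2)[OF Lp_funD(1)[OF cadd[OF that]]] by simp
  have rscale: "AE t in M. ae_rep (vscale ?E a x) t = a * ae_rep x t" if "x \<in> vcarrier ?E" for a x
    using AE_ae_rep(2)[OF Lp_funD(1)[OF cscale[OF that]]] by simp
  have rneg: "AE t in M. ae_rep (vneg ?E x) t = - ae_rep x t" if "x \<in> vcarrier ?E" for x
    using rscale[OF that, of "- 1"] by simp
  have rzero: "AE t in M. ae_rep (vzero ?E) t = 0" using AE_ae_rep(2)[of "\<lambda>t. 0" M] by simp
  have add: "vadd ?E x y \<in> vcarrier ?E" if "x \<in> vcarrier ?E" "y \<in> vcarrier ?E" for x y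
    using Lp_closed[OF cadd[OF that]] by simp
  have scale: "vscale ?E a x \<in> vcarrier ?E" if "x \<in> vcarrier ?E" for a x
    using Lp_closed[OF cscale[OF that]] by simp
  have neg: "vneg ?E x \<in> vcarrier ?E" if "x \<in> vcarrier ?E" for x
    using scale[OF that, of "- 1"] by simp
  have zero: "vzero ?E \<in> vcarrier ?E" by (simp add: Lp_closed[OF Lp_fun_zero])
  have pre: "preordered_on ?E"
  proof
    show "vzero ?E \<in> vcarrier ?E" by (rule zero)
    fix x assume x: "x \<in> vcarrier ?E"
    show "vscale ?E a x \<in> vcarrier ?E" for a by (rule scale[OF x])
    show "vadd ?E (vzero ?E) x = x"
    proof (rule Lp_eqI[OF add[OF zero x] x])
      show "AE t in M. ae_rep (vadd ?E (vzero ?E) x) t = ae_rep x t"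
        using radd[OF zero x] rzero by eventually_elim simp
    qed
    show "vadd ?E x (vneg ?E x) = vzero ?E"
    proof (rule Lp_eqI[OF add[OF x neg[OF x]] zero])
      show "AE t in M. ae_rep (vadd ?E x (vneg ?E x)) t = ae_rep (vzero ?E) t"
        using radd[OF x neg[OF x]] rneg[OF x] rzero by eventually_elim simp
    qed
    show "vscale ?E (a + b) x = vadd ?E (vscale ?E a x) (vscale ?E b x)" for a b
    proof (rule Lp_eqI[OF scale[OF x] add[OF scale[OF x] scale[OF x]]])
      show "AE t in M. ae_rep (vscale ?E (a + b) x) t = ae_rep (vadd ?E (vscale ?E a x) (vscale ?E b x)) t"
        using radd[OF scale[OF x, of a] scale[OF x, of b]] rscale[OF x, of a] rscale[OF x, of b] rscale[OF x, of "a + b"]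
        by eventually_elim (simp add: algebra_simps)
    qed
    show "vscale ?E a (vscale ?E b x) = vscale ?E (a * b) x" for a b
    proof (rule Lp_eqI[OF scale[OF scale[OF x]] scale[OF x]])
      show "AE t in M. ae_rep (vscale ?E a (vscale ?E b x)) t = ae_rep (vscale ?E (a * b) x) t"
        using rscale[OF scale[OF x, of b], of a] rscale[OF x, of b] rscale[OF x, of "a * b"]
        by eventually_elim simp
    qed
    show "vscale ?E 1 x = x"
    proof (rule Lp_eqI[OF scale[OF x] x])
      show "AE t in M. ae_rep (vscale ?E 1 x) t = ae_rep x t" using rscale[OF x, of 1] by eventually_elim simp
    qed
    show "0 \<le> vnorm ?E x" by (simp add: Lp_norm_nonneg)
    show "(vnorm ?E x = 0) = (x = vzero ?E)"
    proof
      assume "vnorm ?E x = 0"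
      then have "AE t in M. ae_rep x t = 0" using Lp_norm_eq_0[OF p0 Lp_rep(1)[OF x]] by simp
      then have "AE t in M. ae_rep x t = ae_rep (vzero ?E) t" using rzero by eventually_elim simp
      then show "x = vzero ?E" by (rule Lp_eqI[OF x zero])
    next
      assume "x = vzero ?E"
      then have "vnorm ?E x = Lp_norm p M (\<lambda>t. 0)" using Lp_norm_rep[of "\<lambda>t. 0" M p] by simp
      then show "vnorm ?E x = 0" using p0 by (simp add: Lp_norm_def)
    qed
    show "vnorm ?E (vscale ?E a x) = \<bar>a\<bar> * vnorm ?E x" for a
      using Lp_norm_rep[OF Lp_funD(1)[OF cscale[OF x, of a]]] Lp_norm_scale[OF p0] by simp
    show "vle ?E x x" by simp
    show "vle ?E (vzero ?E) (vscale ?E a x)" if "vle ?E (vzero ?E) x" "0 \<le> a" for a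
    proof -
      have "AE t in M. ae_rep (vzero ?E) t \<le> ae_rep x t" using that by simp
      then have "AE t in M. ae_rep (vzero ?E) t \<le> ae_rep (vscale ?E a x) t"
        using rzero rscale[OF x, of a] by eventually_elim (use that in simp)
      then show ?thesis by simp
    qed
    fix y assume y: "y \<in> vcarrier ?E"
    show "vadd ?E x y \<in> vcarrier ?E" by (rule add[OF x y])
    show "vadd ?E x y = vadd ?E y x" by (simp add: add.commute)
    show "vscale ?E a (vadd ?E x y) = vadd ?E (vscale ?E a x) (vscale ?E a y)" for a
    proof (rule Lp_eqI[OF scale[OF add[OF x y]] add[OF scale[OF x] scale[OF y]]])
      show "AE t in M. ae_rep (vscale ?E a (vadd ?E x y)) t = ae_rep (vadd ?E (vscale ?E a x) (vscale ?E a y)) t"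
        using rscale[OF add[OF x y], of a] radd[OF x y] radd[OF scale[OF x, of a] scale[OF y, of a]]
          rscale[OF x, of a] rscale[OF y, of a]
        by eventually_elim (simp add: algebra_simps)
    qed
    show "vnorm ?E (vadd ?E x y) \<le> vnorm ?E x + vnorm ?E y"
      using Lp_norm_rep[OF Lp_funD(1)[OF cadd[OF x y]]] Minkowski_Lp[OF p Lp_rep(1)[OF x] Lp_rep(1)[OF y]] by simp
    show "x = y" if "vle ?E x y" "vle ?E y x"
    proof (rule Lp_eqI[OF x y])
      have "AE t in M. ae_rep x t \<le> ae_rep y t" "AE t in M. ae_rep y t \<le> ae_rep x t" using that by simp_all
      then show "AE t in M. ae_rep x t = ae_rep y t" by eventually_elim simp
    qed
    fix z assume z: "z \<in> vcarrier ?E"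
    show "vadd ?E (vadd ?E x y) z = vadd ?E x (vadd ?E y z)"
    proof (rule Lp_eqI[OF add[OF add[OF x y] z] add[OF x add[OF y z]]])
      show "AE t in M. ae_rep (vadd ?E (vadd ?E x y) z) t = ae_rep (vadd ?E x (vadd ?E y z)) t"
        using radd[OF add[OF x y] z] radd[OF x y] radd[OF x add[OF y z]] radd[OF y z]
        by eventually_elim simp
    qed
    show "vle ?E x z" if "vle ?E x y" "vle ?E y z"
    proof -
      have "AE t in M. ae_rep x t \<le> ae_rep y t" "AE t in M. ae_rep y t \<le> ae_rep z t" using that by simp_all
      then have "AE t in M. ae_rep x t \<le> ae_rep z t" by eventually_elim simp
      then show ?thesis by simp
    qed
    show "vle ?E (vadd ?E x z) (vadd ?E y z)" if "vle ?E x y"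
    proof -
      have "AE t in M. ae_rep x t \<le> ae_rep y t" using that by simp
      then have "AE t in M. ae_rep (vadd ?E x z) t \<le> ae_rep (vadd ?E y z) t"
        using radd[OF x z] radd[OF y z] by eventually_elim simp
      then show ?thesis by simp
    qed
  qed
  interpret preordered_on ?E by (rule pre)
  define S where "S x y = ae_class M (\<lambda>t. max (ae_rep x t) (ae_rep y t))" for x y
  define J where "J x y = ae_class M (\<lambda>t. min (ae_rep x t) (ae_rep y t))" for x y
  have S: "S x y \<in> vcarrier ?E" "AE t in M. ae_rep (S x y) t = max (ae_rep x t) (ae_rep y t)"
    and J: "J x y \<in> vcarrier ?E" "AE t in M. ae_rep (J x y) t = min (ae_rep x t) (ae_rep y t)"
    if "x \<in> vcarrier ?E" "y \<in> vcarrier ?E" for x y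
    unfolding S_def J_def using AE_ae_rep(2)[OF Lp_funD(1)] cmax[OF that] Lp_closed by auto
  have sup: "is_vsup ?E x y (S x y)" and inf: "is_vinf ?E x y (J x y)"
    if xy: "x \<in> vcarrier ?E" "y \<in> vcarrier ?E" for x y
  proof -
    have 1: "AE t in M. ae_rep x t \<le> ae_rep (S x y) t" "AE t in M. ae_rep y t \<le> ae_rep (S x y) t"
      using S(2)[OF xy] by (auto elim!: eventually_mono)
    have 2: "AE t in M. ae_rep (J x y) t \<le> ae_rep x t" "AE t in M. ae_rep (J x y) t \<le> ae_rep y t"
      using J(2)[OF xy] by (auto elim!: eventually_mono)
    have 3: "AE t in M. ae_rep (S x y) t \<le> ae_rep w t"
      if "AE t in M. ae_rep x t \<le> ae_rep w t" "AE t in M. ae_rep y t \<le> ae_rep w t" for w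
      using S(2)[OF xy] that by eventually_elim simp
    have 4: "AE t in M. ae_rep w t \<le> ae_rep (J x y) t"
      if "AE t in M. ae_rep w t \<le> ae_rep x t" "AE t in M. ae_rep w t \<le> ae_rep y t" for w
      using J(2)[OF xy] that by eventually_elim simp
    show "is_vsup ?E x y (S x y)" unfolding is_vsup_def using S(1)[OF xy] 1 3 by simp
    show "is_vinf ?E x y (J x y)" unfolding is_vinf_def using J(1)[OF xy] 2 4 by simp
  qed
  have vabs: "AE t in M. ae_rep (vabs ?E x) t = \<bar>ae_rep x t\<bar>" if x: "x \<in> vcarrier ?E" for x
  proof -
    \<comment> \<open>\<open>normed_lattice_on\<close> is what is being proved, so the uniqueness of
      suprema is derived directly from antisymmetry here.\<close>
    have "vsup ?E x (vneg ?E x) = S x (vneg ?E x)" unfolding vsup_def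
    proof (rule the_equality)
      show "is_vsup ?E x (vneg ?E x) (S x (vneg ?E x))" by (rule sup[OF x neg[OF x]])
      fix z assume "is_vsup ?E x (vneg ?E x) z"
      then show "z = S x (vneg ?E x)" using sup[OF x neg[OF x]] unfolding is_vsup_def by (meson le_antisym)
    qed
    then have "vabs ?E x = S x (vneg ?E x)" by (simp add: vabs_def)
    moreover have "AE t in M. ae_rep (S x (vneg ?E x)) t = \<bar>ae_rep x t\<bar>"
      using S(2)[OF x neg[OF x]] rneg[OF x] by eventually_elim auto
    ultimately show ?thesis by simp
  qed
  show ?thesis
  proof
    fix x y assume xy: "x \<in> vcarrier ?E" "y \<in> vcarrier ?E"
    show "\<exists>z. is_vsup ?E x y z" "\<exists>z. is_vinf ?E x y z" using sup[OF xy] inf[OF xy] by auto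
    show "vnorm ?E x \<le> vnorm ?E y" if "vle ?E (vabs ?E x) (vabs ?E y)"
    proof -
      have "AE t in M. ae_rep (vabs ?E x) t \<le> ae_rep (vabs ?E y) t" using that by simp
      then have "AE t in M. \<bar>ae_rep x t\<bar> \<le> \<bar>ae_rep y t\<bar>"
        using vabs[OF xy(1)] vabs[OF xy(2)] by eventually_elim simp
      then show ?thesis using Lp_norm_mono[OF p0 Lp_rep(1)[OF xy(1)] Lp_rep(1)[OF xy(2)]] by simp
    qed
  qed
qed

lemma AE_ae_rep_le_iff:
  assumes "f \<in> borel_measurable M"
  shows "(AE t in M. ae_rep C t \<le> ae_rep (ae_class M f) t) \<longleftrightarrow> (AE t in M. ae_rep C t \<le> f t)"
    "(AE t in M. ae_rep (ae_class M f) t \<le> ae_rep C t) \<longleftrightarrow> (AE t in M. f t \<le> ae_rep C t)"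
  by (rule eventually_subst; use AE_ae_rep(2)[OF assms] in \<open>auto elim: eventually_mono\<close>)+

lemma Lp_space_upper_bound_finite:
  fixes m :: nat
  assumes p: "p \<ge> 1" and x: "\<And>j. j < m \<Longrightarrow> x j \<in> vcarrier (Lp_space p M)"
  shows "\<exists>w\<in>vcarrier (Lp_space p M). vle (Lp_space p M) (vzero (Lp_space p M)) w \<and>
    (\<forall>j<m. vle (Lp_space p M) (x j) w) \<and>
    vnorm (Lp_space p M) w powr p = (\<Sum>j<m. vnorm (Lp_space p M) (x j) powr p)"
proof -
  obtain w where w: "w \<in> Lp_fun p M" "\<And>t. 0 \<le> w t" "\<And>j t. j < m \<Longrightarrow> \<bar>ae_rep (x j) t\<bar> \<le> w t"
    "Lp_norm p M w powr p = (\<Sum>j<m. Lp_norm p M (ae_rep (x j)) powr p)"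
    using Lp_upper_bound_finite[of p m "\<lambda>j. ae_rep (x j)" M] p Lp_rep(1)[OF x] by auto
  note wm = Lp_funD(1)[OF w(1)]
  have zm: "(\<lambda>t. 0) \<in> borel_measurable M" by simp
  show ?thesis
  proof (intro bexI conjI allI impI)
    show "ae_class M w \<in> vcarrier (Lp_space p M)" by (rule Lp_closed[OF w(1)])
    show "vle (Lp_space p M) (vzero (Lp_space p M)) (ae_class M w)"
      unfolding Lp_simps using AE_ae_rep(2)[OF wm] AE_ae_rep(2)[OF zm]
      by eventually_elim (use w(2) in simp)
    show "vle (Lp_space p M) (x j) (ae_class M w)" if "j < m" for j
      using w(3)[OF that] abs_le_D1 AE_ae_rep_le_iff(1)[OF wm] by (auto intro!: AE_I2)
    show "vnorm (Lp_space p M) (ae_class M w) powr p = (\<Sum>j<m. vnorm (Lp_space p M) (x j) powr p)"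
      using w(4) Lp_norm_rep[OF Lp_funD(1)[OF w(1)]] by simp
  qed
qed


lemma solid_domain_Lp:
  fixes M :: "'a measure"
  assumes p: "p \<ge> 1" shows "solid_domain (Lp_space p M)"
proof -
  let ?E = "Lp_space p M"
  interpret normed_lattice_on ?E by (rule normed_lattice_on_Lp[OF p])
  show ?thesis unfolding solid_domain_def
  proof (intro conjI ballI allI impI)
    show "ordered_normed_space_on ?E" by (rule ordered_normed_space_on_axioms)
    fix x assume "x \<in> vcarrier ?E"
    then show "\<exists>y\<in>vcarrier ?E. vle ?E (vneg ?E y) x \<and> vle ?E x y \<and> vnorm ?E y \<le> vnorm ?E x"
      using le_vabs neg_le_vabs neg_le_swap norm_vabs by (intro bexI[of _ "vabs ?E x"]) (auto simp del: Lp_simps)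
  next
    fix x :: "nat \<Rightarrow> ('a \<Rightarrow> real) set" assume x: "\<forall>j. x j \<in> vball ?E \<and> vle ?E (vzero ?E) (x j)"
    then have xV: "x j \<in> vcarrier ?E" "Lp_norm p M (ae_rep (x j)) \<le> 1" for j
      by (simp_all add: vball_def)
    obtain w where w: "w \<in> Lp_fun p M" "\<And>t. 0 \<le> w t" "AE t in M. \<forall>j. \<bar>ae_rep (x j) t\<bar> / 2 ^ j \<le> w t"
      using Lp_upper_bound_geometric[OF p, of "\<lambda>j. ae_rep (x j)" M] Lp_rep(1)[OF xV(1)] xV(2) by blast
    note wm = Lp_funD(1)[OF w(1)]
    have zm: "(\<lambda>t. 0) \<in> borel_measurable M" by simp
    show "\<exists>w\<in>vcarrier ?E. vle ?E (vzero ?E) w \<and> (\<forall>j. vle ?E (vscale ?E (1 / 2 ^ j) (x j)) w)"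
    proof (intro bexI conjI allI)
      show "ae_class M w \<in> vcarrier ?E" by (rule Lp_closed[OF w(1)])
      show "vle ?E (vzero ?E) (ae_class M w)"
        unfolding Lp_simps using AE_ae_rep(2)[OF wm] AE_ae_rep(2)[OF zm]
        by eventually_elim (use w(2) in simp)
      fix j
      have sm: "(\<lambda>t. 1 / 2 ^ j * ae_rep (x j) t) \<in> borel_measurable M"
        by (rule Lp_funD(1)[OF Lp_fun_scale[OF Lp_rep(1)[OF xV(1)]]])
      show "vle ?E (vscale ?E (1 / 2 ^ j) (x j)) (ae_class M w)"
        unfolding Lp_simps using AE_ae_rep(2)[OF wm] AE_ae_rep(2)[OF sm] w(3)
      proof eventually_elim
        case (elim t)
        have "ae_rep (x j) t / 2 ^ j \<le> \<bar>ae_rep (x j) t\<bar> / 2 ^ j" by (intro divide_right_mono) auto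
        also have "\<dots> \<le> w t" using elim by blast
        finally show ?case using elim by simp
      qed
    qed
  qed
qed

lemma upper_bounds_Lp:
  fixes M :: "'a measure"
  assumes p: "p \<ge> 1" shows "upper_bounds p (Lp_space p M)"
  unfolding upper_bounds_def
proof (intro allI impI)
  let ?E = "Lp_space p M"
  fix m :: nat and x assume x: "\<forall>j<m. x j \<in> vball ?E \<and> vle ?E (vzero ?E) (x j)"
  then have xV: "x j \<in> vcarrier ?E" "vnorm ?E (x j) \<le> 1" if "j < m" for j
    using that unfolding vball_def by blast+
  obtain w where w: "w \<in> vcarrier ?E" "vle ?E (vzero ?E) w" "\<forall>j<m. vle ?E (x j) w"
    "vnorm ?E w powr p = (\<Sum>j<m. vnorm ?E (x j) powr p)"
    using Lp_space_upper_bound_finite[OF p xV(1), of m "\<lambda>j. j"] by blast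
  have "(\<Sum>j<m. vnorm ?E (x j) powr p) \<le> (\<Sum>j<m. 1)"
  proof (rule sum_mono)
    fix j assume "j \<in> {..<m}"
    then have "vnorm ?E (x j) powr p \<le> 1 powr p"
      using xV(2)[of j] p by (intro powr_mono2) (auto simp: Lp_norm_nonneg)
    then show "vnorm ?E (x j) powr p \<le> 1" by simp
  qed
  then have "(vnorm ?E w powr p) powr (1 / p) \<le> real m powr (1 / p)"
    unfolding w(4) using p by (intro powr_mono2 sum_nonneg) auto
  then have "vnorm ?E w \<le> real m powr (1 / p)" using p by (simp add: powr_powr Lp_norm_nonneg)
  then show "\<exists>w\<in>vcarrier ?E. vle ?E (vzero ?E) w \<and> vnorm ?E w \<le> real m powr (1 / p) \<and> (\<forall>j<m. vle ?E (x j) w)"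
    using w by blast
qed

text \<open>All norms are at most 1, so lowering the exponent from \<open>p\<close> to
  \<open>r\<close> can only increase the sum of their powers, and the upper bound for exponent
  \<open>p\<close> gives the constant 1.\<close>

lemma upper_estimate_Lp:
  fixes M :: "'a measure"
  assumes r: "1 \<le> r" "r \<le> p" shows "upper_estimate r (Lp_space p M)"
  unfolding upper_estimate_def
proof (intro exI[of _ 1] allI impI)
  let ?E = "Lp_space p M"
  have p: "p \<ge> 1" using r by simp
  interpret normed_lattice_on ?E by (rule normed_lattice_on_Lp[OF p])
  fix k :: nat and x
  assume a: "(\<forall>i<k. x i \<in> vcarrier ?E \<and> vle ?E (vzero ?E) (x i)) \<and> (\<Sum>i<k. vnorm ?E (x i) powr r) \<le> 1"
  then have x: "x i \<in> vcarrier ?E" if "i < k" for i using that by blast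
  obtain w where w: "w \<in> vcarrier ?E" "vle ?E (vzero ?E) w" "\<forall>j<k. vle ?E (x j) w"
    "vnorm ?E w powr p = (\<Sum>j<k. vnorm ?E (x j) powr p)"
    using Lp_space_upper_bound_finite[OF p x, of k "\<lambda>j. j"] by blast
  have "(\<Sum>j<k. vnorm ?E (x j) powr p) \<le> (\<Sum>j<k. vnorm ?E (x j) powr r)"
  proof (rule sum_mono)
    fix j assume j: "j \<in> {..<k}"
    have "vnorm ?E (x j) powr r \<le> (\<Sum>i<k. vnorm ?E (x i) powr r)" by (rule member_le_sum) (use j in auto)
    then have "vnorm ?E (x j) powr r \<le> 1" using a by linarith
    then have "vnorm ?E (x j) \<le> 1" using r gr_one_powr[of "vnorm ?E (x j)" r] by linarith
    then show "vnorm ?E (x j) powr p \<le> vnorm ?E (x j) powr r"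
      using r by (intro powr_mono') (auto simp: Lp_norm_nonneg)
  qed
  then have "vnorm ?E w powr p \<le> 1" using a w(4) by linarith
  then have wn: "vnorm ?E w \<le> 1" using p gr_one_powr[of "vnorm ?E w" p] by linarith
  have "vnorm ?E (vpsup ?E x k) \<le> vnorm ?E w"
    using x w by (intro norm_le_positive vpsup_closed vpsup_nonneg vpsup_least) (auto simp del: Lp_simps)
  then show "vnorm ?E (vpsup ?E x k) \<le> 1" using wn by linarith
qed

lemma upper_bounds_lp:
  assumes p: "p \<ge> 1" shows "upper_bounds p (lp_space p)"
  unfolding upper_bounds_def
proof (intro allI impI)
  let ?E = "lp_space p" and ?M = "count_space (UNIV :: nat set)"
  have p0: "p > 0" using p by simp
  fix m :: nat and x assume x: "\<forall>j<m. x j \<in> vball ?E \<and> vle ?E (vzero ?E) (x j)"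
  then have xV: "x j \<in> vcarrier ?E" "vnorm ?E (x j) \<le> 1" if "j < m" for j
    using that unfolding vball_def by blast+
  have xL: "x j \<in> Lp_fun p ?M" "Lp_norm p ?M (x j) \<le> 1" if "j < m" for j
    using xV[OF that] lp_norm[of "x j" p] by (simp_all add: lp_carrier)
  obtain w where w: "w \<in> Lp_fun p ?M" "\<forall>t. 0 \<le> w t" "\<forall>j<m. \<forall>t. \<bar>x j t\<bar> \<le> w t"
    "Lp_norm p ?M w powr p = (\<Sum>j<m. Lp_norm p ?M (x j) powr p)"
    using Lp_upper_bound_finite[OF p0 xL(1), of m "\<lambda>j. j"] by blast
  have "(\<Sum>j<m. Lp_norm p ?M (x j) powr p) \<le> (\<Sum>j<m. 1)"
  proof (rule sum_mono)
    fix j assume "j \<in> {..<m}"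
    then have "Lp_norm p ?M (x j) powr p \<le> 1 powr p"
      using xL(2)[of j] p by (intro powr_mono2) (auto simp: Lp_norm_nonneg)
    then show "Lp_norm p ?M (x j) powr p \<le> 1" by simp
  qed
  then have "(Lp_norm p ?M w powr p) powr (1 / p) \<le> real m powr (1 / p)"
    unfolding w(4) using p by (intro powr_mono2 sum_nonneg) auto
  then have "Lp_norm p ?M w \<le> real m powr (1 / p)" using p by (simp add: powr_powr Lp_norm_nonneg)
  moreover have wV: "w \<in> vcarrier ?E" using w(1) by (simp add: lp_carrier)
  ultimately show "\<exists>w\<in>vcarrier ?E. vle ?E (vzero ?E) w \<and> vnorm ?E w \<le> real m powr (1 / p) \<and> (\<forall>j<m. vle ?E (x j) w)"
    using w lp_norm[OF wV] by (intro bexI[OF _ wV]) (auto intro: order_trans[OF abs_ge_self])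
qed

section \<open>Positive multilinear operators\<close>

lemma solid_domain_upper_bound:
  fixes E :: "('a, 'm) nlattice_scheme"
  assumes "solid_domain E" "\<And>j::nat. x j \<in> vball E" "\<And>j. vle E (vzero E) (x j)"
  shows "\<exists>w\<in>vcarrier E. vle E (vzero E) w \<and> (\<forall>j. vle E (vscale E (1 / 2 ^ j) (x j)) w)"
proof -
  have "\<forall>x :: nat \<Rightarrow> 'a. (\<forall>j. x j \<in> vball E \<and> vle E (vzero E) (x j)) \<longrightarrow>
        (\<exists>w\<in>vcarrier E. vle E (vzero E) w \<and> (\<forall>j. vle E (vscale E (1 / 2 ^ j) (x j)) w))"
    using assms(1) by (simp add: solid_domain_def)
  from this[THEN spec, of x] assms(2,3) show ?thesis by simp
qed

locale positive_multilinear =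
  fixes I :: "'i set" and E :: "'i \<Rightarrow> ('a, 'm) nlattice_scheme" and F :: "('b, 'k) nlattice_scheme"
    and A :: "('i \<Rightarrow> 'a) \<Rightarrow> 'b"
  assumes finI: "finite I" and dom: "\<And>i. i \<in> I \<Longrightarrow> solid_domain (E i)"
    and cod: "ordered_normed_space_on F" and pos: "positive_multilinear_on I E F A"
begin

sublocale F: ordered_normed_space_on F by (rule cod)

lemma ons: "i \<in> I \<Longrightarrow> ordered_normed_space_on (E i)"
  using dom by (simp add: solid_domain_def)

lemma pre: "i \<in> I \<Longrightarrow> preordered_on (E i)"
proof -
  assume i: "i \<in> I"
  interpret ordered_normed_space_on "E i" by (rule ons[OF i])
  show ?thesis by unfold_locales
qed

lemma ns: "i \<in> I \<Longrightarrow> normed_space_on (E i)"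
  using ons ordered_normed_space_on_def by blast

definition D :: "('i \<Rightarrow> 'a) set" where "D = (\<Pi>\<^sub>E i\<in>I. vcarrier (E i))"
definition B :: "('i \<Rightarrow> 'a) set" where "B = (\<Pi>\<^sub>E i\<in>I. vball (E i))"

lemma B_D: "x \<in> B \<Longrightarrow> x \<in> D"
  by (auto simp: B_def D_def vball_def PiE_iff)

lemma D_upd: "x \<in> D \<Longrightarrow> i \<in> I \<Longrightarrow> u \<in> vcarrier (E i) \<Longrightarrow> x(i := u) \<in> D"
  unfolding D_def by (auto simp: PiE_iff extensional_def)

lemma D_mem: "x \<in> D \<Longrightarrow> i \<in> I \<Longrightarrow> x i \<in> vcarrier (E i)"
  by (auto simp: D_def)

lemma D_restrict: "(\<And>i. i \<in> I \<Longrightarrow> f i \<in> vcarrier (E i)) \<Longrightarrow> (\<lambda>i\<in>I. f i) \<in> D"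
  by (simp add: D_def)

lemma A_closed: "x \<in> D \<Longrightarrow> A x \<in> vcarrier F"
  using pos by (auto simp: positive_multilinear_on_def multilinear_on_def D_def)

lemma A_slot: "x \<in> D \<Longrightarrow> i \<in> I \<Longrightarrow> linear_map_on (E i) F (\<lambda>u. A (x(i := u)))"
  using pos by (simp add: positive_multilinear_on_def multilinear_on_def D_def)

lemma A_nonneg: "x \<in> D \<Longrightarrow> (\<And>i. i \<in> I \<Longrightarrow> vle (E i) (vzero (E i)) (x i)) \<Longrightarrow> vle F (vzero F) (A x)"
  using pos by (simp add: positive_multilinear_on_def D_def)

lemma A_add: "x \<in> D \<Longrightarrow> i \<in> I \<Longrightarrow> u \<in> vcarrier (E i) \<Longrightarrow> v \<in> vcarrier (E i) \<Longrightarrow>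
    A (x(i := vadd (E i) u v)) = vadd F (A (x(i := u))) (A (x(i := v)))"
  and A_scale: "x \<in> D \<Longrightarrow> i \<in> I \<Longrightarrow> u \<in> vcarrier (E i) \<Longrightarrow>
    A (x(i := vscale (E i) a u)) = vscale F a (A (x(i := u)))"
  and A_neg: "x \<in> D \<Longrightarrow> i \<in> I \<Longrightarrow> u \<in> vcarrier (E i) \<Longrightarrow>
    A (x(i := vneg (E i) u)) = vneg F (A (x(i := u)))"
  using linear_map_onD[OF A_slot[of x i]] by blast+

text \<open>The modulus inequality for positive multilinear maps, by induction on the set
  \<open>J\<close> of slots in which \<open>z\<close> and \<open>y\<close> may differ. The vectors
  \<open>p = y k \<oplus> z k\<close> and \<open>q = y k \<ominus> z k\<close> are positive. Twice
  \<open>A z\<close> is the difference of the values with \<open>p\<close> and \<open>q\<close> in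
  slot \<open>k\<close> of \<open>z\<close>, and twice \<open>A y\<close> is the sum of the values
  with \<open>p\<close> and \<open>q\<close> in slot \<open>k\<close> of \<open>y\<close>.\<close>

lemma A_dominated_aux:
  assumes "finite J" "J \<subseteq> I" "y \<in> D" "z \<in> D"
    and "\<And>i. i \<in> J \<Longrightarrow> vle (E i) (vneg (E i) (y i)) (z i) \<and> vle (E i) (z i) (y i)"
    and "\<And>i. i \<in> I - J \<Longrightarrow> z i = y i \<and> vle (E i) (vzero (E i)) (y i)"
  shows "vle F (vneg F (A y)) (A z) \<and> vle F (A z) (A y)"
  using assms
proof (induction J arbitrary: y z rule: finite_induct)
  case empty
  have "z = y" using empty by (intro PiE_ext[of z I "\<lambda>i. vcarrier (E i)" y]) (auto simp: D_def)
  moreover have "vle F (vzero F) (A y)" using empty by (intro A_nonneg) auto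
  ultimately show ?case
    using F.neg_nonpos[of "A y"] F.le_trans[of "vneg F (A y)" "vzero F" "A y"] A_closed[of y] empty
    by (simp add: F.le_refl)
next
  case (insert k J)
  have k: "k \<in> I" "k \<notin> J" using insert by auto
  interpret Ek: preordered_on "E k" by (rule pre[OF k(1)])
  have yk: "y k \<in> vcarrier (E k)" "z k \<in> vcarrier (E k)" using insert k D_mem by auto
  have dk: "vle (E k) (vneg (E k) (y k)) (z k)" "vle (E k) (z k) (y k)" using insert by auto
  have both: "vle F (vneg F (A (y(k := u)))) (A (z(k := u))) \<and> vle F (A (z(k := u))) (A (y(k := u)))"
    if u: "u \<in> vcarrier (E k)" "vle (E k) (vzero (E k)) u" for u
  proof (rule insert.IH)
    show "J \<subseteq> I" using insert by auto
    show "y(k := u) \<in> D" "z(k := u) \<in> D" using insert k u by (auto intro: D_upd)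
  qed (use insert.prems k u in auto)
  define p where "p = vadd (E k) (y k) (z k)"
  define q where "q = vadd (E k) (y k) (vneg (E k) (z k))"
  have pq: "p \<in> vcarrier (E k)" "q \<in> vcarrier (E k)" using yk by (auto simp: p_def q_def)
  have q0: "vle (E k) (vzero (E k)) q" using Ek.le_iff_diff[of "z k" "y k"] yk dk by (simp add: q_def)
  have p0: "vle (E k) (vzero (E k)) p"
  proof -
    have "vadd (E k) (z k) (vneg (E k) (vneg (E k) (y k))) = p"
      unfolding p_def using yk by (intro Ek.lin_eqI) (auto simp: Ek.lin_simps)
    then show ?thesis using Ek.le_iff_diff[of "vneg (E k) (y k)" "z k"] yk dk by simp
  qed
  define \<alpha> \<beta> Y \<gamma> where "\<alpha> = A (z(k := y k))" and "\<beta> = A z" and "Y = A y" and "\<gamma> = A (y(k := z k))"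
  have V: "\<alpha> \<in> vcarrier F" "\<beta> \<in> vcarrier F" "Y \<in> vcarrier F" "\<gamma> \<in> vcarrier F"
    unfolding \<alpha>_def \<beta>_def Y_def \<gamma>_def using insert k yk by (auto intro!: A_closed D_upd)
  have e: "A (z(k := p)) = vadd F \<alpha> \<beta>" "A (y(k := p)) = vadd F Y \<gamma>"
    "A (z(k := q)) = vadd F \<alpha> (vneg F \<beta>)" "A (y(k := q)) = vadd F Y (vneg F \<gamma>)"
    unfolding p_def q_def \<alpha>_def \<beta>_def Y_def \<gamma>_def
    using insert.prems(2,3) k yk by (simp_all add: A_add A_neg)
  note P = both[OF pq(1) p0, unfolded e] and Q = both[OF pq(2) q0, unfolded e]
  have half: "vle F a b" if "a \<in> vcarrier F" "b \<in> vcarrier F" "vle F (vscale F 2 a) (vscale F 2 b)" for a b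
    using F.scale_mono[of "vscale F 2 a" "vscale F 2 b" "1 / 2"] that by (simp add: F.scale_scale F.scale_one)
  have "vle F (vadd F (vadd F \<alpha> \<beta>) (vneg F (vadd F \<alpha> (vneg F \<beta>)))) (vadd F (vadd F Y \<gamma>) (vadd F Y (vneg F \<gamma>)))"
    using P Q V F.neg_le_swap[of "vadd F Y (vneg F \<gamma>)" "vadd F \<alpha> (vneg F \<beta>)"] by - (rule F.add_mono, auto)
  moreover have "vadd F (vadd F \<alpha> \<beta>) (vneg F (vadd F \<alpha> (vneg F \<beta>))) = vscale F 2 \<beta>"
    "vadd F (vadd F Y \<gamma>) (vadd F Y (vneg F \<gamma>)) = vscale F 2 Y"
    using V by (auto intro!: F.lin_eqI simp: F.lin_simps)
  ultimately have 1: "vle F \<beta> Y" using half V by simp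
  have "vle F (vadd F (vneg F (vadd F \<alpha> \<beta>)) (vadd F \<alpha> (vneg F \<beta>))) (vadd F (vadd F Y \<gamma>) (vadd F Y (vneg F \<gamma>)))"
    using P Q V F.neg_le_swap[of "vadd F Y \<gamma>" "vadd F \<alpha> \<beta>"] by - (rule F.add_mono, auto)
  moreover have "vadd F (vneg F (vadd F \<alpha> \<beta>)) (vadd F \<alpha> (vneg F \<beta>)) = vscale F 2 (vneg F \<beta>)"
    "vadd F (vadd F Y \<gamma>) (vadd F Y (vneg F \<gamma>)) = vscale F 2 Y"
    using V by (auto intro!: F.lin_eqI simp: F.lin_simps)
  ultimately have "vle F (vneg F \<beta>) Y" using half V by simp
  then have "vle F (vneg F Y) \<beta>" using V F.neg_le_swap[of \<beta> Y] by simp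
  with 1 show ?case by (simp add: \<beta>_def Y_def)
qed

lemma A_dominated:
  assumes "x \<in> D" "y \<in> D" "\<And>i. i \<in> I \<Longrightarrow> vle (E i) (vneg (E i) (y i)) (x i)" "\<And>i. i \<in> I \<Longrightarrow> vle (E i) (x i) (y i)"
  shows "vle F (vneg F (A y)) (A x)" "vle F (A x) (A y)" "vnorm F (A x) \<le> vnorm F (A y)"
proof -
  have *: "vle F (vneg F (A y)) (A x) \<and> vle F (A x) (A y)"
    by (rule A_dominated_aux[OF finI]) (use assms in auto)
  then show "vle F (vneg F (A y)) (A x)" "vle F (A x) (A y)" by auto
  show "vnorm F (A x) \<le> vnorm F (A y)" using * assms by (intro F.norm_le_dominated A_closed) auto
qed

lemma A_mono:
  assumes x: "x \<in> D" and y: "y \<in> D" and xy: "\<And>i. i \<in> I \<Longrightarrow> vle (E i) (vzero (E i)) (x i)" "\<And>i. i \<in> I \<Longrightarrow> vle (E i) (x i) (y i)"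
  shows "vle F (A x) (A y)"
proof (rule A_dominated(2)[OF x y _ xy(2)])
  fix i assume i: "i \<in> I"
  interpret Ei: preordered_on "E i" by (rule pre[OF i])
  have V: "x i \<in> vcarrier (E i)" "y i \<in> vcarrier (E i)" using x y i D_mem by auto
  have "vle (E i) (vzero (E i)) (y i)" using Ei.le_trans[of "vzero (E i)" "x i" "y i"] V xy[OF i] by simp
  then show "vle (E i) (vneg (E i) (y i)) (x i)"
    using Ei.neg_nonpos[of "y i"] Ei.le_trans[of "vneg (E i) (y i)" "vzero (E i)" "x i"] V xy[OF i] by simp
qed

lemma ex_dominating:
  assumes x: "x \<in> B"
  obtains y where "y \<in> B" "\<And>i. i \<in> I \<Longrightarrow> vle (E i) (vzero (E i)) (y i)"
    "\<And>i. i \<in> I \<Longrightarrow> vle (E i) (vneg (E i) (y i)) (x i)" "\<And>i. i \<in> I \<Longrightarrow> vle (E i) (x i) (y i)"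
proof -
  have "\<exists>y\<in>vball (E i). vle (E i) (vzero (E i)) y \<and> vle (E i) (vneg (E i) y) (x i) \<and> vle (E i) (x i) y" if i: "i \<in> I" for i
  proof -
    interpret Ei: preordered_on "E i" by (rule pre[OF i])
    have xi: "x i \<in> vcarrier (E i)" "vnorm (E i) (x i) \<le> 1" using x i by (auto simp: B_def vball_def)
    then obtain y where y: "y \<in> vcarrier (E i)" "vle (E i) (vneg (E i) y) (x i)" "vle (E i) (x i) y" "vnorm (E i) y \<le> vnorm (E i) (x i)"
      using dom[OF i] unfolding solid_domain_def by blast
    then show ?thesis using Ei.nonneg_if_dominates[of "x i" y] xi by (intro bexI[of _ y]) (auto simp: vball_def)
  qed
  then obtain f where f: "\<And>i. i \<in> I \<Longrightarrow> f i \<in> vball (E i) \<and> vle (E i) (vzero (E i)) (f i) \<and> vle (E i) (vneg (E i) (f i)) (x i) \<and> vle (E i) (x i) (f i)"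
    by metis
  show thesis by (rule that[of "\<lambda>i\<in>I. f i"]) (use f in \<open>auto simp: B_def\<close>)
qed

lemma A_scale_all:
  assumes x: "x \<in> D"
  shows "A (\<lambda>i\<in>I. vscale (E i) (c i) (x i)) = vscale F (\<Prod>i\<in>I. c i) (A x)"
proof -
  define g where "g J = (\<lambda>i\<in>I. if i \<in> J then vscale (E i) (c i) (x i) else x i)" for J
  have gD: "g J \<in> D" for J unfolding g_def
    using x D_mem by (intro D_restrict) (auto intro: normed_space_on.scale_closed[OF ns])
  have "A (g J) = vscale F (\<Prod>i\<in>J. c i) (A x)" if "J \<subseteq> I" for J
    using finite_subset[OF that finI] that
  proof (induction J rule: finite_induct)
    case empty
    have "g {} = x" using x unfolding g_def D_def by (auto simp: fun_eq_iff PiE_iff extensional_def)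
    then show ?case using A_closed[OF x] by (simp add: F.scale_one)
  next
    case (insert k J)
    have k: "k \<in> I" "k \<notin> J" using insert by auto
    have "g (insert k J) = (g J)(k := vscale (E k) (c k) (x k))" "(g J)(k := x k) = g J"
      using k by (auto simp: g_def fun_eq_iff)
    then have "A (g (insert k J)) = vscale F (c k) (A (g J))" using A_scale[OF gD k(1) D_mem[OF x k(1)]] by simp
    then show ?case using insert A_closed[OF x] by (simp add: F.scale_scale)
  qed
  from this[of I] show ?thesis by (simp add: g_def cong: restrict_cong)
qed

text \<open>Otherwise positive tuples \<open>y j\<close> in the ball have values of norm above
  \<open>j * (2 ^ j) ^ card I\<close>. The factor \<open>1 / 2 ^ j\<close> in every slot brings all
  of them below one tuple \<open>W\<close>, and the norm of \<open>A W\<close> exceeds every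
  \<open>j\<close>.\<close>

lemma bounded_on_ball: "\<exists>K\<ge>0. \<forall>x\<in>B. vnorm F (A x) \<le> K"
proof (rule ccontr)
  assume n: "\<not> ?thesis"
  have "\<exists>x\<in>B. real j * (2 ^ j) ^ card I < vnorm F (A x)" for j :: nat
    using n by (meson not_le of_nat_0_le_iff mult_nonneg_nonneg zero_le_power zero_le_numeral)
  then obtain x where x: "\<And>j. x j \<in> B" "\<And>j::nat. real j * (2 ^ j) ^ card I < vnorm F (A (x j))" by metis
  have "\<exists>y\<in>B. (\<forall>i\<in>I. vle (E i) (vzero (E i)) (y i)) \<and> vnorm F (A (x j)) \<le> vnorm F (A y)" for j
  proof -
    obtain y where "y \<in> B" "\<And>i. i \<in> I \<Longrightarrow> vle (E i) (vzero (E i)) (y i)"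
      "\<And>i. i \<in> I \<Longrightarrow> vle (E i) (vneg (E i) (y i)) (x j i)" "\<And>i. i \<in> I \<Longrightarrow> vle (E i) (x j i) (y i)"
      using ex_dominating[OF x(1)[of j]] by blast
    then show ?thesis using A_dominated(3)[OF B_D[OF x(1)[of j]] B_D[of y]] by blast
  qed
  then obtain y where y: "\<And>j. y j \<in> B" "\<And>i j. i \<in> I \<Longrightarrow> vle (E i) (vzero (E i)) (y j i)"
    "\<And>j. vnorm F (A (x j)) \<le> vnorm F (A (y j))" by metis
  have yb: "y j i \<in> vball (E i)" if "i \<in> I" for i j using y(1)[of j] that by (auto simp: B_def)
  have "\<exists>w\<in>vcarrier (E i). vle (E i) (vzero (E i)) w \<and> (\<forall>j. vle (E i) (vscale (E i) (1 / 2 ^ j) (y j i)) w)" if i: "i \<in> I" for i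
    by (rule solid_domain_upper_bound[OF dom[OF i] yb[OF i] y(2)[OF i]])
  then obtain w where w: "\<And>i. i \<in> I \<Longrightarrow> w i \<in> vcarrier (E i) \<and> (\<forall>j. vle (E i) (vscale (E i) (1 / 2 ^ j) (y j i)) (w i))" by metis
  define W where "W = (\<lambda>i\<in>I. w i)"
  have WD: "W \<in> D" using w unfolding W_def by (intro D_restrict) auto
  have "real j < vnorm F (A W)" for j
  proof -
    have yD: "y j \<in> D" by (rule B_D[OF y(1)])
    have sD: "(\<lambda>i\<in>I. vscale (E i) (1 / 2 ^ j) (y j i)) \<in> D"
      using yD D_mem by (intro D_restrict) (auto intro: normed_space_on.scale_closed[OF ns])
    have s0: "vle (E i) (vzero (E i)) (vscale (E i) (1 / 2 ^ j) (y j i))" if "i \<in> I" for i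
      using preordered_on.le_scale[OF pre[OF that]] D_mem[OF yD that] y(2)[OF that] by simp
    have "vnorm F (A (\<lambda>i\<in>I. vscale (E i) (1 / 2 ^ j) (y j i))) \<le> vnorm F (A W)"
    proof (rule F.norm_le_positive)
      show "vle F (vzero F) (A (\<lambda>i\<in>I. vscale (E i) (1 / 2 ^ j) (y j i)))" by (rule A_nonneg[OF sD]) (use s0 in simp)
      show "vle F (A (\<lambda>i\<in>I. vscale (E i) (1 / 2 ^ j) (y j i))) (A W)"
        by (rule A_mono[OF sD WD]) (use s0 w in \<open>auto simp: W_def\<close>)
    qed (auto intro: A_closed sD WD)
    then have "vnorm F (A (y j)) / (2 ^ j) ^ card I \<le> vnorm F (A W)"
      unfolding A_scale_all[OF yD] using A_closed[OF yD] by (simp add: F.norm_scale power_one_over)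
    moreover have "real j * (2 ^ j) ^ card I < vnorm F (A (y j))" using x(2)[of j] y(3)[of j] by linarith
    then have "real j < vnorm F (A (y j)) / (2 ^ j) ^ card I" by (simp add: less_divide_eq)
    ultimately show ?thesis by linarith
  qed
  moreover obtain j :: nat where "vnorm F (A W) \<le> real j" using real_arch_simple by blast
  ultimately show False by (metis not_le)
qed

text \<open>Positive bounds \<open>R i\<close> in place of the norms allow dividing also when an
  entry is zero.\<close>

lemma norm_le_prod:
  assumes K: "\<And>x. x \<in> B \<Longrightarrow> vnorm F (A x) \<le> K" and x: "x \<in> D"
    and R: "\<And>i. i \<in> I \<Longrightarrow> 0 < R i" "\<And>i. i \<in> I \<Longrightarrow> vnorm (E i) (x i) \<le> R i"
  shows "vnorm F (A x) \<le> K * (\<Prod>i\<in>I. R i)"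
proof -
  have "(\<lambda>i\<in>I. vscale (E i) (1 / R i) (x i)) \<in> B"
    using D_mem[OF x] R by (auto simp: B_def vball_def normed_space_on.scale_closed[OF ns] normed_space_on.norm_scale[OF ns] divide_le_eq
      intro: order_trans[OF R(2) abs_ge_self])
  then have "vnorm F (A (\<lambda>i\<in>I. vscale (E i) (1 / R i) (x i))) \<le> K" by (rule K)
  moreover have P: "0 < (\<Prod>i\<in>I. R i)" using R by (intro prod_pos) auto
  moreover have "vnorm F (A (\<lambda>i\<in>I. vscale (E i) (1 / R i) (x i))) = vnorm F (A x) / (\<Prod>i\<in>I. R i)"
    unfolding A_scale_all[OF x] using A_closed[OF x] P by (simp add: F.norm_scale prod_dividef abs_of_pos)
  ultimately show ?thesis by (simp add: divide_le_eq)
qed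

lemma norm_le_slot:
  assumes K: "\<And>x. x \<in> B \<Longrightarrow> vnorm F (A x) \<le> K" and K0: "K \<ge> 0" and x: "x \<in> B" and k: "k \<in> I"
    and u: "u \<in> vcarrier (E k)"
  shows "vnorm F (A (x(k := u))) \<le> K * vnorm (E k) u"
proof (rule field_le_epsilon)
  interpret Ek: normed_space_on "E k" by (rule ns[OF k])
  fix e :: real assume e: "e > 0"
  \<comment> \<open>Keeps the bound in slot \<open>k\<close> positive when \<open>u\<close> is zero;
    it is removed by letting \<open>e\<close> tend to zero.\<close>
  define d where "d = e / (K + 1)"
  have d: "d > 0" "K * d \<le> e" using e K0 by (auto simp: d_def field_simps)
  have "vnorm F (A (x(k := u))) \<le> K * (\<Prod>i\<in>I. if i = k then vnorm (E k) u + d else 1)"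
    using D_upd[OF B_D[OF x] k u] x d Ek.norm_nonneg[OF u]
    by (intro norm_le_prod[OF K]) (auto simp: B_def vball_def PiE_iff)
  also have "(\<Prod>i\<in>I. if i = k then vnorm (E k) u + d else 1) = vnorm (E k) u + d"
    using finI k by (simp add: prod.delta)
  finally show "vnorm F (A (x(k := u))) \<le> K * vnorm (E k) u + e" using d unfolding distrib_left by linarith
qed

end

section \<open>Compactness of positive operators defined on \<open>\<ell>\<^sub>p\<close>\<close>

text \<open>Tychonoff's theorem. The index type is countable, so compactness of the product gives
  convergent subsequences.\<close>

lemma coordinatewise_convergent_subsequence:
  fixes f :: "nat \<Rightarrow> 'c::countable \<Rightarrow> real"
  assumes "\<And>j c. \<bar>f j c\<bar> \<le> K"
  obtains r g where "strict_mono r" "\<And>c. (\<lambda>j. f (r j) c) \<longlonglongrightarrow> g c"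
proof -
  define S where "S = (PiE UNIV (\<lambda>_ :: 'c. {-K..K}))"
  have "compactin (product_topology (\<lambda>_. euclidean) UNIV) S"
    unfolding S_def by (subst compactin_PiE) auto
  then have "compact S" by (simp add: euclidean_product_topology)
  then have "seq_compact S" by (rule compact_imp_seq_compact)
  moreover have "\<forall>j. f j \<in> S" using assms by (auto simp: S_def abs_le_iff minus_le_iff)
  ultimately obtain g r where g: "strict_mono r" "(f \<circ> r) \<longlonglongrightarrow> g" by (meson seq_compactE)
  have "(\<lambda>j. f (r j) c) \<longlonglongrightarrow> g c" for c
  proof -
    have "continuous_on UNIV (\<lambda>x :: 'c \<Rightarrow> real. x c)" by (rule continuous_on_product_coordinates)
    then have "isCont (\<lambda>x :: 'c \<Rightarrow> real. x c) g"
      using continuous_on_eq_continuous_at[OF open_UNIV, of "\<lambda>x :: 'c \<Rightarrow> real. x c"] by blast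
    then show ?thesis using isCont_tendsto_compose[OF _ g(2), of "\<lambda>x. x c"] by (simp add: o_def)
  qed
  with g(1) show thesis by (rule that)
qed

lemma upper_boundsD:
  assumes "upper_bounds p E" "\<forall>j<m. x j \<in> vball E \<and> vle E (vzero E) (x j)"
  shows "\<exists>w\<in>vcarrier E. vle E (vzero E) w \<and> vnorm E w \<le> real m powr (1 / p) \<and> (\<forall>j<m. vle E (x j) w)"
  using assms(1)[unfolded upper_bounds_def, THEN spec[of _ m], THEN spec[of _ x]] assms(2) by simp

section \<open>Restrictions to coordinate sets and coordinatewise limits in
  \<open>lp_space\<close>\<close>

definition cut :: "nat set \<Rightarrow> (nat \<Rightarrow> real) \<Rightarrow> nat \<Rightarrow> real" where
  "cut S x = (\<lambda>l. if l \<in> S then x l else 0)"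

context
  fixes p :: real assumes p: "p \<ge> 1"
begin

lemma lp_norm_powr: "x \<in> vcarrier (lp_space p) \<Longrightarrow> vnorm (lp_space p) x powr p = (\<Sum>l. \<bar>x l\<bar> powr p)"
  using p by (simp add: lp_space_def powr_powr suminf_nonneg)

lemma lp_norm_nonneg: "0 \<le> vnorm (lp_space p) x"
  by (simp add: lp_space_def)

lemma lp_norm_le_iff:
  assumes "x \<in> vcarrier (lp_space p)" "0 \<le> K"
  shows "vnorm (lp_space p) x \<le> K \<longleftrightarrow> (\<Sum>l. \<bar>x l\<bar> powr p) \<le> K powr p"
proof
  assume "vnorm (lp_space p) x \<le> K"
  then have "vnorm (lp_space p) x powr p \<le> K powr p" using p lp_norm_nonneg by (intro powr_mono2) auto
  then show "(\<Sum>l. \<bar>x l\<bar> powr p) \<le> K powr p" using assms by (simp add: lp_norm_powr)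
next
  assume "(\<Sum>l. \<bar>x l\<bar> powr p) \<le> K powr p"
  then have "vnorm (lp_space p) x powr p \<le> K powr p" using assms by (simp add: lp_norm_powr)
  then have "(vnorm (lp_space p) x powr p) powr (1 / p) \<le> (K powr p) powr (1 / p)" using p by - (rule powr_mono2, auto)
  then show "vnorm (lp_space p) x \<le> K" using p assms lp_norm_nonneg by (simp add: powr_powr)
qed

lemma lp_sum_le:
  assumes "x \<in> vcarrier (lp_space p)" "finite S"
  shows "(\<Sum>l\<in>S. \<bar>x l\<bar> powr p) \<le> vnorm (lp_space p) x powr p"
  unfolding lp_norm_powr[OF assms(1)] using assms by (intro sum_le_suminf) (auto simp: lp_carrier_iff)

lemma lp_coord_le: "x \<in> vcarrier (lp_space p) \<Longrightarrow> \<bar>x l\<bar> \<le> vnorm (lp_space p) x"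
proof -
  assume x: "x \<in> vcarrier (lp_space p)"
  have "\<bar>x l\<bar> powr p \<le> vnorm (lp_space p) x powr p" using lp_sum_le[OF x, of "{l}"] by simp
  then have "(\<bar>x l\<bar> powr p) powr (1 / p) \<le> (vnorm (lp_space p) x powr p) powr (1 / p)"
    using p by - (rule powr_mono2, auto)
  then show ?thesis using p lp_norm_nonneg by (simp add: powr_powr)
qed

lemma cut_closed: "x \<in> vcarrier (lp_space p) \<Longrightarrow> cut S x \<in> vcarrier (lp_space p)"
  unfolding lp_carrier_iff by (rule summable_comparison_test') (auto simp: cut_def)

lemma lp_norm_cut_powr:
  assumes "x \<in> vcarrier (lp_space p)"
  shows "vnorm (lp_space p) (cut S x) powr p = (\<Sum>l. if l \<in> S then \<bar>x l\<bar> powr p else 0)"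
proof -
  have "(\<lambda>l. \<bar>cut S x l\<bar> powr p) = (\<lambda>l. if l \<in> S then \<bar>x l\<bar> powr p else 0)"
    using p by (auto simp: cut_def fun_eq_iff)
  then show ?thesis using lp_norm_powr[OF cut_closed[OF assms, of S]] by simp
qed

lemma lp_norm_cut_finite:
  assumes "x \<in> vcarrier (lp_space p)" "finite S"
  shows "vnorm (lp_space p) (cut S x) powr p = (\<Sum>l\<in>S. \<bar>x l\<bar> powr p)"
  unfolding lp_norm_cut_powr[OF assms(1)] using assms(2) by (subst suminf_finite[of S]) auto

lemma lp_norm_cut_le: "x \<in> vcarrier (lp_space p) \<Longrightarrow> vnorm (lp_space p) (cut S x) \<le> vnorm (lp_space p) x"
proof -
  assume x: "x \<in> vcarrier (lp_space p)"
  have s: "summable (\<lambda>l. \<bar>x l\<bar> powr p)" using x by (simp add: lp_carrier_iff)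
  have "vnorm (lp_space p) (cut S x) powr p \<le> vnorm (lp_space p) x powr p"
    unfolding lp_norm_cut_powr[OF x] lp_norm_powr[OF x]
    by (intro suminf_le s summable_comparison_test'[OF s]) auto
  then have "(vnorm (lp_space p) (cut S x) powr p) powr (1 / p) \<le> (vnorm (lp_space p) x powr p) powr (1 / p)"
    using p by - (rule powr_mono2, auto)
  then show ?thesis using p lp_norm_nonneg by (simp add: powr_powr)
qed

lemma lp_norm_tail_tendsto:
  assumes x: "x \<in> vcarrier (lp_space p)"
  shows "(\<lambda>M. vnorm (lp_space p) (cut {M..} x)) \<longlonglongrightarrow> 0"
proof -
  have s: "summable (\<lambda>l. \<bar>x l\<bar> powr p)" using x by (simp add: lp_carrier_iff)
  have "vnorm (lp_space p) (cut {M..} x) powr p = (\<Sum>l. \<bar>x (l + M)\<bar> powr p)" for M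
  proof -
    have s': "summable (\<lambda>l. if l \<in> {M..} then \<bar>x l\<bar> powr p else 0)" by (rule summable_comparison_test'[OF s]) auto
    show ?thesis unfolding lp_norm_cut_powr[OF x] by (subst suminf_split_initial_segment[OF s', of M]) simp
  qed
  then have "vnorm (lp_space p) (cut {M..} x) = (\<Sum>l. \<bar>x (l + M)\<bar> powr p) powr (1 / p)" for M
    using p lp_norm_nonneg[of "cut {M..} x"] by (metis powr_one_gt_zero_iff powr_powr less_le_trans nonzero_divide_eq_eq
        not_one_le_zero mult.commute powr_one times_divide_eq_right mult.right_neutral)
  moreover have "(\<lambda>M. (\<Sum>l. \<bar>x (l + M)\<bar> powr p) powr (1 / p)) \<longlonglongrightarrow> 0 powr (1 / p)"
  proof (rule tendsto_powr')
    show "(\<lambda>M. \<Sum>l. \<bar>x (l + M)\<bar> powr p) \<longlonglongrightarrow> 0" by (rule suminf_exist_split2[OF s])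
    show "0 \<noteq> (0::real) \<or> (0 < 1 / p \<and> (\<forall>\<^sub>F M in sequentially. 0 \<le> (\<Sum>l. \<bar>x (l + M)\<bar> powr p)))"
      using p s by (auto intro!: always_eventually suminf_nonneg summable_ignore_initial_segment[of "\<lambda>l. \<bar>x l\<bar> powr p"])
  qed simp
  ultimately show ?thesis by simp
qed

text \<open>Fatou's lemma for series: the bound passes to the limit in each finite partial
  sum.\<close>

lemma lp_ball_limit:
  assumes x: "\<And>j. x j \<in> vcarrier (lp_space p)" "\<And>j. vnorm (lp_space p) (x j) \<le> K"
    and lim: "\<And>l. (\<lambda>j. x j l) \<longlonglongrightarrow> g l"
  shows "g \<in> vcarrier (lp_space p)" "vnorm (lp_space p) g \<le> K"
proof -
  have K: "K \<ge> 0" using order_trans[OF lp_norm_nonneg x(2)] .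
  have part: "(\<Sum>l<L. \<bar>g l\<bar> powr p) \<le> K powr p" for L
  proof (rule LIMSEQ_le_const2)
    show "(\<lambda>j. \<Sum>l<L. \<bar>x j l\<bar> powr p) \<longlonglongrightarrow> (\<Sum>l<L. \<bar>g l\<bar> powr p)"
      using p by (intro tendsto_sum tendsto_powr' tendsto_rabs lim tendsto_const) auto
    have "(\<Sum>l<L. \<bar>x j l\<bar> powr p) \<le> K powr p" for j
      using lp_sum_le[OF x(1)[of j], of "{..<L}"] powr_mono2[of p "vnorm (lp_space p) (x j)" K] x(2)[of j] p lp_norm_nonneg
      by fastforce
    then show "\<exists>N. \<forall>n\<ge>N. (\<Sum>l<L. \<bar>x n l\<bar> powr p) \<le> K powr p" by blast
  qed
  have s: "summable (\<lambda>l. \<bar>g l\<bar> powr p)" by (rule summableI_nonneg_bounded) (use part in auto)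
  then show g: "g \<in> vcarrier (lp_space p)" by (simp add: lp_carrier_iff)
  show "vnorm (lp_space p) g \<le> K" unfolding lp_norm_le_iff[OF g K] using s part by (rule suminf_le_const)
qed

end

text \<open>The exponent in \<open>growth\<close> is the one with which the product of the norms
  grows when \<open>m\<close> tuples are replaced by an upper bound in every slot.\<close>

locale positive_multilinear_lp =
  fixes I :: "nat set" and p :: "nat \<Rightarrow> real" and F :: "('b, 'k) nlattice_scheme"
    and A :: "(nat \<Rightarrow> nat \<Rightarrow> real) \<Rightarrow> 'b"
  assumes fin: "finite I" and p: "\<And>i. i \<in> I \<Longrightarrow> 1 \<le> p i" and F: "ordered_normed_space_on F"
    and posA: "positive_multilinear_on I (\<lambda>i. lp_space (p i)) F A"
    and growth: "lower_growth (\<Sum>i\<in>I. 1 / p i) F"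

sublocale positive_multilinear_lp \<subseteq> positive_multilinear I "\<lambda>i. lp_space (p i)" F A
  by (rule positive_multilinear.intro) (use fin p F posA solid_domain_lp in auto)

context positive_multilinear_lp
begin

abbreviation "E i \<equiv> lp_space (p i)"

text \<open>Otherwise there are arguments whose \<open>k\<close>-th components have disjoint supports; for upper bounds
  of \<open>m\<close> of them the values of \<open>A\<close> would grow faster than the norms.\<close>

lemma uniformly_small_tails:
  assumes k: "k \<in> I" and \<epsilon>: "\<epsilon> > 0"
  shows "\<exists>N. \<forall>x\<in>B. (\<forall>l<N. x k l = 0) \<longrightarrow> vnorm F (A x) \<le> \<epsilon>"
proof (rule ccontr)
  assume n: "\<not> ?thesis"
  interpret Ek: ordered_normed_space_on "E k" by (rule ons[OF k])
  note pk = p[OF k]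
  obtain K where K: "K \<ge> 0" "\<And>x. x \<in> B \<Longrightarrow> vnorm F (A x) \<le> K" using bounded_on_ball by blast
  \<comment> \<open>A tuple with a large value can be made positive and finitely supported in slot
    \<open>k\<close>, at the cost of \<open>\<epsilon> / 2\<close>.\<close>
  have "\<exists>M x. N \<le> M \<and> x \<in> B \<and> (\<forall>i\<in>I. \<forall>l. 0 \<le> x i l) \<and> (\<forall>l. l \<notin> {N..<M} \<longrightarrow> x k l = 0) \<and> \<epsilon> / 2 \<le> vnorm F (A x)" for N
  proof -
    obtain x where x: "x \<in> B" "\<forall>l<N. x k l = 0" "\<epsilon> < vnorm F (A x)" using n by (meson not_le)
    define y where "y = (\<lambda>i\<in>I. \<lambda>l. \<bar>x i l\<bar>)"
    have yB: "y \<in> B"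
      unfolding B_def
    proof (rule PiE_I)
      fix i assume i: "i \<in> I"
      have xi: "x i \<in> vcarrier (E i)" "vnorm (E i) (x i) \<le> 1" using x(1) i by (auto simp: B_def vball_def)
      have "y i = (\<lambda>l. \<bar>x i l\<bar>)" using i by (simp add: y_def)
      moreover have "vnorm (E i) (\<lambda>l. \<bar>x i l\<bar>) = vnorm (E i) (x i)" by (simp add: lp_space_def)
      ultimately show "y i \<in> vball (E i)" using xi by (simp add: vball_def lp_carrier_iff)
    qed (simp add: y_def)
    note yD = B_D[OF yB]
    have yk: "y k \<in> vcarrier (E k)" by (rule D_mem[OF yD k])
    have "vnorm F (A x) \<le> vnorm F (A y)"
      by (rule A_dominated(3)[OF B_D[OF x(1)] yD]) (auto simp: y_def)
    then have big: "\<epsilon> < vnorm F (A y)" using x(3) by simp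
    have "(\<lambda>M. K * vnorm (E k) (cut {M..} (y k))) \<longlonglongrightarrow> 0"
      by (rule tendsto_mult_right_zero[OF lp_norm_tail_tendsto[OF pk yk]])
    then have "eventually (\<lambda>M. K * vnorm (E k) (cut {M..} (y k)) < \<epsilon> / 2) sequentially"
      by (rule order_tendstoD(2)) (use \<epsilon> in simp)
    then obtain M0 where M0: "\<And>M. M \<ge> M0 \<Longrightarrow> K * vnorm (E k) (cut {M..} (y k)) < \<epsilon> / 2"
      by (auto simp: eventually_sequentially)
    define M where "M = max M0 N"
    define z where "z = y(k := cut {..<M} (y k))"
    have c: "cut {M..} (y k) \<in> vcarrier (E k)" "cut {..<M} (y k) \<in> vcarrier (E k)" by (auto intro: cut_closed[OF pk] yk)
    have zD: "z \<in> D" unfolding z_def by (rule D_upd[OF yD k c(2)])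
    have "A y = vadd F (A z) (A (y(k := cut {M..} (y k))))"
    proof -
      have "y k = vadd (E k) (cut {..<M} (y k)) (cut {M..} (y k))" by (auto simp: cut_def fun_eq_iff)
      then have "y = y(k := vadd (E k) (cut {..<M} (y k)) (cut {M..} (y k)))" by (metis fun_upd_triv)
      then show ?thesis using A_add[OF yD k c(2) c(1)] unfolding z_def by metis
    qed
    then have "vnorm F (A y) \<le> vnorm F (A z) + vnorm F (A (y(k := cut {M..} (y k))))"
      using F.norm_triangle A_closed[OF zD] A_closed[OF D_upd[OF yD k c(1)]] by simp
    moreover have "vnorm F (A (y(k := cut {M..} (y k)))) \<le> K * vnorm (E k) (cut {M..} (y k))"
      by (rule norm_le_slot[OF K(2) K(1) yB k c(1)])
    moreover have "K * vnorm (E k) (cut {M..} (y k)) < \<epsilon> / 2" by (rule M0) (simp add: M_def)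
    ultimately have "\<epsilon> / 2 \<le> vnorm F (A z)" using big by linarith
    moreover have "z \<in> B"
    proof -
      have "vnorm (E k) (cut {..<M} (y k)) \<le> 1"
        using lp_norm_cut_le[OF pk yk, of "{..<M}"] yB k by (force simp: B_def vball_def)
      then show ?thesis using yB k c(2) unfolding z_def B_def by (auto simp: PiE_iff extensional_def vball_def)
    qed
    moreover have "\<forall>i\<in>I. \<forall>l. 0 \<le> z i l" by (auto simp: z_def y_def cut_def)
    moreover have "\<forall>l. l \<notin> {N..<M} \<longrightarrow> z k l = 0" using x(2) k by (auto simp: z_def y_def cut_def)
    ultimately show ?thesis by (intro exI[of _ M] exI[of _ z]) (simp add: M_def)
  qed
  then obtain Mf X where MX: "\<And>N. N \<le> Mf N" "\<And>N. X N \<in> B" "\<And>N i l. i \<in> I \<Longrightarrow> 0 \<le> X N i l"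
    "\<And>N l. l \<notin> {N..<Mf N} \<Longrightarrow> X N k l = 0" "\<And>N. \<epsilon> / 2 \<le> vnorm F (A (X N))" by metis
  \<comment> \<open>Each block starts where the preceding one ends, so the entries in slot
    \<open>k\<close> have disjoint supports.\<close>
  define Nf where "Nf = rec_nat 0 (\<lambda>_ N. Mf N)"
  have Nf: "Nf (Suc j) = Mf (Nf j)" for j by (simp add: Nf_def)
  have Nmono: "Nf j \<le> Nf j'" if "j \<le> j'" for j j'
    using that by (rule lift_Suc_mono_le[of Nf, rotated]) (simp add: Nf MX(1))
  define x where "x j = X (Nf j)" for j
  have xB: "x j \<in> B" and x0: "i \<in> I \<Longrightarrow> 0 \<le> x j i l" and xA: "\<epsilon> / 2 \<le> vnorm F (A (x j))" for j i l
    using MX by (auto simp: x_def)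
  have supp: "l \<in> {Nf j..<Nf (Suc j)}" if "x j k l \<noteq> 0" for j l
    using MX(4)[of l "Nf j"] that by (auto simp: x_def Nf)
  have one: "j = j'" if nz: "x j k l \<noteq> 0" "x j' k l \<noteq> 0" for j j' l
  proof (rule ccontr)
    assume "j \<noteq> j'"
    then have "Suc j \<le> j' \<or> Suc j' \<le> j" by linarith
    then show False using supp[OF nz(1)] supp[OF nz(2)] Nmono[of "Suc j" j'] Nmono[of "Suc j'" j] by auto
  qed
  obtain m where m: "m \<ge> 1" "\<And>g. (\<forall>j<m. g j \<in> vcarrier F \<and> vle F (vzero F) (g j) \<and> \<epsilon> / 2 \<le> vnorm F (g j)) \<Longrightarrow>
     K * real m powr (\<Sum>i\<in>I. 1 / p i) < vnorm F (vpsum F g m)"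
    using growth \<epsilon> unfolding lower_growth_def by (meson half_gt_zero)
  have xD: "x j \<in> D" for j by (rule B_D[OF xB])
  have A0: "vle F (vzero F) (A (x j))" for j by (rule A_nonneg[OF xD]) (use x0 in simp)
  have "\<exists>w\<in>vcarrier (E i). vnorm (E i) w \<le> real m powr (1 / p i) \<and> (\<forall>j<m. \<forall>l. x j i l \<le> w l) \<and> (\<forall>l. 0 \<le> w l)" if i: "i \<in> I" for i
  proof -
    have "\<forall>j<m. x j i \<in> vball (E i) \<and> vle (E i) (vzero (E i)) (x j i)"
      using xB i x0 by (auto simp: B_def)
    from upper_boundsD[OF upper_bounds_lp[OF p[OF i]] this] show ?thesis by auto
  qed
  then obtain w where w: "\<And>i. i \<in> I \<Longrightarrow> w i \<in> vcarrier (E i)" "\<And>i. i \<in> I \<Longrightarrow> vnorm (E i) (w i) \<le> real m powr (1 / p i)"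
    "\<And>i j l. i \<in> I \<Longrightarrow> j < m \<Longrightarrow> x j i l \<le> w i l" "\<And>i l. i \<in> I \<Longrightarrow> 0 \<le> w i l" by metis
  define W where "W = (\<lambda>i\<in>I. w i)"
  have WD: "W \<in> D" unfolding W_def by (rule D_restrict) (rule w)
  have xk: "x j k \<in> vcarrier (E k)" for j by (rule D_mem[OF xD k])
  \<comment> \<open>Owing to the disjoint supports the sum of the entries in slot \<open>k\<close>
    is still below their common upper bound \<open>w k\<close>. This is why \<open>m\<close> values
    of \<open>A\<close> can be added up inside a single one.\<close>
  define s where "s = vpsum (E k) (\<lambda>j. x j k) m"
  have sV: "s \<in> vcarrier (E k)" unfolding s_def using xk by (rule Ek.vpsum_closed)
  have s_val: "vpsum (E k) (\<lambda>j. x j k) m' l = (\<Sum>j<m'. x j k l)" for m' l by (induction m') auto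
  have sW: "s l \<le> w k l" for l
  proof (cases "\<exists>j<m. x j k l \<noteq> 0")
    case True
    then obtain j where j: "j < m" "x j k l \<noteq> 0" by blast
    have "s l = (\<Sum>j'<m. if j' = j then x j k l else 0)"
      unfolding s_def s_val using one[OF _ j(2)] by (intro sum.cong) auto
    also have "\<dots> = x j k l" using j by simp
    finally show ?thesis using w(3)[OF k j(1)] by simp
  next
    case False
    then have "s l = 0" unfolding s_def s_val by (intro sum.neutral) auto
    then show ?thesis using w(4)[OF k] by simp
  qed
  have s0: "0 \<le> s l" for l unfolding s_def s_val using x0[OF k] by (simp add: sum_nonneg)
  have "vnorm F (vpsum F (\<lambda>j. A (x j)) m) \<le> vnorm F (vpsum F (\<lambda>j. A (W(k := x j k))) m)"
  proof (rule F.norm_le_positive)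
    show "vle F (vpsum F (\<lambda>j. A (x j)) m) (vpsum F (\<lambda>j. A (W(k := x j k))) m)"
    proof (rule F.vpsum_mono, intro conjI)
      fix j assume j: "j < m"
      show "A (x j) \<in> vcarrier F" "A (W(k := x j k)) \<in> vcarrier F" by (auto intro: A_closed D_upd xD WD k xk)
      show "vle F (A (x j)) (A (W(k := x j k)))"
        by (rule A_mono[OF xD D_upd[OF WD k xk]]) (use x0 w(3) j in \<open>auto simp: W_def\<close>)
    qed
    show "vle F (vzero F) (vpsum F (\<lambda>j. A (x j)) m)" by (rule F.vpsum_nonneg) (use A_closed[OF xD] A0 in auto)
  qed (auto intro!: F.vpsum_closed A_closed xD D_upd WD k xk)
  also have "vpsum F (\<lambda>j. A (W(k := x j k))) m = A (W(k := s))"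
    unfolding s_def
    using linear_map_on_vpsum[OF Ek.normed_space_on_axioms F.normed_space_on_axioms A_slot[OF WD k], of m "\<lambda>j. x j k"] xk
    by simp
  also have "vnorm F (A (W(k := s))) \<le> vnorm F (A W)"
  proof (rule F.norm_le_positive)
    have WsD: "W(k := s) \<in> D" by (rule D_upd[OF WD k sV])
    show "vle F (vzero F) (A (W(k := s)))" by (rule A_nonneg[OF WsD]) (use s0 w(4) in \<open>auto simp: W_def\<close>)
    show "vle F (A (W(k := s))) (A W)" by (rule A_mono[OF WsD WD]) (use s0 w(4) sW in \<open>auto simp: W_def\<close>)
    show "A (W(k := s)) \<in> vcarrier F" "A W \<in> vcarrier F" by (auto intro: A_closed WsD WD)
  qed
  also have "\<dots> \<le> K * (\<Prod>i\<in>I. real m powr (1 / p i))"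
    by (rule norm_le_prod[OF K(2) WD]) (use w m in \<open>auto simp: W_def\<close>)
  also have "(\<Prod>i\<in>I. real m powr (1 / p i)) = real m powr (\<Sum>i\<in>I. 1 / p i)"
    using m by (simp add: powr_sum)
  finally have "vnorm F (vpsum F (\<lambda>j. A (x j)) m) \<le> K * real m powr (\<Sum>i\<in>I. 1 / p i)" .
  moreover have "K * real m powr (\<Sum>i\<in>I. 1 / p i) < vnorm F (vpsum F (\<lambda>j. A (x j)) m)"
    by (rule m(2)) (use A_closed[OF xD] A0 xA in auto)
  ultimately show False by simp
qed

text \<open>The first \<open>N\<close> coordinates of \<open>d j\<close> tend to zero in norm, and
  the tail is covered by \<open>uniformly_small_tails\<close>. The \<open>d j\<close> will be
  differences of two vectors of the ball, hence the bound 2 and the halving of the tail.\<close>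

lemma slot_tendsto:
  assumes k: "k \<in> I" and z: "\<And>j. z j \<in> B"
    and d: "\<And>j. d j \<in> vcarrier (E k)" "\<And>j. vnorm (E k) (d j) \<le> 2" and lim: "\<And>l. (\<lambda>j. d j l) \<longlonglongrightarrow> 0"
  shows "(\<lambda>j. vnorm F (A ((z j)(k := d j)))) \<longlonglongrightarrow> 0"
proof (rule LIMSEQ_I)
  fix \<epsilon> :: real assume \<epsilon>: "\<epsilon> > 0"
  note pk = p[OF k]
  interpret Ek: ordered_normed_space_on "E k" by (rule ons[OF k])
  obtain K where K: "K \<ge> 0" "\<And>x. x \<in> B \<Longrightarrow> vnorm F (A x) \<le> K" using bounded_on_ball by blast
  obtain N where N: "\<And>x. x \<in> B \<Longrightarrow> (\<forall>l<N. x k l = 0) \<Longrightarrow> vnorm F (A x) \<le> \<epsilon> / 8"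
    using uniformly_small_tails[OF k, of "\<epsilon> / 8"] \<epsilon> by auto
  have "(\<lambda>j. K * (\<Sum>l<N. \<bar>d j l\<bar> powr p k) powr (1 / p k)) \<longlonglongrightarrow> K * 0"
  proof (rule tendsto_mult_left)
    have "(\<lambda>j. \<Sum>l<N. \<bar>d j l\<bar> powr p k) \<longlonglongrightarrow> (\<Sum>l<N. \<bar>0\<bar> powr p k)"
      using pk by (intro tendsto_sum tendsto_powr' tendsto_rabs lim tendsto_const) auto
    then have "(\<lambda>j. (\<Sum>l<N. \<bar>d j l\<bar> powr p k) powr (1 / p k)) \<longlonglongrightarrow> 0 powr (1 / p k)"
      using pk by (intro tendsto_powr' tendsto_const) (auto intro!: always_eventually sum_nonneg)
    then show "(\<lambda>j. (\<Sum>l<N. \<bar>d j l\<bar> powr p k) powr (1 / p k)) \<longlonglongrightarrow> 0" by simp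
  qed
  then have "eventually (\<lambda>j. K * (\<Sum>l<N. \<bar>d j l\<bar> powr p k) powr (1 / p k) < \<epsilon> / 4) sequentially"
    using \<epsilon> by (intro order_tendstoD(2)) auto
  then obtain j0 where j0: "\<And>j. j \<ge> j0 \<Longrightarrow> K * (\<Sum>l<N. \<bar>d j l\<bar> powr p k) powr (1 / p k) < \<epsilon> / 4"
    by (auto simp: eventually_sequentially)
  have "vnorm F (A ((z j)(k := d j))) < \<epsilon>" if j: "j \<ge> j0" for j
  proof -
    have zD: "z j \<in> D" by (rule B_D[OF z])
    define a where "a = cut {..<N} (d j)"
    define b where "b = (\<lambda>l. (1 / 2) * cut {N..} (d j) l)"
    have aV: "a \<in> vcarrier (E k)" unfolding a_def by (rule cut_closed[OF pk d(1)])
    have c: "cut {N..} (d j) \<in> vcarrier (E k)" by (rule cut_closed[OF pk d(1)])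
    have b': "b = vscale (E k) (1 / 2) (cut {N..} (d j))" by (simp add: b_def)
    have bV: "b \<in> vcarrier (E k)" unfolding b' using c by (rule Ek.scale_closed)
    have "vnorm (E k) b \<le> 1"
      unfolding b' using Ek.norm_scale[OF c, of "1 / 2"] lp_norm_cut_le[OF pk d(1)[of j], of "{N..}"] d(2)[of j] by simp
    then have zb: "(z j)(k := b) \<in> B" using z[of j] k bV unfolding B_def by (auto simp: PiE_iff extensional_def vball_def)
    have "d j = vadd (E k) a (vscale (E k) 2 b)" by (auto simp: a_def b_def cut_def fun_eq_iff)
    then have "A ((z j)(k := d j)) = vadd F (A ((z j)(k := a))) (vscale F 2 (A ((z j)(k := b))))"
      using A_add[OF zD k aV Ek.scale_closed[OF bV, of 2]] A_scale[OF zD k bV, of 2] by metis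
    then have "vnorm F (A ((z j)(k := d j))) \<le> vnorm F (A ((z j)(k := a))) + 2 * vnorm F (A ((z j)(k := b)))"
      using F.norm_triangle[of "A ((z j)(k := a))" "vscale F 2 (A ((z j)(k := b)))"] F.norm_scale[of "A ((z j)(k := b))" 2]
        A_closed[OF D_upd[OF zD k aV]] A_closed[OF D_upd[OF zD k bV]] by simp
    moreover have "vnorm F (A ((z j)(k := b))) \<le> \<epsilon> / 8" by (rule N[OF zb]) (auto simp: b_def cut_def)
    moreover have "vnorm F (A ((z j)(k := a))) < \<epsilon> / 4"
    proof -
      have "vnorm (E k) a powr p k = (\<Sum>l<N. \<bar>d j l\<bar> powr p k)"
        unfolding a_def by (rule lp_norm_cut_finite[OF pk d(1)]) simp
      then have "(\<Sum>l<N. \<bar>d j l\<bar> powr p k) powr (1 / p k) = (vnorm (E k) a powr p k) powr (1 / p k)" by simp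
      also have "\<dots> = vnorm (E k) a" using pk lp_norm_nonneg[OF pk, of a] by (simp add: powr_powr)
      finally show ?thesis using j0[OF j] norm_le_slot[OF K(2) K(1) z[of j] k aV] by simp
    qed
    ultimately show ?thesis using \<epsilon> by linarith
  qed
  then show "\<exists>no. \<forall>j\<ge>no. norm (vnorm F (A ((z j)(k := d j))) - 0) < \<epsilon>"
    using F.norm_nonneg A_closed[OF D_upd[OF B_D[OF z] k d(1)]] by (intro exI[of _ j0]) auto
qed

text \<open>The slots are changed from \<open>y\<close> to \<open>x j\<close> one at a time; each
  change is a value of \<open>A\<close> with a coordinatewise null sequence in one slot.\<close>

lemma tendsto_of_coordinatewise:
  assumes x: "\<And>j. x j \<in> B" and y: "y \<in> B" and lim: "\<And>i l. i \<in> I \<Longrightarrow> (\<lambda>j. x j i l) \<longlonglongrightarrow> y i l"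
  shows "(\<lambda>j. vnorm F (vadd F (A (x j)) (vneg F (A y)))) \<longlonglongrightarrow> 0"
proof -
  define g where "g J j = (\<lambda>i\<in>I. if i \<in> J then x j i else y i)" for J j
  have gB: "g J j \<in> B" for J j using x[of j] y by (auto simp: g_def B_def)
  note gD = B_D[OF gB]
  have yD: "y \<in> D" by (rule B_D[OF y])
  have "(\<lambda>j. vnorm F (vadd F (A (g J j)) (vneg F (A y)))) \<longlonglongrightarrow> 0" if "J \<subseteq> I" for J
    using finite_subset[OF that fin] that
  proof (induction J rule: finite_induct)
    case empty
    have "g {} j = y" for j using y unfolding g_def B_def by (auto simp: fun_eq_iff PiE_iff extensional_def)
    then show ?case using A_closed[OF yD] by (simp add: F.add_neg F.norm_zero)
  next
    case (insert k J)
    have k: "k \<in> I" "k \<notin> J" using insert by auto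
    interpret Ek: ordered_normed_space_on "E k" by (rule ons[OF k(1)])
    have xk: "x j k \<in> vcarrier (E k)" "vnorm (E k) (x j k) \<le> 1" for j using x[of j] k by (auto simp: B_def vball_def)
    have yk: "y k \<in> vcarrier (E k)" "vnorm (E k) (y k) \<le> 1" using y k by (auto simp: B_def vball_def)
    define d where "d j = vadd (E k) (x j k) (vneg (E k) (y k))" for j
    have dV: "d j \<in> vcarrier (E k)" for j unfolding d_def using xk yk by (intro Ek.add_closed Ek.neg_closed)
    have d2: "vnorm (E k) (d j) \<le> 2" for j
      using Ek.norm_triangle[OF xk(1)[of j] Ek.neg_closed[OF yk(1)]] Ek.norm_neg[OF yk(1)] xk(2)[of j] yk(2)
      unfolding d_def by linarith
    have dl: "(\<lambda>j. d j l) \<longlonglongrightarrow> 0" for l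
      using tendsto_diff[OF lim[OF k(1), of l] tendsto_const[of "y k l"]] by (simp add: d_def)
    have t: "(\<lambda>j. vnorm F (A ((g J j)(k := d j)))) \<longlonglongrightarrow> 0" by (rule slot_tendsto[OF k(1) gB dV d2 dl])
    have le: "vnorm F (vadd F (A (g (insert k J) j)) (vneg F (A y))) \<le>
        vnorm F (A ((g J j)(k := d j))) + vnorm F (vadd F (A (g J j)) (vneg F (A y)))" for j
    proof -
      have 1: "g (insert k J) j = (g J j)(k := x j k)" and 2: "(g J j)(k := y k) = g J j"
        using k by (auto simp: g_def fun_eq_iff)
      have "A ((g J j)(k := d j)) = vadd F (A (g (insert k J) j)) (vneg F (A (g J j)))"
        unfolding d_def A_add[OF gD k(1) xk(1) Ek.neg_closed[OF yk(1)]] A_neg[OF gD k(1) yk(1)] 1 2 ..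
      then show ?thesis using F.norm_sub_triangle[OF A_closed[OF gD] A_closed[OF gD] A_closed[OF yD]] by metis
    qed
    have nn: "0 \<le> vnorm F (vadd F (A (g (insert k J) j)) (vneg F (A y)))" for j
      using A_closed[OF gD] A_closed[OF yD] by (intro F.norm_nonneg F.add_closed F.neg_closed)
    have tt: "(\<lambda>j. vnorm F (A ((g J j)(k := d j))) + vnorm F (vadd F (A (g J j)) (vneg F (A y)))) \<longlonglongrightarrow> 0"
      using tendsto_add[OF t insert.IH] insert.prems by simp
    show ?case
      by (rule tendsto_sandwich[OF always_eventually[OF allI[OF nn]] always_eventually[OF allI[OF le]] tendsto_const tt])
  qed
  from this[of I] have "(\<lambda>j. vnorm F (vadd F (A (g I j)) (vneg F (A y)))) \<longlonglongrightarrow> 0" by simp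
  moreover have "g I j = x j" for j using x[of j] unfolding g_def B_def by (auto simp: fun_eq_iff PiE_iff extensional_def)
  ultimately show ?thesis by simp
qed

text \<open>For coordinatewise convergence the product of the unit balls is sequentially compact,
  and \<open>A\<close> is sequentially continuous on it with respect to the norm of
  \<open>F\<close>.\<close>

theorem compact: "compact_multilinear_on I (\<lambda>i. lp_space (p i)) F A"
  unfolding compact_multilinear_on_def
proof (rule F.relatively_compactI)
  show "A ` (\<Pi>\<^sub>E i\<in>I. vball (E i)) \<subseteq> vcarrier F" using A_closed[OF B_D] unfolding B_def by auto
  fix \<sigma> :: "nat \<Rightarrow> 'b" assume "range \<sigma> \<subseteq> A ` (\<Pi>\<^sub>E i\<in>I. vball (E i))"
  then have "\<forall>j. \<exists>x\<in>B. \<sigma> j = A x" unfolding B_def by blast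
  then obtain x where x: "\<And>j. x j \<in> B" "\<And>j. \<sigma> j = A (x j)" by metis
  define f where "f j c = (if fst c \<in> I then x j (fst c) (snd c) else 0)" for j and c :: "nat \<times> nat"
  have "\<bar>f j c\<bar> \<le> 1" for j c
  proof (cases "fst c \<in> I")
    case True
    then have "x j (fst c) \<in> vcarrier (E (fst c))" "vnorm (E (fst c)) (x j (fst c)) \<le> 1" using x(1)[of j] by (auto simp: B_def vball_def)
    then show ?thesis using lp_coord_le[OF p[OF True], of "x j (fst c)" "snd c"] True by (simp add: f_def)
  qed (simp add: f_def)
  then obtain r h where r: "strict_mono r" "\<And>c. (\<lambda>j. f (r j) c) \<longlonglongrightarrow> h c"
    using coordinatewise_convergent_subsequence[of f 1] by blast
  define y where "y = (\<lambda>i\<in>I. \<lambda>l. h (i, l))"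
  have lim: "(\<lambda>j. x (r j) i l) \<longlonglongrightarrow> y i l" if "i \<in> I" for i l
    using r(2)[of "(i, l)"] that by (simp add: f_def y_def)
  have yB: "y \<in> B" unfolding B_def
  proof (rule PiE_I)
    fix i assume i: "i \<in> I"
    have xi: "x (r j) i \<in> vcarrier (E i)" "vnorm (E i) (x (r j) i) \<le> 1" for j using x(1)[of "r j"] i by (auto simp: B_def vball_def)
    show "y i \<in> vball (E i)" using lp_ball_limit[OF p[OF i] xi lim[OF i]] by (simp add: vball_def)
  qed (simp add: y_def)
  have "(\<lambda>j. vnorm F (vadd F (A (x (r j))) (vneg F (A y)))) \<longlonglongrightarrow> 0"
    by (rule tendsto_of_coordinatewise[OF x(1) yB lim])
  then show "\<exists>l\<in>vcarrier F. \<exists>r. strict_mono r \<and> (\<lambda>k. vnorm F (vadd F (\<sigma> (r k)) (vneg F l))) \<longlonglongrightarrow> 0"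
    using r(1) A_closed[OF B_D[OF yB]] by (intro bexI[of _ "A y"] exI[of _ r]) (simp_all add: x(2))
qed

end

section \<open>Compactness of positive operators with values in \<open>\<ell>\<^sub>q\<close>\<close>

definition block :: "(nat \<Rightarrow> nat) \<Rightarrow> nat \<Rightarrow> nat set" where
  "block N j = {N j..<N (Suc j)}"

context
  fixes q :: real assumes q: "q \<ge> 1"
begin

lemma lq_ordered: "ordered_normed_space_on (lp_space q)"
  by (rule ordered_normed_space_on_lp[OF q])

lemma lq_norm_mono:
  assumes "x \<in> vcarrier (lp_space q)" "y \<in> vcarrier (lp_space q)" "\<And>l. \<bar>x l\<bar> \<le> y l"
  shows "vnorm (lp_space q) x \<le> vnorm (lp_space q) y"
  by (rule ordered_normed_space_on.norm_le_dominated[OF lq_ordered assms(1,2)])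
    (use assms(3) in \<open>auto simp: abs_le_iff minus_le_iff\<close>)

lemma sum_blocks_le:
  assumes w: "w \<in> vcarrier (lp_space q)" and N: "mono N"
  shows "(\<Sum>j<m. vnorm (lp_space q) (cut (block N j) w) powr q) \<le> vnorm (lp_space q) w powr q"
proof -
  have "(\<Sum>j<m. \<Sum>l\<in>block N j. \<bar>w l\<bar> powr q) = (\<Sum>l\<in>{N 0..<N m}. \<bar>w l\<bar> powr q)"
  proof (induction m)
    case (Suc m)
    have "N 0 \<le> N m" "N m \<le> N (Suc m)" using N by (auto simp: mono_def)
    then show ?case using Suc sum.atLeastLessThan_concat[of "N 0" "N m" "N (Suc m)" "\<lambda>l. \<bar>w l\<bar> powr q"]
      by (simp add: block_def)
  qed simp
  also have "\<dots> \<le> vnorm (lp_space q) w powr q" by (rule lp_sum_le[OF q w]) simp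
  finally show ?thesis using lp_norm_cut_finite[OF q w] by (simp add: block_def)
qed

text \<open>If beyond every position some element of \<open>S\<close> has a large tail, cutting
  these tails at far points yields arbitrarily long lists of consecutive blocks with large
  norms.\<close>

lemma uniform_tails_if_no_blocks:
  assumes S: "S \<subseteq> vcarrier (lp_space q)"
    and no_blocks: "\<And>\<epsilon>. \<epsilon> > 0 \<Longrightarrow> \<exists>m. \<forall>N z. mono N \<and> (\<forall>j<m. z j \<in> S) \<longrightarrow>
      (\<exists>j<m. vnorm (lp_space q) (cut (block N j) (z j)) < \<epsilon>)"
    and \<epsilon>: "\<epsilon> > 0"
  shows "\<exists>N. \<forall>z\<in>S. vnorm (lp_space q) (cut {N..} z) \<le> \<epsilon>"
proof (rule ccontr)
  interpret ordered_normed_space_on "lp_space q" by (rule lq_ordered)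
  assume n: "\<not> ?thesis"
  have "\<exists>M z. N \<le> M \<and> z \<in> S \<and> \<epsilon> / 2 \<le> vnorm (lp_space q) (cut {N..<M} z)" for N
  proof -
    obtain z where z: "z \<in> S" "\<epsilon> < vnorm (lp_space q) (cut {N..} z)" using n by (meson not_le)
    have zV: "z \<in> vcarrier (lp_space q)" using S z by auto
    have "eventually (\<lambda>M. vnorm (lp_space q) (cut {M..} z) < \<epsilon> / 2) sequentially"
      using lp_norm_tail_tendsto[OF q zV] by (rule order_tendstoD(2)) (use \<epsilon> in simp)
    then obtain M0 where M0: "\<And>M. M \<ge> M0 \<Longrightarrow> vnorm (lp_space q) (cut {M..} z) < \<epsilon> / 2"
      by (auto simp: eventually_sequentially)
    define M where "M = max M0 N"
    have "cut {N..} z = vadd (lp_space q) (cut {N..<M} z) (cut {M..} z)" by (auto simp: cut_def M_def fun_eq_iff)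
    then have "vnorm (lp_space q) (cut {N..} z) \<le> vnorm (lp_space q) (cut {N..<M} z) + vnorm (lp_space q) (cut {M..} z)"
      using norm_triangle[OF cut_closed[OF q zV] cut_closed[OF q zV]] by metis
    moreover have "vnorm (lp_space q) (cut {M..} z) < \<epsilon> / 2" by (rule M0) (simp add: M_def)
    ultimately have "\<epsilon> / 2 \<le> vnorm (lp_space q) (cut {N..<M} z)" using z(2) by linarith
    then show ?thesis using z(1) by (intro exI[of _ M] exI[of _ z]) (simp add: M_def)
  qed
  then obtain Mf Z where MZ: "\<And>N. N \<le> Mf N" "\<And>N. Z N \<in> S" "\<And>N. \<epsilon> / 2 \<le> vnorm (lp_space q) (cut {N..<Mf N} (Z N))"
    by metis
  define Nf where "Nf = rec_nat 0 (\<lambda>_ N. Mf N)"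
  have Nf: "Nf (Suc j) = Mf (Nf j)" for j by (simp add: Nf_def)
  have Nmono: "mono Nf" by (rule incseq_SucI) (simp add: Nf MZ(1))
  obtain m where m: "\<And>N z. mono N \<Longrightarrow> (\<forall>j<m. z j \<in> S) \<Longrightarrow> \<exists>j<m. vnorm (lp_space q) (cut (block N j) (z j)) < \<epsilon> / 2"
    using no_blocks[OF half_gt_zero[OF \<epsilon>]] by blast
  have "\<exists>j<m. vnorm (lp_space q) (cut (block Nf j) (Z (Nf j))) < \<epsilon> / 2"
    by (rule m[OF Nmono]) (simp add: MZ(2))
  then obtain j where "vnorm (lp_space q) (cut (block Nf j) (Z (Nf j))) < \<epsilon> / 2" by blast
  moreover have "\<epsilon> / 2 \<le> vnorm (lp_space q) (cut (block Nf j) (Z (Nf j)))" unfolding block_def Nf by (rule MZ(3))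
  ultimately show False by linarith
qed

text \<open>Boundedness and uniformly small tails give relative compactness. The tails are
  controlled by excluding long lists of consecutive blocks, since such lists are what the estimates
  for operators refute.\<close>

theorem relatively_compact_lq:
  assumes S: "S \<subseteq> vcarrier (lp_space q)" and bd: "\<And>z. z \<in> S \<Longrightarrow> vnorm (lp_space q) z \<le> K"
    and no_blocks: "\<And>\<epsilon>. \<epsilon> > 0 \<Longrightarrow> \<exists>m. \<forall>N z. mono N \<and> (\<forall>j<m. z j \<in> S) \<longrightarrow>
      (\<exists>j<m. vnorm (lp_space q) (cut (block N j) (z j)) < \<epsilon>)"
  shows "relatively_compact_in (lp_space q) S"
proof -
  interpret E: ordered_normed_space_on "lp_space q" by (rule lq_ordered)
  show ?thesis
  proof (rule E.relatively_compactI[OF S])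
    fix \<sigma> :: "nat \<Rightarrow> nat \<Rightarrow> real" assume \<sigma>: "range \<sigma> \<subseteq> S"
    have \<sigma>V: "\<sigma> j \<in> vcarrier (lp_space q)" and \<sigma>K: "vnorm (lp_space q) (\<sigma> j) \<le> K" for j
      using \<sigma> S bd by auto
    have "\<bar>\<sigma> j l\<bar> \<le> K" for j l using lp_coord_le[OF q \<sigma>V[of j], of l] \<sigma>K[of j] by linarith
    then obtain r g where r: "strict_mono r" "\<And>l. (\<lambda>j. \<sigma> (r j) l) \<longlonglongrightarrow> g l"
      using coordinatewise_convergent_subsequence[of \<sigma> K] by blast
    have gV: "g \<in> vcarrier (lp_space q)" by (rule lp_ball_limit(1)[OF q \<sigma>V \<sigma>K r(2)])
    define d where "d j = vadd (lp_space q) (\<sigma> (r j)) (vneg (lp_space q) g)" for j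
    have dV: "d j \<in> vcarrier (lp_space q)" for j unfolding d_def using \<sigma>V gV by (intro E.add_closed E.neg_closed)
    have "(\<lambda>j. vnorm (lp_space q) (d j)) \<longlonglongrightarrow> 0"
    proof (rule LIMSEQ_I)
      fix \<epsilon> :: real assume \<epsilon>: "\<epsilon> > 0"
      obtain N where N: "\<And>z. z \<in> S \<Longrightarrow> vnorm (lp_space q) (cut {N..} z) \<le> \<epsilon> / 4"
        using uniform_tails_if_no_blocks[OF S no_blocks, of "\<epsilon> / 4"] \<epsilon> by auto
      have tg: "vnorm (lp_space q) (cut {N..} g) \<le> \<epsilon> / 4"
      proof (rule lp_ball_limit(2)[OF q, of "\<lambda>j. cut {N..} (\<sigma> (r j))"])
        show "cut {N..} (\<sigma> (r j)) \<in> vcarrier (lp_space q)" for j by (rule cut_closed[OF q \<sigma>V])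
        show "vnorm (lp_space q) (cut {N..} (\<sigma> (r j))) \<le> \<epsilon> / 4" for j by (rule N) (use \<sigma> in auto)
        show "(\<lambda>j. cut {N..} (\<sigma> (r j)) l) \<longlonglongrightarrow> cut {N..} g l" for l using r(2)[of l] by (simp add: cut_def)
      qed
      have td: "vnorm (lp_space q) (cut {N..} (d j)) \<le> \<epsilon> / 2" for j
      proof -
        have c: "cut {N..} (\<sigma> (r j)) \<in> vcarrier (lp_space q)" "cut {N..} g \<in> vcarrier (lp_space q)"
          by (auto intro: cut_closed[OF q] \<sigma>V gV)
        have "cut {N..} (d j) = vadd (lp_space q) (cut {N..} (\<sigma> (r j))) (vneg (lp_space q) (cut {N..} g))"
          by (auto simp: d_def cut_def fun_eq_iff)
        then have "vnorm (lp_space q) (cut {N..} (d j)) \<le> vnorm (lp_space q) (cut {N..} (\<sigma> (r j))) + vnorm (lp_space q) (cut {N..} g)"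
          using E.norm_triangle[OF c(1) E.neg_closed[OF c(2)]] E.norm_neg[OF c(2)] by simp
        moreover have "vnorm (lp_space q) (cut {N..} (\<sigma> (r j))) \<le> \<epsilon> / 4" by (rule N) (use \<sigma> in auto)
        ultimately show ?thesis using tg by linarith
      qed
      have dl: "(\<lambda>j. d j l) \<longlonglongrightarrow> 0" for l
        using tendsto_diff[OF r(2)[of l] tendsto_const[of "g l"]] by (simp add: d_def)
      have "(\<lambda>j. \<Sum>l<N. \<bar>d j l\<bar> powr q) \<longlonglongrightarrow> (\<Sum>l<N. \<bar>0\<bar> powr q)"
        using q by (intro tendsto_sum tendsto_powr' tendsto_rabs dl tendsto_const) auto
      then have "(\<lambda>j. (\<Sum>l<N. \<bar>d j l\<bar> powr q) powr (1 / q)) \<longlonglongrightarrow> 0 powr (1 / q)"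
        using q by (intro tendsto_powr' tendsto_const) (auto intro!: always_eventually sum_nonneg)
      then have "eventually (\<lambda>j. (\<Sum>l<N. \<bar>d j l\<bar> powr q) powr (1 / q) < \<epsilon> / 2) sequentially"
        using \<epsilon> by (intro order_tendstoD(2)) auto
      then obtain j0 where j0: "\<And>j. j \<ge> j0 \<Longrightarrow> (\<Sum>l<N. \<bar>d j l\<bar> powr q) powr (1 / q) < \<epsilon> / 2"
        by (auto simp: eventually_sequentially)
      have "vnorm (lp_space q) (d j) < \<epsilon>" if j: "j \<ge> j0" for j
      proof -
        have c: "cut {..<N} (d j) \<in> vcarrier (lp_space q)" "cut {N..} (d j) \<in> vcarrier (lp_space q)"
          by (auto intro: cut_closed[OF q] dV)
        have "d j = vadd (lp_space q) (cut {..<N} (d j)) (cut {N..} (d j))" by (auto simp: cut_def fun_eq_iff)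
        then have "vnorm (lp_space q) (d j) \<le> vnorm (lp_space q) (cut {..<N} (d j)) + vnorm (lp_space q) (cut {N..} (d j))"
          using E.norm_triangle[OF c] by metis
        moreover have "vnorm (lp_space q) (cut {..<N} (d j)) < \<epsilon> / 2"
        proof -
          have "vnorm (lp_space q) (cut {..<N} (d j)) powr q = (\<Sum>l<N. \<bar>d j l\<bar> powr q)"
            by (rule lp_norm_cut_finite[OF q dV]) simp
          then have "(\<Sum>l<N. \<bar>d j l\<bar> powr q) powr (1 / q) = (vnorm (lp_space q) (cut {..<N} (d j)) powr q) powr (1 / q)" by simp
          also have "\<dots> = vnorm (lp_space q) (cut {..<N} (d j))"
            using q lp_norm_nonneg[OF q, of "cut {..<N} (d j)"] by (simp add: powr_powr)
          finally show ?thesis using j0[OF j] by simp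
        qed
        ultimately show ?thesis using td[of j] by linarith
      qed
      then show "\<exists>no. \<forall>j\<ge>no. norm (vnorm (lp_space q) (d j) - 0) < \<epsilon>"
        using lp_norm_nonneg[OF q] by (intro exI[of _ j0]) auto
    qed
    then show "\<exists>l\<in>vcarrier (lp_space q). \<exists>r. strict_mono r \<and> (\<lambda>k. vnorm (lp_space q) (vadd (lp_space q) (\<sigma> (r k)) (vneg (lp_space q) l))) \<longlonglongrightarrow> 0"
      using gV r(1) unfolding d_def by blast
  qed
qed

lemma norm_ge_blocks:
  assumes w: "w \<in> vcarrier (lp_space q)" and N: "mono N" and \<epsilon>: "\<epsilon> \<ge> 0"
    and ge: "\<And>j. j < m \<Longrightarrow> \<epsilon> \<le> vnorm (lp_space q) (cut (block N j) w)"
  shows "\<epsilon> * real m powr (1 / q) \<le> vnorm (lp_space q) w"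
proof -
  have "real m * \<epsilon> powr q = (\<Sum>j<m. \<epsilon> powr q)" by simp
  also have "\<dots> \<le> (\<Sum>j<m. vnorm (lp_space q) (cut (block N j) w) powr q)"
    using ge \<epsilon> q by (intro sum_mono powr_mono2) auto
  also have "\<dots> \<le> vnorm (lp_space q) w powr q" by (rule sum_blocks_le[OF w N])
  finally have "(real m * \<epsilon> powr q) powr (1 / q) \<le> (vnorm (lp_space q) w powr q) powr (1 / q)"
    using q \<epsilon> by - (rule powr_mono2, auto)
  then show ?thesis using q \<epsilon> lp_norm_nonneg[OF q, of w] by (simp add: powr_mult powr_powr mult.commute)
qed

end

text \<open>Suppose \<open>m\<close> values are large on consecutive blocks. For a common upper
  bound \<open>W\<close> of dominating arguments the single value \<open>A W\<close> is large on all
  blocks, so its norm is at least \<open>\<epsilon> * m powr (1 / q)\<close>; but it is at most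
  \<open>K\<close> times \<open>m\<close> to the power of the sum of the
  \<open>1 / p i\<close>.\<close>

theorem compact_into_lq:
  fixes q :: real
  assumes A: "positive_multilinear I E (lp_space q) A" and q: "q \<ge> 1"
    and ub: "\<And>i. i \<in> I \<Longrightarrow> upper_bounds (p i) (E i)" and \<sigma>: "(\<Sum>i\<in>I. 1 / p i) < 1 / q"
  shows "compact_multilinear_on I E (lp_space q) A"
proof -
  interpret positive_multilinear I E "lp_space q" A by (rule A)
  let ?F = "lp_space q"
  obtain K where K: "K \<ge> 0" "\<And>x. x \<in> B \<Longrightarrow> vnorm ?F (A x) \<le> K" using bounded_on_ball by blast
  have "relatively_compact_in ?F (A ` B)"
  proof (rule relatively_compact_lq[OF q])
    show "A ` B \<subseteq> vcarrier ?F" using A_closed[OF B_D] by auto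
    show "vnorm ?F z \<le> K" if "z \<in> A ` B" for z using that K(2) by auto
    fix \<epsilon> :: real assume \<epsilon>: "\<epsilon> > 0"
    define \<delta> where "\<delta> = 1 / q - (\<Sum>i\<in>I. 1 / p i)"
    have \<delta>: "\<delta> > 0" using \<sigma> by (simp add: \<delta>_def)
    obtain m where m: "m \<ge> 1" "K < \<epsilon> * real m powr \<delta>" using ex_nat_powr_gt[OF \<delta> \<epsilon>, of 1 K] by blast
    have "\<exists>j<m. vnorm ?F (cut (block N j) (z j)) < \<epsilon>"
      if N: "mono N" and z: "\<And>j. j < m \<Longrightarrow> z j \<in> A ` B" for N z
    proof (rule ccontr)
      assume "\<not> ?thesis"
      then have big: "\<epsilon> \<le> vnorm ?F (cut (block N j) (z j))" if "j < m" for j using that by force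
      have "\<exists>x\<in>B. z j = A x" if "j < m" for j using z[OF that] by blast
      then obtain x where x: "\<And>j. j < m \<Longrightarrow> x j \<in> B" "\<And>j. j < m \<Longrightarrow> z j = A (x j)" by metis
      have "\<exists>y\<in>B. (\<forall>i\<in>I. vle (E i) (vzero (E i)) (y i)) \<and> (\<forall>l. \<bar>z j l\<bar> \<le> A y l)" if j: "j < m" for j
      proof -
        obtain y where y: "y \<in> B" "\<And>i. i \<in> I \<Longrightarrow> vle (E i) (vzero (E i)) (y i)"
          "\<And>i. i \<in> I \<Longrightarrow> vle (E i) (vneg (E i) (y i)) (x j i)" "\<And>i. i \<in> I \<Longrightarrow> vle (E i) (x j i) (y i)"
          using ex_dominating[OF x(1)[OF j]] by blast
        have "vle ?F (vneg ?F (A y)) (z j)" "vle ?F (z j) (A y)"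
          using A_dominated(1,2)[OF B_D[OF x(1)[OF j]] B_D[OF y(1)] y(3,4)] x(2)[OF j] by auto
        then have "\<forall>l. \<bar>z j l\<bar> \<le> A y l" by (auto simp: abs_le_iff minus_le_iff)
        then show ?thesis using y by blast
      qed
      then obtain y where y: "\<And>j. j < m \<Longrightarrow> y j \<in> B" "\<And>j i. j < m \<Longrightarrow> i \<in> I \<Longrightarrow> vle (E i) (vzero (E i)) (y j i)"
        "\<And>j l. j < m \<Longrightarrow> \<bar>z j l\<bar> \<le> A (y j) l" by metis
      have "\<exists>w\<in>vcarrier (E i). vle (E i) (vzero (E i)) w \<and> vnorm (E i) w \<le> real m powr (1 / p i) \<and> (\<forall>j<m. vle (E i) (y j i) w)"
        if i: "i \<in> I" for i
        by (rule upper_boundsD[OF ub[OF i]]) (use y(1,2) i in \<open>auto simp: B_def\<close>)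
      then obtain w where w: "\<And>i. i \<in> I \<Longrightarrow> w i \<in> vcarrier (E i)" "\<And>i. i \<in> I \<Longrightarrow> vnorm (E i) (w i) \<le> real m powr (1 / p i)"
        "\<And>i j. i \<in> I \<Longrightarrow> j < m \<Longrightarrow> vle (E i) (y j i) (w i)" by metis
      define W where "W = (\<lambda>i\<in>I. w i)"
      have WD: "W \<in> D" unfolding W_def by (rule D_restrict) (rule w)
      have AWV: "A W \<in> vcarrier ?F" by (rule A_closed[OF WD])
      have le: "\<bar>z j l\<bar> \<le> A W l" if j: "j < m" for j l
      proof -
        have "vle ?F (A (y j)) (A W)"
          by (rule A_mono[OF B_D[OF y(1)[OF j]] WD]) (use y(2) w(3) j in \<open>auto simp: W_def\<close>)
        then show ?thesis using y(3)[OF j, of l] by (auto intro: order_trans)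
      qed
      have "\<epsilon> * real m powr (1 / q) \<le> vnorm ?F (A W)"
      proof (rule norm_ge_blocks[OF q AWV N])
        fix j assume j: "j < m"
        have zV: "z j \<in> vcarrier ?F" using x[OF j] A_closed[OF B_D] by simp
        have "vnorm ?F (cut (block N j) (z j)) \<le> vnorm ?F (cut (block N j) (A W))"
          by (rule lq_norm_mono[OF q cut_closed[OF q zV] cut_closed[OF q AWV]]) (use le[OF j] in \<open>auto simp: cut_def\<close>)
        then show "\<epsilon> \<le> vnorm ?F (cut (block N j) (A W))" using big[OF j] by simp
      qed (use \<epsilon> in simp)
      also have "\<dots> \<le> K * (\<Prod>i\<in>I. real m powr (1 / p i))"
        by (rule norm_le_prod[OF K(2) WD]) (use w m in \<open>auto simp: W_def\<close>)
      also have "(\<Prod>i\<in>I. real m powr (1 / p i)) = real m powr (\<Sum>i\<in>I. 1 / p i)"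
        using m by (simp add: powr_sum)
      finally have "\<epsilon> * real m powr (1 / q) \<le> K * real m powr (\<Sum>i\<in>I. 1 / p i)" .
      also have "\<dots> < (\<epsilon> * real m powr \<delta>) * real m powr (\<Sum>i\<in>I. 1 / p i)"
        using m by (intro mult_strict_right_mono) auto
      also have "\<dots> = \<epsilon> * real m powr (1 / q)" by (simp add: mult.assoc \<delta>_def flip: powr_add)
      finally show False by simp
    qed
    then show "\<exists>m. \<forall>N z. mono N \<and> (\<forall>j<m. z j \<in> A ` B) \<longrightarrow> (\<exists>j<m. vnorm ?F (cut (block N j) (z j)) < \<epsilon>)" by blast
  qed
  then show ?thesis by (simp add: compact_multilinear_on_def B_def)
qed

text \<open>The norm of a block of \<open>T (vabs (L k) u)\<close> is a lattice seminorm in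
  \<open>u\<close>. The upper bounds used in \<open>compact_into_lq\<close> are replaced by
  \<open>free_banach_lattice_test_element\<close>, which provides one argument whose value is large
  on all blocks.\<close>

theorem free_compact_into_lq:
  fixes L :: "'i \<Rightarrow> 'f nlattice" and X :: "('x, 'm) nlattice_scheme"
  assumes free: "free_banach_lattice X (L k) \<phi>" and X: "normed_lattice_on X"
    and ue: "upper_estimate r X" and r: "1 < r" "r < 2" and q: "q \<ge> 1" and rq: "1 / r < 1 / q"
    and A: "positive_multilinear_on {k} L (lp_space q) A"
  shows "compact_multilinear_on {k} L (lp_space q) A"
proof -
  interpret L: banach_lattice_on "L k" using free by (simp add: free_banach_lattice_def)
  interpret positive_multilinear "{k}" L "lp_space q" A
    by (rule positive_multilinear.intro)
      (use A solid_domain_banach_lattice[OF L.banach_lattice_on_axioms] ordered_normed_space_on_lp[OF q] in auto)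
  let ?F = "lp_space q"
  obtain K where K: "K \<ge> 0" "\<And>x. x \<in> B \<Longrightarrow> vnorm ?F (A x) \<le> K" using bounded_on_ball by blast
  \<comment> \<open>There is only the slot \<open>k\<close>, so \<open>A\<close> amounts to a
    positive linear map \<open>T\<close>; \<open>e\<close> makes a tuple from a vector.\<close>
  define e where "e u = (\<lambda>i\<in>{k}. u)" for u :: 'f
  have eD: "e u \<in> D" if "u \<in> vcarrier (L k)" for u using that by (auto simp: e_def D_def)
  have eB: "e u \<in> B" if "u \<in> vball (L k)" for u using that by (auto simp: e_def B_def)
  have e_of: "x = e (x k)" if "x \<in> B" for x using that by (auto simp: e_def B_def fun_eq_iff PiE_iff extensional_def)
  have e_upd: "(e v)(k := u) = e u" for u v by (auto simp: e_def fun_eq_iff)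
  define T where "T u = A (e u)" for u
  have TV: "T u \<in> vcarrier ?F" if "u \<in> vcarrier (L k)" for u unfolding T_def by (rule A_closed[OF eD[OF that]])
  have T_add: "T (vadd (L k) u v) = vadd ?F (T u) (T v)" if "u \<in> vcarrier (L k)" "v \<in> vcarrier (L k)" for u v
    using A_add[OF eD[OF that(1)] _ that] by (simp add: T_def e_upd del: lp_simps)
  have T_scale: "T (vscale (L k) a u) = vscale ?F a (T u)" if "u \<in> vcarrier (L k)" for u a
    using A_scale[OF eD[OF that] _ that] by (simp add: T_def e_upd del: lp_simps)
  have T_mono: "T u l \<le> T v l" if "u \<in> vcarrier (L k)" "v \<in> vcarrier (L k)" "vle (L k) (vzero (L k)) u" "vle (L k) u v" for u v l
    using A_mono[OF eD[OF that(1)] eD[OF that(2)]] that by (simp add: T_def e_def)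
  have T_pos: "0 \<le> T u l" if "u \<in> vcarrier (L k)" "vle (L k) (vzero (L k)) u" for u l
    using A_nonneg[OF eD[OF that(1)]] that by (simp add: T_def e_def)
  have T_bound: "vnorm ?F (T u) \<le> K * vnorm (L k) u" if "u \<in> vcarrier (L k)" for u
  proof -
    have "e (vzero (L k)) \<in> B" by (rule eB[OF L.zero_in_vball])
    from norm_le_slot[OF K(2) K(1) this _ that] show ?thesis by (simp add: e_upd T_def)
  qed
  have T_abs: "\<bar>T u l\<bar> \<le> T (vabs (L k) u) l" if u: "u \<in> vcarrier (L k)" for u l
    using A_dominated(1,2)[of "e u" "e (vabs (L k) u)"] eD u L.le_vabs[OF u] L.neg_le_vabs[OF u] L.neg_le_swap[of u "vabs (L k) u"]
    by (auto simp: T_def e_def abs_le_iff minus_le_iff)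
  have sn: "lattice_seminorm (L k) (\<lambda>u. vnorm ?F (cut S (T (vabs (L k) u))))" for S
    unfolding lattice_seminorm_def
  proof (intro conjI ballI allI impI)
    fix x y assume xy: "x \<in> vcarrier (L k)" "y \<in> vcarrier (L k)"
    have c: "cut S (T (vabs (L k) z)) \<in> vcarrier ?F" if "z \<in> vcarrier (L k)" for z
      using that by (intro cut_closed[OF q] TV) simp
    have "vnorm ?F (cut S (T (vabs (L k) (vadd (L k) x y)))) \<le>
        vnorm ?F (vadd ?F (cut S (T (vabs (L k) x))) (cut S (T (vabs (L k) y))))"
    proof (rule lq_norm_mono[OF q])
      show "cut S (T (vabs (L k) (vadd (L k) x y))) \<in> vcarrier ?F" using xy by (intro c) simp
      show "vadd ?F (cut S (T (vabs (L k) x))) (cut S (T (vabs (L k) y))) \<in> vcarrier ?F"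
        using c xy by (intro F.add_closed)
      fix l
      have "T (vabs (L k) (vadd (L k) x y)) l \<le> T (vadd (L k) (vabs (L k) x) (vabs (L k) y)) l"
        using xy by (intro T_mono L.vabs_add_le L.vabs_nonneg) auto
      then show "\<bar>cut S (T (vabs (L k) (vadd (L k) x y))) l\<bar> \<le> vadd ?F (cut S (T (vabs (L k) x))) (cut S (T (vabs (L k) y))) l"
        using xy T_add[of "vabs (L k) x" "vabs (L k) y"] T_pos[of "vabs (L k) (vadd (L k) x y)" l]
        by (auto simp: cut_def L.vabs_nonneg)
    qed
    also have "\<dots> \<le> vnorm ?F (cut S (T (vabs (L k) x))) + vnorm ?F (cut S (T (vabs (L k) y)))"
      using c xy by (intro F.norm_triangle)
    finally show "vnorm ?F (cut S (T (vabs (L k) (vadd (L k) x y)))) \<le>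
      vnorm ?F (cut S (T (vabs (L k) x))) + vnorm ?F (cut S (T (vabs (L k) y)))" .
    show "vnorm ?F (cut S (T (vabs (L k) x))) \<le> vnorm ?F (cut S (T (vabs (L k) y)))"
      if le: "vle (L k) (vabs (L k) x) (vabs (L k) y)"
      using T_mono[OF _ _ _ le] T_pos[of "vabs (L k) x"] xy
      by (intro lq_norm_mono[OF q] c) (auto simp: cut_def L.vabs_nonneg)
    show "vnorm ?F (cut S (T (vabs (L k) (vscale (L k) a x)))) = \<bar>a\<bar> * vnorm ?F (cut S (T (vabs (L k) x)))" for a
    proof -
      have "cut S (T (vabs (L k) (vscale (L k) a x))) = vscale ?F \<bar>a\<bar> (cut S (T (vabs (L k) x)))"
        using xy T_scale[of "vabs (L k) x" "\<bar>a\<bar>"] by (auto simp: L.vabs_scale cut_def fun_eq_iff)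
      then show ?thesis using F.norm_scale[OF c[OF xy(1)], of "\<bar>a\<bar>"] by simp
    qed
  next
    show "\<exists>K. \<forall>x\<in>vcarrier (L k). vnorm ?F (cut S (T (vabs (L k) x))) \<le> K * vnorm (L k) x"
    proof (intro exI ballI)
      fix x assume x: "x \<in> vcarrier (L k)"
      have "vnorm ?F (cut S (T (vabs (L k) x))) \<le> vnorm ?F (T (vabs (L k) x))"
        using x by (intro lp_norm_cut_le[OF q] TV) simp
      also have "\<dots> \<le> K * vnorm (L k) x" using T_bound[of "vabs (L k) x"] x by (simp add: L.norm_vabs)
      finally show "vnorm ?F (cut S (T (vabs (L k) x))) \<le> K * vnorm (L k) x" .
    qed
  qed
  obtain C where C: "C > 0" "\<And>m N \<epsilon>. m \<ge> 16 \<Longrightarrow> \<epsilon> > 0 \<and> (\<forall>j<m. lattice_seminorm (L k) (N j) \<and> (\<exists>u\<in>vball (L k). \<epsilon> \<le> N j u)) \<Longrightarrow>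
    (\<exists>u\<in>vcarrier (L k). vle (L k) (vzero (L k)) u \<and> vnorm (L k) u \<le> C * ln (real m) * real m powr (1 / r) \<and>
      (\<forall>j<m. \<epsilon> / 4 \<le> N j u))"
    using free_banach_lattice_test_element[OF free X ue r] by blast
  have "relatively_compact_in ?F (A ` B)"
  proof (rule relatively_compact_lq[OF q])
    show "A ` B \<subseteq> vcarrier ?F" using A_closed[OF B_D] by auto
    show "vnorm ?F z \<le> K" if "z \<in> A ` B" for z using that K(2) by auto
    fix \<epsilon> :: real assume \<epsilon>: "\<epsilon> > 0"
    \<comment> \<open>As in \<open>lower_growth_dual_free\<close>, one half of the gap is for the
      logarithm and one for the constants.\<close>
    define \<delta> where "\<delta> = (1 / q - 1 / r) / 2"
    have \<delta>: "\<delta> > 0" using rq by (simp add: \<delta>_def)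
    obtain m where m: "m \<ge> 16" "K * C / \<delta> < \<epsilon> / 4 * real m powr \<delta>"
      using ex_nat_powr_gt[OF \<delta>, of "\<epsilon> / 4" 16 "K * C / \<delta>"] \<epsilon> by auto
    have "\<exists>j<m. vnorm ?F (cut (block N j) (z j)) < \<epsilon>"
      if N: "mono N" and z: "\<And>j. j < m \<Longrightarrow> z j \<in> A ` B" for N z
    proof (rule ccontr)
      assume "\<not> ?thesis"
      then have big: "\<epsilon> \<le> vnorm ?F (cut (block N j) (z j))" if "j < m" for j using that by force
      have "\<exists>u\<in>vball (L k). \<epsilon> \<le> vnorm ?F (cut (block N j) (T (vabs (L k) u)))" if j: "j < m" for j
      proof -
        obtain x where x: "x \<in> B" "z j = A x" using z[OF j] by blast
        have u: "x k \<in> vball (L k)" using x(1) by (auto simp: B_def)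
        then have uV: "x k \<in> vcarrier (L k)" by (simp add: vball_def)
        have zT: "z j = T (x k)" using x e_of[OF x(1)] by (simp add: T_def)
        have "vnorm ?F (cut (block N j) (T (x k))) \<le> vnorm ?F (cut (block N j) (T (vabs (L k) (x k))))"
          using uV T_abs[OF uV] by (intro lq_norm_mono[OF q] cut_closed[OF q] TV) (auto simp: cut_def)
        then show ?thesis using big[OF j] zT u by (intro bexI[of _ "x k"]) auto
      qed
      then obtain u where u: "u \<in> vcarrier (L k)" "vle (L k) (vzero (L k)) u" "vnorm (L k) u \<le> C * ln (real m) * real m powr (1 / r)"
        "\<And>j. j < m \<Longrightarrow> \<epsilon> / 4 \<le> vnorm ?F (cut (block N j) (T (vabs (L k) u)))"
        using C(2)[OF m(1), of \<epsilon> "\<lambda>j u. vnorm ?F (cut (block N j) (T (vabs (L k) u)))"] \<epsilon> sn by blast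
      have "\<epsilon> / 4 * real m powr (1 / q) \<le> vnorm ?F (T u)"
        using u(4) \<epsilon> by (intro norm_ge_blocks[OF q TV[OF u(1)] N]) (auto simp: L.vabs_of_nonneg[OF u(1,2)])
      also have "\<dots> \<le> K * vnorm (L k) u" by (rule T_bound[OF u(1)])
      also have "\<dots> \<le> K * (C * ln (real m) * real m powr (1 / r))" using u(3) K(1) by (rule mult_left_mono)
      also have "\<dots> \<le> K * (C * (real m powr \<delta> / \<delta>) * real m powr (1 / r))"
        using m(1) C(1) \<delta> K(1) by (intro mult_left_mono mult_right_mono ln_powr_bound) auto
      also have "\<dots> = K * C / \<delta> * (real m powr \<delta> * real m powr (1 / r))" by simp
      also have "\<dots> < \<epsilon> / 4 * real m powr \<delta> * (real m powr \<delta> * real m powr (1 / r))"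
        using m by (intro mult_strict_right_mono) auto
      also have "\<dots> = \<epsilon> / 4 * (real m powr \<delta> * real m powr \<delta> * real m powr (1 / r))" by simp
      also have "real m powr \<delta> * real m powr \<delta> * real m powr (1 / r) = real m powr (1 / q)"
      proof -
        have "\<delta> + \<delta> + 1 / r = 1 / q" by (simp add: \<delta>_def)
        then show ?thesis by (simp only: powr_add[symmetric])
      qed
      finally show False by simp
    qed
    then show "\<exists>m. \<forall>N z. mono N \<and> (\<forall>j<m. z j \<in> A ` B) \<longrightarrow> (\<exists>j<m. vnorm ?F (cut (block N j) (z j)) < \<epsilon>)" by blast
  qed
  then show ?thesis by (simp add: compact_multilinear_on_def B_def)
qed

section \<open>Growth of positive sums in \<open>Lp_space\<close>, and the cases of the
  theorem\<close>

lemma powr_superadditive: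
  fixes a b q :: real
  assumes "a \<ge> 0" "b \<ge> 0" "q \<ge> 1" shows "a powr q + b powr q \<le> (a + b) powr q"
proof (cases "a + b = 0")
  case False
  then have s: "a + b > 0" using assms by simp
  have t: "(x / (a + b)) powr q \<le> x / (a + b)" if "0 \<le> x" "x \<le> a + b" for x
    using powr_mono'[of 1 q "x / (a + b)"] that s assms by simp
  have "(a / (a + b)) powr q + (b / (a + b)) powr q \<le> a / (a + b) + b / (a + b)"
    using t[of a] t[of b] assms by simp
  also have "\<dots> = 1" using s by (simp flip: add_divide_distrib)
  finally show ?thesis using assms s by (simp add: powr_divide flip: add_divide_distrib)
next
  case True
  then have "a = 0" "b = 0" using assms by linarith+
  then show ?thesis by simp
qed

text \<open>On positive functions the \<open>q\<close>-th power of the norm is superadditive, so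
  sums of \<open>m\<close> vectors of norm at least \<open>\<epsilon>\<close> have norm at least
  \<open>\<epsilon> * m powr (1 / q)\<close>.\<close>

lemma lower_growth_Lp:
  fixes M :: "'a measure"
  assumes q: "q \<ge> 1" and \<sigma>: "\<sigma> < 1 / q"
  shows "lower_growth \<sigma> (Lp_space q M)"
  unfolding lower_growth_def
proof (intro allI impI)
  fix \<epsilon> K :: real assume \<epsilon>: "\<epsilon> > 0"
  let ?E = "Lp_space q M"
  interpret normed_lattice_on ?E by (rule normed_lattice_on_Lp[OF q])
  have q0: "q > 0" using q by simp
  have two: "vnorm ?E x powr q + vnorm ?E y powr q \<le> vnorm ?E (vadd ?E x y) powr q"
    if x: "x \<in> vcarrier ?E" "vle ?E (vzero ?E) x" and y: "y \<in> vcarrier ?E" "vle ?E (vzero ?E) y" for x y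
  proof -
    note fx = Lp_rep(1)[OF x(1)] and fy = Lp_rep(1)[OF y(1)]
    note fxy = Lp_fun_add[OF q fx fy]
    have zr: "AE t in M. ae_rep (ae_class M (\<lambda>t. 0)) t = 0" by (rule AE_ae_rep(2)) simp
    have "AE t in M. ae_rep (ae_class M (\<lambda>t. 0)) t \<le> ae_rep x t" "AE t in M. ae_rep (ae_class M (\<lambda>t. 0)) t \<le> ae_rep y t"
      using x(2) y(2) by simp_all
    with zr have pos: "AE t in M. 0 \<le> ae_rep x t \<and> 0 \<le> ae_rep y t" by eventually_elim simp
    have "vnorm ?E x powr q + vnorm ?E y powr q = (\<integral>t. \<bar>ae_rep x t\<bar> powr q + \<bar>ae_rep y t\<bar> powr q \<partial>M)"
      using Lp_funD(2)[OF fx] Lp_funD(2)[OF fy] by (simp add: Lp_norm_powr[OF q0])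
    also have "\<dots> \<le> (\<integral>t. \<bar>ae_rep x t + ae_rep y t\<bar> powr q \<partial>M)"
    proof (rule integral_mono_AE)
      show "AE t in M. \<bar>ae_rep x t\<bar> powr q + \<bar>ae_rep y t\<bar> powr q \<le> \<bar>ae_rep x t + ae_rep y t\<bar> powr q"
        using pos by eventually_elim (use powr_superadditive[OF _ _ q] in simp)
    qed (use Lp_funD(2)[OF fx] Lp_funD(2)[OF fy] Lp_funD(2)[OF fxy] in auto)
    also have "\<dots> = vnorm ?E (vadd ?E x y) powr q"
      using Lp_norm_rep[OF Lp_funD(1)[OF fxy]] by (simp add: Lp_norm_powr[OF q0])
    finally show ?thesis .
  qed
  have sum: "(\<Sum>j<k. vnorm ?E (g j) powr q) \<le> vnorm ?E (vpsum ?E g k) powr q"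
    if "\<And>j. j < k \<Longrightarrow> g j \<in> vcarrier ?E \<and> vle ?E (vzero ?E) (g j)" for g k
    using that
  proof (induction k)
    case (Suc k)
    have "vpsum ?E g k \<in> vcarrier ?E" "vle ?E (vzero ?E) (vpsum ?E g k)"
      using Suc.prems by (auto intro!: vpsum_closed vpsum_nonneg simp del: Lp_simps)
    then have "vnorm ?E (vpsum ?E g k) powr q + vnorm ?E (g k) powr q \<le> vnorm ?E (vpsum ?E g (Suc k)) powr q"
      using two[of "vpsum ?E g k" "g k"] Suc.prems[of k] by (simp del: Lp_simps)
    moreover have "(\<Sum>j<k. vnorm ?E (g j) powr q) \<le> vnorm ?E (vpsum ?E g k) powr q"
      by (rule Suc.IH) (use Suc.prems in \<open>simp del: Lp_simps\<close>)
    ultimately show ?case by (simp del: Lp_simps vpsum.simps)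
  qed simp
  define \<delta> where "\<delta> = 1 / q - \<sigma>"
  have \<delta>: "\<delta> > 0" using \<sigma> by (simp add: \<delta>_def)
  obtain m where m: "m \<ge> 1" "K < \<epsilon> * real m powr \<delta>" using ex_nat_powr_gt[OF \<delta> \<epsilon>, of 1 K] by blast
  show "\<exists>m\<ge>1. \<forall>g. (\<forall>j<m. g j \<in> vcarrier ?E \<and> vle ?E (vzero ?E) (g j) \<and> \<epsilon> \<le> vnorm ?E (g j)) \<longrightarrow>
     K * real m powr \<sigma> < vnorm ?E (vpsum ?E g m)"
  proof (intro exI[of _ m] conjI allI impI m(1))
    fix g assume g: "\<forall>j<m. g j \<in> vcarrier ?E \<and> vle ?E (vzero ?E) (g j) \<and> \<epsilon> \<le> vnorm ?E (g j)"
    have "real m * \<epsilon> powr q = (\<Sum>j<m. \<epsilon> powr q)" by simp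
    also have "\<dots> \<le> (\<Sum>j<m. vnorm ?E (g j) powr q)"
      using g \<epsilon> q by (intro sum_mono powr_mono2) auto
    also have "\<dots> \<le> vnorm ?E (vpsum ?E g m) powr q" by (rule sum) (use g in blast)
    finally have "(real m * \<epsilon> powr q) powr (1 / q) \<le> (vnorm ?E (vpsum ?E g m) powr q) powr (1 / q)"
      using q \<epsilon> by - (rule powr_mono2, auto)
    then have "\<epsilon> * real m powr (1 / q) \<le> vnorm ?E (vpsum ?E g m)"
      using q \<epsilon> by (simp add: powr_mult powr_powr mult.commute Lp_norm_nonneg)
    moreover have "K * real m powr \<sigma> < \<epsilon> * real m powr \<delta> * real m powr \<sigma>"
      using m by (intro mult_strict_right_mono) auto
    moreover have "real m powr \<delta> * real m powr \<sigma> = real m powr (1 / q)" by (simp add: \<delta>_def flip: powr_add)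
    ultimately show "K * real m powr \<sigma> < vnorm ?E (vpsum ?E g m)" by (simp add: mult.assoc)
  qed
qed

lemma compact_from_lp_into_dual_free:
  fixes L :: "'f nlattice" and X :: "('x, 'm) nlattice_scheme" and I :: "nat set" and p :: "nat \<Rightarrow> real"
  assumes "finite I" "\<And>i. i \<in> I \<Longrightarrow> 1 \<le> p i"
    and free: "free_banach_lattice X L \<phi>" and X: "normed_lattice_on X"
    and ue: "upper_estimate r X" and r: "1 < r" "r < 2" "(\<Sum>i\<in>I. 1 / p i) < 1 - 1 / r"
    and A: "positive_multilinear_on I (\<lambda>i. lp_space (p i)) (dual_lattice L) A"
  shows "compact_multilinear_on I (\<lambda>i. lp_space (p i)) (dual_lattice L) A"
proof -
  interpret L: banach_lattice_on L using free by (simp add: free_banach_lattice_def)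
  have "positive_multilinear_lp I p (dual_lattice L) A"
    by (rule positive_multilinear_lp.intro)
      (use assms L.ordered_normed_space_on_dual lower_growth_dual_free[OF free X ue r] in auto)
  then show ?thesis by (rule positive_multilinear_lp.compact)
qed

theorem theorem4p4:
  fixes n :: nat and p :: "nat \<Rightarrow> real" and q :: real
    and \<mu> :: "nat \<Rightarrow> 'a measure" and \<nu> :: "'b measure"
  assumes "1 \<le> n"
    and "\<forall>i\<in>{1..n}. 1 < p i"
    and "1 \<le> q"
  shows "((\<Sum>i=1..n. 1 / p i) < 1 / q \<longrightarrow>
            all_positive_compact n (\<lambda>i. Lp_space (p i) (\<mu> i)) (lp_space q) \<and>
            all_positive_compact n (\<lambda>i. lp_space (p i)) (Lp_space q \<nu>))
    \<and> ((\<forall>i\<in>{1..n}. p i < 2) \<and> (\<Sum>i=1..n. 1 / p i) < 1 / q \<longrightarrow>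
         (\<forall>(L :: nat \<Rightarrow> 'c nlattice) \<phi>.
            (\<forall>i\<in>{1..n}. free_banach_lattice (Lp_space (p i) (\<mu> i)) (L i) (\<phi> i)) \<longrightarrow>
            all_positive_compact n L (lp_space q)))
    \<and> (2 \<le> q \<and> (\<Sum>i=1..n. 1 / p i) < 1 / 2 \<longrightarrow>
         (\<forall>(L :: 'd nlattice) \<phi>. free_banach_lattice (Lp_space q \<nu>) L \<phi> \<longrightarrow>
            all_positive_compact n (\<lambda>i. lp_space (p i)) (dual_lattice L)))
    \<and> ((\<Sum>i=1..n. 1 / p i) < 1 / 2 \<longrightarrow>
         (\<forall>F :: 'e nlattice. banach_lattice_on F \<and> 2 \<le> lower_index F \<and> lower_index F < \<infinity> \<longrightarrow>
            (\<forall>(L :: 'f nlattice) \<phi>. free_banach_lattice F L \<phi> \<longrightarrow>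
               all_positive_compact n (\<lambda>i. lp_space (p i)) (dual_lattice L))))"
proof (intro conjI impI allI)
  have p1: "1 \<le> p i" if "i \<in> {1..n}" for i using assms(2) that by force
  have p0: "0 < p i" if "i \<in> {1..n}" for i using p1[OF that] by simp
  show "compact_multilinear_on {1..n} (\<lambda>i. Lp_space (p i) (\<mu> i)) (lp_space q) A"
    if "(\<Sum>i=1..n. 1 / p i) < 1 / q" "positive_multilinear_on {1..n} (\<lambda>i. Lp_space (p i) (\<mu> i)) (lp_space q) A" for A
  proof (rule compact_into_lq[where p = p])
    show "positive_multilinear {1..n} (\<lambda>i. Lp_space (p i) (\<mu> i)) (lp_space q) A"
      by (rule positive_multilinear.intro)
        (use that solid_domain_Lp[OF p1] ordered_normed_space_on_lp[OF assms(3)] in auto)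
  qed (use that assms upper_bounds_Lp[OF p1] in auto)
  show "compact_multilinear_on {1..n} (\<lambda>i. lp_space (p i)) (Lp_space q \<nu>) A"
    if "(\<Sum>i=1..n. 1 / p i) < 1 / q" "positive_multilinear_on {1..n} (\<lambda>i. lp_space (p i)) (Lp_space q \<nu>) A" for A
  proof (rule positive_multilinear_lp.compact)
    interpret normed_lattice_on "Lp_space q \<nu>" by (rule normed_lattice_on_Lp[OF assms(3)])
    show "positive_multilinear_lp {1..n} p (Lp_space q \<nu>) A"
      by (rule positive_multilinear_lp.intro)
        (use that p1 ordered_normed_space_on_axioms lower_growth_Lp[OF assms(3) that(1)] in auto)
  qed
  show "compact_multilinear_on {1..n} L (lp_space q) A"
    if a: "(\<forall>i\<in>{1..n}. p i < 2) \<and> (\<Sum>i=1..n. 1 / p i) < 1 / q"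
      and free: "\<forall>i\<in>{1..n}. free_banach_lattice (Lp_space (p i) (\<mu> i)) (L i) (\<phi> i)"
      and A: "positive_multilinear_on {1..n} L (lp_space q) A" for L :: "nat \<Rightarrow> 'c nlattice" and \<phi> A
  proof -
    \<comment> \<open>Two exponents below 2 would make the sum exceed 1 and hence
      \<open>1 / q\<close>; this leaves only one slot.\<close>
    have half: "1 / 2 < 1 / p i" if "i \<in> {1..n}" for i
      using a p0[OF that] that by (simp add: field_simps)
    have "n = 1"
    proof (rule ccontr)
      assume "n \<noteq> 1"
      then have n2: "{1, 2} \<subseteq> {1..n}" using assms(1) by auto
      have "(\<Sum>i\<in>{1, 2}. 1 / p i) \<le> (\<Sum>i=1..n. 1 / p i)"
        using n2 p0 by (intro sum_mono2) (auto intro: less_imp_le)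
      moreover have "1 < (\<Sum>i\<in>{1, 2}. 1 / p i)" using half[of 1] half[of 2] n2 by simp
      moreover have "1 / q \<le> 1" using assms(3) by simp
      ultimately show False using a by linarith
    qed
    then have I: "{1..n} = {1}" and one: "1 \<in> {1..n}" by simp_all
    have \<sigma>: "1 / p 1 < 1 / q" using a unfolding I by simp
    show ?thesis unfolding I
    proof (rule free_compact_into_lq)
      show "free_banach_lattice (Lp_space (p 1) (\<mu> 1)) (L 1) (\<phi> 1)" using free one by blast
      show "normed_lattice_on (Lp_space (p 1) (\<mu> 1))" by (rule normed_lattice_on_Lp[OF p1[OF one]])
      show "upper_estimate (p 1) (Lp_space (p 1) (\<mu> 1))" by (rule upper_estimate_Lp[OF p1[OF one]]) auto
      show "positive_multilinear_on {1} L (lp_space q) A" using A unfolding I .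
      show "1 < p 1" "p 1 < 2" "1 / p 1 < 1 / q" "1 \<le> q" using a \<sigma> assms one by blast+
    qed
  qed
  \<comment> \<open>The witness makes \<open>1 - 1 / r\<close> the midpoint of the sum and
    \<open>1 / 2\<close>.\<close>
  have ex_r: "\<exists>r. 1 < r \<and> r < 2 \<and> (\<Sum>i=1..n. 1 / p i) < 1 - 1 / r" if s: "(\<Sum>i=1..n. 1 / p i) < 1 / 2"
  proof -
    define \<sigma> where "\<sigma> = (\<Sum>i=1..n. 1 / p i)"
    have "0 \<le> \<sigma>" unfolding \<sigma>_def using p0 by (intro sum_nonneg) (auto intro: less_imp_le)
    then show ?thesis using s unfolding \<sigma>_def[symmetric]
      by (intro exI[of _ "4 / (3 - 2 * \<sigma>)"]) (simp add: field_simps)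
  qed
  show "compact_multilinear_on {1..n} (\<lambda>i. lp_space (p i)) (dual_lattice L) A"
    if a: "2 \<le> q \<and> (\<Sum>i=1..n. 1 / p i) < 1 / 2" and free: "free_banach_lattice (Lp_space q \<nu>) L \<phi>"
      and A: "positive_multilinear_on {1..n} (\<lambda>i. lp_space (p i)) (dual_lattice L) A"
    for L :: "'d nlattice" and \<phi> A
  proof -
    obtain r where r: "1 < r" "r < 2" "(\<Sum>i=1..n. 1 / p i) < 1 - 1 / r" using ex_r a by blast
    have "upper_estimate r (Lp_space q \<nu>)" by (rule upper_estimate_Lp) (use r a in auto)
    then show ?thesis
      by (intro compact_from_lp_into_dual_free[OF _ p1 free normed_lattice_on_Lp[OF assms(3)] _ r A]) auto
  qed
  show "compact_multilinear_on {1..n} (\<lambda>i. lp_space (p i)) (dual_lattice L) A"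
    if s: "(\<Sum>i=1..n. 1 / p i) < 1 / 2" and F: "banach_lattice_on F \<and> 2 \<le> lower_index F \<and> lower_index F < \<infinity>"
      and free: "free_banach_lattice F L \<phi>"
      and A: "positive_multilinear_on {1..n} (\<lambda>i. lp_space (p i)) (dual_lattice L) A"
    for F :: "'e nlattice" and L :: "'f nlattice" and \<phi> A
  proof -
    interpret F: banach_lattice_on F using F by simp
    obtain r where r: "1 < r" "r < 2" "(\<Sum>i=1..n. 1 / p i) < 1 - 1 / r" using ex_r[OF s] by blast
    have "ereal r < 2" using r(2) by simp
    \<comment> \<open>As \<open>r\<close> is strictly below 2, some exponent above \<open>r\<close>
      has the composition property even if the index is 2 and not attained.\<close>
    then have "ereal r < Sup {p. 1 \<le> p \<and> lp_composition_property p F}"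
      using F unfolding lower_index_def by (meson less_le_trans)
    then obtain p' where p': "lp_composition_property p' F" "ereal r < p'" by (auto simp: less_Sup_iff)
    have "lp_composition_property (ereal r) F"
      using lp_composition_property_mono[OF p'(1) _ p'(2)] r(1) by simp
    then have "upper_estimate r F" using F.upper_estimate_if_composition r(1) by simp
    then show ?thesis
      by (intro compact_from_lp_into_dual_free[OF _ p1 free F.normed_lattice_on_axioms _ r A]) auto
  qed
qed

end
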